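(* Let $G$ be of type $D_n$, $\mathbf{i}_0=(1\,2\cdots n)^{n-1}$ and $c=(c^{(m)}_i)_{1\le i\le n,\,1\le m\le n-1}\in(\mathbb{C}^\times)^{n(n-1)}$. Let $m^{(k)}_i:B(\Lambda_i)\hookrightarrow\mathcal{Y}(p_0)$ be the embedding of crystals sending the highest weight element $u_{\Lambda_i}$ to the monomial $c^{(k)}_i$. Then for $k=1,2,\dots,n-2$, $$\Delta_{w_0\Lambda_k,s_k\Lambda_k}(\Theta^-_{\mathbf{i}_0}(c))=\sum_{j=1}^n m^{(k)}_1(v_j)+\sum_{j=k+1}^n m^{(k)}_1(v_{\overline{j}}),$$ $$\Delta_{w_0s_k\Lambda_k,\Lambda_k}(\Theta^-_{\mathbf{i}_0}(c))=\sum_{j=1}^k m^{(k-n+1)}_1(v_{\overline{j}}),$$ and $$\Delta_{w_0\Lambda_{n-1},s_{n-1}\Lambda_{n-1}}(\Theta^-_{\mathbf{i}_0}(c))=m^{(n-1)}_{n-1}(u_{\Lambda_{n-1}}),\qquad \Delta_{w_0\Lambda_n,s_n\Lambda_n}(\Theta^-_{\mathbf{i}_0}(c))=m^{(n-1)}_n(u_{\Lambda_n}).$$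
   Context: Group side. $G$ is the simply connected simple algebraic group over $\mathbb{C}$ of type $D_n$ ($n\ge4$), $I=\{1,\dots,n\}$, with Chevalley generators $e_i,f_i,h_i$, simple roots $\alpha_i$, fundamental weights $\Lambda_i$, Cartan matrix $a_{ij}=\alpha_j(h_i)$: $a_{ii}=2$; $a_{ij}=-1$ if $|i-j|=1$ and $\{i,j\}\ne\{n-1,n\}$, or $\{i,j\}=\{n-2,n\}$; $0$ otherwise. $T$ is the maximal torus, $U^{\pm}$ the unipotent subgroups generated by $x_i(t)=\exp(te_i)$, resp. $y_i(t)=\exp(tf_i)$; $\alpha_i^\vee$ is the coroot one-parameter subgroup; $s_i$ are the simple reflections, $w_0$ the longest Weyl group element. $\overline{s}_i=x_i(-1)y_i(1)x_i(-1)$ and $\overline{w}=\overline{s}_{i_1}\cdots\overline{s}_{i_l}$ for any reduced expression $w=s_{i_1}\cdots s_{i_l}$. $\Delta_{\Lambda_i}$ is the regular function on $G$ with $\Delta_{\Lambda_i}(u^-tu^+)=\Lambda_i(t)$ ($u^\pm\in U^\pm$, $t\in T$), and $\Delta_{u\Lambda_i,v\Lambda_i}(g)=\Delta_{\Lambda_i}(\overline{u}^{-1}g\,\overline{v})$ for Weyl group elements $u,v$. With $\mathbf{y}_i(c)=y_i(c)\alpha_i^\vee(c^{-1})$, $\Theta^-_{\mathbf{i}_0}(c)=\prod_{m=1}^{n-1}\mathbf{y}_1(c^{(m)}_1)\cdots\mathbf{y}_n(c^{(m)}_n)$ (factors for $m=1,\dots,n-1$ from left to right). Monomial crystals. $\mathcal{Y}$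 is the set of Laurent monomials $Y=\prod_{m\in\mathbb{Z},i\in I}(c^{(m)}_i)^{l_{m,i}}$ in variables $c_i^{(m)}$, with only finitely many $l_{m,i}\in\mathbb{Z}$ nonzero. For a sign $p=(p_{i,j})_{i\ne j}$ (integers with $p_{i,j}+p_{j,i}=1$) put $A_{m,i}=c^{(m)}_ic^{(m+1)}_i\prod_{j\ne i}(c^{(m+p_{j,i})}_j)^{a_{j,i}}$. The crystal $\mathcal{Y}(p)$ is $\mathcal{Y}$ with $\mathrm{wt}(Y)=\sum l_{m,i}\Lambda_i$, $\varphi_i(Y)=\max_m\sum_{k\le m}l_{k,i}$, $\varepsilon_i(Y)=\varphi_i(Y)-\langle h_i,\mathrm{wt}(Y)\rangle$, $\tilde f_iY=A_{n_f,i}^{-1}Y$ if $\varphi_i(Y)>0$ and $0$ otherwise, $\tilde e_iY=A_{n_e,i}Y$ if $\varepsilon_i(Y)>0$ and $0$ otherwise, where $n_f=\min\{n:\varphi_i(Y)=\sum_{k\le n}l_{k,i}\}$, $n_e=\max\{n:\varphi_i(Y)=\sum_{k\le n}l_{k,i}\}$. Known: the connected component of a monomial $Y$ with all $\varepsilon_i(Y)=0$ is isomorphic to the crystal $B(\mathrm{wt}(Y))$ of the irreducible highest weight module. Here $p_0$ is the sign with $p_{i,j}=1$ if $i<j$ and $p_{i,j}=0$ if $i>j$. The crystal $B(\Lambda_1)=\{v_i,v_{\overline{i}}\mid1\le i\le n\}$ has $u_{\Lambda_1}=v_1$ and arrows $\tilde f_iv_i=v_{i+1}$, $\tilde f_iv_{\overline{i+1}}=v_{\overline{i}}$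 ($1\le i<n$), $\tilde f_nv_{n-1}=v_{\overline{n}}$, $\tilde f_nv_n=v_{\overline{n-1}}$ (all other $\tilde f_i$ are $0$). Explicitly, with $c^{(m)}_0=1$: $m^{(k)}_1(v_j)=c^{(k)}_j/c^{(k+1)}_{j-1}$ for $j\le n-2$, $m^{(k)}_1(v_{n-1})=c^{(k)}_{n-1}c^{(k)}_n/c^{(k+1)}_{n-2}$, $m^{(k)}_1(v_n)=c^{(k)}_n/c^{(k+1)}_{n-1}$; $m^{(k)}_1(v_{\overline{j}})=c^{(k+n-j)}_{j-1}/c^{(k+n-j)}_j$ for $j\le n-2$, $m^{(k)}_1(v_{\overline{n-1}})=c^{(k+1)}_{n-2}/(c^{(k+1)}_{n-1}c^{(k+1)}_n)$, $m^{(k)}_1(v_{\overline{n}})=c^{(k)}_{n-1}/c^{(k+1)}_n$. Monomials are evaluated at the given $c$. *)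

theory Defs
  imports
    Complex_Main
    "HOL-Library.Poly_Mapping"
    "HOL-Algebra.Generated_Groups"
    "Jordan_Normal_Form.Determinant"
begin

section \<open>The root datum of type D\<close>

text \<open>The index set is \<open>{1..n}\<close>, and \<open>cartan_D n i j\<close> is \<open>\<alpha>\<^sub>j(h\<^sub>i)\<close>.\<close>

definition cartan_D :: "nat \<Rightarrow> nat \<Rightarrow> nat \<Rightarrow> int" where
  "cartan_D n i j =
     (if i = j then 2
      else if (i = Suc j \<or> j = Suc i) \<and> {i, j} \<noteq> {n - 1, n} \<or> {i, j} = {n - 2, n} then - 1
      else 0)"

text \<open>
  A weight \<open>\<Sum>\<^sub>j l\<^sub>j \<Lambda>\<^sub>j\<close> is the function \<open>j \<mapsto> l\<^sub>j = \<langle>h\<^sub>j, l\<rangle>\<close>; in these coordinates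
  \<open>\<alpha>\<^sub>i = \<Sum>\<^sub>j a\<^sub>j\<^sub>i \<Lambda>\<^sub>j\<close>. A Weyl group element is its action on weights.
\<close>

type_synonym weight = "nat \<Rightarrow> int"
type_synonym weyl = "weight \<Rightarrow> weight"

definition refl_D :: "nat \<Rightarrow> nat \<Rightarrow> weyl" where
  "refl_D n i l = (\<lambda>j. if j \<in> {1..n} then l j - l i * cartan_D n j i else l j)"

definition weyl_word :: "nat \<Rightarrow> nat list \<Rightarrow> weyl" where
  "weyl_word n ks = foldr (\<lambda>i w. refl_D n i \<circ> w) ks id"

definition weyl_group :: "nat \<Rightarrow> weyl set" where
  "weyl_group n = {weyl_word n ks | ks. set ks \<subseteq> {1..n}}"

definition weyl_length :: "nat \<Rightarrow> weyl \<Rightarrow> nat" where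
  "weyl_length n w = (LEAST l. \<exists>ks. set ks \<subseteq> {1..n} \<and> weyl_word n ks = w \<and> length ks = l)"

definition reduced_expr :: "nat \<Rightarrow> weyl \<Rightarrow> nat list \<Rightarrow> bool" where
  "reduced_expr n w ks \<longleftrightarrow>
     set ks \<subseteq> {1..n} \<and> weyl_word n ks = w \<and> length ks = weyl_length n w"

definition longest_D :: "nat \<Rightarrow> weyl" where
  "longest_D n = (THE w. w \<in> weyl_group n \<and> (\<forall>u \<in> weyl_group n. weyl_length n u \<le> weyl_length n w))"

section \<open>The group\<close>

text \<open>
  The group is given as a closed subgroup of \<open>GL\<^sub>N(\<complex>)\<close>, for an arbitrary \<open>N\<close>; every affine
  algebraic group is of this form. Its Chevalley generators are then \<open>N \<times> N\<close> matrices
  \<open>e i\<close>, \<open>f i\<close>, \<open>h i\<close> subject to the Chevalley--Serre relations.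
\<close>

definition bracket :: "complex mat \<Rightarrow> complex mat \<Rightarrow> complex mat" where
  "bracket A B = A * B - B * A"

definition mat_exp :: "nat \<Rightarrow> complex mat \<Rightarrow> complex mat" where
  "mat_exp N A = mat N N (\<lambda>(r, s). suminf (\<lambda>k. (A ^\<^sub>m k) $$ (r, s) / fact k))"

definition mat_prod :: "nat \<Rightarrow> complex mat list \<Rightarrow> complex mat" where
  "mat_prod N As = foldr (*) As (1\<^sub>m N)"

abbreviation GL :: "nat \<Rightarrow> complex mat monoid" where
  "GL N \<equiv> units_of (ring_mat TYPE(complex) N ())"

text \<open>
  \<open>one_param N (e i) t\<close> is \<open>x\<^sub>i(t)\<close> and \<open>one_param N (f i) t\<close> is \<open>y\<^sub>i(t)\<close>.
\<close>

definition one_param :: "nat \<Rightarrow> complex mat \<Rightarrow> complex \<Rightarrow> complex mat" where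
  "one_param N a t = mat_exp N (t \<cdot>\<^sub>m a)"

definition s_bar :: "nat \<Rightarrow> (nat \<Rightarrow> complex mat) \<Rightarrow> (nat \<Rightarrow> complex mat) \<Rightarrow> nat \<Rightarrow> complex mat" where
  "s_bar N e f i = mat_prod N [one_param N (e i) (- 1), one_param N (f i) 1, one_param N (e i) (- 1)]"

text \<open>
  \<open>\<alpha>\<^sub>i\<^sup>\<or>(t)\<close> is the image of \<open>diag(t, t\<^sup>-\<^sup>1)\<close> under the homomorphism from \<open>SL\<^sub>2\<close> attached to \<open>i\<close>.
  It is obtained from the identity
  \<open>diag(t, t\<^sup>-\<^sup>1) = x(t) y(-t\<^sup>-\<^sup>1) x(t) x(-1) y(1) x(-1)\<close> in \<open>SL\<^sub>2\<close>. Only \<open>t \<noteq> 0\<close> is meaningful.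
\<close>

definition coroot ::
  "nat \<Rightarrow> (nat \<Rightarrow> complex mat) \<Rightarrow> (nat \<Rightarrow> complex mat) \<Rightarrow> nat \<Rightarrow> complex \<Rightarrow> complex mat" where
  "coroot N e f i t =
     mat_prod N [one_param N (e i) t, one_param N (f i) (- inverse t), one_param N (e i) t, s_bar N e f i]"

definition group_G ::
  "nat \<Rightarrow> nat \<Rightarrow> (nat \<Rightarrow> complex mat) \<Rightarrow> (nat \<Rightarrow> complex mat) \<Rightarrow> complex mat set" where
  "group_G n N e f =
     generate (GL N) ({one_param N (e i) t | i t. i \<in> {1..n}} \<union> {one_param N (f i) t | i t. i \<in> {1..n}})"

text \<open>\<open>U\<^sup>+\<close> and \<open>U\<^sup>-\<close> are \<open>unip n N e\<close> and \<open>unip n N f\<close>.\<close>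

definition unip :: "nat \<Rightarrow> nat \<Rightarrow> (nat \<Rightarrow> complex mat) \<Rightarrow> complex mat set" where
  "unip n N a = generate (GL N) {one_param N (a i) t | i t. i \<in> {1..n}}"

definition torus_elt ::
  "nat \<Rightarrow> nat \<Rightarrow> (nat \<Rightarrow> complex mat) \<Rightarrow> (nat \<Rightarrow> complex mat) \<Rightarrow> (nat \<Rightarrow> complex) \<Rightarrow> complex mat" where
  "torus_elt n N e f s = mat_prod N (map (\<lambda>i. coroot N e f i (s i)) [1..<Suc n])"

definition torus_T ::
  "nat \<Rightarrow> nat \<Rightarrow> (nat \<Rightarrow> complex mat) \<Rightarrow> (nat \<Rightarrow> complex mat) \<Rightarrow> complex mat set" where
  "torus_T n N e f = {torus_elt n N e f s | s. \<forall>i \<in> {1..n}. s i \<noteq> 0}"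

text \<open>
  The Chevalley--Serre relations say that \<open>e\<close>, \<open>f\<close>, \<open>h\<close> generate a quotient of the simple Lie
  algebra of type \<open>D\<^sub>n\<close>. Simple connectedness means that the simple coroots form a basis of the
  cocharacter lattice of the maximal torus, that is, that
  \<open>(s\<^sub>1, \<dots>, s\<^sub>n) \<mapsto> \<Prod>\<^sub>i \<alpha>\<^sub>i\<^sup>\<or>(s\<^sub>i)\<close> has trivial kernel. That condition also excludes the zero quotient.
\<close>

definition chevalley_serre_D ::
  "nat \<Rightarrow> nat \<Rightarrow> (nat \<Rightarrow> complex mat) \<Rightarrow> (nat \<Rightarrow> complex mat) \<Rightarrow> (nat \<Rightarrow> complex mat) \<Rightarrow> bool" where
  "chevalley_serre_D n N e f h \<longleftrightarrow>
     (\<forall>i \<in> {1..n}. e i \<in> carrier_mat N N \<and> f i \<in> carrier_mat N N \<and> h i \<in> carrier_mat N N) \<and>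
     (\<forall>i \<in> {1..n}. \<forall>j \<in> {1..n}.
        bracket (h i) (h j) = 0\<^sub>m N N \<and>
        bracket (h i) (e j) = of_int (cartan_D n i j) \<cdot>\<^sub>m e j \<and>
        bracket (h i) (f j) = of_int (- cartan_D n i j) \<cdot>\<^sub>m f j \<and>
        bracket (e i) (f j) = (if i = j then h i else 0\<^sub>m N N) \<and>
        (i \<noteq> j \<longrightarrow>
           (bracket (e i) ^^ nat (1 - cartan_D n i j)) (e j) = 0\<^sub>m N N \<and>
           (bracket (f i) ^^ nat (1 - cartan_D n i j)) (f j) = 0\<^sub>m N N))"

definition simply_connected_D ::
  "nat \<Rightarrow> nat \<Rightarrow> (nat \<Rightarrow> complex mat) \<Rightarrow> (nat \<Rightarrow> complex mat) \<Rightarrow> (nat \<Rightarrow> complex mat) \<Rightarrow> bool" where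
  "simply_connected_D n N e f h \<longleftrightarrow>
     chevalley_serre_D n N e f h \<and>
     (\<forall>s. (\<forall>i \<in> {1..n}. s i \<noteq> 0) \<and> torus_elt n N e f s = 1\<^sub>m N \<longrightarrow> (\<forall>i \<in> {1..n}. s i = 1))"

section \<open>Generalized minors\<close>

text \<open>The regular functions on \<open>GL\<^sub>N\<close> are the elements of \<open>\<complex>[x\<^sub>r\<^sub>s, det\<^sup>-\<^sup>1]\<close>.\<close>

inductive regular_GL :: "nat \<Rightarrow> (complex mat \<Rightarrow> complex) \<Rightarrow> bool" for N where
  const: "regular_GL N (\<lambda>g. a)"
| entry: "r < N \<Longrightarrow> s < N \<Longrightarrow> regular_GL N (\<lambda>g. g $$ (r, s))"
| inv_det: "regular_GL N (\<lambda>g. inverse (det g))"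
| add: "regular_GL N P \<Longrightarrow> regular_GL N Q \<Longrightarrow> regular_GL N (\<lambda>g. P g + Q g)"
| mult: "regular_GL N P \<Longrightarrow> regular_GL N Q \<Longrightarrow> regular_GL N (\<lambda>g. P g * Q g)"

definition regular_on :: "nat \<Rightarrow> complex mat set \<Rightarrow> (complex mat \<Rightarrow> complex) \<Rightarrow> bool" where
  "regular_on N G F \<longleftrightarrow> (\<exists>P. regular_GL N P \<and> (\<forall>g \<in> G. F g = P g))"

text \<open>The character \<open>\<Lambda>\<^sub>i\<close> of the torus; it is well defined when the group is simply connected.\<close>

definition fund_char ::
  "nat \<Rightarrow> nat \<Rightarrow> (nat \<Rightarrow> complex mat) \<Rightarrow> (nat \<Rightarrow> complex mat) \<Rightarrow> nat \<Rightarrow> complex mat \<Rightarrow> complex" where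
  "fund_char n N e f i t =
     (THE z. \<exists>s. (\<forall>j \<in> {1..n}. s j \<noteq> 0) \<and> t = torus_elt n N e f s \<and> z = s i)"

definition is_principal_minor ::
  "nat \<Rightarrow> nat \<Rightarrow> (nat \<Rightarrow> complex mat) \<Rightarrow> (nat \<Rightarrow> complex mat) \<Rightarrow> nat \<Rightarrow> (complex mat \<Rightarrow> complex) \<Rightarrow> bool" where
  "is_principal_minor n N e f i F \<longleftrightarrow>
     regular_on N (group_G n N e f) F \<and>
     (\<forall>a \<in> unip n N f. \<forall>t \<in> torus_T n N e f. \<forall>b \<in> unip n N e. F (a * t * b) = fund_char n N e f i t)"

text \<open>The representative \<open>w_bar\<close> does not depend on the choice of the reduced expression.\<close>

definition w_bar ::
  "nat \<Rightarrow> nat \<Rightarrow> (nat \<Rightarrow> complex mat) \<Rightarrow> (nat \<Rightarrow> complex mat) \<Rightarrow> weyl \<Rightarrow> complex mat" where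
  "w_bar n N e f w = mat_prod N (map (s_bar N e f) (SOME ks. reduced_expr n w ks))"

text \<open>
  If \<open>\<Delta> i\<close> is the principal minor attached to \<open>\<Lambda>\<^sub>i\<close>, then \<open>gen_minor n N e f \<Delta> i u v\<close> is the
  generalized minor attached to the pair of weights \<open>u \<Lambda>\<^sub>i\<close>, \<open>v \<Lambda>\<^sub>i\<close>.
\<close>

definition gen_minor ::
  "nat \<Rightarrow> nat \<Rightarrow> (nat \<Rightarrow> complex mat) \<Rightarrow> (nat \<Rightarrow> complex mat) \<Rightarrow> (nat \<Rightarrow> complex mat \<Rightarrow> complex) \<Rightarrow>
   nat \<Rightarrow> weyl \<Rightarrow> weyl \<Rightarrow> complex mat \<Rightarrow> complex" where
  "gen_minor n N e f \<Delta> i u v g =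
     \<Delta> i (m_inv (GL N) (w_bar n N e f u) * g * w_bar n N e f v)"

definition y_bold ::
  "nat \<Rightarrow> (nat \<Rightarrow> complex mat) \<Rightarrow> (nat \<Rightarrow> complex mat) \<Rightarrow> nat \<Rightarrow> complex \<Rightarrow> complex mat" where
  "y_bold N e f i a = one_param N (f i) a * coroot N e f i (inverse a)"

text \<open>Here and below \<open>c m i\<close> is \<open>c\<^sub>i\<^sup>(\<^sup>m\<^sup>)\<close>.\<close>

definition Theta_minus ::
  "nat \<Rightarrow> nat \<Rightarrow> (nat \<Rightarrow> complex mat) \<Rightarrow> (nat \<Rightarrow> complex mat) \<Rightarrow> (int \<Rightarrow> nat \<Rightarrow> complex) \<Rightarrow> complex mat" where
  "Theta_minus n N e f c =
     mat_prod N (concat (map (\<lambda>m. map (\<lambda>i. y_bold N e f i (c m i)) [1..<Suc n]) [1..int n - 1]))"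

section \<open>Crystals\<close>

text \<open>The result \<open>None\<close> of a Kashiwara operator stands for \<open>0\<close>.\<close>

record 'b crystal =
  cr_set :: "'b set"
  cr_wt :: "'b \<Rightarrow> weight"
  cr_eps :: "nat \<Rightarrow> 'b \<Rightarrow> int"
  cr_phi :: "nat \<Rightarrow> 'b \<Rightarrow> int"
  cr_e :: "nat \<Rightarrow> 'b \<Rightarrow> 'b option"
  cr_f :: "nat \<Rightarrow> 'b \<Rightarrow> 'b option"

definition crystal_embedding :: "nat \<Rightarrow> 'a crystal \<Rightarrow> 'b crystal \<Rightarrow> ('a \<Rightarrow> 'b) \<Rightarrow> bool" where
  "crystal_embedding n B B' \<psi> \<longleftrightarrow>
     inj_on \<psi> (cr_set B) \<and> \<psi> ` cr_set B \<subseteq> cr_set B' \<and>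
     (\<forall>b \<in> cr_set B.
        (\<forall>i \<in> {1..n}.
           cr_wt B' (\<psi> b) i = cr_wt B b i \<and>
           cr_eps B' i (\<psi> b) = cr_eps B i b \<and>
           cr_phi B' i (\<psi> b) = cr_phi B i b \<and>
           cr_e B' i (\<psi> b) = map_option \<psi> (cr_e B i b) \<and>
           cr_f B' i (\<psi> b) = map_option \<psi> (cr_f B i b)))"

inductive_set connected_part :: "nat \<Rightarrow> 'b crystal \<Rightarrow> 'b \<Rightarrow> 'b set" for n B b where
  base: "b \<in> connected_part n B b"
| step_e: "x \<in> connected_part n B b \<Longrightarrow> i \<in> {1..n} \<Longrightarrow> cr_e B i x = Some y \<Longrightarrow> y \<in> connected_part n B b"
| step_f: "x \<in> connected_part n B b \<Longrightarrow> i \<in> {1..n} \<Longrightarrow> cr_f B i x = Some y \<Longrightarrow> y \<in> connected_part n B b"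

subsection \<open>Monomial crystals\<close>

text \<open>
  A Laurent monomial in the variables \<open>c\<^sub>i\<^sup>(\<^sup>m\<^sup>)\<close> is the finitely supported function sending
  \<open>(m, i)\<close> to its exponent \<open>l\<^sub>m\<^sub>,\<^sub>i\<close>. Monomials are thus written additively: \<open>+\<close> is their product.
\<close>

type_synonym monomial = "int \<times> nat \<Rightarrow>\<^sub>0 int"

definition c_var :: "int \<Rightarrow> nat \<Rightarrow> monomial" where
  "c_var m i = Poly_Mapping.single (m, i) 1"

definition mon_eval :: "(int \<Rightarrow> nat \<Rightarrow> complex) \<Rightarrow> monomial \<Rightarrow> complex" where
  "mon_eval c Y = (\<Prod>(m, i) \<in> Poly_Mapping.keys Y. c m i powi Poly_Mapping.lookup Y (m, i))"

definition A_mon :: "nat \<Rightarrow> (nat \<Rightarrow> nat \<Rightarrow> int) \<Rightarrow> int \<Rightarrow> nat \<Rightarrow> monomial" where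
  "A_mon n p m i = c_var m i + c_var (m + 1) i
     + (\<Sum>j \<in> {1..n} - {i}. Poly_Mapping.single (m + p j i, j) (cartan_D n j i))"

text \<open>The exponent sum \<open>\<Sum>\<^sub>k\<^sub>\<le>\<^sub>m l\<^sub>k\<^sub>,\<^sub>i\<close>, restricted to the support so that it is a finite sum.\<close>

definition psum :: "monomial \<Rightarrow> nat \<Rightarrow> int \<Rightarrow> int" where
  "psum Y i m = (\<Sum>k \<in> {k. k \<le> m \<and> (k, i) \<in> Poly_Mapping.keys Y}. Poly_Mapping.lookup Y (k, i))"

definition mon_wt :: "monomial \<Rightarrow> weight" where
  "mon_wt Y i = (\<Sum>k \<in> {k. (k, i) \<in> Poly_Mapping.keys Y}. Poly_Mapping.lookup Y (k, i))"

definition mon_phi :: "nat \<Rightarrow> monomial \<Rightarrow> int" where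
  "mon_phi i Y = Max (range (psum Y i))"

definition mon_eps :: "nat \<Rightarrow> monomial \<Rightarrow> int" where
  "mon_eps i Y = mon_phi i Y - mon_wt Y i"

definition mon_f :: "nat \<Rightarrow> (nat \<Rightarrow> nat \<Rightarrow> int) \<Rightarrow> nat \<Rightarrow> monomial \<Rightarrow> monomial option" where
  "mon_f n p i Y =
     (if mon_phi i Y > 0 then Some (Y - A_mon n p (LEAST m. mon_phi i Y = psum Y i m) i) else None)"

definition mon_e :: "nat \<Rightarrow> (nat \<Rightarrow> nat \<Rightarrow> int) \<Rightarrow> nat \<Rightarrow> monomial \<Rightarrow> monomial option" where
  "mon_e n p i Y =
     (if mon_eps i Y > 0 then Some (Y + A_mon n p (GREATEST m. mon_phi i Y = psum Y i m) i) else None)"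

definition mon_crystal :: "nat \<Rightarrow> (nat \<Rightarrow> nat \<Rightarrow> int) \<Rightarrow> monomial crystal" where
  "mon_crystal n p =
     \<lparr>cr_set = {Y. Poly_Mapping.keys Y \<subseteq> UNIV \<times> {1..n}}, cr_wt = mon_wt, cr_eps = mon_eps,
      cr_phi = mon_phi, cr_e = mon_e n p, cr_f = mon_f n p\<rparr>"

definition p0 :: "nat \<Rightarrow> nat \<Rightarrow> int" where
  "p0 i j = (if i < j then 1 else 0)"

text \<open>
  \<open>B(\<Lambda>\<^sub>i)\<close> is realized as the connected component of the highest weight monomial \<open>c\<^sub>i\<^sup>(\<^sup>0\<^sup>)\<close>.
\<close>

definition hw_elt :: "nat \<Rightarrow> monomial" where
  "hw_elt i = c_var 0 i"

definition fund_crystal :: "nat \<Rightarrow> nat \<Rightarrow> monomial crystal" where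
  "fund_crystal n i =
     (mon_crystal n p0)\<lparr>cr_set := connected_part n (mon_crystal n p0) (hw_elt i)\<rparr>"

subsection \<open>The vector crystal\<close>

text \<open>The labels \<open>V j\<close> and \<open>Vbar j\<close>, for \<open>1 \<le> j \<le> n\<close>, of the elements of \<open>B(\<Lambda>\<^sub>1)\<close>, and their arrows.\<close>

datatype vec_label = V nat | Vbar nat

fun vec_f :: "nat \<Rightarrow> nat \<Rightarrow> vec_label \<Rightarrow> vec_label option" where
  "vec_f n i (V j) =
     (if i < n \<and> j = i then Some (V (i + 1))
      else if i = n \<and> j = n - 1 then Some (Vbar n)
      else if i = n \<and> j = n then Some (Vbar (n - 1))
      else None)"
| "vec_f n i (Vbar j) = (if i < n \<and> j = i + 1 then Some (Vbar i) else None)"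

definition vec_labelling :: "nat \<Rightarrow> (vec_label \<Rightarrow> monomial) \<Rightarrow> bool" where
  "vec_labelling n v \<longleftrightarrow>
     bij_betw v (V ` {1..n} \<union> Vbar ` {1..n}) (cr_set (fund_crystal n 1)) \<and>
     v (V 1) = hw_elt 1 \<and>
     (\<forall>b \<in> V ` {1..n} \<union> Vbar ` {1..n}. \<forall>i \<in> {1..n}.
        cr_f (fund_crystal n 1) i (v b) = map_option v (vec_f n i b))"

end

theory Submission
  imports "HOL-Complex_Analysis.Conformal_Mappings" Defs
begin

text \<open>
  A principal minor is determined on the big cell, hence on any word in the one-parameter subgroups,
  by analytic continuation from the neighbourhood of the identity where all prefixes of the word stay
  in the cell. Running the Gauss decomposition simultaneously in \<open>G\<close> and in a second representation
  of the Chevalley--Serre relations therefore identifies \<open>\<Delta>\<close> with any function that takes the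
  right values on the big cell of the second representation: the leading \<open>k \<times> k\<close> minor of the vector
  representation for \<open>k \<le> n - 2\<close>, and the highest weight matrix coefficient of a half-spin
  representation for \<open>k = n - 1, n\<close>. Both representations are minuscule, so the Chevalley generators
  act by partial permutations of the weight vectors. In the vector representation the rows of partial
  products of \<open>\<Theta>\<close> telescope, so that condensation reduces the determinants to single matrix
  entries, and these are sums of monomials. In the half-spin representations the entry is extremal, and only one path contributes.
\<close>

hide_const (open) Finite_Cartesian_Product.mat Determinants.det Finite_Cartesian_Product.vec Finite_Cartesian_Product.row Finite_Cartesian_Product.transpose
no_notation Finite_Cartesian_Product.vec_nth (infixl "$" 90)

section \<open>One-parameter subgroups\<close>

text \<open>The group is given only by matrices satisfying the Chevalley-Serre relations, so no
  homomorphism from it to the comparison group is at hand. The product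
  \<open>GL N \<times>\<times> GL N'\<close> replaces one: the relations hold in both components,
  hence the two evaluations of a word get Gauss decompositions with the same torus coordinates
  \<open>s\<close>, and both functions to be compared take the value \<open>s k\<close>. The vector
  representation stops at k = n - 2 because its leading minor of size n - 1 has weight
  \<Lambda>_{n-1} + \<Lambda>_n; this is why the half-spin representations enter. The other obstacle
  is that \<open>w_bar\<close> uses an unspecified reduced word, so the signs of the representatives
  have to follow from reducedness alone. For this the Weyl group is realized by signed permutations
  and the length as half a number of inversions. The representative of w_0 then acts on row a of the
  vector representation with the sign (-1)^a; over k rows these signs multiply to the sign of
  reversing the rows, and the minors come out free of signs.\<close>

definition has_mderiv :: "nat \<Rightarrow> (complex \<Rightarrow> complex mat) \<Rightarrow> complex mat \<Rightarrow> complex \<Rightarrow> bool" where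
  "has_mderiv N F D t \<longleftrightarrow> D \<in> carrier_mat N N \<and> (\<forall>z. F z \<in> carrier_mat N N) \<and>
     (\<forall>r<N. \<forall>s<N. ((\<lambda>z. F z $$ (r, s)) has_field_derivative D $$ (r, s)) (at t))"

lemma has_mderivI:
  assumes "D \<in> carrier_mat N N" "\<And>z. F z \<in> carrier_mat N N"
    "\<And>r s. r < N \<Longrightarrow> s < N \<Longrightarrow> ((\<lambda>z. F z $$ (r, s)) has_field_derivative D $$ (r, s)) (at t)"
  shows "has_mderiv N F D t"
  using assms by (auto simp: has_mderiv_def)

lemma has_mderiv_dims:
  assumes "has_mderiv N F D t"
  shows "dim_row (F z) = N" "dim_col (F z) = N" "dim_row D = N" "dim_col D = N"
  using assms by (auto simp: has_mderiv_def)

lemma has_mderivD: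
  assumes "has_mderiv N F D t" "r < N" "s < N"
  shows "((\<lambda>z. F z $$ (r, s)) has_field_derivative D $$ (r, s)) (at t)"
  using assms by (auto simp: has_mderiv_def)

lemma has_mderiv_const: "A \<in> carrier_mat N N \<Longrightarrow> has_mderiv N (\<lambda>z. A) (0\<^sub>m N N) t"
  by (rule has_mderivI) auto

lemma has_mderiv_chain:
  assumes "has_mderiv N F D (g t)" "(g has_field_derivative g') (at t)"
  shows "has_mderiv N (\<lambda>z. F (g z)) (g' \<cdot>\<^sub>m D) t"
proof (intro has_mderivI carrier_matI)
  fix r s assume rs: "r < N" "s < N"
  have "((\<lambda>z. F (g z) $$ (r, s)) has_field_derivative D $$ (r, s) * g') (at t)"
    using DERIV_chain2[OF has_mderivD[OF assms(1) rs] assms(2)] .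
  then show "((\<lambda>z. F (g z) $$ (r, s)) has_field_derivative (g' \<cdot>\<^sub>m D) $$ (r, s)) (at t)"
    using has_mderiv_dims[OF assms(1)] rs by (simp add: mult.commute)
qed (use has_mderiv_dims[OF assms(1)] in auto)

lemma mult_entry:
  assumes "A \<in> carrier_mat N N" "B \<in> carrier_mat N N" "r < N" "s < N"
  shows "(A * B) $$ (r, s) = (\<Sum>k<N. A $$ (r, k) * B $$ (k, s))"
  using assms by (auto simp: scalar_prod_def atLeast0LessThan intro!: sum.cong)

lemma has_mderiv_mult:
  assumes F: "has_mderiv N F D t" and G: "has_mderiv N G E t"
  shows "has_mderiv N (\<lambda>z. F z * G z) (D * G t + F t * E) t"
proof (rule has_mderivI)
  fix r s assume rs: "r < N" "s < N"
  have c: "D \<in> carrier_mat N N" "E \<in> carrier_mat N N" "\<And>z. F z \<in> carrier_mat N N" "\<And>z. G z \<in> carrier_mat N N"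
    using F G by (auto simp: has_mderiv_def)
  have 1: "(\<lambda>z. (F z * G z) $$ (r, s)) = (\<lambda>z. \<Sum>k<N. F z $$ (r, k) * G z $$ (k, s))"
    using rs c by (auto simp: mult_entry[where N = N])
  have "(D * G t + F t * E) $$ (r, s) = (D * G t) $$ (r, s) + (F t * E) $$ (r, s)"
    using rs c(1,2) c(3)[of t] c(4)[of t] by (subst index_add_mat) auto
  also have "\<dots> = (\<Sum>k<N. D $$ (r, k) * G t $$ (k, s) + F t $$ (r, k) * E $$ (k, s))"
    using rs c by (simp add: mult_entry[where N = N] sum.distrib del: index_mult_mat)
  finally have 2: "(D * G t + F t * E) $$ (r, s) = (\<Sum>k<N. D $$ (r, k) * G t $$ (k, s) + F t $$ (r, k) * E $$ (k, s))" .
  show "((\<lambda>z. (F z * G z) $$ (r, s)) has_field_derivative (D * G t + F t * E) $$ (r, s)) (at t)"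
    unfolding 1 2 by (rule DERIV_sum, rule DERIV_cong[OF DERIV_mult])
       (use F G rs in \<open>auto simp: has_mderiv_def\<close>)
qed (use assms in \<open>auto simp: has_mderiv_def intro!: add_carrier_mat mult_carrier_mat\<close>)

lemma has_mderiv_zero_const:
  assumes "\<And>t. has_mderiv N F (0\<^sub>m N N) t"
  shows "F t = F 0"
proof (rule eq_matI)
  have c: "F z \<in> carrier_mat N N" for z using assms by (auto simp: has_mderiv_def)
  show "dim_row (F t) = dim_row (F 0)" "dim_col (F t) = dim_col (F 0)" using c[of t] c[of 0] by auto
  fix r s assume "r < dim_row (F 0)" "s < dim_col (F 0)"
  then have rs: "r < N" "s < N" using c[of 0] by auto
  then have "((\<lambda>z. F z $$ (r, s)) has_field_derivative 0) (at z within UNIV)" for z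
    using assms[of z] by (auto simp: has_mderiv_def)
  then have "\<exists>k. \<forall>z\<in>UNIV. F z $$ (r, s) = (k :: complex)"
    by (intro has_field_derivative_zero_constant) auto
  then show "F t $$ (r, s) = F 0 $$ (r, s)" by (metis UNIV_I)
qed

lemma smult_pow_mat:
  assumes "(A :: complex mat) \<in> carrier_mat N N"
  shows "(t \<cdot>\<^sub>m A) ^\<^sub>m k = t ^ k \<cdot>\<^sub>m A ^\<^sub>m k"
proof (induction k)
  case (Suc k)
  have "(t \<cdot>\<^sub>m A) ^\<^sub>m Suc k = (t ^ k \<cdot>\<^sub>m A ^\<^sub>m k) * (t \<cdot>\<^sub>m A)" using Suc by simp
  also have "\<dots> = t ^ Suc k \<cdot>\<^sub>m (A ^\<^sub>m k * A)"
    using assms pow_carrier_mat[OF assms, of k]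
    by (intro eq_matI) (auto simp: scalar_prod_def sum_distrib_left intro!: sum.cong)
  finally show ?case by simp
qed (use assms in auto)

text \<open>Each matrix product sums N terms, each bounded by the previous bound times the sum of
  all norms of entries. Geometric growth of the powers bounds the exponential series entrywise by a
  scalar exponential series.\<close>

lemma pow_mat_entry_bound:
  assumes A: "(A :: complex mat) \<in> carrier_mat N N"
  obtains B where "\<And>k r s. r < N \<Longrightarrow> s < N \<Longrightarrow> norm ((A ^\<^sub>m k) $$ (r, s)) \<le> B ^ k" "B \<ge> 0"
proof -
  define M where "M = (\<Sum>r<N. \<Sum>s<N. norm (A $$ (r, s)))"
  have M: "norm (A $$ (r, s)) \<le> M" if "r < N" "s < N" for r s
  proof -
    have "norm (A $$ (r, s)) \<le> (\<Sum>s<N. norm (A $$ (r, s)))"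
      using that by (intro member_le_sum) auto
    also have "\<dots> \<le> M" unfolding M_def using that
      by (intro member_le_sum[where f = "\<lambda>r. \<Sum>s<N. norm (A $$ (r, s))"]) (auto intro: sum_nonneg)
    finally show ?thesis .
  qed
  have M0: "M \<ge> 0" unfolding M_def by (intro sum_nonneg) auto
  have "norm ((A ^\<^sub>m k) $$ (r, s)) \<le> (real N * M) ^ k" if "r < N" "s < N" for k r s
    using that
  proof (induction k arbitrary: r s)
    case (Suc k)
    have "norm ((A ^\<^sub>m Suc k) $$ (r, s)) = norm (\<Sum>l<N. (A ^\<^sub>m k) $$ (r, l) * A $$ (l, s))"
      using Suc.prems A by (simp add: mult_entry[where N = N] del: index_mult_mat)
    also have "\<dots> \<le> (\<Sum>l<N. (real N * M) ^ k * M)"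
      by (intro order.trans[OF norm_sum] sum_mono) (use Suc M M0 in \<open>auto simp: norm_mult intro!: mult_mono\<close>)
    finally show ?case by (simp add: mult_ac)
  qed (use A in auto)
  then show ?thesis using that[of "real N * M"] M0 by auto
qed

lemma one_param_carrier [simp]: "one_param N A t \<in> carrier_mat N N"
  by (auto simp: one_param_def mat_exp_def)

lemma one_param_dim [simp]: "dim_row (one_param N A t) = N" "dim_col (one_param N A t) = N"
  by (auto simp: one_param_def mat_exp_def)

lemma one_param_entry:
  assumes "A \<in> carrier_mat N N" "r < N" "s < N"
  shows "one_param N A t $$ (r, s) = (suminf (\<lambda>k. (A ^\<^sub>m k) $$ (r, s) / fact k * t ^ k))"
proof -
  have d: "dim_row (A ^\<^sub>m k) = N" "dim_col (A ^\<^sub>m k) = N" for k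
    using pow_carrier_mat[OF assms(1), of k] by auto
  show ?thesis using assms(2,3) d
    by (simp add: one_param_def mat_exp_def smult_pow_mat[OF assms(1)] mult_ac)
qed

lemma one_param_summable:
  assumes "A \<in> carrier_mat N N" "r < N" "s < N"
  shows "summable (\<lambda>k. (A ^\<^sub>m k) $$ (r, s) / fact k * (t :: complex) ^ k)"
proof -
  obtain B where B: "\<And>k r s. r < N \<Longrightarrow> s < N \<Longrightarrow> norm ((A ^\<^sub>m k) $$ (r, s)) \<le> B ^ k" "B \<ge> 0"
    using pow_mat_entry_bound[OF assms(1)] by blast
  show ?thesis
  proof (rule summable_comparison_test')
    show "summable (\<lambda>k. inverse (fact k) * (B * norm t) ^ k)" by (rule summable_exp)
    show "norm ((A ^\<^sub>m k) $$ (r, s) / fact k * t ^ k) \<le> inverse (fact k) * (B * norm t) ^ k" for k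
      using mult_right_mono[OF B(1)[OF assms(2,3), of k], of "norm t ^ k / fact k"]
      by (simp add: norm_mult norm_divide norm_power power_mult_distrib field_simps)
  qed
qed

lemma one_param_zero [simp]:
  assumes "A \<in> carrier_mat N N"
  shows "one_param N A 0 = 1\<^sub>m N"
proof (rule eq_matI)
  fix r s assume "r < dim_row (1\<^sub>m N)" "s < dim_col (1\<^sub>m N)"
  then have rs: "r < N" "s < N" by auto
  show "one_param N A 0 $$ (r, s) = 1\<^sub>m N $$ (r, s)"
    unfolding one_param_entry[OF assms rs] powser_zero using rs assms by simp
qed auto

lemma one_param_deriv_entry:
  assumes A: "A \<in> carrier_mat N N" and rs: "r < N" "s < N"
  shows "((\<lambda>t. one_param N A t $$ (r, s)) has_field_derivative (suminf (\<lambda>k. (A ^\<^sub>m Suc k) $$ (r, s) / fact k * t ^ k))) (at t)"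
proof -
  have "((\<lambda>t. suminf (\<lambda>k. (A ^\<^sub>m k) $$ (r, s) / fact k * t ^ k)) has_field_derivative
      (suminf (\<lambda>k. diffs (\<lambda>k. (A ^\<^sub>m k) $$ (r, s) / fact k) k * t ^ k))) (at t)"
    by (rule termdiffs_strong_converges_everywhere) (rule one_param_summable[OF A rs])
  moreover have "diffs (\<lambda>k. (A ^\<^sub>m k) $$ (r, s) / fact k) = (\<lambda>k. (A ^\<^sub>m Suc k) $$ (r, s) / fact k)"
    by (rule ext) (simp add: diffs_def divide_simps del: pow_mat.simps of_nat_Suc)
  ultimately show ?thesis using one_param_entry[OF A rs] by simp
qed

lemma pow_mat_Suc_left: "A \<in> carrier_mat N N \<Longrightarrow> A ^\<^sub>m Suc k = A * A ^\<^sub>m k" for A :: "complex mat"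
proof (induction k)
  case (Suc k)
  have "A ^\<^sub>m Suc (Suc k) = A * A ^\<^sub>m k * A" using Suc by simp
  also have "\<dots> = A * (A ^\<^sub>m k * A)" using Suc.prems by (intro assoc_mult_mat) (auto intro: pow_carrier_mat)
  finally show ?case by simp
qed auto

lemma one_param_deriv_right:
  assumes A: "A \<in> carrier_mat N N"
  shows "has_mderiv N (one_param N A) (one_param N A t * A) t"
proof (rule has_mderivI)
  fix r s assume rs: "r < N" "s < N"
  have "(one_param N A t * A) $$ (r, s) = (\<Sum>l<N. (suminf (\<lambda>k. (A ^\<^sub>m k) $$ (r, l) / fact k * t ^ k)) * A $$ (l, s))"
    using rs A by (simp add: mult_entry[where N = N] one_param_entry[OF A] del: index_mult_mat)
  also have "\<dots> = (\<Sum>l<N. (suminf (\<lambda>k. (A ^\<^sub>m k) $$ (r, l) / fact k * t ^ k * A $$ (l, s))))"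
    by (intro sum.cong refl suminf_mult2) (use one_param_summable[OF A] rs in auto)
  also have "\<dots> = (suminf (\<lambda>k. \<Sum>l<N. (A ^\<^sub>m k) $$ (r, l) / fact k * t ^ k * A $$ (l, s)))"
    by (intro suminf_sum[symmetric] summable_mult2) (use one_param_summable[OF A] rs in auto)
  also have "\<dots> = (suminf (\<lambda>k. (A ^\<^sub>m Suc k) $$ (r, s) / fact k * t ^ k))"
    using A rs by (intro arg_cong[where f = suminf] ext)
      (simp only: pow_mat.simps mult_entry[OF pow_carrier_mat[OF A] A] sum_divide_distrib sum_distrib_right, simp add: mult_ac)
  finally show "((\<lambda>z. one_param N A z $$ (r, s)) has_field_derivative (one_param N A t * A) $$ (r, s)) (at t)"
    using one_param_deriv_entry[OF A rs] by simp
qed (use A in auto)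

lemma one_param_deriv_left:
  assumes A: "A \<in> carrier_mat N N"
  shows "has_mderiv N (one_param N A) (A * one_param N A t) t"
proof (rule has_mderivI)
  fix r s assume rs: "r < N" "s < N"
  have "(A * one_param N A t) $$ (r, s) = (\<Sum>l<N. A $$ (r, l) * (suminf (\<lambda>k. (A ^\<^sub>m k) $$ (l, s) / fact k * t ^ k)))"
    using rs A by (simp add: mult_entry[where N = N] one_param_entry[OF A] del: index_mult_mat)
  also have "\<dots> = (\<Sum>l<N. (suminf (\<lambda>k. A $$ (r, l) * ((A ^\<^sub>m k) $$ (l, s) / fact k * t ^ k))))"
    by (intro sum.cong refl suminf_mult[symmetric]) (use one_param_summable[OF A] rs in auto)
  also have "\<dots> = (suminf (\<lambda>k. \<Sum>l<N. A $$ (r, l) * ((A ^\<^sub>m k) $$ (l, s) / fact k * t ^ k)))"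
    by (intro suminf_sum[symmetric] summable_mult) (use one_param_summable[OF A] rs in auto)
  also have "\<dots> = (suminf (\<lambda>k. (A ^\<^sub>m Suc k) $$ (r, s) / fact k * t ^ k))"
    using A rs by (intro arg_cong[where f = suminf] ext)
      (simp only: pow_mat_Suc_left[OF A] mult_entry[OF A pow_carrier_mat[OF A]] sum_divide_distrib sum_distrib_right, simp add: mult_ac)
  finally show "((\<lambda>z. one_param N A z $$ (r, s)) has_field_derivative (A * one_param N A t) $$ (r, s)) (at t)"
    using one_param_deriv_entry[OF A rs] by simp
qed (use A in auto)

lemma has_mderiv_cong: "has_mderiv N F D t \<Longrightarrow> D = D' \<Longrightarrow> has_mderiv N F D' t"
  by simp

context
  fixes N :: nat
begin

lemma sq_assoc: "A \<in> carrier_mat N N \<Longrightarrow> B \<in> carrier_mat N N \<Longrightarrow> C \<in> carrier_mat N N \<Longrightarrow> A * B * C = A * (B * C)"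
  for A B C :: "complex mat" by (rule assoc_mult_mat)
lemma sq_distl: "A \<in> carrier_mat N N \<Longrightarrow> B \<in> carrier_mat N N \<Longrightarrow> C \<in> carrier_mat N N \<Longrightarrow> A * (B + C) = A * B + A * C"
  for A B C :: "complex mat" by (rule mult_add_distrib_mat)
lemma sq_distr: "A \<in> carrier_mat N N \<Longrightarrow> B \<in> carrier_mat N N \<Longrightarrow> C \<in> carrier_mat N N \<Longrightarrow> (A + B) * C = A * C + B * C"
  for A B C :: "complex mat" by (rule add_mult_distrib_mat)
lemma sq_distl': "A \<in> carrier_mat N N \<Longrightarrow> B \<in> carrier_mat N N \<Longrightarrow> C \<in> carrier_mat N N \<Longrightarrow> A * (B - C) = A * B - A * C"
  for A B C :: "complex mat" by (rule mult_minus_distrib_mat)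
lemma sq_distr': "A \<in> carrier_mat N N \<Longrightarrow> B \<in> carrier_mat N N \<Longrightarrow> C \<in> carrier_mat N N \<Longrightarrow> (A - B) * C = A * C - B * C"
  for A B C :: "complex mat" by (rule minus_mult_distrib_mat)
lemma sq_smultl: "A \<in> carrier_mat N N \<Longrightarrow> B \<in> carrier_mat N N \<Longrightarrow> (c \<cdot>\<^sub>m A) * B = c \<cdot>\<^sub>m (A * B)"
  for A B :: "complex mat" by (rule mult_smult_assoc_mat)
lemma sq_smultr: "A \<in> carrier_mat N N \<Longrightarrow> B \<in> carrier_mat N N \<Longrightarrow> A * (c \<cdot>\<^sub>m B) = c \<cdot>\<^sub>m (A * B)"
  for A B :: "complex mat" by (rule mult_smult_distrib)
lemma sq_closed:
  "A \<in> carrier_mat N N \<Longrightarrow> B \<in> carrier_mat N N \<Longrightarrow> A * B \<in> carrier_mat N N"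
  "A \<in> carrier_mat N N \<Longrightarrow> B \<in> carrier_mat N N \<Longrightarrow> A + B \<in> carrier_mat N N"
  "A \<in> carrier_mat N N \<Longrightarrow> B \<in> carrier_mat N N \<Longrightarrow> A - B \<in> carrier_mat N N"
  "A \<in> carrier_mat N N \<Longrightarrow> c \<cdot>\<^sub>m A \<in> carrier_mat N N"
  for A B :: "complex mat" by auto
lemma sq_add_entry: "A \<in> carrier_mat N N \<Longrightarrow> B \<in> carrier_mat N N \<Longrightarrow> r < N \<Longrightarrow> s < N \<Longrightarrow>
    (A + B) $$ (r, s) = A $$ (r, s) + B $$ (r, s)" for A B :: "complex mat" by simp
lemma sq_minus_entry: "A \<in> carrier_mat N N \<Longrightarrow> B \<in> carrier_mat N N \<Longrightarrow> r < N \<Longrightarrow> s < N \<Longrightarrow>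
    (A - B) $$ (r, s) = A $$ (r, s) - B $$ (r, s)" for A B :: "complex mat" by simp
lemma sq_smult_entry: "A \<in> carrier_mat N N \<Longrightarrow> r < N \<Longrightarrow> s < N \<Longrightarrow>
    (c \<cdot>\<^sub>m A) $$ (r, s) = c * A $$ (r, s)" for A :: "complex mat" by simp

lemmas sq_simps = sq_assoc sq_distl sq_distr sq_distl' sq_distr' sq_smultl sq_smultr sq_closed
lemmas sq_entries = sq_add_entry sq_minus_entry sq_smult_entry

lemma sq_eqI:
  assumes "A \<in> carrier_mat N N" "B \<in> carrier_mat N N"
    "\<And>r s. r < N \<Longrightarrow> s < N \<Longrightarrow> A $$ (r, s) = B $$ (r, s)"
  shows "A = B"
  using assms by (intro eq_matI) auto

abbreviation (input) "E \<equiv> one_param N"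

lemma one_param_neg_deriv:
  assumes A: "A \<in> carrier_mat N N"
  shows "has_mderiv N (\<lambda>z. E A (- z)) ((-1) \<cdot>\<^sub>m (E A (- t) * A)) t"
    and "has_mderiv N (\<lambda>z. E A (- z)) ((-1) \<cdot>\<^sub>m (A * E A (- t))) t"
proof -
  have d: "((\<lambda>z :: complex. - z) has_field_derivative - 1) (at t)" by (auto intro!: derivative_eq_intros)
  show "has_mderiv N (\<lambda>z. E A (- z)) ((-1) \<cdot>\<^sub>m (E A (- t) * A)) t"
    by (rule has_mderiv_chain[OF one_param_deriv_right[OF A] d])
  show "has_mderiv N (\<lambda>z. E A (- z)) ((-1) \<cdot>\<^sub>m (A * E A (- t))) t"
    by (rule has_mderiv_chain[OF one_param_deriv_left[OF A] d])
qed

lemma one_param_inverse: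
  assumes A: "A \<in> carrier_mat N N"
  shows "E A t * E A (- t) = 1\<^sub>m N"
proof -
  have "has_mderiv N (\<lambda>t. E A t * E A (- t)) (0\<^sub>m N N) t" for t
    by (rule has_mderiv_cong[OF has_mderiv_mult[OF one_param_deriv_right[OF A, of t] one_param_neg_deriv(2)[OF A, of t]]],
        rule sq_eqI) (simp_all add: A sq_simps sq_entries del: index_mult_mat)
  from has_mderiv_zero_const[OF this, of t] show ?thesis using A by simp
qed

lemma one_param_inverse':
  assumes A: "A \<in> carrier_mat N N"
  shows "E A (- t) * E A t = 1\<^sub>m N"
  using one_param_inverse[OF A, of "- t"] by simp

text \<open>The derivative of \<open>E A (- t) * F t\<close> vanishes. The identities between
  exponentials below rest on this: both sides solve the same linear equation with the same value at
  0.\<close>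

lemma one_param_uniqueness:
  assumes A: "A \<in> carrier_mat N N" and F: "\<And>t. has_mderiv N F (A * F t) t"
  shows "F t = E A t * F 0"
proof -
  have c: "F t \<in> carrier_mat N N" for t using F[of t] by (auto simp: has_mderiv_def)
  have "has_mderiv N (\<lambda>t. E A (- t) * F t) (0\<^sub>m N N) t" for t
    by (rule has_mderiv_cong[OF has_mderiv_mult[OF one_param_neg_deriv(1)[OF A, of t] F[of t]]],
        rule sq_eqI) (simp_all add: A c sq_simps sq_entries del: index_mult_mat)
  from has_mderiv_zero_const[OF this, of t] have *: "E A (- t) * F t = F 0" using A c[of 0] by simp
  have "F t = E A t * E A (- t) * F t" using one_param_inverse[OF A, of t] c[of t] by simp
  also have "\<dots> = E A t * (E A (- t) * F t)" using c A by (simp add: sq_simps)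
  finally show ?thesis using * by simp
qed

text \<open>The hypothesis is the Lax equation X' = [A, X], solved by the conjugates of
  \<open>X 0\<close> under exp(t A). An adjoint action is thus computed by exhibiting a solution,
  which below is polynomial or a scalar exponential in t.\<close>

lemma one_param_conj:
  assumes A: "A \<in> carrier_mat N N" and X: "\<And>t. has_mderiv N X (A * X t - X t * A) t"
  shows "E A t * X 0 = X t * E A t"
proof -
  have c: "X t \<in> carrier_mat N N" for t using X[of t] by (auto simp: has_mderiv_def)
  have "has_mderiv N (\<lambda>t. X t * E A t) (A * (X t * E A t)) t" for t
    by (rule has_mderiv_cong[OF has_mderiv_mult[OF X[of t] one_param_deriv_left[OF A, of t]]],
        rule sq_eqI) (simp_all add: A c sq_simps sq_entries del: index_mult_mat)
  from one_param_uniqueness[OF A this, of t] show ?thesis using A c[of 0] by simp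
qed

lemma one_param_intertwine:
  assumes "X \<in> carrier_mat N N" "Y \<in> carrier_mat N N" and g: "g \<in> carrier_mat N N" and "g * X = Y * g"
  shows "g * E X t = E Y t * g"
proof -
  have "has_mderiv N (\<lambda>t. g * E X t) (Y * (g * E X t)) t" for t
  proof (rule has_mderiv_cong[OF has_mderiv_mult[OF has_mderiv_const[OF g] one_param_deriv_left[OF assms(1), of t]]])
    have "g * (X * E X t) = (g * X) * E X t" using assms(1-3) by (simp add: sq_assoc)
    also have "\<dots> = Y * (g * E X t)" unfolding assms(4) using assms(1-3) by (simp add: sq_assoc)
    finally have "g * (X * E X t) = Y * (g * E X t)" .
    then show "0\<^sub>m N N * E X t + g * (X * E X t) = Y * (g * E X t)" using assms
      by (simp add: left_add_zero_mat[of _ N N] sq_simps)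
  qed
  from one_param_uniqueness[OF assms(2) this, of t] show ?thesis using assms by simp
qed

lemma one_param_add:
  assumes A: "A \<in> carrier_mat N N"
  shows "E A (s + t) = E A s * E A t"
proof -
  have "has_mderiv N (\<lambda>s. E A (s + t)) (A * E A (s + t)) s" for s
  proof -
    have d: "((\<lambda>z. z + t) has_field_derivative 1) (at s)" by (auto intro!: derivative_eq_intros)
    show ?thesis
      by (rule has_mderiv_cong[OF has_mderiv_chain[OF one_param_deriv_left[OF A] d]])
        (use A in \<open>auto intro!: eq_matI\<close>)
  qed
  from one_param_uniqueness[OF A this, of s] show ?thesis by simp
qed

lemma one_param_smult:
  shows "E (c \<cdot>\<^sub>m A) t = E A (c * t)"
proof -
  have "t \<cdot>\<^sub>m (c \<cdot>\<^sub>m A) = (c * t) \<cdot>\<^sub>m A" by (rule eq_matI) auto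
  then show ?thesis by (simp add: one_param_def)
qed

lemma one_param_sum:
  assumes A: "A \<in> carrier_mat N N" and B: "B \<in> carrier_mat N N" and AB: "A * B = B * A"
  shows "E (A + B) t = E A t * E B t"
proof -
  have 1: "E A t * B = B * E A t" for t
    using one_param_intertwine[OF A A B] AB by simp
  have "has_mderiv N (\<lambda>t. E A t * E B t) ((A + B) * (E A t * E B t)) t" for t
  proof (rule has_mderiv_cong[OF has_mderiv_mult[OF one_param_deriv_left[OF A, of t] one_param_deriv_left[OF B, of t]]])
    have "E A t * (B * E B t) = (E A t * B) * E B t" using A B by (simp add: sq_assoc)
    also have "\<dots> = B * (E A t * E B t)" unfolding 1[of t] using A B by (simp add: sq_assoc)
    finally have "E A t * (B * E B t) = B * (E A t * E B t)" .
    then show "A * E A t * E B t + E A t * (B * E B t) = (A + B) * (E A t * E B t)"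
      using A B by (simp add: sq_simps)
  qed
  from one_param_uniqueness[OF _ this, of t] show ?thesis using A B by simp
qed

end

lemma smult_one: "1 \<cdot>\<^sub>m (A :: complex mat) = A"
  by (rule eq_matI) auto

text \<open>As Y is an eigenvector of ad H, the Lax equation is solved by exp(a z) times Y.
  Exponentiating the resulting intertwining relation gives the action of the torus on a root
  subgroup.\<close>

lemma one_param_weight:
  assumes H: "H \<in> carrier_mat N N" and Y: "Y \<in> carrier_mat N N" and w: "H * Y - Y * H = a \<cdot>\<^sub>m Y"
  shows "one_param N H z * one_param N Y r = one_param N Y (exp (a * z) * r) * one_param N H z"
proof -
  have w': "(H * Y) $$ (i, j) = (Y * H) $$ (i, j) + a * Y $$ (i, j)" if "i < N" "j < N" for i j
  proof -
    have "(H * Y - Y * H) $$ (i, j) = (a \<cdot>\<^sub>m Y) $$ (i, j)" using w by simp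
    then show ?thesis using that H Y by (simp add: sq_entries[where N = N] sq_closed[where N = N] algebra_simps del: index_mult_mat)
  qed
  have "has_mderiv N (\<lambda>z. exp (a * z) \<cdot>\<^sub>m Y) (H * (exp (a * t) \<cdot>\<^sub>m Y) - (exp (a * t) \<cdot>\<^sub>m Y) * H) t" for t
  proof (rule has_mderiv_cong)
    show "has_mderiv N (\<lambda>z. exp (a * z) \<cdot>\<^sub>m Y) ((a * exp (a * t)) \<cdot>\<^sub>m Y) t"
      by (rule has_mderivI) (use Y in \<open>auto intro!: derivative_eq_intros\<close>)
    show "(a * exp (a * t)) \<cdot>\<^sub>m Y = H * (exp (a * t) \<cdot>\<^sub>m Y) - (exp (a * t) \<cdot>\<^sub>m Y) * H"
      by (rule sq_eqI[of _ N]) (use H Y in \<open>simp_all add: sq_simps[where N = N] sq_entries[where N = N] w' algebra_simps del: index_mult_mat\<close>)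
  qed
  from one_param_conj[OF H this, of z] have "one_param N H z * Y = (exp (a * z) \<cdot>\<^sub>m Y) * one_param N H z"
    using Y by (simp add: smult_one)
  from one_param_intertwine[OF Y _ _ this, of r] show ?thesis using Y by (simp add: one_param_smult)
qed

section \<open>Identities of SL2 for an arbitrary sl2-triple of matrices\<close>

locale sl2_triple =
  fixes N :: nat and e f h :: "complex mat"
  assumes carr: "e \<in> carrier_mat N N" "f \<in> carrier_mat N N" "h \<in> carrier_mat N N"
    and ef: "e * f - f * e = h" and he: "h * e - e * h = 2 \<cdot>\<^sub>m e" and hf: "h * f - f * h = (-2) \<cdot>\<^sub>m f"
begin

lemmas s_assoc = sq_assoc[where N = N]
lemmas s_closed = sq_closed[where N = N]
lemmas s_simps = sq_simps[where N = N]
lemmas s_entries = sq_entries[where N = N]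
lemmas s_distl = sq_distl[where N = N]
lemmas s_distr = sq_distr[where N = N]

abbreviation "x \<equiv> one_param N e"
abbreviation "y \<equiv> one_param N f"

lemma entry_rels:
  assumes "i < N" "j < N"
  shows "(e * f) $$ (i, j) = (f * e) $$ (i, j) + h $$ (i, j)"
    "(h * e) $$ (i, j) = (e * h) $$ (i, j) + 2 * e $$ (i, j)"
    "(h * f) $$ (i, j) = (f * h) $$ (i, j) - 2 * f $$ (i, j)"
proof -
  have "(e * f - f * e) $$ (i, j) = h $$ (i, j)" "(h * e - e * h) $$ (i, j) = (2 \<cdot>\<^sub>m e) $$ (i, j)"
    "(h * f - f * h) $$ (i, j) = ((-2) \<cdot>\<^sub>m f) $$ (i, j)" using ef he hf by simp_all
  then show "(e * f) $$ (i, j) = (f * e) $$ (i, j) + h $$ (i, j)"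
    "(h * e) $$ (i, j) = (e * h) $$ (i, j) + 2 * e $$ (i, j)"
    "(h * f) $$ (i, j) = (f * h) $$ (i, j) - 2 * f $$ (i, j)"
    using assms carr by (simp_all add: s_entries s_closed algebra_simps del: index_mult_mat)
qed

text \<open>Coordinates with respect to e, h, f. The three matrices may be linearly dependent;
  coordinates are only ever sent to matrices, never read off from them.\<close>

definition lin :: "complex \<Rightarrow> complex \<Rightarrow> complex \<Rightarrow> complex mat" where
  "lin a b c = a \<cdot>\<^sub>m e + b \<cdot>\<^sub>m h + c \<cdot>\<^sub>m f"

lemma lin_carrier [simp]: "lin a b c \<in> carrier_mat N N"
  using carr by (simp add: lin_def)

lemma lin_basis: "lin 1 0 0 = e" "lin 0 1 0 = h" "lin 0 0 1 = f"
  by (rule sq_eqI[of _ N]; use carr in \<open>simp add: lin_def\<close>)+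

lemma lin_smult: "r \<cdot>\<^sub>m lin a b c = lin (r * a) (r * b) (r * c)"
  by (rule sq_eqI[of _ N]; use carr in \<open>simp add: lin_def algebra_simps\<close>)

lemma lin_add: "lin a b c + lin a' b' c' = lin (a + a') (b + b') (c + c')"
  by (rule sq_eqI[of _ N]; use carr in \<open>simp add: lin_def algebra_simps\<close>)

lemma lin_deriv:
  assumes "(a has_field_derivative a') (at t)" "(b has_field_derivative b') (at t)" "(c has_field_derivative c') (at t)"
  shows "has_mderiv N (\<lambda>t. lin (a t) (b t) (c t)) (lin a' b' c') t"
proof (rule has_mderivI)
  fix i j assume "i < N" "j < N"
  then have *: "lin u v w $$ (i, j) = u * e $$ (i, j) + v * h $$ (i, j) + w * f $$ (i, j)" for u v w
    using carr by (simp add: lin_def)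
  show "((\<lambda>z. lin (a z) (b z) (c z) $$ (i, j)) has_field_derivative lin a' b' c' $$ (i, j)) (at t)"
    unfolding * by (intro DERIV_add DERIV_cmult_right assms)
qed auto

text \<open>The coordinates are those of exp(t ad e), which stops at the quadratic term because (ad
  e)^3 = 0 on the span of the triple.\<close>

lemma Ad_x: "x t * lin a b c = lin (a - 2 * t * b - t\<^sup>2 * c) (b + t * c) c * x t"
proof -
  define X where "X t = lin (a - 2 * t * b - t\<^sup>2 * c) (b + t * c) c" for t
  have "has_mderiv N X (e * X t - X t * e) t" for t
  proof (rule has_mderiv_cong)
    show "has_mderiv N X (lin (- 2 * b - 2 * t * c) c 0) t"
      unfolding X_def by (rule lin_deriv) (auto intro!: derivative_eq_intros)
    show "lin (- 2 * b - 2 * t * c) c 0 = e * X t - X t * e"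
      unfolding X_def lin_def
      by (rule sq_eqI[of _ N]) (use carr in \<open>simp_all add: s_simps s_entries entry_rels algebra_simps del: index_mult_mat\<close>)
  qed
  from one_param_conj[OF carr(1) this, of t] show ?thesis by (simp add: X_def)
qed

lemma Ad_y: "y t * lin a b c = lin a (b - t * a) (c + 2 * t * b - t\<^sup>2 * a) * y t"
proof -
  define X where "X t = lin a (b - t * a) (c + 2 * t * b - t\<^sup>2 * a)" for t
  have "has_mderiv N X (f * X t - X t * f) t" for t
  proof (rule has_mderiv_cong)
    show "has_mderiv N X (lin 0 (- a) (2 * b - 2 * t * a)) t"
      unfolding X_def by (rule lin_deriv) (auto intro!: derivative_eq_intros)
    show "lin 0 (- a) (2 * b - 2 * t * a) = f * X t - X t * f"
      unfolding X_def lin_def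
      by (rule sq_eqI[of _ N]) (use carr in \<open>simp_all add: s_simps s_entries entry_rels algebra_simps del: index_mult_mat\<close>)
  qed
  from one_param_conj[OF carr(2) this, of t] show ?thesis by (simp add: X_def)
qed

lemma x_carrier: "x t \<in> carrier_mat N N" and y_carrier: "y t \<in> carrier_mat N N"
  by simp_all

text \<open>For u \<noteq> 0, \<open>W u\<close> is the image of the SL2-matrix with rows (0, u),
  (-1/u, 0); \<open>sb\<close> is the image of the one with rows (0, -1), (1, 0), and
  \<open>cor u\<close> that of diag(u, 1/u).\<close>

definition W :: "complex \<Rightarrow> complex mat" where "W u = x u * (y (- inverse u) * x u)"
definition sb :: "complex mat" where "sb = x (- 1) * (y 1 * x (- 1))"
definition cor :: "complex \<Rightarrow> complex mat" where "cor u = x u * (y (- inverse u) * (x u * sb))"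

lemma WS_carrier [simp]: "W u \<in> carrier_mat N N" "sb \<in> carrier_mat N N" "cor u \<in> carrier_mat N N"
  unfolding W_def sb_def cor_def by (intro s_closed x_carrier y_carrier)+

lemma cor_W: "cor u = W u * sb"
  unfolding cor_def W_def by (simp add: s_assoc s_closed)

lemma x_cancel: "x t * x (- t) = 1\<^sub>m N" "x (- t) * x t = 1\<^sub>m N" and y_cancel: "y t * y (- t) = 1\<^sub>m N" "y (- t) * y t = 1\<^sub>m N"
  using one_param_inverse carr one_param_inverse' by auto

lemma x_cancel': "A \<in> carrier_mat N N \<Longrightarrow> x t * (x (- t) * A) = A" "A \<in> carrier_mat N N \<Longrightarrow> x (- t) * (x t * A) = A"
  and y_cancel': "A \<in> carrier_mat N N \<Longrightarrow> y t * (y (- t) * A) = A" "A \<in> carrier_mat N N \<Longrightarrow> y (- t) * (y t * A) = A"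
  by (simp_all add: x_cancel y_cancel s_assoc[symmetric])

lemma W_neg: "W u * W (- u) = 1\<^sub>m N"
  unfolding W_def by (simp add: s_assoc s_closed x_cancel' y_cancel' x_cancel y_cancel)

lemma sb_W: "sb = W (- 1)" unfolding sb_def W_def by simp

lemma W_lin:
  assumes "u \<noteq> 0"
  shows "W u * lin a b c = lin (- u\<^sup>2 * c) (- b) (- a / u\<^sup>2) * W u"
proof -
  let ?v = "- inverse u"
  have "W u * lin a b c = x u * (y ?v * (x u * lin a b c))"
    by (simp add: W_def s_assoc s_closed)
  also have "\<dots> = x u * ((y ?v * lin (a - 2 * u * b - u\<^sup>2 * c) (b + u * c) c) * x u)"
    by (simp add: Ad_x s_assoc s_closed)
  also have "\<dots> = (x u * lin (a - 2 * u * b - u\<^sup>2 * c) (b + u * c - ?v * (a - 2 * u * b - u\<^sup>2 * c))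
      (c + 2 * ?v * (b + u * c) - ?v\<^sup>2 * (a - 2 * u * b - u\<^sup>2 * c))) * (y ?v * x u)"
    unfolding Ad_y by (simp add: s_assoc s_closed)
  also have "\<dots> = lin (- u\<^sup>2 * c) (- b) (- a / u\<^sup>2) * (x u * (y ?v * x u))"
  proof -
    have 1: "c + 2 * ?v * (b + u * c) - ?v\<^sup>2 * (a - 2 * u * b - u\<^sup>2 * c) = - a / u\<^sup>2"
      using assms by (simp add: field_simps power2_eq_square)
    have 2: "b + u * c - ?v * (a - 2 * u * b - u\<^sup>2 * c) = a / u - b"
      using assms by (simp add: field_simps power2_eq_square)
    have 3: "a - 2 * u * b - u\<^sup>2 * c - 2 * u * (a / u - b) - u\<^sup>2 * (- a / u\<^sup>2) = - u\<^sup>2 * c"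
      "a / u - b + u * (- a / u\<^sup>2) = - b"
      using assms by (simp_all add: field_simps power2_eq_square)
    show ?thesis unfolding 1 2 Ad_x 3 by (simp add: s_assoc s_closed)
  qed
  finally show ?thesis by (simp add: W_def)
qed

lemma cor_1: "cor 1 = 1\<^sub>m N"
  unfolding cor_W sb_W by (rule W_neg)

text \<open>The product rule gives one term for each of the factors x, y, x. Moving the
  differentiated generator to the left past the preceding factors turns these terms into
  \<open>lin u 0 0\<close>, \<open>lin (- u) 1 (- v)\<close> and \<open>lin 0 0 v\<close> times
  \<open>cor u\<close>, where u = exp z and v = - exp(-z). They add up to h, so both sides solve the
  same linear equation.\<close>

lemma cor_exp: "cor (exp z) = one_param N h z"
proof -
  have "has_mderiv N (\<lambda>z. cor (exp z)) (h * cor (exp z)) z" for z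
  proof -
    let ?u = "exp z" and ?v = "- exp (- z)"
    have uv: "?v = - inverse ?u" by (simp add: exp_minus)
    have d1: "has_mderiv N (\<lambda>z. x (exp z)) (?u \<cdot>\<^sub>m (e * x ?u)) z"
      by (rule has_mderiv_chain[OF one_param_deriv_left[OF carr(1)]]) (auto intro!: derivative_eq_intros)
    have d2: "has_mderiv N (\<lambda>z. y (- exp (- z))) ((- ?v) \<cdot>\<^sub>m (f * y ?v)) z"
      by (rule has_mderiv_chain[where g = "\<lambda>z. - exp (- z)", OF one_param_deriv_left[OF carr(2)]]) (auto intro!: derivative_eq_intros)
    have cor: "cor (exp z) = x (exp z) * (y (- exp (- z)) * (x (exp z) * sb))" for z
      by (simp add: cor_def exp_minus)
    let ?R = "y ?v * (x ?u * sb)"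
    have "has_mderiv N (\<lambda>z. cor (exp z)) (?u \<cdot>\<^sub>m (e * x ?u) * ?R +
        x ?u * ((- ?v) \<cdot>\<^sub>m (f * y ?v) * (x ?u * sb) + y ?v * (?u \<cdot>\<^sub>m (e * x ?u) * sb + x ?u * 0\<^sub>m N N))) z"
      unfolding cor
      by (intro has_mderiv_mult d1 d2 has_mderiv_const WS_carrier)
    moreover have "?u \<cdot>\<^sub>m (e * x ?u) * ?R +
        x ?u * ((- ?v) \<cdot>\<^sub>m (f * y ?v) * (x ?u * sb) + y ?v * (?u \<cdot>\<^sub>m (e * x ?u) * sb + x ?u * 0\<^sub>m N N)) = h * cor ?u"
    proof -
      have R: "?R \<in> carrier_mat N N" by (intro s_closed y_carrier x_carrier WS_carrier)
      have p1: "?u \<cdot>\<^sub>m (e * x ?u) * ?R = lin ?u 0 0 * cor ?u"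
      proof -
        have "?u \<cdot>\<^sub>m (e * x ?u) * ?R = (?u \<cdot>\<^sub>m e) * (x ?u * ?R)" using R carr by (simp add: s_simps)
        also have "?u \<cdot>\<^sub>m e = lin ?u 0 0" using lin_smult[of ?u 1 0 0] by (simp add: lin_basis)
        finally show ?thesis unfolding cor .
      qed
      have xf: "x ?u * f = lin (- ?u\<^sup>2) ?u 1 * x ?u"
        using Ad_x[of ?u 0 0 1] by (simp add: lin_basis)
      have "x ?u * ((- ?v) \<cdot>\<^sub>m (f * y ?v) * (x ?u * sb)) = (- ?v) \<cdot>\<^sub>m (x ?u * f * ?R)"
        using R carr by (simp add: s_simps)
      also have "\<dots> = ((- ?v) \<cdot>\<^sub>m lin (- ?u\<^sup>2) ?u 1) * cor ?u"
        unfolding xf cor using R by (simp add: s_simps)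
      also have "(- ?v) \<cdot>\<^sub>m lin (- ?u\<^sup>2) ?u 1 = lin (- ?u) 1 (- ?v)"
      proof -
        have "exp (- z) * (exp z)\<^sup>2 = exp z" "exp (- z) * exp z = 1"
          by (simp_all add: exp_minus power2_eq_square)
        then show ?thesis unfolding lin_smult by simp
      qed
      finally have p2: "x ?u * ((- ?v) \<cdot>\<^sub>m (f * y ?v) * (x ?u * sb)) = lin (- ?u) 1 (- ?v) * cor ?u" .
      have We: "W ?u * e = lin 0 0 (- (?v\<^sup>2)) * W ?u"
      proof -
        have "- 1 / ?u\<^sup>2 = - (?v\<^sup>2)" by (simp add: exp_minus divide_inverse power_inverse)
        then show ?thesis using W_lin[of ?u 1 0 0] by (simp add: lin_basis)
      qed
      have xe: "x ?u * e = e * x ?u" using Ad_x[of ?u 1 0 0] by (simp add: lin_basis)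
      have "x ?u * (y ?v * (?u \<cdot>\<^sub>m (e * x ?u) * sb)) = ?u \<cdot>\<^sub>m (x ?u * (y ?v * (e * x ?u * sb)))"
        using carr by (simp add: s_simps)
      also have "x ?u * (y ?v * (e * x ?u * sb)) = W ?u * e * sb"
        unfolding xe[symmetric] W_def uv using carr by (simp add: s_simps)
      also have "?u \<cdot>\<^sub>m (W ?u * e * sb) = (?u \<cdot>\<^sub>m lin 0 0 (- (?v\<^sup>2))) * cor ?u"
        unfolding We cor_W by (simp add: s_simps)
      also have "?u \<cdot>\<^sub>m lin 0 0 (- (?v\<^sup>2)) = lin 0 0 ?v"
      proof -
        have "exp z * ((exp (- z))\<^sup>2) = (exp z * exp (- z)) * exp (- z)"
          unfolding power2_eq_square by (simp only: mult.assoc)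
        also have "\<dots> = exp (- z)" by (simp add: exp_minus)
        finally show ?thesis unfolding lin_smult by simp
      qed
      finally have p3: "x ?u * (y ?v * (?u \<cdot>\<^sub>m (e * x ?u) * sb)) = lin 0 0 ?v * cor ?u" .
      have "?u \<cdot>\<^sub>m (e * x ?u) * ?R +
        x ?u * ((- ?v) \<cdot>\<^sub>m (f * y ?v) * (x ?u * sb) + y ?v * (?u \<cdot>\<^sub>m (e * x ?u) * sb + x ?u * 0\<^sub>m N N))
        = ?u \<cdot>\<^sub>m (e * x ?u) * ?R + (x ?u * ((- ?v) \<cdot>\<^sub>m (f * y ?v) * (x ?u * sb)) + x ?u * (y ?v * (?u \<cdot>\<^sub>m (e * x ?u) * sb)))"
        using carr by (simp add: s_closed s_distl right_mult_zero_mat[where nr = N and n = N and nc = N] right_add_zero_mat[where nr = N and nc = N])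
      also have "\<dots> = lin 0 1 0 * cor ?u"
        unfolding p1 p2 p3 by (simp add: s_distr[symmetric] lin_add)
      finally show ?thesis by (simp add: lin_basis)
    qed
    ultimately show ?thesis by simp
  qed
  from one_param_uniqueness[OF carr(3) this, of z] show ?thesis by (simp add: cor_1)
qed

lemma cor_ln: "u \<noteq> 0 \<Longrightarrow> cor u = one_param N h (Ln u)"
  using cor_exp[of "Ln u"] by simp

text \<open>Every nonzero number is an exponential, so this is additivity of the one-parameter group
  of h. \<open>Ln u + Ln v\<close> is some logarithm of u v, not always the principal one.\<close>

lemma cor_mult:
  assumes "u \<noteq> 0" "v \<noteq> 0"
  shows "cor (u * v) = cor u * cor v"
  using cor_exp[of "Ln u + Ln v"] assms one_param_add[OF carr(3), of "Ln u" "Ln v"]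
  by (simp add: exp_add cor_ln)

text \<open>\<open>W a\<close> anticommutes with h and therefore carries \<open>cor u\<close> to its
  inverse, while \<open>W (u * a) = cor u * W a\<close>.\<close>

lemma W_cor:
  assumes u: "u \<noteq> 0" and a: "a \<noteq> 0"
  shows "W (u * a) * cor u = W a"
proof -
  have W: "W w = cor w * W 1" for w
    using W_neg[of "-1"] by (simp add: cor_W s_assoc sb_W right_mult_one_mat[where nr = N and nc = N])
  have Wh: "W a * h = ((-1) \<cdot>\<^sub>m h) * W a"
    using W_lin[OF a, of 0 1 0] lin_smult[of "-1" 0 1 0] by (simp add: lin_basis)
  have "W (u * a) = cor u * W a"
    using W[of "u * a"] W[of a] cor_mult[OF u a] by (simp add: s_assoc)
  then have "W (u * a) * cor u = cor u * (W a * cor u)" by (simp add: s_assoc)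
  also have "W a * cor u = one_param N h (- Ln u) * W a"
    using one_param_intertwine[OF carr(3) _ WS_carrier(1) Wh, of "Ln u"] carr u
    by (simp add: cor_ln one_param_smult)
  also have "cor u * (one_param N h (- Ln u) * W a) = W a"
    using one_param_inverse[OF carr(3), of "Ln u"] u by (simp add: cor_ln s_assoc[symmetric] left_mult_one_mat[where nr = N and nc = N])
  finally show ?thesis .
qed

text \<open>The Gauss decomposition of x(t) y(s). For r \<noteq> 0 one has y(r) = x(1/r) W(-1/r)
  x(1/r); inserting this on the right for r = s / (1 + t s) and collecting the torus part gives x(t)
  times the same expression for r = s. The case s = 0 is separate because 1/s occurs.\<close>

lemma x_y:
  assumes u: "1 + t * s \<noteq> 0"
  shows "x t * y s = y (s / (1 + t * s)) * (cor (1 + t * s) * x (t / (1 + t * s)))"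
proof (cases "s = 0")
  case False
  let ?u = "1 + t * s"
  have y: "y r = x (1 / r) * (W (- (1 / r)) * x (1 / r))" if "r \<noteq> 0" for r
  proof -
    have "W (- (1 / r)) = x (- (1 / r)) * (y r * x (- (1 / r)))" by (simp add: W_def)
    then have "x (1 / r) * (W (- (1 / r)) * x (1 / r))
        = x (1 / r) * (x (- (1 / r)) * (y r * (x (- (1 / r)) * x (1 / r))))"
      by (simp add: s_assoc s_closed)
    also have "\<dots> = y r * (x (- (1 / r)) * x (1 / r))"
      by (rule x_cancel'(1)) (intro s_closed x_carrier y_carrier)
    also have "\<dots> = y r * 1\<^sub>m N" unfolding x_cancel(2) ..
    also have "\<dots> = y r" by (rule right_mult_one_mat) (rule y_carrier)
    finally show ?thesis by (rule sym)
  qed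
  have cx: "x (?u / s) * cor ?u = cor ?u * x (1 / (s * ?u))"
  proof -
    have e2: "exp (2 * Ln ?u) = ?u * ?u" using u unfolding mult_2 exp_add by simp
    have "?u * ?u * (1 / (s * ?u)) = ?u / s" using u False by (simp add: divide_simps)
    then show ?thesis
      using one_param_weight[OF carr(3,1) he, of "Ln ?u" "1 / (s * ?u)"] unfolding cor_ln[OF u] e2 by simp
  qed
  have "y (s / ?u) * (cor ?u * x (t / ?u)) = x (?u / s) * (W (- (?u / s)) * (x (?u / s) * cor ?u) * x (t / ?u))"
    using y[of "s / ?u"] u False by (simp add: s_assoc s_closed)
  also have "\<dots> = x (?u / s) * (W (- (?u / s)) * cor ?u * (x (1 / (s * ?u)) * x (t / ?u)))"
    unfolding cx by (simp add: s_assoc s_closed)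
  also have "W (- (?u / s)) * cor ?u = W (- (1 / s))"
    using W_cor[OF u, of "- (1 / s)"] False by simp
  also have "x (1 / (s * ?u)) * x (t / ?u) = x (1 / s)"
  proof -
    have "1 / (s * ?u) + t / ?u = 1 / s" using u False by (simp add: divide_simps)
    then show ?thesis using one_param_add[OF carr(1), of "1 / (s * ?u)" "t / ?u"] by simp
  qed
  also have "x (?u / s) = x t * x (1 / s)"
  proof -
    have "?u / s = t + 1 / s" using False by (simp add: divide_simps)
    then show ?thesis using one_param_add[OF carr(1), of t "1 / s"] by simp
  qed
  also have "x t * x (1 / s) * (W (- (1 / s)) * x (1 / s)) = x t * y s"
    using y[OF False] by (simp add: s_assoc s_closed)
  finally show ?thesis by simp
qed (use carr in \<open>simp add: cor_1\<close>)

end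

section \<open>Commutation relations between root subgroups\<close>

lemma cartan_D_simps:
  "cartan_D n i i = 2" "i \<noteq> j \<Longrightarrow> cartan_D n i j = 0 \<or> cartan_D n i j = - 1" "cartan_D n i j = cartan_D n j i"
  by (auto simp: cartan_D_def insert_commute)

text \<open>The Jacobi identity: as f commutes with g, [f, [e, g]] = [[f, e], g] = - [h, g] = g. For
  g = e_j with j a neighbour of i, it says that f_i lowers the root vector of \<alpha>_i +
  \<alpha>_j to that of \<alpha>_j.\<close>

lemma lower_step:
  fixes e f h g :: "complex mat"
  assumes c: "e \<in> carrier_mat N N" "f \<in> carrier_mat N N" "h \<in> carrier_mat N N" "g \<in> carrier_mat N N"
    and ef: "e * f - f * e = h" and gf: "g * f = f * g" and hg: "h * g - g * h = (- 1) \<cdot>\<^sub>m g"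
  shows "f * (e * g - g * e) - (e * g - g * e) * f = g"
proof (rule sq_eqI[of _ N])
  note S = sq_simps[where N = N]
  have ef': "e * f = f * e + h" using c unfolding ef[symmetric]
    by (intro sq_eqI[of _ N]) (simp_all add: S sq_entries[where N = N] del: index_mult_mat)
  have 1: "e * (g * f) = f * (e * g) + h * g"
  proof -
    have "e * (g * f) = (e * f) * g" unfolding gf using c by (simp add: S)
    also have "\<dots> = f * (e * g) + h * g" unfolding ef' using c by (simp add: S)
    finally show ?thesis .
  qed
  have 2: "g * (e * f) = f * (g * e) + g * h"
  proof -
    have "g * (e * f) = (g * f) * e + g * h" unfolding ef' using c by (simp add: S)
    also have "(g * f) * e = f * (g * e)" unfolding gf using c by (simp add: S)
    finally show ?thesis .
  qed
  fix r s assume rs: "r < N" "s < N"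
  have "(h * g - g * h) $$ (r, s) = ((- 1) \<cdot>\<^sub>m g) $$ (r, s)" using hg by simp
  then have 3: "(g * h) $$ (r, s) = (h * g) $$ (r, s) + g $$ (r, s)"
    using rs c by (simp add: sq_entries[where N = N] S algebra_simps del: index_mult_mat)
  show "(f * (e * g - g * e) - (e * g - g * e) * f) $$ (r, s) = g $$ (r, s)"
    using rs c by (simp add: S 1 2 3 sq_entries[where N = N] algebra_simps del: index_mult_mat)
qed (use c in \<open>simp_all add: sq_closed\<close>)

text \<open>A Heisenberg relation: d commutes with a and b, so the conjugate of b by exp(t a) is b +
  t d, and the exponential of this sum factors.\<close>

lemma one_param_ladder:
  assumes c: "a \<in> carrier_mat N N" "b \<in> carrier_mat N N" "d \<in> carrier_mat N N"
    and ab: "a * b - b * a = d" and ad: "a * d = d * a" and bd: "b * d = d * b"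
  shows "one_param N a t * one_param N b s = one_param N b s * (one_param N d (t * s) * one_param N a t)"
proof -
  note S = sq_simps[where N = N]
  define X where "X t = b + t \<cdot>\<^sub>m d" for t
  have X: "X t \<in> carrier_mat N N" for t using c by (simp add: X_def)
  have "has_mderiv N X (a * X t - X t * a) t" for t
  proof (rule has_mderiv_cong)
    show "has_mderiv N X d t"
      by (rule has_mderivI) (use c X in \<open>auto simp: X_def intro!: derivative_eq_intros\<close>)
    show "d = a * X t - X t * a"
      unfolding X_def ab[symmetric]
    proof (rule sq_eqI[of _ N])
      fix r s assume rs: "r < N" "s < N"
      have "a * (a * b - b * a) = (a * b - b * a) * a" using ad ab by simp
      then have "(a * (a * b - b * a)) $$ (r, s) = ((a * b - b * a) * a) $$ (r, s)" by simp
      then have *: "(a * (a * b)) $$ (r, s) - (a * (b * a)) $$ (r, s) = (a * (b * a)) $$ (r, s) - (b * (a * a)) $$ (r, s)"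
        using rs c by (simp add: S sq_entries[where N = N] del: index_mult_mat)
      have "t * ((a * (a * b)) $$ (r, s) - (a * (b * a)) $$ (r, s)) = t * ((a * (b * a)) $$ (r, s) - (b * (a * a)) $$ (r, s))"
        using * by simp
      then show "(a * b - b * a) $$ (r, s) = (a * (b + t \<cdot>\<^sub>m (a * b - b * a)) - (b + t \<cdot>\<^sub>m (a * b - b * a)) * a) $$ (r, s)"
        using rs c by (simp add: S sq_entries[where N = N] algebra_simps del: index_mult_mat)
    qed (use c in \<open>simp_all add: sq_closed\<close>)
  qed
  moreover have "X 0 = b" unfolding X_def by (rule sq_eqI[of _ N]) (use c in auto)
  ultimately have "one_param N a t * b = X t * one_param N a t"
    using one_param_conj[OF c(1), of X t] by simp
  from one_param_intertwine[OF c(2) X _ this, of s]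
  have "one_param N a t * one_param N b s = one_param N (X t) s * one_param N a t" by simp
  also have "one_param N (X t) s = one_param N b s * one_param N d (t * s)"
  proof -
    have "b * (t \<cdot>\<^sub>m d) = (t \<cdot>\<^sub>m d) * b" using c bd by (simp add: S)
    then show ?thesis unfolding X_def using one_param_sum[of b N "t \<cdot>\<^sub>m d" s] c
      by (simp add: one_param_smult)
  qed
  finally show ?thesis using c by (simp add: sq_assoc[where N = N])
qed

lemma one_param_commute:
  assumes c: "a \<in> carrier_mat N N" "b \<in> carrier_mat N N" and ab: "a * b = b * a"
  shows "one_param N a t * one_param N b s = one_param N b s * one_param N a t"
proof -
  have "b * one_param N a t = one_param N a t * b"
    using one_param_intertwine[OF c(1) c(1) c(2), of t] ab by simp
  from one_param_intertwine[OF c(2) c(2) one_param_carrier this[symmetric], of s]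
  show ?thesis .
qed

lemma diff_zero_iff:
  assumes "(A :: complex mat) \<in> carrier_mat N N" "B \<in> carrier_mat N N"
  shows "A - B = 0\<^sub>m N N \<longleftrightarrow> A = B"
proof
  assume *: "A - B = 0\<^sub>m N N"
  show "A = B"
  proof (rule sq_eqI[OF assms])
    fix r s assume rs: "r < N" "s < N"
    have "(A - B) $$ (r, s) = 0" using * rs by simp
    then show "A $$ (r, s) = B $$ (r, s)" using rs assms by (simp add: sq_entries[where N = N])
  qed
qed (use assms in auto)

locale chevalley_rep =
  fixes n N :: nat and e f h :: "nat \<Rightarrow> complex mat"
  assumes serre: "chevalley_serre_D n N e f h"
begin

abbreviation "x i \<equiv> one_param N (e i)"
abbreviation "y i \<equiv> one_param N (f i)"
text \<open>The root subgroup of \<alpha>_i + \<alpha>_j, meaningful for adjacent nodes i and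
  j.\<close>

definition xx where "xx i j = one_param N (bracket (e i) (e j))"

lemma carr: "i \<in> {1..n} \<Longrightarrow> e i \<in> carrier_mat N N" "i \<in> {1..n} \<Longrightarrow> f i \<in> carrier_mat N N" "i \<in> {1..n} \<Longrightarrow> h i \<in> carrier_mat N N"
  using serre by (auto simp: chevalley_serre_D_def)

lemma rels:
  assumes "i \<in> {1..n}" "j \<in> {1..n}"
  shows "h i * h j - h j * h i = 0\<^sub>m N N"
    "h i * e j - e j * h i = of_int (cartan_D n i j) \<cdot>\<^sub>m e j"
    "h i * f j - f j * h i = of_int (- cartan_D n i j) \<cdot>\<^sub>m f j"
    "e i * f j - f j * e i = (if i = j then h i else 0\<^sub>m N N)"
    "i \<noteq> j \<Longrightarrow> (bracket (e i) ^^ nat (1 - cartan_D n i j)) (e j) = 0\<^sub>m N N"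
  using serre assms unfolding chevalley_serre_D_def by (auto simp: bracket_def)

lemma triple: "i \<in> {1..n} \<Longrightarrow> sl2_triple N (e i) (f i) (h i)"
  by unfold_locales (use carr rels(2-4)[of i i] in \<open>auto simp: cartan_D_simps\<close>)

lemma s_bar_sb: "i \<in> {1..n} \<Longrightarrow> s_bar N e f i = sl2_triple.sb N (e i) (f i)"
  using sl2_triple.sb_def[OF triple] by (simp add: s_bar_def mat_prod_def right_mult_one_mat[of _ N N])

lemma s_bar_carrier [simp]: "i \<in> {1..n} \<Longrightarrow> s_bar N e f i \<in> carrier_mat N N"
  using sl2_triple.WS_carrier[OF triple] by (simp add: s_bar_sb)

lemma coroot_cor: "i \<in> {1..n} \<Longrightarrow> coroot N e f i u = sl2_triple.cor N (e i) (f i) u"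
  using sl2_triple.cor_def[OF triple] s_bar_carrier[of i]
  by (simp add: coroot_def mat_prod_def right_mult_one_mat[of _ N N] s_bar_sb)

lemma coroot_carrier [simp]: "i \<in> {1..n} \<Longrightarrow> coroot N e f i u \<in> carrier_mat N N"
  using sl2_triple.WS_carrier[OF triple] by (simp add: coroot_cor)

lemma coroot_Ln: "i \<in> {1..n} \<Longrightarrow> u \<noteq> 0 \<Longrightarrow> coroot N e f i u = one_param N (h i) (Ln u)"
  using sl2_triple.cor_ln[OF triple] by (simp add: coroot_cor)

lemma coroot_mult: "i \<in> {1..n} \<Longrightarrow> u \<noteq> 0 \<Longrightarrow> v \<noteq> 0 \<Longrightarrow> coroot N e f i (u * v) = coroot N e f i u * coroot N e f i v"
  using sl2_triple.cor_mult[OF triple] by (simp add: coroot_cor)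

lemma coroot_commute:
  assumes "i \<in> {1..n}" "j \<in> {1..n}" "u \<noteq> 0" "v \<noteq> 0"
  shows "coroot N e f i u * coroot N e f j v = coroot N e f j v * coroot N e f i u"
proof -
  have "h i * h j = h j * h i"
    using rels(1)[OF assms(1,2)] diff_zero_iff[of "h i * h j" N "h j * h i"] carr assms by (simp add: sq_closed)
  then show ?thesis using one_param_commute[of "h i" N "h j"] carr assms by (simp add: coroot_Ln)
qed

lemma coroot_y:
  assumes "i \<in> {1..n}" "j \<in> {1..n}" "u \<noteq> 0"
  shows "coroot N e f i u * y j r = y j (exp (of_int (- cartan_D n i j) * Ln u) * r) * coroot N e f i u"
  using one_param_weight[OF carr(3) carr(2) rels(3)] assms by (simp add: coroot_Ln)

lemma x_y_same:
  assumes "i \<in> {1..n}" "1 + t * s \<noteq> 0"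
  shows "x i t * y i s = y i (s / (1 + t * s)) * (coroot N e f i (1 + t * s) * x i (t / (1 + t * s)))"
  using sl2_triple.x_y[OF triple] assms by (simp add: coroot_cor)

lemma e_f_commute:
  assumes "i \<in> {1..n}" "j \<in> {1..n}" "i \<noteq> j"
  shows "e i * f j = f j * e i"
  using rels(4)[OF assms(1,2)] diff_zero_iff[of "e i * f j" N "f j * e i"] carr assms by (simp add: sq_closed)

lemma x_y_commute:
  assumes "i \<in> {1..n}" "j \<in> {1..n}" "i \<noteq> j"
  shows "x i t * y j s = y j s * x i t"
  using one_param_commute[OF carr(1) carr(2) e_f_commute] assms by blast

lemma x_x_commute:
  assumes "i \<in> {1..n}" "j \<in> {1..n}" "i \<noteq> j" "cartan_D n i j = 0"
  shows "x i t * x j s = x j s * x i t"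
proof -
  have "e i * e j = e j * e i"
    using rels(5)[OF assms(1-3)] diff_zero_iff[of "e i * e j" N "e j * e i"] carr assms
    by (simp add: sq_closed bracket_def)
  then show ?thesis using one_param_commute carr assms by blast
qed

lemma bracket_carrier: "A \<in> carrier_mat N N \<Longrightarrow> B \<in> carrier_mat N N \<Longrightarrow> bracket A B \<in> carrier_mat N N"
  by (simp add: bracket_def sq_closed)

text \<open>For adjacent nodes both Serre relations have exponent 2. One of them is the first claim;
  the one with i and j exchanged is the second, up to the sign of the bracket.\<close>

lemma serre_bracket:
  assumes "i \<in> {1..n}" "j \<in> {1..n}" "cartan_D n i j = - 1"
  shows "e i * bracket (e i) (e j) = bracket (e i) (e j) * e i"
    and "e j * bracket (e i) (e j) = bracket (e i) (e j) * e j"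
proof -
  have ij: "i \<noteq> j" using assms(3) cartan_D_simps(1)[of n i] by auto
  have ci: "e i \<in> carrier_mat N N" "e j \<in> carrier_mat N N" using carr assms by auto
  have *: "nat (1 - cartan_D n i j) = Suc (Suc 0)" "nat (1 - cartan_D n j i) = Suc (Suc 0)"
    using assms(3) cartan_D_simps(3)[of n i j] by auto
  have "bracket (e i) (bracket (e i) (e j)) = 0\<^sub>m N N" "bracket (e j) (bracket (e j) (e i)) = 0\<^sub>m N N"
    using rels(5)[OF assms(1,2) ij] rels(5)[OF assms(2,1) ij[symmetric]] unfolding * by simp_all
  then have 1: "e i * bracket (e i) (e j) = bracket (e i) (e j) * e i"
    and 2: "e j * bracket (e j) (e i) = bracket (e j) (e i) * e j"
    using diff_zero_iff[of "e i * bracket (e i) (e j)" N "bracket (e i) (e j) * e i"]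
      diff_zero_iff[of "e j * bracket (e j) (e i)" N "bracket (e j) (e i) * e j"] ci
      by (simp_all add: bracket_def[of "e i" "bracket (e i) (e j)"] bracket_def[of "e j" "bracket (e j) (e i)"] bracket_carrier sq_closed)
  show "e i * bracket (e i) (e j) = bracket (e i) (e j) * e i" by fact
  have "bracket (e i) (e j) = (- 1) \<cdot>\<^sub>m bracket (e j) (e i)"
    by (rule sq_eqI[of _ N]) (use ci in \<open>simp_all add: bracket_def sq_closed sq_entries[where N = N] del: index_mult_mat\<close>)
  then show "e j * bracket (e i) (e j) = bracket (e i) (e j) * e j"
    using 2 ci by (simp add: sq_simps[where N = N] bracket_carrier)
qed

lemma xx_rels:
  assumes "i \<in> {1..n}" "j \<in> {1..n}" "cartan_D n i j = - 1"
  shows "x i t * x j s = x j s * (xx i j (t * s) * x i t)"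
    and "x i t * xx i j s = xx i j s * x i t"
    and "y i t * xx i j s = xx i j s * (x j (t * s) * y i t)"
proof -
  have ij: "i \<noteq> j" using assms(3) cartan_D_simps(1)[of n i] by auto
  note c = carr(1)[OF assms(1)] carr(1)[OF assms(2)] carr(2)[OF assms(1)] carr(3)[OF assms(1)]
  note b = bracket_carrier[OF c(1,2)]
  note sb = serre_bracket[OF assms]
  show "x i t * x j s = x j s * (xx i j (t * s) * x i t)"
    unfolding xx_def by (rule one_param_ladder[OF c(1,2) b _ sb]) (simp add: bracket_def)
  show "x i t * xx i j s = xx i j s * x i t"
    unfolding xx_def by (rule one_param_commute[OF c(1) b sb(1)])
  have "f i * bracket (e i) (e j) - bracket (e i) (e j) * f i = e j"
    unfolding bracket_def
    by (rule lower_step[OF c(1,3,4,2)])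
      (use rels(4)[OF assms(1,1)] e_f_commute[OF assms(2,1)] ij rels(2)[OF assms(1,2)] assms(3) in auto)
  then show "y i t * xx i j s = xx i j s * (x j (t * s) * y i t)"
    unfolding xx_def using one_param_ladder[OF c(3) b c(2)] sb(2) e_f_commute[OF assms(2,1)] ij by auto
qed

end

section \<open>The big cell\<close>

lemma (in group) inv_mult_cancel: "g \<in> carrier G \<Longrightarrow> h \<in> carrier G \<Longrightarrow> inv g \<otimes> (g \<otimes> h) = h"
  by (simp add: m_assoc[symmetric])

lemma (in group) conj_generate:
  assumes K: "K \<subseteq> carrier G" and g: "g \<in> carrier G"
    and conj: "\<And>k. k \<in> K \<Longrightarrow> g \<otimes> k \<otimes> inv g \<in> generate G K" and u: "u \<in> generate G K"
  shows "g \<otimes> u \<otimes> inv g \<in> generate G K"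
  using u
proof (induction rule: generate.induct)
  case one
  then show ?case using g by (simp add: generate.one)
next
  case (incl h)
  then show ?case by (rule conj)
next
  case (inv k)
  have k: "k \<in> carrier G" using inv K by auto
  have "g \<otimes> inv k \<otimes> inv g = inv (g \<otimes> k \<otimes> inv g)"
    using g k by (simp add: inv_mult_group m_assoc)
  then show ?case using generate_m_inv_closed[OF K conj[OF inv]] by simp
next
  case (eng h1 h2)
  have "h1 \<in> carrier G" "h2 \<in> carrier G" using eng(1,2) generate_in_carrier[OF K] by auto
  then have "g \<otimes> (h1 \<otimes> h2) \<otimes> inv g = (g \<otimes> h1 \<otimes> inv g) \<otimes> (g \<otimes> h2 \<otimes> inv g)"
    using g by (simp add: m_assoc inv_mult_cancel)
  then show ?case using eng generate.eng by metis
qed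

text \<open>The relations on which the Gauss decomposition rests, stated in an arbitrary group.
  Being equations, they pass to direct products, and the decomposition is run in a product of two
  matrix groups.\<close>

locale chev_group = group H for H :: "('a, 'b) monoid_scheme" (structure) +
  fixes n :: nat and x y A :: "nat \<Rightarrow> complex \<Rightarrow> 'a" and xx :: "nat \<Rightarrow> nat \<Rightarrow> complex \<Rightarrow> 'a"
  assumes x_closed: "i \<in> {1..n} \<Longrightarrow> x i t \<in> carrier H"
    and y_closed: "i \<in> {1..n} \<Longrightarrow> y i t \<in> carrier H"
    and A_closed: "i \<in> {1..n} \<Longrightarrow> A i u \<in> carrier H"
    and xx_closed: "i \<in> {1..n} \<Longrightarrow> j \<in> {1..n} \<Longrightarrow> xx i j t \<in> carrier H"
    and x_add: "i \<in> {1..n} \<Longrightarrow> x i (s + t) = x i s \<otimes> x i t"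
    and y_add: "i \<in> {1..n} \<Longrightarrow> y i (s + t) = y i s \<otimes> y i t"
    and A_mult: "i \<in> {1..n} \<Longrightarrow> u \<noteq> 0 \<Longrightarrow> v \<noteq> 0 \<Longrightarrow> A i (u * v) = A i u \<otimes> A i v"
    and A_commute: "i \<in> {1..n} \<Longrightarrow> j \<in> {1..n} \<Longrightarrow> u \<noteq> 0 \<Longrightarrow> v \<noteq> 0 \<Longrightarrow> A i u \<otimes> A j v = A j v \<otimes> A i u"
    and A_y: "i \<in> {1..n} \<Longrightarrow> j \<in> {1..n} \<Longrightarrow> u \<noteq> 0 \<Longrightarrow>
        A i u \<otimes> y j r = y j (exp (of_int (- cartan_D n i j) * Ln u) * r) \<otimes> A i u"
    and x_y_commute: "i \<in> {1..n} \<Longrightarrow> j \<in> {1..n} \<Longrightarrow> i \<noteq> j \<Longrightarrow> x i t \<otimes> y j s = y j s \<otimes> x i t"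
    and x_y_same: "i \<in> {1..n} \<Longrightarrow> 1 + t * s \<noteq> 0 \<Longrightarrow>
        x i t \<otimes> y i s = y i (s / (1 + t * s)) \<otimes> (A i (1 + t * s) \<otimes> x i (t / (1 + t * s)))"
    and x_x_commute: "i \<in> {1..n} \<Longrightarrow> j \<in> {1..n} \<Longrightarrow> i \<noteq> j \<Longrightarrow> cartan_D n i j = 0 \<Longrightarrow> x i t \<otimes> x j s = x j s \<otimes> x i t"
    and x_x: "i \<in> {1..n} \<Longrightarrow> j \<in> {1..n} \<Longrightarrow> cartan_D n i j = - 1 \<Longrightarrow>
        x i t \<otimes> x j s = x j s \<otimes> (xx i j (t * s) \<otimes> x i t)"
    and x_xx: "i \<in> {1..n} \<Longrightarrow> j \<in> {1..n} \<Longrightarrow> cartan_D n i j = - 1 \<Longrightarrow> x i t \<otimes> xx i j s = xx i j s \<otimes> x i t"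
    and y_xx: "i \<in> {1..n} \<Longrightarrow> j \<in> {1..n} \<Longrightarrow> cartan_D n i j = - 1 \<Longrightarrow>
        y i t \<otimes> xx i j s = xx i j s \<otimes> (x j (t * s) \<otimes> y i t)"
begin

definition Up where "Up = generate H {x i t | i t. i \<in> {1..n}}"
definition Um where "Um = generate H {y i t | i t. i \<in> {1..n}}"
text \<open>Plays the role of the unipotent radical of the i-th minimal parabolic subgroup. The
  subgroups of \<alpha>_i + \<alpha>_j are added because they arise when x_j is conjugated by
  x_i.\<close>

definition rad where "rad i = generate H ({x j t | j t. j \<in> {1..n} \<and> j \<noteq> i} \<union> {xx i j t | j t. j \<in> {1..n} \<and> cartan_D n i j = - 1})"
definition tor where "tor s = foldr (\<otimes>) (map (\<lambda>i. A i (s i)) [1..<Suc n]) \<one>"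

lemma x_zero: "i \<in> {1..n} \<Longrightarrow> x i 0 = \<one>"
  using x_add[of i 0 0] x_closed[of i 0] by simp

lemma y_zero: "i \<in> {1..n} \<Longrightarrow> y i 0 = \<one>"
  using y_add[of i 0 0] y_closed[of i 0] by simp

lemma x_inv: "i \<in> {1..n} \<Longrightarrow> inv (x i t) = x i (- t)"
  using x_closed[of i] by (intro inv_equality) (auto simp: x_zero x_add[symmetric])

lemma y_inv: "i \<in> {1..n} \<Longrightarrow> inv (y i t) = y i (- t)"
  using y_closed[of i] by (intro inv_equality) (auto simp: y_zero y_add[symmetric])

lemma Up_subset: "{x i t | i t. i \<in> {1..n}} \<subseteq> carrier H"
  and Um_subset: "{y i t | i t. i \<in> {1..n}} \<subseteq> carrier H"
  using x_closed y_closed by auto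

lemma Up_carrier: "u \<in> Up \<Longrightarrow> u \<in> carrier H" and Um_carrier: "u \<in> Um \<Longrightarrow> u \<in> carrier H"
  unfolding Up_def Um_def using generate_in_carrier Up_subset Um_subset by blast+

lemma Up_x: "i \<in> {1..n} \<Longrightarrow> x i t \<in> Up" and Um_y: "i \<in> {1..n} \<Longrightarrow> y i t \<in> Um"
  unfolding Up_def Um_def by (auto intro!: generate.incl)

lemma Up_mult: "u \<in> Up \<Longrightarrow> v \<in> Up \<Longrightarrow> u \<otimes> v \<in> Up" and Um_mult: "u \<in> Um \<Longrightarrow> v \<in> Um \<Longrightarrow> u \<otimes> v \<in> Um"
  unfolding Up_def Um_def by (auto intro!: generate.eng)

lemma rad_subset:
  assumes "i \<in> {1..n}"
  shows "{x j t | j t. j \<in> {1..n} \<and> j \<noteq> i} \<union> {xx i j t | j t. j \<in> {1..n} \<and> cartan_D n i j = - 1} \<subseteq> carrier H"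
  using x_closed xx_closed[OF assms] by auto

lemma rad_carrier: "i \<in> {1..n} \<Longrightarrow> u \<in> rad i \<Longrightarrow> u \<in> carrier H"
  unfolding rad_def using generate_in_carrier rad_subset by blast

lemma rad_x: "j \<in> {1..n} \<Longrightarrow> j \<noteq> i \<Longrightarrow> x j t \<in> rad i"
  and rad_xx: "j \<in> {1..n} \<Longrightarrow> cartan_D n i j = - 1 \<Longrightarrow> xx i j t \<in> rad i"
  and rad_mult: "u \<in> rad i \<Longrightarrow> v \<in> rad i \<Longrightarrow> u \<otimes> v \<in> rad i"
  unfolding rad_def by (rule generate.incl, blast, rule generate.incl, blast, rule generate.eng)

lemma xx_Up:
  assumes ij: "i \<in> {1..n}" "j \<in> {1..n}" "cartan_D n i j = - 1"
  shows "xx i j s \<in> Up"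
proof -
  have c: "x i 1 \<in> carrier H" "x j s \<in> carrier H" "xx i j s \<in> carrier H" using ij x_closed xx_closed by auto
  have "xx i j s = inv (x j s) \<otimes> (x i 1 \<otimes> x j s) \<otimes> inv (x i 1)"
    unfolding x_x[OF ij, of 1 s, simplified] using c by (simp add: m_assoc inv_mult_cancel)
  also have "\<dots> \<in> Up" using ij by (simp add: x_inv) (intro Up_mult Up_x; simp)
  finally show ?thesis .
qed

lemma rad_Up:
  assumes i: "i \<in> {1..n}" and u: "u \<in> rad i"
  shows "u \<in> Up"
  using u unfolding rad_def
proof (induction rule: generate.induct)
  case one show ?case unfolding Up_def by (rule generate.one)
next
  case (incl h) then show ?case using Up_x xx_Up[OF i] by auto
next
  case (inv h)
  then have "h \<in> Up" using Up_x xx_Up[OF i] by auto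
  then show ?case unfolding Up_def by (rule generate_m_inv_closed[OF Up_subset])
next
  case (eng h1 h2) then show ?case by (intro Up_mult)
qed

lemma commute_conj: "g \<in> carrier H \<Longrightarrow> u \<in> carrier H \<Longrightarrow> v \<in> carrier H \<Longrightarrow> g \<otimes> u = v \<otimes> g \<Longrightarrow> g \<otimes> u \<otimes> inv g = v"
  by (simp add: m_assoc)

lemma rad_conj_x:
  assumes i: "i \<in> {1..n}" and u: "u \<in> rad i"
  shows "x i t \<otimes> u \<otimes> x i (- t) \<in> rad i"
proof -
  have "x i t \<otimes> u \<otimes> inv (x i t) \<in> rad i"
  proof -
    have cg: "x i t \<otimes> k \<otimes> inv (x i t) \<in> rad i"
      if "k \<in> {x j t | j t. j \<in> {1..n} \<and> j \<noteq> i} \<union> {xx i j t | j t. j \<in> {1..n} \<and> cartan_D n i j = - 1}" for k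
    proof -
    from that consider (c) j s where "k = x j s" "j \<in> {1..n}" "j \<noteq> i" "cartan_D n i j = 0"
      | (a) j s where "k = x j s" "j \<in> {1..n}" "j \<noteq> i" "cartan_D n i j = - 1"
      | (b) j s where "k = xx i j s" "j \<in> {1..n}" "cartan_D n i j = - 1"
      using cartan_D_simps(2)[of i] by (elim UnE CollectE exE conjE; metis)
    then show ?thesis
    proof cases
      case c
      then show ?thesis using commute_conj[OF x_closed[OF i] x_closed x_closed x_x_commute[OF i]] rad_x by auto
    next
      case a
      have "x i t \<otimes> k \<otimes> inv (x i t) = x j s \<otimes> xx i j (t * s)"
        using x_x[OF i a(2,4), of t s] x_closed[OF i, of t] x_closed[OF a(2), of s] xx_closed[OF i a(2), of "t * s"] a(1)
        by (intro commute_conj) (auto simp: m_assoc)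
      then show ?thesis using a by (simp add: rad_mult rad_x rad_xx)
    next
      case b
      then show ?thesis using commute_conj[OF x_closed[OF i] xx_closed[OF i] xx_closed[OF i] x_xx[OF i]] rad_xx by auto
    qed
    qed
    show ?thesis
      using conj_generate[OF rad_subset[OF i] x_closed[OF i] cg[unfolded rad_def] u[unfolded rad_def]] unfolding rad_def by simp
  qed
  then show ?thesis using i by (simp add: x_inv)
qed

text \<open>y_i commutes with the other x_j, and conjugating the subgroup of \<alpha>_i + \<alpha>_j
  only creates factors from that of \<alpha>_j. So the radical is normalized by both root subgroups
  of node i.\<close>

lemma rad_conj_y:
  assumes i: "i \<in> {1..n}" and u: "u \<in> rad i"
  shows "y i t \<otimes> u \<otimes> y i (- t) \<in> rad i"
proof -
  have "y i t \<otimes> u \<otimes> inv (y i t) \<in> rad i"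
  proof -
    have cg: "y i t \<otimes> k \<otimes> inv (y i t) \<in> rad i"
      if "k \<in> {x j t | j t. j \<in> {1..n} \<and> j \<noteq> i} \<union> {xx i j t | j t. j \<in> {1..n} \<and> cartan_D n i j = - 1}" for k
    proof -
    from that consider (a) j s where "k = x j s" "j \<in> {1..n}" "j \<noteq> i"
      | (b) j s where "k = xx i j s" "j \<in> {1..n}" "cartan_D n i j = - 1"
      by auto
    then show ?thesis
    proof cases
      case a
      then show ?thesis using commute_conj[OF y_closed[OF i] x_closed x_closed x_y_commute[symmetric, OF _ i]] rad_x by auto
    next
      case b
      have "j \<noteq> i" using b cartan_D_simps(1)[of n i] by auto
      have "y i t \<otimes> k \<otimes> inv (y i t) = xx i j s \<otimes> x j (t * s)"
        using y_xx[OF i b(2,3), of t s] y_closed[OF i, of t] x_closed[OF b(2), of "t * s"] xx_closed[OF i b(2), of s] b(1)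
        by (intro commute_conj) (auto simp: m_assoc)
      then show ?thesis using b \<open>j \<noteq> i\<close> by (simp add: rad_mult rad_x rad_xx)
    qed
    qed
    show ?thesis
      using conj_generate[OF rad_subset[OF i] y_closed[OF i] cg[unfolded rad_def] u[unfolded rad_def]] unfolding rad_def by simp
  qed
  then show ?thesis using i by (simp add: y_inv)
qed

text \<open>Because x_i normalizes the radical, in a product of two decomposed elements the second
  x_i-factor can be moved left across the first radical factor.\<close>

lemma Up_decomp:
  assumes i: "i \<in> {1..n}" and b: "b \<in> Up"
  shows "\<exists>\<tau> u. u \<in> rad i \<and> b = x i \<tau> \<otimes> u"
  using b unfolding Up_def
proof (induction rule: generate.induct)
  case one
  show ?case using x_zero[OF i] by (intro exI[of _ 0] exI[of _ \<one>]) (auto simp: rad_def generate.one)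
next
  case (incl h)
  then obtain j t where h: "h = x j t" "j \<in> {1..n}" by auto
  show ?case
  proof (cases "j = i")
    case True
    then show ?thesis using h x_closed by (intro exI[of _ t] exI[of _ \<one>]) (auto simp: rad_def generate.one)
  next
    case False
    then show ?thesis using h x_closed rad_x by (intro exI[of _ 0] exI[of _ h]) (auto simp: x_zero[OF i])
  qed
next
  case (inv h)
  then obtain j t where h: "inv h = x j (- t)" "j \<in> {1..n}" by (auto simp: x_inv)
  show ?case
  proof (cases "j = i")
    case True
    then show ?thesis using h x_closed by (intro exI[of _ "- t"] exI[of _ \<one>]) (auto simp: rad_def generate.one)
  next
    case False
    then show ?thesis using h x_closed rad_x by (intro exI[of _ 0] exI[of _ "inv h"]) (auto simp: x_zero[OF i])
  qed
next
  case (eng h1 h2)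
  then obtain t1 u1 t2 u2 where u: "u1 \<in> rad i" "h1 = x i t1 \<otimes> u1" "u2 \<in> rad i" "h2 = x i t2 \<otimes> u2" by auto
  have c: "u1 \<in> carrier H" "u2 \<in> carrier H" "\<And>t. x i t \<in> carrier H" using u rad_carrier[OF i] x_closed[OF i] by auto
  have "h1 \<otimes> h2 = x i t1 \<otimes> u1 \<otimes> x i t2 \<otimes> u2" using u c by (simp add: m_assoc)
  also have "\<dots> = x i t1 \<otimes> (x i t2 \<otimes> x i (- t2)) \<otimes> u1 \<otimes> x i t2 \<otimes> u2"
    using c x_add[OF i, of t2 "- t2", symmetric] by (simp add: x_zero[OF i])
  also have "\<dots> = x i (t1 + t2) \<otimes> ((x i (- t2) \<otimes> u1 \<otimes> x i (- (- t2))) \<otimes> u2)"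
    using c by (simp add: m_assoc x_add[OF i])
  finally show ?case using rad_mult[OF rad_conj_x[OF i u(1), of "- t2"] u(3)] by blast
qed

text \<open>Only the x_i-part of b obstructs passing y_i(r): the radical part is conjugated by
  y_i(-r) and stays in the upper unipotent group.\<close>

lemma Up_y:
  assumes i: "i \<in> {1..n}" and b: "b \<in> Up"
  shows "\<exists>\<tau>. \<forall>r. \<exists>u\<in>Up. b \<otimes> y i r = x i \<tau> \<otimes> (y i r \<otimes> u)"
proof -
  obtain \<tau> u where u: "u \<in> rad i" "b = x i \<tau> \<otimes> u" using Up_decomp[OF assms] by blast
  have c: "u \<in> carrier H" "x i \<tau> \<in> carrier H" "\<And>t. y i t \<in> carrier H"
    using u rad_carrier[OF i] x_closed[OF i] y_closed[OF i] by auto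
  show ?thesis
  proof (intro exI[of _ \<tau>] allI bexI)
    fix r
    show "y i (- r) \<otimes> u \<otimes> y i (- (- r)) \<in> Up" using rad_Up[OF i rad_conj_y[OF i u(1)]] .
    have "y i r \<otimes> (y i (- r) \<otimes> u \<otimes> y i (- (- r))) = (y i r \<otimes> y i (- r)) \<otimes> u \<otimes> y i r"
      using c by (simp add: m_assoc)
    also have "\<dots> = u \<otimes> y i r" using c y_add[OF i, of r "- r", symmetric] by (simp add: y_zero[OF i])
    finally show "b \<otimes> y i r = x i \<tau> \<otimes> (y i r \<otimes> (y i (- r) \<otimes> u \<otimes> y i (- (- r))))"
      using u c by (simp add: m_assoc)
  qed
qed

lemma fold_closed: "(\<And>i. i \<in> set is \<Longrightarrow> g i \<in> carrier H) \<Longrightarrow> foldr (\<otimes>) (map g is) \<one> \<in> carrier H"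
  by (induction "is") auto

lemma tor_closed: "tor s \<in> carrier H"
  unfolding tor_def by (rule fold_closed) (auto intro: A_closed)

lemma fold_A_y:
  assumes "j \<in> {1..n}" "set is \<subseteq> {1..n}" "\<forall>i\<in>{1..n}. s i \<noteq> 0"
  shows "\<exists>r'. foldr (\<otimes>) (map (\<lambda>i. A i (s i)) is) \<one> \<otimes> y j r = y j r' \<otimes> foldr (\<otimes>) (map (\<lambda>i. A i (s i)) is) \<one>"
  using assms(2)
proof (induction "is" arbitrary: r)
  case (Cons i "is")
  let ?P = "foldr (\<otimes>) (map (\<lambda>i. A i (s i)) is) \<one>"
  have P: "?P \<in> carrier H" by (rule fold_closed) (use Cons.prems A_closed in auto)
  obtain r' where r': "?P \<otimes> y j r = y j r' \<otimes> ?P" using Cons by auto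
  have i: "i \<in> {1..n}" using Cons.prems by auto
  have c: "A i (s i) \<in> carrier H" "\<And>t. y j t \<in> carrier H" using A_closed[OF i] y_closed[OF assms(1)] by auto
  obtain r'' where r'': "A i (s i) \<otimes> y j r' = y j r'' \<otimes> A i (s i)"
    using A_y[OF i assms(1), of "s i" r'] assms(3) i by blast
  have "A i (s i) \<otimes> ?P \<otimes> y j r = A i (s i) \<otimes> (?P \<otimes> y j r)" using P c by (simp add: m_assoc)
  also have "\<dots> = (A i (s i) \<otimes> y j r') \<otimes> ?P" unfolding r' using P c by (simp add: m_assoc)
  also have "\<dots> = y j r'' \<otimes> (A i (s i) \<otimes> ?P)" unfolding r'' using P c by (simp add: m_assoc)
  finally show ?case by auto
qed (use y_closed[OF assms(1)] in auto)

lemma fold_A_commute: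
  assumes "j \<in> {1..n}" "u \<noteq> 0" "set is \<subseteq> {1..n}" "\<forall>i\<in>{1..n}. s i \<noteq> 0"
  shows "foldr (\<otimes>) (map (\<lambda>i. A i (s i)) is) \<one> \<otimes> A j u = A j u \<otimes> foldr (\<otimes>) (map (\<lambda>i. A i (s i)) is) \<one>"
  using assms(3)
proof (induction "is")
  case (Cons i "is")
  let ?P = "foldr (\<otimes>) (map (\<lambda>i. A i (s i)) is) \<one>"
  have P: "?P \<in> carrier H" by (rule fold_closed) (use Cons.prems A_closed in auto)
  have i: "i \<in> {1..n}" using Cons.prems by auto
  have c: "A i (s i) \<in> carrier H" "A j u \<in> carrier H" using A_closed[OF i] A_closed[OF assms(1)] by auto
  have IH: "?P \<otimes> A j u = A j u \<otimes> ?P" using Cons by auto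
  have "A i (s i) \<otimes> ?P \<otimes> A j u = A i (s i) \<otimes> A j u \<otimes> ?P" using P c IH by (simp add: m_assoc)
  also have "A i (s i) \<otimes> A j u = A j u \<otimes> A i (s i)" using A_commute[OF i assms(1), of "s i" u] assms i by auto
  finally show ?case using P c by (simp add: m_assoc)
qed (use A_closed[OF assms(1)] in auto)

lemma fold_A_upd:
  assumes "j \<in> set is" "distinct is" "u \<noteq> 0" "set is \<subseteq> {1..n}" "\<forall>i\<in>{1..n}. s i \<noteq> 0"
  shows "foldr (\<otimes>) (map (\<lambda>i. A i (s i)) is) \<one> \<otimes> A j u = foldr (\<otimes>) (map (\<lambda>i. A i ((s(j := s j * u)) i)) is) \<one>"
  using assms(1,2,4)
proof (induction "is")
  case (Cons i "is")
  let ?P = "foldr (\<otimes>) (map (\<lambda>i. A i (s i)) is) \<one>"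
  have P: "?P \<in> carrier H" by (rule fold_closed) (use Cons.prems A_closed in auto)
  have i: "i \<in> {1..n}" and j: "j \<in> {1..n}" using Cons.prems by auto
  have c: "A i (s i) \<in> carrier H" "A j u \<in> carrier H" "\<And>v. A j v \<in> carrier H" using A_closed[OF i] A_closed[OF j] by auto
  show ?case
  proof (cases "i = j")
    case True
    have "?P \<otimes> A j u = A j u \<otimes> ?P" by (rule fold_A_commute) (use j assms Cons.prems in auto)
    then have "A i (s i) \<otimes> ?P \<otimes> A j u = A j (s j) \<otimes> A j u \<otimes> ?P" using True P c by (simp add: m_assoc)
    also have "A j (s j) \<otimes> A j u = A j (s j * u)" using A_mult[OF j, of "s j" u] assms j by auto
    finally have *: "A i (s i) \<otimes> ?P \<otimes> A j u = A j (s j * u) \<otimes> ?P" .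
    have "?P = foldr (\<otimes>) (map (\<lambda>i. A i ((s(j := s j * u)) i)) is) \<one>"
    proof -
      have "map (\<lambda>i. A i (s i)) is = map (\<lambda>i. A i ((s(j := s j * u)) i)) is"
        using Cons.prems True by (intro map_cong) auto
      then show ?thesis by (rule arg_cong)
    qed
    with * show ?thesis using True by simp
  next
    case False
    then have "?P \<otimes> A j u = foldr (\<otimes>) (map (\<lambda>i. A i ((s(j := s j * u)) i)) is) \<one>" using Cons by auto
    then show ?thesis using False P c by (simp add: m_assoc)
  qed
qed auto

lemma fold_A_mult:
  assumes "set is \<subseteq> {1..n}" "\<forall>i\<in>{1..n}. s i \<noteq> 0" "\<forall>i\<in>{1..n}. s' i \<noteq> 0"
  shows "foldr (\<otimes>) (map (\<lambda>i. A i (s i)) is) \<one> \<otimes> foldr (\<otimes>) (map (\<lambda>i. A i (s' i)) is) \<one>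
    = foldr (\<otimes>) (map (\<lambda>i. A i (s i * s' i)) is) \<one>"
  using assms(1)
proof (induction "is")
  case (Cons i "is")
  let ?P = "\<lambda>s. foldr (\<otimes>) (map (\<lambda>i. A i (s i)) is) \<one>"
  have P: "?P s \<in> carrier H" for s by (rule fold_closed) (use Cons.prems A_closed in auto)
  have i: "i \<in> {1..n}" using Cons.prems by auto
  have c: "A i u \<in> carrier H" for u using A_closed[OF i] .
  have Pc: "?P s \<otimes> A i (s' i) = A i (s' i) \<otimes> ?P s"
    by (rule fold_A_commute) (use i assms Cons.prems in auto)
  have "A i (s i) \<otimes> ?P s \<otimes> (A i (s' i) \<otimes> ?P s') = A i (s i) \<otimes> (?P s \<otimes> A i (s' i)) \<otimes> ?P s'"
    using P c by (simp add: m_assoc)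
  also have "\<dots> = A i (s i) \<otimes> (A i (s' i) \<otimes> ?P s) \<otimes> ?P s'" unfolding Pc ..
  also have "\<dots> = (A i (s i) \<otimes> A i (s' i)) \<otimes> (?P s \<otimes> ?P s')" using P c by (simp add: m_assoc)
  also have "A i (s i) \<otimes> A i (s' i) = A i (s i * s' i)" using A_mult[OF i, of "s i" "s' i"] assms i by auto
  finally show ?case using Cons by simp
qed auto

lemma tor_mult: "\<forall>i\<in>{1..n}. s i \<noteq> 0 \<Longrightarrow> \<forall>i\<in>{1..n}. s' i \<noteq> 0 \<Longrightarrow> tor s \<otimes> tor s' = tor (\<lambda>i. s i * s' i)"
  unfolding tor_def by (rule fold_A_mult) auto

lemma tor_one: "(\<And>i. i \<in> {1..n} \<Longrightarrow> s i = 1) \<Longrightarrow> tor s = \<one>"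
proof -
  assume s: "\<And>i. i \<in> {1..n} \<Longrightarrow> s i = 1"
  have "A i 1 = \<one>" if "i \<in> {1..n}" for i using A_mult[OF that, of 1 1] A_closed[OF that] by simp
  then have "set is \<subseteq> {1..n} \<Longrightarrow> foldr (\<otimes>) (map (\<lambda>i. A i (s i)) is) \<one> = \<one>" for "is"
    using s by (induction "is") auto
  moreover have "set [1..<Suc n] \<subseteq> {1..n}" by auto
  ultimately show ?thesis unfolding tor_def by blast
qed

lemma tor_A: "j \<in> {1..n} \<Longrightarrow> u \<noteq> 0 \<Longrightarrow> \<forall>i\<in>{1..n}. s i \<noteq> 0 \<Longrightarrow> tor s \<otimes> A j u = tor (s(j := s j * u))"
  unfolding tor_def by (rule fold_A_upd) auto

lemma tor_y: "j \<in> {1..n} \<Longrightarrow> \<forall>i\<in>{1..n}. s i \<noteq> 0 \<Longrightarrow> \<exists>r'. tor s \<otimes> y j r = y j r' \<otimes> tor s"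
  unfolding tor_def by (rule fold_A_y) auto

text \<open>The SL2 decomposition is applied to x_i(\<tau>) y_i(r). Its lower factor crosses the
  torus and is absorbed on the left, its upper factor on the right, and its torus factor multiplies
  the i-th coordinate alone by 1 + \<tau> r.\<close>

lemma big_cell_step:
  assumes i: "i \<in> {1..n}" and a: "a \<in> Um" and s: "\<forall>i\<in>{1..n}. s i \<noteq> 0" and u: "u \<in> Up" and nz: "1 + \<tau> * r \<noteq> 0"
  shows "\<exists>a'\<in>Um. \<exists>b'\<in>Up. (a \<otimes> tor s) \<otimes> (x i \<tau> \<otimes> (y i r \<otimes> u)) = (a' \<otimes> tor (s(i := s i * (1 + \<tau> * r)))) \<otimes> b'"
proof -
  let ?w = "1 + \<tau> * r"
  obtain r' where r': "tor s \<otimes> y i (r / ?w) = y i r' \<otimes> tor s" using tor_y[OF i s] by blast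
  have c: "a \<in> carrier H" "u \<in> carrier H" "tor s \<in> carrier H" "\<And>t. x i t \<in> carrier H" "\<And>t. y i t \<in> carrier H" "\<And>t. A i t \<in> carrier H"
    using a u Um_carrier Up_carrier tor_closed x_closed y_closed A_closed i by auto
  have "(a \<otimes> tor s) \<otimes> (x i \<tau> \<otimes> (y i r \<otimes> u)) = a \<otimes> tor s \<otimes> (x i \<tau> \<otimes> y i r) \<otimes> u"
    using c by (simp add: m_assoc)
  also have "\<dots> = a \<otimes> (tor s \<otimes> y i (r / ?w)) \<otimes> A i ?w \<otimes> (x i (\<tau> / ?w) \<otimes> u)"
    unfolding x_y_same[OF i nz] using c by (simp add: m_assoc)
  also have "\<dots> = a \<otimes> y i r' \<otimes> (tor s \<otimes> A i ?w) \<otimes> (x i (\<tau> / ?w) \<otimes> u)"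
    unfolding r' using c by (simp add: m_assoc)
  also have "tor s \<otimes> A i ?w = tor (s(i := s i * ?w))" by (rule tor_A[OF i nz s])
  finally show ?thesis using Um_mult[OF a Um_y[OF i]] Up_mult[OF Up_x[OF i] u] by blast
qed

end

section \<open>Direct products and the general linear group\<close>

lemma chev_group_DirProd:
  assumes "chev_group H n x y A xx" "chev_group H' n x' y' A' xx'"
  shows "chev_group (H \<times>\<times> H') n (\<lambda>i t. (x i t, x' i t)) (\<lambda>i t. (y i t, y' i t)) (\<lambda>i t. (A i t, A' i t)) (\<lambda>i j t. (xx i j t, xx' i j t))"
proof -
  interpret G: chev_group H n x y A xx by fact
  interpret G': chev_group H' n x' y' A' xx' by fact
  interpret D: group "H \<times>\<times> H'" by (rule DirProd_group) unfold_locales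
  show ?thesis
    by unfold_locales
      (auto simp: G.x_closed G'.x_closed G.y_closed G'.y_closed G.A_closed G'.A_closed G.xx_closed G'.xx_closed
        intro: G.x_add G'.x_add G.y_add G'.y_add G.A_mult G'.A_mult G.A_commute G'.A_commute G.A_y[simplified] G'.A_y[simplified]
        G.x_y_commute G'.x_y_commute G.x_y_same G'.x_y_same G.x_x_commute G'.x_x_commute G.x_x G'.x_x G.x_xx G'.x_xx G.y_xx G'.y_xx)
qed

lemma GL_group: "group (GL N)"
proof -
  interpret R: ring "ring_mat TYPE(complex) N ()" by (rule ring_mat)
  show ?thesis by (rule R.units_group)
qed

lemma GL_simps [simp]: "mult (GL N) = (*)" "one (GL N) = 1\<^sub>m N"
  by (auto simp: units_of_def ring_mat_simps)

lemma GL_carrier_mat: "A \<in> carrier (GL N) \<Longrightarrow> A \<in> carrier_mat N N"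
  by (auto simp: units_of_def Units_def ring_mat_simps)

lemma GL_carrierI:
  assumes "A \<in> carrier_mat N N" "B \<in> carrier_mat N N" "A * B = 1\<^sub>m N" "B * A = 1\<^sub>m N"
  shows "A \<in> carrier (GL N)"
  using assms by (auto simp: units_of_def Units_def ring_mat_simps)

lemma GL_det: "A \<in> carrier (GL N) \<Longrightarrow> det A \<noteq> 0"
proof -
  assume A: "A \<in> carrier (GL N)"
  then obtain B where B: "B \<in> carrier_mat N N" "A * B = 1\<^sub>m N" "A \<in> carrier_mat N N"
    by (auto simp: units_of_def Units_def ring_mat_simps)
  then have "det A * det B = 1" using det_mult[of A N B] by simp
  then show ?thesis by auto
qed

lemma GL_closed: "A \<in> carrier (GL N) \<Longrightarrow> B \<in> carrier (GL N) \<Longrightarrow> A * B \<in> carrier (GL N)"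
  using monoid.m_closed[OF group.is_monoid[OF GL_group]] by (metis GL_simps(1))

lemma GL_one: "1\<^sub>m N \<in> carrier (GL N)"
  using monoid.one_closed[OF group.is_monoid[OF GL_group], of N] by simp

lemma one_param_GL: "A \<in> carrier_mat N N \<Longrightarrow> one_param N A t \<in> carrier (GL N)"
  using GL_carrierI[OF _ _ one_param_inverse one_param_inverse'] by simp

lemma mat_prod_Cons [simp]: "mat_prod N (A # As) = A * mat_prod N As" "mat_prod N [] = 1\<^sub>m N"
  by (simp_all add: mat_prod_def)

lemma mat_prod_GL: "set As \<subseteq> carrier (GL N) \<Longrightarrow> mat_prod N As \<in> carrier (GL N)"
  by (induction As) (auto intro: GL_closed GL_one)

lemma mat_prod_carrier: "set As \<subseteq> carrier_mat N N \<Longrightarrow> mat_prod N As \<in> carrier_mat N N"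
  by (induction As) (auto intro!: mult_carrier_mat)

lemma mat_prod_append:
  assumes "set As \<subseteq> carrier_mat N N" "set Bs \<subseteq> carrier_mat N N"
  shows "mat_prod N (As @ Bs) = mat_prod N As * mat_prod N Bs"
  using assms(1)
proof (induction As)
  case Nil
  then show ?case using mat_prod_carrier[OF assms(2)] by simp
next
  case (Cons A As)
  then show ?case using mat_prod_carrier[of As N] mat_prod_carrier[OF assms(2)]
    by (simp add: sq_assoc[where N = N])
qed

context chevalley_rep
begin

lemma coroot_GL: "i \<in> {1..n} \<Longrightarrow> coroot N e f i u \<in> carrier (GL N)"
  unfolding coroot_def s_bar_def
  by (rule mat_prod_GL) (use carr in \<open>auto intro!: one_param_GL mat_prod_GL GL_closed GL_one\<close>)

lemma chev_group: "chev_group (GL N) n x y (coroot N e f) xx"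
proof -
  interpret group "GL N" by (rule GL_group)
  show ?thesis
  proof unfold_locales
    show "xx i j t \<in> carrier (GL N)" if "i \<in> {1..n}" "j \<in> {1..n}" for i j t
      unfolding xx_def using carr that by (auto intro!: one_param_GL bracket_carrier)
  qed ((unfold GL_simps)?; (assumption | rule one_param_GL carr coroot_GL one_param_add coroot_mult coroot_commute coroot_y
    x_y_commute x_y_same x_x_commute xx_rels)+)+
qed

end

sublocale chevalley_rep \<subseteq> CG: chev_group "GL N" n x y "coroot N e f" xx
  by (rule chev_group)

context chevalley_rep
begin

lemma tor_torus_elt: "CG.tor s = torus_elt n N e f s"
  unfolding CG.tor_def torus_elt_def mat_prod_def by simp

lemma Up_unip: "CG.Up = unip n N e" and Um_unip: "CG.Um = unip n N f"
  unfolding CG.Up_def CG.Um_def unip_def by simp_all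

end

section \<open>Entire families of matrices and words in the one-parameter subgroups\<close>

definition holo :: "nat \<Rightarrow> (complex \<Rightarrow> complex mat) \<Rightarrow> bool" where
  "holo N g \<longleftrightarrow> (\<forall>z. g z \<in> carrier_mat N N) \<and> (\<forall>r<N. \<forall>s<N. (\<lambda>z. g z $$ (r, s)) holomorphic_on UNIV)"

lemma holo_const: "A \<in> carrier_mat N N \<Longrightarrow> holo N (\<lambda>z. A)"
  by (auto simp: holo_def)

lemma holo_mult: "holo N F \<Longrightarrow> holo N G \<Longrightarrow> holo N (\<lambda>z. F z * G z)"
  unfolding holo_def by (auto simp: mult_entry[where N = N] simp del: index_mult_mat intro!: holomorphic_intros mult_carrier_mat)

lemma holo_one_param:
  assumes "A \<in> carrier_mat N N"
  shows "holo N (one_param N A)"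
  unfolding holo_def holomorphic_on_def field_differentiable_def
  using one_param_deriv_left[OF assms] by (auto simp: has_mderiv_def)

lemma holo_compose:
  assumes "holo N F" "g holomorphic_on UNIV"
  shows "holo N (\<lambda>z. F (g z))"
  using assms unfolding holo_def
  by (auto intro!: holomorphic_on_compose_gen[of g UNIV _ UNIV, unfolded o_def])

lemma holo_det:
  assumes "\<And>z. g z \<in> carrier_mat k k" "\<And>r s. r < k \<Longrightarrow> s < k \<Longrightarrow> (\<lambda>z. g z $$ (r, s)) holomorphic_on UNIV"
  shows "(\<lambda>z. det (g z :: complex mat)) holomorphic_on UNIV"
  unfolding det_def'[OF assms(1)]
  by (intro holomorphic_intros assms(2)) (auto simp: permutes_in_image)

lemma regular_GL_holomorphic:
  assumes "regular_GL N P" "holo N g" "\<And>z. det (g z) \<noteq> 0"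
  shows "(\<lambda>z. P (g z)) holomorphic_on UNIV"
  using assms(1)
proof induction
  case (entry r s)
  then show ?case using assms(2) by (auto simp: holo_def)
next
  case inv_det
  have "(\<lambda>z. det (g z)) holomorphic_on UNIV"
    by (rule holo_det[of _ N]) (use assms(2) in \<open>auto simp: holo_def\<close>)
  then show ?case using assms(3) by (intro holomorphic_intros) auto
qed (auto intro!: holomorphic_intros)

text \<open>A letter (True, i, t) stands for x_i(t) and (False, i, t) for y_i(t). Words are kept as
  data so that one word can be evaluated in two representations and deformed to the identity by
  scaling its parameters.\<close>

definition word_ok :: "nat \<Rightarrow> (bool \<times> nat \<times> complex) list \<Rightarrow> bool" where
  "word_ok n w \<longleftrightarrow> (\<forall>(b, i, t) \<in> set w. i \<in> {1..n})"

definition word_letter :: "nat \<Rightarrow> (nat \<Rightarrow> complex mat) \<Rightarrow> (nat \<Rightarrow> complex mat) \<Rightarrow> bool \<times> nat \<times> complex \<Rightarrow> complex mat" where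
  "word_letter N e f l = (case l of (b, i, t) \<Rightarrow> one_param N (if b then e i else f i) t)"

definition word_eval :: "nat \<Rightarrow> (nat \<Rightarrow> complex mat) \<Rightarrow> (nat \<Rightarrow> complex mat) \<Rightarrow> (bool \<times> nat \<times> complex) list \<Rightarrow> complex mat" where
  "word_eval N e f w = mat_prod N (map (word_letter N e f) w)"

definition word_scale :: "complex \<Rightarrow> (bool \<times> nat \<times> complex) list \<Rightarrow> (bool \<times> nat \<times> complex) list" where
  "word_scale z w = map (\<lambda>(b, i, t). (b, i, z * t)) w"

lemma word_ok_simps [simp]:
  "word_ok n []" "word_ok n (l # w) \<longleftrightarrow> fst (snd l) \<in> {1..n} \<and> word_ok n w"
  "word_ok n (v @ w) \<longleftrightarrow> word_ok n v \<and> word_ok n w"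
  by (auto simp: word_ok_def split: prod.splits)

lemma word_ok_take: "word_ok n w \<Longrightarrow> word_ok n (take j w)"
  by (auto simp: word_ok_def dest: in_set_takeD)

lemma word_ok_scale [simp]: "word_ok n (word_scale z w) \<longleftrightarrow> word_ok n w"
  by (auto simp: word_ok_def word_scale_def)

context chevalley_rep
begin

lemma word_letter_GL: "fst (snd l) \<in> {1..n} \<Longrightarrow> word_letter N e f l \<in> carrier (GL N)"
  using carr by (auto simp: word_letter_def split: prod.splits intro!: one_param_GL)

lemma word_letters_GL: "word_ok n w \<Longrightarrow> set (map (word_letter N e f) w) \<subseteq> carrier (GL N)"
  by (induction w) (auto simp: word_letter_GL)

lemma word_eval_GL: "word_ok n w \<Longrightarrow> word_eval N e f w \<in> carrier (GL N)"
  unfolding word_eval_def using word_letters_GL by (intro mat_prod_GL)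

lemma word_eval_carrier: "word_ok n w \<Longrightarrow> word_eval N e f w \<in> carrier_mat N N"
  using word_eval_GL GL_carrier_mat by blast

lemma word_eval_append:
  assumes "word_ok n v" "word_ok n w"
  shows "word_eval N e f (v @ w) = word_eval N e f v * word_eval N e f w"
  using word_letters_GL[OF assms(1)] word_letters_GL[OF assms(2)] GL_carrier_mat
  unfolding word_eval_def map_append by (intro mat_prod_append) blast+

lemma word_eval_Cons:
  "word_eval N e f (l # w) = word_letter N e f l * word_eval N e f w"
  by (simp add: word_eval_def)

lemma word_eval_Nil: "word_eval N e f [] = 1\<^sub>m N"
  by (simp add: word_eval_def)

lemma word_letter_G:
  assumes "fst (snd l) \<in> {1..n}"
  shows "word_letter N e f l \<in> group_G n N e f"
  unfolding group_G_def
  by (rule generate.incl) (use assms in \<open>auto simp: word_letter_def split: prod.splits\<close>)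

lemma word_eval_G:
  assumes "word_ok n w"
  shows "word_eval N e f w \<in> group_G n N e f"
  using assms
proof (induction w)
  case Nil
  show ?case using generate.one[of "GL N"] unfolding group_G_def word_eval_Nil by simp
next
  case (Cons l w)
  then have "word_letter N e f l \<in> group_G n N e f" "word_eval N e f w \<in> group_G n N e f"
    using word_letter_G by auto
  then show ?case unfolding word_eval_Cons group_G_def using generate.eng[of _ "GL N"] by simp
qed

lemma group_G_subset:
  "{one_param N (e i) t | i t. i \<in> {1..n}} \<union> {one_param N (f i) t | i t. i \<in> {1..n}} \<subseteq> carrier (GL N)"
  using carr by (auto intro!: one_param_GL)

lemma group_G_GL: "g \<in> group_G n N e f \<Longrightarrow> g \<in> carrier (GL N)"
  unfolding group_G_def using CG.generate_in_carrier[OF group_G_subset] by blast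

lemma group_G_mult: "g \<in> group_G n N e f \<Longrightarrow> g' \<in> group_G n N e f \<Longrightarrow> g * g' \<in> group_G n N e f"
  unfolding group_G_def using generate.eng[of _ "GL N"] by simp

lemma Up_G: "u \<in> CG.Up \<Longrightarrow> u \<in> group_G n N e f" and Um_G: "u \<in> CG.Um \<Longrightarrow> u \<in> group_G n N e f"
  unfolding CG.Up_def CG.Um_def group_G_def using CG.mono_generate[of _ "_ \<union> _"] by blast+

lemma x_G: "i \<in> {1..n} \<Longrightarrow> x i t \<in> group_G n N e f" and y_G: "i \<in> {1..n} \<Longrightarrow> y i t \<in> group_G n N e f"
  unfolding group_G_def by (auto intro!: generate.incl)

lemma mat_prod_G: "set As \<subseteq> group_G n N e f \<Longrightarrow> mat_prod N As \<in> group_G n N e f"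
proof (induction As)
  case Nil
  show ?case using generate.one[of "GL N"] unfolding group_G_def by simp
qed (auto intro: group_G_mult)

lemma coroot_G: "i \<in> {1..n} \<Longrightarrow> coroot N e f i u \<in> group_G n N e f"
  unfolding coroot_def s_bar_def by (intro mat_prod_G) (auto intro!: x_G y_G mat_prod_G group_G_mult mat_prod_G[of "[]", simplified])

lemma torus_G: "torus_elt n N e f s \<in> group_G n N e f"
  unfolding torus_elt_def by (intro mat_prod_G) (auto intro!: coroot_G)

lemma holo_word:
  assumes "word_ok n w"
  shows "holo N (\<lambda>z. word_eval N e f (word_scale z w))"
  using assms
proof (induction w)
  case Nil
  then show ?case by (simp add: word_scale_def word_eval_Nil holo_const)
next
  case (Cons l w)
  obtain b i t where l: "l = (b, i, t)" by (cases l)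
  have "(if b then e i else f i) \<in> carrier_mat N N" using Cons.prems carr l by auto
  from holo_compose[OF holo_one_param[OF this], of "\<lambda>z. z * t"]
  have "holo N (\<lambda>z. one_param N (if b then e i else f i) (z * t))" by (simp add: holomorphic_intros)
  from holo_mult[OF this Cons.IH] Cons.prems show ?case
    by (simp add: word_scale_def word_eval_Cons l word_letter_def)
qed

lemma word_eval_zero:
  assumes "word_ok n w"
  shows "word_eval N e f (word_scale 0 w) = 1\<^sub>m N"
  using assms
proof (induction w)
  case Nil
  then show ?case by (simp add: word_scale_def word_eval_Nil)
next
  case (Cons l w)
  then show ?case using carr by (auto simp: word_scale_def word_eval_Cons word_letter_def split: prod.splits)
qed

end

lemma agree_off_point:
  fixes F G :: "complex \<Rightarrow> complex"
  assumes "F holomorphic_on UNIV" "G holomorphic_on UNIV" "\<And>z. z \<noteq> r \<Longrightarrow> F z = G z"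
  shows "F r = G r"
proof -
  have "isCont F r" "isCont G r"
    using assms(1,2) holomorphic_on_imp_continuous_on continuous_on_eq_continuous_at[OF open_UNIV] by blast+
  then have "(F \<longlongrightarrow> F r) (at r)" "(G \<longlongrightarrow> G r) (at r)" by (auto simp: isCont_def)
  moreover have "eventually (\<lambda>z. F z = G z) (at r)"
    using assms(3) by (auto simp: eventually_at_filter)
  ultimately show ?thesis
    using tendsto_unique[of "at r" F] tendsto_cong[of F G "at r"] by auto
qed

section \<open>Simultaneous Gauss decomposition and the transfer of minors\<close>

locale chevalley_pair = R: chevalley_rep n N e f h + R': chevalley_rep n N' e' f' h'
  for n N N' :: nat and e f h e' f' h' :: "nat \<Rightarrow> complex mat" +
  fixes \<Delta> :: "nat \<Rightarrow> complex mat \<Rightarrow> complex"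
  assumes sc: "simply_connected_D n N e f h"
    and minors: "\<forall>i \<in> {1..n}. is_principal_minor n N e f i (\<Delta> i)"
begin

sublocale P: chev_group "GL N \<times>\<times> GL N'" n "\<lambda>i t. (R.x i t, R'.x i t)" "\<lambda>i t. (R.y i t, R'.y i t)"
  "\<lambda>i t. (coroot N e f i t, coroot N' e' f' i t)" "\<lambda>i j t. (R.xx i j t, R'.xx i j t)"
  by (rule chev_group_DirProd[OF R.chev_group R'.chev_group])

lemma mult_pair: "(a, b) \<otimes>\<^bsub>GL N \<times>\<times> GL N'\<^esub> (c, d) = (a * c, b * d)"
  by (simp add: DirProd_def)

lemma one_pair: "\<one>\<^bsub>GL N \<times>\<times> GL N'\<^esub> = (1\<^sub>m N, 1\<^sub>m N')"
  by (simp add: DirProd_def)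

lemma generate_pair:
  assumes "u \<in> generate (GL N \<times>\<times> GL N') {(a i t, b i t) | i t. i \<in> {1..n}}"
    "\<And>i t. i \<in> {1..n} \<Longrightarrow> a i t \<in> carrier (GL N)" "\<And>i t. i \<in> {1..n} \<Longrightarrow> b i t \<in> carrier (GL N')"
  shows "fst u \<in> generate (GL N) {a i t | i t. i \<in> {1..n}} \<and> snd u \<in> generate (GL N') {b i t | i t. i \<in> {1..n}}"
  using assms(1)
proof (induction rule: generate.induct)
  case one
  then show ?case using generate.one[of "GL N"] generate.one[of "GL N'"] by (simp add: one_pair)
next
  case (incl h)
  then obtain i t where h: "h = (a i t, b i t)" "i \<in> {1..n}" by auto
  show ?case unfolding h(1) fst_conv snd_conv by (intro conjI generate.incl) (use h(2) in blast)+
next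
  case (inv h)
  then obtain i t where h: "h = (a i t, b i t)" "i \<in> {1..n}" by auto
  have "inv\<^bsub>GL N \<times>\<times> GL N'\<^esub> h = (inv\<^bsub>GL N\<^esub> a i t, inv\<^bsub>GL N'\<^esub> b i t)"
    unfolding h(1) by (rule inv_DirProd[OF GL_group GL_group]) (use assms(2,3) h in auto)
  then show ?case by (simp only: fst_conv snd_conv) (intro conjI generate.inv; use h(2) in blast)
next
  case (eng h1 h2)
  have "h1 \<otimes>\<^bsub>GL N \<times>\<times> GL N'\<^esub> h2 = (fst h1 * fst h2, snd h1 * snd h2)" by (cases h1; cases h2) (simp add: mult_pair)
  then show ?case using eng generate.eng[of _ "GL N"] generate.eng[of _ "GL N'"] by simp
qed

lemma P_Up: "u \<in> P.Up \<Longrightarrow> fst u \<in> unip n N e \<and> snd u \<in> unip n N' e'"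
  unfolding P.Up_def unip_def by (erule generate_pair) (fact R.CG.x_closed R'.CG.x_closed)+

lemma P_Um: "u \<in> P.Um \<Longrightarrow> fst u \<in> unip n N f \<and> snd u \<in> unip n N' f'"
  unfolding P.Um_def unip_def by (erule generate_pair) (fact R.CG.y_closed R'.CG.y_closed)+

lemma P_tor: "P.tor s = (torus_elt n N e f s, torus_elt n N' e' f' s)"
proof -
  have "foldr (\<otimes>\<^bsub>GL N \<times>\<times> GL N'\<^esub>) (map (\<lambda>i. (coroot N e f i (s i), coroot N' e' f' i (s i))) is) \<one>\<^bsub>GL N \<times>\<times> GL N'\<^esub>
    = (mat_prod N (map (\<lambda>i. coroot N e f i (s i)) is), mat_prod N' (map (\<lambda>i. coroot N' e' f' i (s i)) is))" for "is"
    by (induction "is") (simp_all add: one_pair mult_pair)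
  then show ?thesis unfolding P.tor_def torus_elt_def by simp
qed

text \<open>Simple connectedness makes torus coordinates unique: if \<open>s\<close> and
  \<open>s'\<close> give the same element, their quotient lies in the kernel of the coordinate map
  and so is 1 at every node.\<close>

lemma fund_char_torus:
  assumes i: "i \<in> {1..n}" and s: "\<forall>i\<in>{1..n}. s i \<noteq> 0"
  shows "fund_char n N e f i (torus_elt n N e f s) = s i"
  unfolding fund_char_def
proof (rule the_equality)
  fix z assume "\<exists>s'. (\<forall>j\<in>{1..n}. s' j \<noteq> 0) \<and> torus_elt n N e f s = torus_elt n N e f s' \<and> z = s' i"
  then obtain s' where s': "\<forall>j\<in>{1..n}. s' j \<noteq> 0" "torus_elt n N e f s = torus_elt n N e f s'" "z = s' i" by auto
  have inv: "\<forall>j\<in>{1..n}. inverse (s j) \<noteq> 0" using s by auto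
  note tm = R.CG.tor_mult[unfolded R.tor_torus_elt GL_simps]
  have "torus_elt n N e f (\<lambda>j. s' j * inverse (s j)) = torus_elt n N e f s' * torus_elt n N e f (\<lambda>j. inverse (s j))"
    by (rule tm[OF s'(1) inv, symmetric])
  also have "\<dots> = torus_elt n N e f (\<lambda>j. s j * inverse (s j))"
    unfolding s'(2)[symmetric] by (rule tm[OF s inv])
  also have "\<dots> = 1\<^sub>m N"
    by (rule R.CG.tor_one[unfolded R.tor_torus_elt GL_simps]) (use s in simp)
  finally have "torus_elt n N e f (\<lambda>j. s' j * inverse (s j)) = 1\<^sub>m N" .
  moreover have "\<forall>j\<in>{1..n}. s' j * inverse (s j) \<noteq> 0" using s s'(1) by simp
  ultimately have *: "(\<forall>j\<in>{1..n}. s' j * inverse (s j) \<noteq> 0) \<and> torus_elt n N e f (\<lambda>j. s' j * inverse (s j)) = 1\<^sub>m N"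
    by (rule conjI[rotated])
  have k: "\<forall>s. (\<forall>i\<in>{1..n}. s i \<noteq> 0) \<and> torus_elt n N e f s = 1\<^sub>m N \<longrightarrow> (\<forall>i\<in>{1..n}. s i = 1)"
    using sc unfolding simply_connected_D_def by (elim conjE)
  from mp[OF spec[OF k] *] have "s' i * inverse (s i) = 1" by (rule bspec) (rule i)
  moreover have "s i \<noteq> 0" using s i by blast
  ultimately have "s' i = s i" by (simp add: divide_inverse[symmetric])
  then show "z = s i" using s'(3) by simp
qed (use s in auto)

lemma minor_cell:
  assumes "i \<in> {1..n}" "\<forall>i\<in>{1..n}. s i \<noteq> 0" "a \<in> unip n N f" "b \<in> unip n N e"
  shows "\<Delta> i (a * torus_elt n N e f s * b) = s i"
proof -
  have "torus_elt n N e f s \<in> torus_T n N e f" unfolding torus_T_def using assms by auto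
  then have "\<Delta> i (a * torus_elt n N e f s * b) = fund_char n N e f i (torus_elt n N e f s)"
    using minors assms unfolding is_principal_minor_def by blast
  then show ?thesis using fund_char_torus assms by simp
qed

lemma minor_regular:
  assumes "i \<in> {1..n}"
  obtains P where "regular_GL N P" "\<And>g. g \<in> group_G n N e f \<Longrightarrow> \<Delta> i g = P g"
  using minors assms unfolding is_principal_minor_def regular_on_def by blast

lemma minor_holo:
  assumes "i \<in> {1..n}" "holo N g" "\<And>z. g z \<in> group_G n N e f"
  shows "(\<lambda>z. \<Delta> i (g z)) holomorphic_on UNIV"
proof -
  obtain P where P: "regular_GL N P" "\<And>g. g \<in> group_G n N e f \<Longrightarrow> \<Delta> i g = P g"
    using minor_regular[OF assms(1)] by blast
  have "(\<lambda>z. P (g z)) holomorphic_on UNIV"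
    by (rule regular_GL_holomorphic[OF P(1) assms(2)]) (use assms(3) R.group_G_GL GL_det in blast)
  then show ?thesis using P(2)[OF assms(3)] by simp
qed

lemma Um_G: "a \<in> unip n N f \<Longrightarrow> a \<in> group_G n N e f" and Up_G: "b \<in> unip n N e \<Longrightarrow> b \<in> group_G n N e f"
  using R.Um_G R.Up_G unfolding R.Up_unip R.Um_unip by auto

lemma unip_one: "1\<^sub>m N \<in> unip n N a"
  unfolding unip_def using generate.one[of "GL N"] by simp

lemma minor_one: "i \<in> {1..n} \<Longrightarrow> \<Delta> i (1\<^sub>m N) = 1"
  using minor_cell[of i "\<lambda>_. 1" "1\<^sub>m N" "1\<^sub>m N"] unip_one R.CG.tor_one[of "\<lambda>_. 1"]
  by (simp add: R.tor_torus_elt)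

text \<open>A word stays in the big cell as long as no principal minor of a prefix vanishes, because
  \<open>1 + \<tau> * r\<close>, the obstruction to absorbing a further \<open>y i r\<close>, is a quotient of principal minors.\<close>

lemma big_cell:
  assumes "word_ok n w" "\<And>i j. i \<in> {1..n} \<Longrightarrow> j \<le> length w \<Longrightarrow> \<Delta> i (word_eval N e f (take j w)) \<noteq> 0"
  shows "\<exists>a\<in>P.Um. \<exists>b\<in>P.Up. \<exists>s. (\<forall>i\<in>{1..n}. s i \<noteq> 0) \<and>
    (word_eval N e f w, word_eval N' e' f' w) = a \<otimes>\<^bsub>GL N \<times>\<times> GL N'\<^esub> P.tor s \<otimes>\<^bsub>GL N \<times>\<times> GL N'\<^esub> b"
  using assms
proof (induction w rule: rev_induct)
  case Nil
  have "(1\<^sub>m N, 1\<^sub>m N') \<in> P.Um" "(1\<^sub>m N, 1\<^sub>m N') \<in> P.Up"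
    unfolding P.Um_def P.Up_def using generate.one[of "GL N \<times>\<times> GL N'"] by (simp_all add: one_pair)
  moreover have "P.tor (\<lambda>_. 1) = (1\<^sub>m N, 1\<^sub>m N')" using P.tor_one[of "\<lambda>_. 1"] by (simp add: one_pair)
  ultimately show ?case
    by (intro bexI[of _ "(1\<^sub>m N, 1\<^sub>m N')"] exI[of _ "\<lambda>_. 1"]) (auto simp: R.word_eval_Nil R'.word_eval_Nil mult_pair)
next
  case (snoc l w)
  let ?m = "\<lambda>u v. u \<otimes>\<^bsub>GL N \<times>\<times> GL N'\<^esub> v"
  obtain p i r where l: "l = (p, i, r)" by (cases l)
  have ok: "word_ok n w" "i \<in> {1..n}" using snoc.prems l by auto
  have pre: "\<Delta> i (word_eval N e f (take j w)) \<noteq> 0" if "i \<in> {1..n}" "j \<le> length w" for i j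
    using snoc.prems(2)[of i j] that by simp
  obtain a b s where ab: "a \<in> P.Um" "b \<in> P.Up" "\<forall>i\<in>{1..n}. s i \<noteq> 0"
    "(word_eval N e f w, word_eval N' e' f' w) = ?m (?m a (P.tor s)) b"
    using snoc.IH[OF ok(1)] pre by blast
  let ?l = "(word_letter N e f l, word_letter N' e' f' l)"
  have c: "a \<in> carrier (GL N \<times>\<times> GL N')" "b \<in> carrier (GL N \<times>\<times> GL N')" "P.tor s \<in> carrier (GL N \<times>\<times> GL N')"
    using ab P.Um_carrier P.Up_carrier P.tor_closed by auto
  have lc: "?l \<in> carrier (GL N \<times>\<times> GL N')"
    using R.word_letter_GL[of l] R'.word_letter_GL[of l] ok l by auto
  have "(word_eval N e f (w @ [l]), word_eval N' e' f' (w @ [l])) = ?m (word_eval N e f w, word_eval N' e' f' w) ?l"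
    using ok l R.word_eval_append[of w "[l]"] R'.word_eval_append[of w "[l]"] R.word_letter_GL[of l, THEN GL_carrier_mat] R'.word_letter_GL[of l, THEN GL_carrier_mat]
    by (simp add: mult_pair R.word_eval_Cons R'.word_eval_Cons R.word_eval_Nil R'.word_eval_Nil right_mult_one_mat[of _ N N] right_mult_one_mat[of _ N' N'])
  also have "\<dots> = ?m (?m a (P.tor s)) (?m b ?l)"
    unfolding ab(4) using c lc by (simp only: P.m_assoc P.m_closed)
  finally have ev: "(word_eval N e f (w @ [l]), word_eval N' e' f' (w @ [l])) = ?m (?m a (P.tor s)) (?m b ?l)" .
  show ?case
  proof (cases p)
    case True
    then have "?l \<in> P.Up" using P.Up_x[OF ok(2), of r] l by (simp add: word_letter_def)
    then have "?m b ?l \<in> P.Up" by (rule P.Up_mult[OF ab(2)])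
    then show ?thesis using ab(1,3) ev by blast
  next
    case False
    then have ly: "?l = (R.y i r, R'.y i r)" using l by (simp add: word_letter_def)
    obtain \<tau> where \<tau>: "\<And>r. \<exists>u\<in>P.Up. ?m b (R.y i r, R'.y i r) = ?m (R.x i \<tau>, R'.x i \<tau>) (?m (R.y i r, R'.y i r) u)"
      using P.Up_y[OF ok(2) ab(2)] by blast
    obtain u where u: "u \<in> P.Up" "?m b ?l = ?m (R.x i \<tau>, R'.x i \<tau>) (?m (R.y i r, R'.y i r) u)"
      using \<tau>[of r] ly by auto
    have step: "\<exists>a'\<in>P.Um. \<exists>b'\<in>P.Up. ?m (?m a (P.tor s)) (?m (R.x i \<tau>, R'.x i \<tau>) (?m (R.y i z, R'.y i z) u))
        = ?m (?m a' (P.tor (s(i := s i * (1 + \<tau> * z))))) b'" if "1 + \<tau> * z \<noteq> 0" for z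
      by (rule P.big_cell_step[OF ok(2) ab(1,3) u(1) that])
    define g where "g z = (fst a * torus_elt n N e f s) * (R.x i \<tau> * (R.y i z * fst u))" for z
    have g: "fst (?m (?m a (P.tor s)) (?m (R.x i \<tau>, R'.x i \<tau>) (?m (R.y i z, R'.y i z) u))) = g z" for z
      by (cases a; cases u) (simp add: g_def mult_pair P_tor)
    \<comment> \<open>Were this quantity zero, the decomposition would still exist for every z
      \<noteq> r and give the minor s_i (1 + \<tau> z). By continuity the minor would vanish at z =
      r, that is, at the whole word.\<close>
    have nz: "1 + \<tau> * r \<noteq> 0"
    proof
      assume z: "1 + \<tau> * r = 0"
      have gG: "g z \<in> group_G n N e f" for z
        unfolding g_def using P_Um[OF ab(1)] P_Up[OF u(1)] ok(2)
        by (intro R.group_G_mult R.torus_G R.x_G R.y_G) (auto intro: Um_G Up_G)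
      have mc: "fst a \<in> carrier_mat N N" "torus_elt n N e f s \<in> carrier_mat N N" "fst u \<in> carrier_mat N N"
        using P_Um[OF ab(1)] P_Up[OF u(1)] Um_G Up_G R.torus_G R.group_G_GL GL_carrier_mat by blast+
      have "holo N g"
        unfolding g_def using mc R.carr ok(2)
        by (intro holo_mult holo_const holo_one_param one_param_carrier) auto
      then have h1: "(\<lambda>z. \<Delta> i (g z)) holomorphic_on UNIV" by (rule minor_holo[OF ok(2) _ gG])
      have eq: "\<Delta> i (g z) = s i * (1 + \<tau> * z)" if "z \<noteq> r" for z
      proof -
        have "\<tau> \<noteq> 0" using z by auto
        then have nz: "1 + \<tau> * z \<noteq> 0" using z that by (metis add_left_cancel mult_left_cancel)
        from step[OF nz] obtain a' b' where ab': "a' \<in> P.Um" "b' \<in> P.Up"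
          "?m (?m a (P.tor s)) (?m (R.x i \<tau>, R'.x i \<tau>) (?m (R.y i z, R'.y i z) u)) = ?m (?m a' (P.tor (s(i := s i * (1 + \<tau> * z))))) b'"
          by blast
        then have "g z = fst a' * torus_elt n N e f (s(i := s i * (1 + \<tau> * z))) * fst b'"
          using g[of z, symmetric] by (cases a'; cases b') (simp add: mult_pair P_tor)
        then show ?thesis
          using minor_cell[OF ok(2), of "s(i := s i * (1 + \<tau> * z))" "fst a'" "fst b'"] P_Um[OF ab'(1)] P_Up[OF ab'(2)] nz ab(3)
          by simp
      qed
      have "\<Delta> i (g r) = s i * (1 + \<tau> * r)"
        by (rule agree_off_point[OF h1]) (auto intro!: holomorphic_intros eq)
      then have "\<Delta> i (g r) = 0" using z by simp
      moreover have "word_eval N e f (w @ [l]) = g r"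
        using ev u(2) g[of r] by (metis fst_conv)
      ultimately show False using snoc.prems(2)[of i "length (w @ [l])"] ok(2) by simp
    qed
    have s': "\<forall>j\<in>{1..n}. (s(i := s i * (1 + \<tau> * r))) j \<noteq> 0" using ab(3) nz ok(2) by simp
    obtain a' b' where ab': "a' \<in> P.Um" "b' \<in> P.Up"
      "?m (?m a (P.tor s)) (?m (R.x i \<tau>, R'.x i \<tau>) (?m (R.y i r, R'.y i r) u)) = ?m (?m a' (P.tor (s(i := s i * (1 + \<tau> * r))))) b'"
      using step[OF nz] by (elim bexE)
    show ?thesis
      by (intro bexI[OF _ ab'(1)] bexI[OF _ ab'(2)] exI conjI, rule s') (simp only: ev u(2) ab'(3))
  qed
qed

theorem minor_transfer:
  assumes k: "k \<in> {1..n}" and w: "word_ok n w"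
    and M_holo: "\<And>g. holo N' g \<Longrightarrow> (\<lambda>z. M (g z)) holomorphic_on UNIV"
    and M_cell: "\<And>a s b. a \<in> unip n N' f' \<Longrightarrow> b \<in> unip n N' e' \<Longrightarrow> \<forall>i\<in>{1..n}. s i \<noteq> 0 \<Longrightarrow>
        M (a * torus_elt n N' e' f' s * b) = s k"
  shows "\<Delta> k (word_eval N e f w) = M (word_eval N' e' f' w)"
proof -
  have mh: "(\<lambda>z. \<Delta> i (word_eval N e f (word_scale z v))) holomorphic_on UNIV" if "i \<in> {1..n}" "word_ok n v" for i v
    by (rule minor_holo[OF that(1) R.holo_word[OF that(2)]]) (use that R.word_eval_G in simp)
  have ev: "eventually (\<lambda>z. \<Delta> i (word_eval N e f (word_scale z v)) \<noteq> 0) (nhds 0)" if "i \<in> {1..n}" "word_ok n v" for i v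
  proof -
    have "isCont (\<lambda>z. \<Delta> i (word_eval N e f (word_scale z v))) 0"
      using mh[OF that] holomorphic_on_imp_continuous_on continuous_on_eq_continuous_at[OF open_UNIV] by blast
    then have "((\<lambda>z. \<Delta> i (word_eval N e f (word_scale z v))) \<longlongrightarrow> \<Delta> i (word_eval N e f (word_scale 0 v))) (nhds 0)"
      using tendsto_at_iff_tendsto_nhds[of "\<lambda>z. \<Delta> i (word_eval N e f (word_scale z v))" 0] by (simp add: isCont_def)
    moreover have "\<Delta> i (word_eval N e f (word_scale 0 v)) = 1"
      using R.word_eval_zero[OF that(2)] minor_one[OF that(1)] by simp
    ultimately have t: "((\<lambda>z. \<Delta> i (word_eval N e f (word_scale z v))) \<longlongrightarrow> 1) (nhds 0)" by simp
    show ?thesis by (rule tendsto_imp_eventually_ne[OF t]) simp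
  qed
  \<comment> \<open>Each of the finitely many prefixes becomes the identity at z = 0, where every
    principal minor is 1, so no minor of a prefix vanishes near 0.\<close>
  have "eventually (\<lambda>z. \<forall>i\<in>{1..n}. \<forall>j\<in>{..length w}. \<Delta> i (word_eval N e f (word_scale z (take j w))) \<noteq> 0) (nhds 0)"
    by (intro eventually_ball_finite ballI ev finite_atLeastAtMost finite_atMost word_ok_take w)
  then obtain S where S: "open S" "0 \<in> S"
    and S': "\<forall>z\<in>S. \<forall>i\<in>{1..n}. \<forall>j\<in>{..length w}. \<Delta> i (word_eval N e f (word_scale z (take j w))) \<noteq> 0"
    unfolding eventually_nhds by blast
  have eq: "\<Delta> k (word_eval N e f (word_scale z w)) = M (word_eval N' e' f' (word_scale z w))" if z: "z \<in> S" for z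
  proof -
    have tk: "take j (word_scale z w) = word_scale z (take j w)" for j by (simp add: word_scale_def take_map)
    have len: "length (word_scale z w) = length w" by (simp add: word_scale_def)
    have nz: "\<Delta> i (word_eval N e f (take j (word_scale z w))) \<noteq> 0" if "i \<in> {1..n}" "j \<le> length (word_scale z w)" for i j
      unfolding tk using S' z that len by simp
    have "word_ok n (word_scale z w)" using w by simp
    from big_cell[OF this nz] obtain a b s where ab: "a \<in> P.Um" "b \<in> P.Up" "\<forall>i\<in>{1..n}. s i \<noteq> 0"
      "(word_eval N e f (word_scale z w), word_eval N' e' f' (word_scale z w))
         = a \<otimes>\<^bsub>GL N \<times>\<times> GL N'\<^esub> P.tor s \<otimes>\<^bsub>GL N \<times>\<times> GL N'\<^esub> b"
      by blast
    then have "word_eval N e f (word_scale z w) = fst a * torus_elt n N e f s * fst b"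
      "word_eval N' e' f' (word_scale z w) = snd a * torus_elt n N' e' f' s * snd b"
      by (cases a; cases b; simp add: mult_pair P_tor)+
    then show ?thesis using minor_cell[OF k ab(3)] M_cell ab(3) P_Um[OF ab(1)] P_Up[OF ab(2)] by simp
  qed
  have "\<Delta> k (word_eval N e f (word_scale 1 w)) = M (word_eval N' e' f' (word_scale 1 w))"
    by (rule analytic_continuation_open[OF S(1) open_UNIV _ _ _ mh[OF k w] M_holo[OF R'.holo_word[OF w]] eq]) (use S in auto)
  moreover have "word_scale 1 w = w" by (auto simp: word_scale_def intro!: map_idI)
  ultimately show ?thesis by simp
qed

end

section \<open>Minuscule representations\<close>

lemma one_param_square_zero:
  assumes A: "A \<in> carrier_mat N N" and "A * A = 0\<^sub>m N N"
  shows "one_param N A t = 1\<^sub>m N + t \<cdot>\<^sub>m A"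
proof -
  have "has_mderiv N (\<lambda>t. 1\<^sub>m N + t \<cdot>\<^sub>m A) (A * (1\<^sub>m N + t \<cdot>\<^sub>m A)) t" for t
  proof (rule has_mderiv_cong)
    show "has_mderiv N (\<lambda>t. 1\<^sub>m N + t \<cdot>\<^sub>m A) A t"
      by (rule has_mderivI) (use A in \<open>auto intro!: derivative_eq_intros\<close>)
    have "A * (1\<^sub>m N + t \<cdot>\<^sub>m A) = A + t \<cdot>\<^sub>m 0\<^sub>m N N"
      using A assms(2) by (simp add: sq_simps[where N = N])
    also have "\<dots> = A" using A by (intro eq_matI) auto
    finally show "A = A * (1\<^sub>m N + t \<cdot>\<^sub>m A)" by simp
  qed
  from one_param_uniqueness[OF A this, of t] have "1\<^sub>m N + t \<cdot>\<^sub>m A = one_param N A t * (1\<^sub>m N + 0 \<cdot>\<^sub>m A)" .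
  moreover have "1\<^sub>m N + 0 \<cdot>\<^sub>m A = 1\<^sub>m N" using A by (intro eq_matI) auto
  ultimately show ?thesis by (simp add: right_mult_one_mat[of _ N N])
qed

definition pmat :: "nat \<Rightarrow> (nat \<Rightarrow> nat option) \<Rightarrow> complex mat" where
  "pmat N \<phi> = mat N N (\<lambda>(r, s). if \<phi> s = Some r then 1 else 0)"

lemma pmat_carrier [simp]: "pmat N \<phi> \<in> carrier_mat N N"
  by (simp add: pmat_def)

lemma pmat_dim [simp]: "dim_row (pmat N \<phi>) = N" "dim_col (pmat N \<phi>) = N"
  by (simp_all add: pmat_def)

lemma pmat_entry: "r < N \<Longrightarrow> s < N \<Longrightarrow> pmat N \<phi> $$ (r, s) = (if \<phi> s = Some r then 1 else 0)"
  by (simp add: pmat_def)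

lemma pmat_mult:
  assumes "\<And>s r. s < N \<Longrightarrow> \<psi> s = Some r \<Longrightarrow> r < N"
  shows "pmat N \<phi> * pmat N \<psi> = pmat N (\<lambda>s. Option.bind (\<psi> s) \<phi>)"
proof (rule sq_eqI[of _ N])
  fix r s assume rs: "r < N" "s < N"
  have "(pmat N \<phi> * pmat N \<psi>) $$ (r, s) = (\<Sum>k<N. (if \<phi> k = Some r then 1 else 0) * (if \<psi> s = Some k then 1 else 0))"
    using rs by (simp add: mult_entry[where N = N] pmat_entry del: index_mult_mat)
  also have "\<dots> = pmat N (\<lambda>s. Option.bind (\<psi> s) \<phi>) $$ (r, s)"
  proof (cases "\<psi> s")
    case None
    then show ?thesis using rs by (simp add: pmat_entry)
  next
    case (Some l)
    then have "l < N" using assms rs by blast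
    then show ?thesis using rs Some by (simp add: pmat_entry if_distrib[of "\<lambda>x. _ * x"] cong: if_cong)
  qed
  finally show "(pmat N \<phi> * pmat N \<psi>) $$ (r, s) = pmat N (\<lambda>s. Option.bind (\<psi> s) \<phi>) $$ (r, s)" .
qed (simp_all add: sq_closed)

lemma pmat_cong: "(\<And>s. s < N \<Longrightarrow> \<phi> s = \<psi> s) \<Longrightarrow> pmat N \<phi> = pmat N \<psi>"
  by (rule sq_eqI[of _ N]) (simp_all add: pmat_entry)

lemma pmat_None: "pmat N (\<lambda>_. None) = 0\<^sub>m N N"
  by (rule sq_eqI[of _ N]) (simp_all add: pmat_entry)

text \<open>Combinatorial data of a representation whose weights have multiplicity one and pair with
  every coroot to -1, 0 or 1: \<open>p i r\<close> is the pairing of h_i with the weight of index r,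
  and \<open>sg i\<close> is the reflection on indices. The weights need not form a single Weyl
  group orbit.\<close>

locale minuscule =
  fixes n N :: nat and p :: "nat \<Rightarrow> nat \<Rightarrow> int" and sg :: "nat \<Rightarrow> nat \<Rightarrow> nat"
  assumes p_range: "i \<in> {1..n} \<Longrightarrow> r < N \<Longrightarrow> p i r \<in> {-1, 0, 1}"
    and sg_lt: "i \<in> {1..n} \<Longrightarrow> r < N \<Longrightarrow> sg i r < N"
    and sg_sg: "i \<in> {1..n} \<Longrightarrow> r < N \<Longrightarrow> sg i (sg i r) = r"
    and sg_fix: "i \<in> {1..n} \<Longrightarrow> r < N \<Longrightarrow> p i r = 0 \<Longrightarrow> sg i r = r"
    and p_sg: "i \<in> {1..n} \<Longrightarrow> j \<in> {1..n} \<Longrightarrow> r < N \<Longrightarrow> p j (sg i r) = p j r - p i r * cartan_D n j i"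
    and sg_comm: "i \<in> {1..n} \<Longrightarrow> j \<in> {1..n} \<Longrightarrow> i \<noteq> j \<Longrightarrow> cartan_D n i j = 0 \<Longrightarrow> r < N \<Longrightarrow>
      sg i (sg j r) = sg j (sg i r)"
begin

definition up where "up i s = (if p i s = -1 then Some (sg i s) else None)"
definition down where "down i s = (if p i s = 1 then Some (sg i s) else None)"
definition mE where "mE i = pmat N (up i)"
definition mF where "mF i = pmat N (down i)"
definition mH where "mH i = mat N N (\<lambda>(r, s). if r = s then of_int (p i r) else (0 :: complex))"

lemma m_carrier [simp]: "mE i \<in> carrier_mat N N" "mF i \<in> carrier_mat N N" "mH i \<in> carrier_mat N N"
  by (simp_all add: mE_def mF_def mH_def)

lemma p_cases:
  assumes "i \<in> {1..n}" "r < N"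
  obtains "p i r = -1" | "p i r = 0" | "p i r = 1"
  using p_range[OF assms] by auto

lemma p_sg_same: "i \<in> {1..n} \<Longrightarrow> r < N \<Longrightarrow> p i (sg i r) = - p i r"
  using p_sg[of i i r] by (simp add: cartan_D_simps)

lemma up_lt: "i \<in> {1..n} \<Longrightarrow> s < N \<Longrightarrow> up i s = Some r \<Longrightarrow> r < N"
  and down_lt: "i \<in> {1..n} \<Longrightarrow> s < N \<Longrightarrow> down i s = Some r \<Longrightarrow> r < N"
  by (auto simp: up_def down_def sg_lt split: if_splits)

lemma mE_mE: "i \<in> {1..n} \<Longrightarrow> j \<in> {1..n} \<Longrightarrow> mE i * mE j = pmat N (\<lambda>s. Option.bind (up j s) (up i))"
  unfolding mE_def by (rule pmat_mult) (rule up_lt)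

lemma mE_square:
  assumes i: "i \<in> {1..n}"
  shows "mE i * mE i = 0\<^sub>m N N"
  unfolding mE_mE[OF i i] pmat_None[symmetric]
  by (rule pmat_cong) (use i in \<open>auto simp: up_def p_sg_same\<close>)

lemma mE_commute:
  assumes ij: "i \<in> {1..n}" "j \<in> {1..n}" "i \<noteq> j" "cartan_D n i j = 0"
  shows "mE i * mE j = mE j * mE i"
  unfolding mE_mE[OF ij(1,2)] mE_mE[OF ij(2,1)]
  using ij cartan_D_simps(3)[of n i j] by (intro pmat_cong) (auto simp: up_def p_sg sg_comm)

text \<open>After e_i the pairing with h_i is 1, and raising by the neighbour \<alpha>_j makes it 0,
  so e_i then gives zero. In the Serre relation the remaining terms contain the square of
  e_i.\<close>

lemma mE_triple:
  assumes ij: "i \<in> {1..n}" "j \<in> {1..n}" "cartan_D n i j = - 1"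
  shows "mE i * (mE j * mE i) = 0\<^sub>m N N"
proof -
  have "mE i * (mE j * mE i) = pmat N (\<lambda>s. Option.bind (Option.bind (up i s) (up j)) (up i))"
    unfolding mE_mE[OF ij(2,1)] unfolding mE_def
    by (rule pmat_mult) (auto simp: bind_eq_Some_conv intro: up_lt[OF ij(2)] up_lt[OF ij(1)])
  also have "\<dots> = pmat N (\<lambda>_. None)"
  proof (rule pmat_cong)
    fix s assume s: "s < N"
    have a: "cartan_D n j i = -1" using ij(3) cartan_D_simps(3)[of n i j] by simp
    show "Option.bind (Option.bind (up i s) (up j)) (up i) = None"
      using ij a s p_range[OF ij(2) s] by (auto simp: up_def p_sg p_sg_same sg_lt cartan_D_simps(1))
  qed
  finally show ?thesis by (simp add: pmat_None)
qed

lemma serre_mE: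
  assumes ij: "i \<in> {1..n}" "j \<in> {1..n}" "i \<noteq> j"
  shows "(bracket (mE i) ^^ nat (1 - cartan_D n i j)) (mE j) = 0\<^sub>m N N"
proof -
  consider "cartan_D n i j = 0" | "cartan_D n i j = - 1" using cartan_D_simps(2)[OF ij(3)] by blast
  then show ?thesis
  proof cases
    case 1
    then show ?thesis using mE_commute[OF ij] by (simp add: bracket_def sq_closed diff_zero_iff[of _ N])
  next
    case 2
    note t = mE_triple[OF ij(1,2) 2] and q = mE_square[OF ij(1)]
    have 3: "mE i * (mE i * mE j) = 0\<^sub>m N N"
      using q left_mult_zero_mat[of "mE j" N N N] by (simp add: sq_assoc[where N = N, symmetric])
    have *: "nat (1 - cartan_D n i j) = Suc (Suc 0)" using 2 by simp
    show ?thesis unfolding *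
      by (simp add: bracket_def sq_simps[where N = N] t q 3 right_mult_zero_mat[of _ N N])
  qed
qed

text \<open>For orthogonal nodes the two reflections commute. For neighbours both composites vanish,
  since a nonzero one would require a pairing of absolute value 2.\<close>

lemma mE_mF:
  assumes ij: "i \<in> {1..n}" "j \<in> {1..n}" "i \<noteq> j"
  shows "mE i * mF j = mF j * mE i"
proof -
  have 1: "mE i * mF j = pmat N (\<lambda>s. Option.bind (down j s) (up i))"
    unfolding mE_def mF_def by (rule pmat_mult) (rule down_lt[OF ij(2)])
  have 2: "mF j * mE i = pmat N (\<lambda>s. Option.bind (up i s) (down j))"
    unfolding mE_def mF_def by (rule pmat_mult) (rule up_lt[OF ij(1)])
  have "Option.bind (down j s) (up i) = Option.bind (up i s) (down j)" if s: "s < N" for s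
  proof -
    consider "cartan_D n i j = 0" "cartan_D n j i = 0" | "cartan_D n i j = - 1" "cartan_D n j i = - 1"
      using cartan_D_simps(2)[OF ij(3)] cartan_D_simps(3)[of n i j] by metis
    then show ?thesis
      using ij s p_range[OF ij(1) s] p_range[OF ij(2) s]
      by cases (auto simp: up_def down_def p_sg sg_comm)
  qed
  then show ?thesis unfolding 1 2 by (rule pmat_cong)
qed

lemma mE_mF_same:
  assumes i: "i \<in> {1..n}"
  shows "mE i * mF i - mF i * mE i = mH i"
proof -
  have 1: "mE i * mF i = pmat N (\<lambda>s. Option.bind (down i s) (up i))"
    unfolding mE_def mF_def by (rule pmat_mult) (rule down_lt[OF i])
  have 2: "mF i * mE i = pmat N (\<lambda>s. Option.bind (up i s) (down i))"
    unfolding mE_def mF_def by (rule pmat_mult) (rule up_lt[OF i])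
  show ?thesis unfolding 1 2
  proof (rule sq_eqI[of _ N])
    fix r s assume rs: "r < N" "s < N"
    show "(pmat N (\<lambda>s. Option.bind (down i s) (up i)) - pmat N (\<lambda>s. Option.bind (up i s) (down i))) $$ (r, s) = mH i $$ (r, s)"
      using rs i p_range[OF i rs(2)]
      by (auto simp: sq_minus_entry[where N = N] pmat_entry mH_def up_def down_def p_sg_same sg_sg)
  qed (simp_all add: sq_closed)
qed

lemma mH_left: "B \<in> carrier_mat N N \<Longrightarrow> r < N \<Longrightarrow> s < N \<Longrightarrow> (mH i * B) $$ (r, s) = of_int (p i r) * B $$ (r, s)"
  by (subst mult_entry[where N = N]) (simp_all add: mH_def if_distrib[of "\<lambda>x. x * _"] cong: if_cong)

lemma mH_right: "B \<in> carrier_mat N N \<Longrightarrow> r < N \<Longrightarrow> s < N \<Longrightarrow> (B * mH i) $$ (r, s) = B $$ (r, s) * of_int (p i s)"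
  by (subst mult_entry[where N = N]) (simp_all add: mH_def if_distrib[of "\<lambda>x. _ * x"] cong: if_cong)

lemma mH_mE:
  assumes ij: "i \<in> {1..n}" "j \<in> {1..n}"
  shows "mH i * mE j - mE j * mH i = of_int (cartan_D n i j) \<cdot>\<^sub>m mE j"
proof (rule sq_eqI[of _ N])
  fix r s assume rs: "r < N" "s < N"
  show "(mH i * mE j - mE j * mH i) $$ (r, s) = (of_int (cartan_D n i j) \<cdot>\<^sub>m mE j) $$ (r, s)"
    using rs ij by (auto simp: sq_entries[where N = N] sq_closed mH_left mH_right mE_def pmat_entry up_def p_sg simp del: index_mult_mat split: if_splits)
qed (simp_all add: sq_closed)

lemma mH_mH: "mH i * mH j - mH j * mH i = 0\<^sub>m N N"
proof (rule sq_eqI[of _ N])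
  fix r s assume rs: "r < N" "s < N"
  then show "(mH i * mH j - mH j * mH i) $$ (r, s) = 0\<^sub>m N N $$ (r, s)"
    by (simp add: sq_entries[where N = N] sq_closed mH_left mH_right del: index_mult_mat) (simp add: mH_def)
qed (simp_all add: sq_closed)

text \<open>Negating all pairings gives the weights of the dual representation and exchanges e and
  f, so the relations for f follow from those for e.\<close>

lemma neg: "minuscule n N (\<lambda>i r. - p i r) sg"
proof unfold_locales
  fix i r assume ir: "i \<in> {1..n}" "r < N"
  show "- p i r \<in> {- 1, 0, 1}" using p_range[OF ir] by auto
  show "sg i r < N" by (rule sg_lt[OF ir])
  show "sg i (sg i r) = r" by (rule sg_sg[OF ir])
  show "- p i r = 0 \<Longrightarrow> sg i r = r" using sg_fix[OF ir] by simp
  fix j assume j: "j \<in> {1..n}"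
  show "- p j (sg i r) = - p j r - - p i r * cartan_D n j i" using p_sg[OF ir(1) j ir(2)] by simp
  show "i \<noteq> j \<Longrightarrow> cartan_D n i j = 0 \<Longrightarrow> sg i (sg j r) = sg j (sg i r)" by (rule sg_comm[OF ir(1) j _ _ ir(2)])
qed

lemma chevalley: "chevalley_serre_D n N mE mF mH"
proof -
  interpret M: minuscule n N "\<lambda>i r. - p i r" sg by (rule neg)
  have E: "M.mE = mF" by (intro ext) (simp add: M.mE_def mF_def M.up_def[abs_def] down_def[abs_def] minus_equation_iff eq_commute[of "1 :: int"])
  have H: "M.mH i = (- 1) \<cdot>\<^sub>m mH i" for i
    by (rule eq_matI) (auto simp: M.mH_def mH_def)
  have HF: "mH i * mF j - mF j * mH i = of_int (- cartan_D n i j) \<cdot>\<^sub>m mF j" if "i \<in> {1..n}" "j \<in> {1..n}" for i j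
  proof (rule sq_eqI[of _ N])
    fix r s assume rs: "r < N" "s < N"
    have "(M.mH i * mF j - mF j * M.mH i) $$ (r, s) = (of_int (cartan_D n i j) \<cdot>\<^sub>m mF j) $$ (r, s)"
      using M.mH_mE[OF that] unfolding E by simp
    then show "(mH i * mF j - mF j * mH i) $$ (r, s) = (of_int (- cartan_D n i j) \<cdot>\<^sub>m mF j) $$ (r, s)"
      using rs unfolding H by (simp add: sq_simps[where N = N] sq_entries[where N = N] algebra_simps del: index_mult_mat)
  qed (simp_all add: sq_closed)
  have F: "(bracket (mF i) ^^ nat (1 - cartan_D n i j)) (mF j) = 0\<^sub>m N N" if "i \<in> {1..n}" "j \<in> {1..n}" "i \<noteq> j" for i j
    using M.serre_mE[OF that] unfolding E .
  show ?thesis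
    unfolding chevalley_serre_D_def
    using mH_mH mH_mE HF mE_mF_same mE_mF serre_mE F
    by (auto simp: bracket_def[of "mH _" "mH _"] bracket_def[of "mH _" "mE _"] bracket_def[of "mH _" "mF _"] bracket_def[of "mE _" "mF _"] sq_closed diff_zero_iff[of _ N])
qed

sublocale chevalley_rep n N mE mF mH
  by unfold_locales (rule chevalley)

section \<open>Rows and columns under the group elements of a minuscule representation\<close>

lemma mF_square:
  assumes i: "i \<in> {1..n}"
  shows "mF i * mF i = 0\<^sub>m N N"
proof -
  have "mF i * mF i = pmat N (\<lambda>s. Option.bind (down i s) (down i))"
    unfolding mF_def by (rule pmat_mult) (rule down_lt[OF i])
  also have "\<dots> = pmat N (\<lambda>_. None)"
    by (rule pmat_cong) (use i in \<open>auto simp: down_def p_sg_same\<close>)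
  finally show ?thesis by (simp add: pmat_None)
qed

lemma x_entry:
  assumes "i \<in> {1..n}" "r < N" "s < N"
  shows "x i t $$ (r, s) = (if r = s then 1 else 0) + (if p i s = -1 \<and> r = sg i s then t else 0)"
  unfolding one_param_square_zero[OF m_carrier(1) mE_square[OF assms(1)]]
  using assms by (auto simp: mE_def pmat_entry up_def)

lemma y_entry:
  assumes "i \<in> {1..n}" "r < N" "s < N"
  shows "y i t $$ (r, s) = (if r = s then 1 else 0) + (if p i s = 1 \<and> r = sg i s then t else 0)"
  unfolding one_param_square_zero[OF m_carrier(2) mF_square[OF assms(1)]]
  using assms by (auto simp: mF_def pmat_entry down_def)

lemma sg_eq_iff: "i \<in> {1..n} \<Longrightarrow> r < N \<Longrightarrow> s < N \<Longrightarrow> r = sg i s \<longleftrightarrow> s = sg i r"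
  using sg_sg by metis

lemma x_row:
  assumes B: "B \<in> carrier_mat N N" and i: "i \<in> {1..n}" and r: "r < N" and s: "s < N"
  shows "(x i t * B) $$ (r, s) = B $$ (r, s) + (if p i r = 1 then t * B $$ (sg i r, s) else 0)"
proof -
  have c: "p i k = -1 \<and> r = sg i k \<longleftrightarrow> p i r = 1 \<and> k = sg i r" if "k < N" for k
    using sg_eq_iff[OF i r that] p_sg_same[OF i that] p_sg_same[OF i r] by auto
  have "(x i t * B) $$ (r, s) = (\<Sum>k<N. ((if r = k then 1 else 0) + (if p i r = 1 \<and> k = sg i r then t else 0)) * B $$ (k, s))"
    using assms c by (simp add: mult_entry[where N = N] x_entry del: index_mult_mat)
  also have "\<dots> = (\<Sum>k<N. (if k = r then B $$ (k, s) else 0)) + (\<Sum>k<N. (if k = sg i r then (if p i r = 1 then t * B $$ (k, s) else 0) else 0))"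
    unfolding sum.distrib[symmetric] by (intro sum.cong) (auto simp: algebra_simps)
  also have "\<dots> = B $$ (r, s) + (if p i r = 1 then t * B $$ (sg i r, s) else 0)"
    using r sg_lt[OF i r] by simp
  finally show ?thesis .
qed

lemma y_row:
  assumes B: "B \<in> carrier_mat N N" and i: "i \<in> {1..n}" and r: "r < N" and s: "s < N"
  shows "(y i t * B) $$ (r, s) = B $$ (r, s) + (if p i r = -1 then t * B $$ (sg i r, s) else 0)"
proof -
  have c: "p i k = 1 \<and> r = sg i k \<longleftrightarrow> p i r = -1 \<and> k = sg i r" if "k < N" for k
    using sg_eq_iff[OF i r that] p_sg_same[OF i that] p_sg_same[OF i r] by auto
  have "(y i t * B) $$ (r, s) = (\<Sum>k<N. ((if r = k then 1 else 0) + (if p i r = -1 \<and> k = sg i r then t else 0)) * B $$ (k, s))"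
    using assms c by (simp add: mult_entry[where N = N] y_entry del: index_mult_mat)
  also have "\<dots> = (\<Sum>k<N. (if k = r then B $$ (k, s) else 0)) + (\<Sum>k<N. (if k = sg i r then (if p i r = -1 then t * B $$ (k, s) else 0) else 0))"
    unfolding sum.distrib[symmetric] by (intro sum.cong) (auto simp: algebra_simps)
  also have "\<dots> = B $$ (r, s) + (if p i r = -1 then t * B $$ (sg i r, s) else 0)"
    using r sg_lt[OF i r] by simp
  finally show ?thesis .
qed

lemma x_col:
  assumes B: "B \<in> carrier_mat N N" and i: "i \<in> {1..n}" and r: "r < N" and s: "s < N"
  shows "(B * x i t) $$ (r, s) = B $$ (r, s) + (if p i s = -1 then t * B $$ (r, sg i s) else 0)"
proof -
  have "(B * x i t) $$ (r, s) = (\<Sum>k<N. B $$ (r, k) * ((if k = s then 1 else 0) + (if p i s = -1 \<and> k = sg i s then t else 0)))"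
    using assms by (simp add: mult_entry[where N = N] x_entry del: index_mult_mat)
  also have "\<dots> = (\<Sum>k<N. (if k = s then B $$ (r, k) else 0)) + (\<Sum>k<N. (if k = sg i s then (if p i s = -1 then t * B $$ (r, k) else 0) else 0))"
    unfolding sum.distrib[symmetric] by (intro sum.cong) (auto simp: algebra_simps)
  also have "\<dots> = B $$ (r, s) + (if p i s = -1 then t * B $$ (r, sg i s) else 0)"
    using s sg_lt[OF i s] by simp
  finally show ?thesis .
qed

lemma y_col:
  assumes B: "B \<in> carrier_mat N N" and i: "i \<in> {1..n}" and r: "r < N" and s: "s < N"
  shows "(B * y i t) $$ (r, s) = B $$ (r, s) + (if p i s = 1 then t * B $$ (r, sg i s) else 0)"
proof -
  have "(B * y i t) $$ (r, s) = (\<Sum>k<N. B $$ (r, k) * ((if k = s then 1 else 0) + (if p i s = 1 \<and> k = sg i s then t else 0)))"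
    using assms by (simp add: mult_entry[where N = N] y_entry del: index_mult_mat)
  also have "\<dots> = (\<Sum>k<N. (if k = s then B $$ (r, k) else 0)) + (\<Sum>k<N. (if k = sg i s then (if p i s = 1 then t * B $$ (r, k) else 0) else 0))"
    unfolding sum.distrib[symmetric] by (intro sum.cong) (auto simp: algebra_simps)
  also have "\<dots> = B $$ (r, s) + (if p i s = 1 then t * B $$ (r, sg i s) else 0)"
    using s sg_lt[OF i s] by simp
  finally show ?thesis .
qed

abbreviation "sbar \<equiv> s_bar N mE mF"
abbreviation "cort \<equiv> coroot N mE mF"
abbreviation "ybold \<equiv> y_bold N mE mF"

lemma sbar_prod: "sbar i = x i (- 1) * (y i 1 * x i (- 1))"
  by (simp add: s_bar_def right_mult_one_mat[of _ N N])

text \<open>On a two-dimensional string, top weight first, \<open>sbar i\<close> has rows (0, -1),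
  (1, 0): only the row of the top weight carries a sign.\<close>

lemma sbar_row:
  assumes B: "B \<in> carrier_mat N N" and i: "i \<in> {1..n}" and r: "r < N" and s: "s < N"
  shows "(sbar i * B) $$ (r, s) = (if p i r = 1 then - B $$ (sg i r, s) else B $$ (sg i r, s))"
proof -
  have "sbar i * B = x i (- 1) * (y i 1 * (x i (- 1) * B))"
    using B by (simp add: sbar_prod sq_simps[where N = N])
  then show ?thesis
    using assms sg_lt[OF i r] by (cases rule: p_cases[OF i r])
      (simp_all add: x_row y_row sq_closed p_sg_same sg_sg sg_fix del: index_mult_mat)
qed

lemma sbar_inv_row:
  assumes B: "B \<in> carrier_mat N N" and i: "i \<in> {1..n}" and r: "r < N" and s: "s < N"
  shows "(x i 1 * (y i (- 1) * (x i 1 * B))) $$ (r, s) = (if p i r = -1 then - B $$ (sg i r, s) else B $$ (sg i r, s))"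
  using assms sg_lt[OF i r] by (cases rule: p_cases[OF i r])
      (simp_all add: x_row y_row sq_closed p_sg_same sg_sg sg_fix del: index_mult_mat)

lemma sbar_col:
  assumes B: "B \<in> carrier_mat N N" and i: "i \<in> {1..n}" and r: "r < N" and s: "s < N"
  shows "(B * sbar i) $$ (r, s) = (if p i s = -1 then - B $$ (r, sg i s) else B $$ (r, sg i s))"
proof -
  have "B * sbar i = B * x i (- 1) * y i 1 * x i (- 1)"
    using B by (simp add: sbar_prod sq_simps[where N = N])
  then show ?thesis
    using assms sg_lt[OF i s] by (cases rule: p_cases[OF i s])
      (simp_all add: x_col y_col sq_closed p_sg_same sg_sg sg_fix del: index_mult_mat)
qed

lemma cort_row:
  assumes B: "B \<in> carrier_mat N N" and i: "i \<in> {1..n}" and r: "r < N" and s: "s < N" and u: "u \<noteq> 0"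
  shows "(cort i u * B) $$ (r, s) = u powi p i r * B $$ (r, s)"
proof -
  have "cort i u * B = x i u * (y i (- inverse u) * (x i u * (sbar i * B)))"
    using B i by (simp add: coroot_def sq_simps[where N = N] right_mult_one_mat[of _ N N])
  then show ?thesis
    using assms sg_lt[OF i r] by (cases rule: p_cases[OF i r])
      (simp_all add: x_row y_row sbar_row sq_closed p_sg_same sg_sg sg_fix power_int_minus field_simps del: index_mult_mat)
qed

text \<open>On a string, top weight first, \<open>ybold i u\<close> has rows (1/u, 0), (1, u). The
  entry leading down the string is free of u, and this is why the extremal entries below are equal
  to 1.\<close>

lemma ybold_row:
  assumes B: "B \<in> carrier_mat N N" and i: "i \<in> {1..n}" and r: "r < N" and s: "s < N" and u: "u \<noteq> 0"
  shows "(ybold i u * B) $$ (r, s) =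
    (if p i r = 1 then B $$ (r, s) / u else if p i r = -1 then u * B $$ (r, s) + B $$ (sg i r, s) else B $$ (r, s))"
proof -
  have "ybold i u * B = y i u * (cort i (inverse u) * B)"
    using B i by (simp add: y_bold_def sq_simps[where N = N])
  then show ?thesis
    using assms sg_lt[OF i r] by (cases rule: p_cases[OF i r])
      (simp_all add: y_row cort_row sq_closed p_sg_same sg_sg sg_fix power_int_minus divide_inverse del: index_mult_mat)
qed

lemma ybold_carrier [simp]: "i \<in> {1..n} \<Longrightarrow> ybold i u \<in> carrier_mat N N"
  by (simp add: y_bold_def sq_closed)

lemma ybold_col:
  assumes B: "B \<in> carrier_mat N N" and i: "i \<in> {1..n}" and r: "r < N" and s: "s < N" and u: "u \<noteq> 0"
  shows "(B * ybold i u) $$ (r, s) =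
    (if p i s = 1 then B $$ (r, s) / u + B $$ (r, sg i s) else if p i s = -1 then u * B $$ (r, s) else B $$ (r, s))"
proof -
  have e: "ybold i u $$ (k, s) = (if p i k = 1 then (if k = s then 1 / u else 0) else if p i k = -1 then u * (if k = s then 1 else 0) + (if sg i k = s then 1 else 0) else (if k = s then 1 else 0))"
    if "k < N" for k
    using ybold_row[of "1\<^sub>m N" i k s u] that i s u sg_lt[OF i that] by (simp add: right_mult_one_mat[of _ N N])
  have sk: "sg i k = s \<longleftrightarrow> k = sg i s" if "k < N" for k using sg_eq_iff[OF i s that] by auto
  have pk: "p i k = - p i s" if "k = sg i s" for k using that p_sg_same[OF i s] by simp
  have "(B * ybold i u) $$ (r, s) = (\<Sum>k<N. B $$ (r, k) * ybold i u $$ (k, s))"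
    using assms by (simp add: mult_entry[where N = N] del: index_mult_mat)
  also have "\<dots> = (\<Sum>k<N. (if k = s then (if p i s = 1 then B $$ (r, k) / u else if p i s = -1 then u * B $$ (r, k) else B $$ (r, k)) else 0)
      + (if k = sg i s then (if p i s = 1 then B $$ (r, k) else 0) else 0))"
  proof (rule sum.cong[OF refl])
    fix k assume k: "k \<in> {..<N}"
    show "B $$ (r, k) * ybold i u $$ (k, s) = (if k = s then (if p i s = 1 then B $$ (r, k) / u else if p i s = -1 then u * B $$ (r, k) else B $$ (r, k)) else 0)
      + (if k = sg i s then (if p i s = 1 then B $$ (r, k) else 0) else 0)"
    proof (cases "k = sg i s")
      case True
      then show ?thesis using k e[of k] sk[of k] pk[OF True]
        by (cases rule: p_cases[OF i s]) (auto simp: algebra_simps)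
    next
      case False
      then show ?thesis using k e[of k] sk[of k] by (cases rule: p_cases[OF i s]) (auto simp: algebra_simps)
    qed
  qed
  also have "\<dots> = (if p i s = 1 then B $$ (r, s) / u + B $$ (r, sg i s) else if p i s = -1 then u * B $$ (r, s) else B $$ (r, s))"
    using s sg_lt[OF i s] by (simp add: sum.distrib)
  finally show ?thesis .
qed

section \<open>Signs and extremal entries along words\<close>

primrec sgn_word :: "nat list \<Rightarrow> nat \<Rightarrow> complex" where
  "sgn_word [] a = 1"
| "sgn_word (i # ks) a = (if p i (foldr sg ks a) = -1 then - sgn_word ks a else sgn_word ks a)"

lemma foldr_sg_lt: "set ks \<subseteq> {1..n} \<Longrightarrow> a < N \<Longrightarrow> foldr sg ks a < N"
  by (induction ks) (auto intro: sg_lt)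

text \<open>The inverse of a representative permutes the rows up to sign. \<open>sgn_word\<close>
  collects a factor -1 for each letter at which the index reached so far has pairing -1. The list is
  reversed because the word spells the inverse of the product over \<open>ks\<close>.\<close>

lemma word_inverse_row:
  assumes "set ks \<subseteq> {1..n}" "a < N" "s < N" "B \<in> carrier_mat N N"
  shows "(word_eval N mE mF (concat (map (\<lambda>i. [(True, i, 1), (False, i, - 1), (True, i, 1)]) (rev ks))) * B) $$ (a, s)
    = sgn_word ks a * B $$ (foldr sg ks a, s)"
  using assms(1,4)
proof (induction ks arbitrary: B)
  case Nil
  then show ?case using assms by (simp add: word_eval_Nil left_mult_one_mat[of _ N N])
next
  case (Cons i ks)
  let ?W = "concat (map (\<lambda>i. [(True, i, 1 :: complex), (False, i, - 1), (True, i, 1)]) (rev ks))"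
  have i: "i \<in> {1..n}" and ks: "set ks \<subseteq> {1..n}" using Cons.prems by auto
  have ok: "word_ok n ?W" using ks by (auto simp: word_ok_def)
  have "word_eval N mE mF (?W @ [(True, i, 1), (False, i, - 1), (True, i, 1)]) * B
    = word_eval N mE mF ?W * (x i 1 * (y i (- 1) * (x i 1 * B)))"
    using word_eval_append[OF ok, of "[(True, i, 1), (False, i, - 1), (True, i, 1)]"] i Cons.prems(2) word_eval_carrier[OF ok]
    by (simp add: word_eval_Cons word_eval_Nil word_letter_def right_mult_one_mat[of _ N N] sq_simps[where N = N])
  then show ?case
    using Cons.IH[OF ks, of "x i 1 * (y i (- 1) * (x i 1 * B))"] sbar_inv_row[OF Cons.prems(2) i foldr_sg_lt[OF ks assms(2)] assms(3)] Cons.prems(2)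
    by (simp add: sq_closed del: index_mult_mat)
qed

lemma torus_row:
  assumes "\<forall>i\<in>{1..n}. u i \<noteq> 0" "r < N" "s < N" "B \<in> carrier_mat N N"
  shows "(torus_elt n N mE mF u * B) $$ (r, s) = (\<Prod>i=1..n. u i powi p i r) * B $$ (r, s)"
proof -
  have "(mat_prod N (map (\<lambda>i. cort i (u i)) is) * B) $$ (r, s) = prod_list (map (\<lambda>i. u i powi p i r) is) * B $$ (r, s)"
    if "set is \<subseteq> {1..n}" for "is"
    using that
  proof (induction "is")
    case (Cons i "is")
    have c: "mat_prod N (map (\<lambda>i. cort i (u i)) is) \<in> carrier_mat N N"
      by (rule mat_prod_carrier) (use Cons.prems in auto)
    have i: "i \<in> {1..n}" using Cons.prems by auto
    have "mat_prod N (map (\<lambda>i. cort i (u i)) (i # is)) * B = cort i (u i) * (mat_prod N (map (\<lambda>i. cort i (u i)) is) * B)"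
      using c i assms(4) by (simp add: sq_assoc[where N = N])
    then show ?case using Cons c i assms by (simp add: cort_row sq_closed del: index_mult_mat)
  qed (use assms in \<open>simp add: left_mult_one_mat[of _ N N]\<close>)
  from this[of "[1..<Suc n]"] have "(torus_elt n N mE mF u * B) $$ (r, s) = prod_list (map (\<lambda>i. u i powi p i r) [1..<Suc n]) * B $$ (r, s)"
    unfolding torus_elt_def by (simp add: atLeastLessThanSuc_atLeastAtMost del: upt_Suc)
  also have "prod_list (map (\<lambda>i. u i powi p i r) [1..<Suc n]) = (\<Prod>i=1..n. u i powi p i r)"
    by (subst prod.distinct_set_conv_list[symmetric]) (simp_all add: atLeastLessThanSuc_atLeastAtMost del: upt_Suc)
  finally show ?thesis .
qed

text \<open>Read from the right, no reflection of the word raises the weight reached so far, and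
  hence no letter contributes a sign. The highest weight behaves like this along a reduced
  word.\<close>

primrec ascending :: "nat list \<Rightarrow> nat \<Rightarrow> bool" where
  "ascending [] r \<longleftrightarrow> True"
| "ascending (i # ks) r \<longleftrightarrow> p i (foldr sg ks r) \<ge> 0 \<and> ascending ks r"

lemma sgn_ascending: "set ks \<subseteq> {1..n} \<Longrightarrow> ascending ks r \<Longrightarrow> sgn_word ks r = 1"
  by (induction ks) auto

definition Yprod :: "(nat \<times> complex) list \<Rightarrow> complex mat" where
  "Yprod w = mat_prod N (map (\<lambda>(i, u). ybold i u) w)"

text \<open>\<open>dominates r R\<close> says that the weight of \<open>r\<close> is that of \<open>R\<close> plus a sum of positive roots. The
  rows of \<open>Yprod\<close> from which a state can be reached all dominate the extremal one, by the
  lifting property of the Bruhat order; this leaves a single path to the extremal entry.\<close>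

definition dominates :: "(nat \<Rightarrow> int) \<Rightarrow> nat \<Rightarrow> nat \<Rightarrow> bool" where
  "dominates ht r R \<longleftrightarrow> (\<exists>m. (\<forall>j\<in>{1..n}. p j r = p j R + (\<Sum>i=1..n. cartan_D n j i * int (m i)))
     \<and> ht r = ht R + (\<Sum>i=1..n. int (m i)))"

lemma dominates_refl: "dominates ht r r"
  unfolding dominates_def by (rule exI[of _ "\<lambda>_. 0"]) simp

lemma sum_upd:
  fixes g :: "nat \<Rightarrow> int"
  assumes "i \<in> {1..n}"
  shows "(\<Sum>j=1..n. g j * int ((m(i := v)) j)) = (\<Sum>j=1..n. g j * int (m j)) + g i * (int v - int (m i))"
proof -
  have 1: "(\<Sum>j=1..n. g j * int ((m(i := v)) j)) = g i * int v + (\<Sum>j\<in>{1..n} - {i}. g j * int (m j))"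
    using assms by (subst sum.remove[of _ i]) auto
  have 2: "(\<Sum>j=1..n. g j * int (m j)) = g i * int (m i) + (\<Sum>j\<in>{1..n} - {i}. g j * int (m j))"
    using assms by (subst sum.remove[of _ i]) auto
  show ?thesis unfolding 1 2 by (simp add: algebra_simps)
qed

lemma sum_upd1:
  assumes "i \<in> {1..n}"
  shows "(\<Sum>j=1..n. int ((m(i := v)) j)) = (\<Sum>j=1..n. int (m j)) + (int v - int (m i))"
  using sum_upd[OF assms, of "\<lambda>_. 1" m v] by simp

text \<open>Induction on the word, new factors being added on the left. If \<open>p i R\<close> is
  1, the new entry at \<open>sg i R\<close> is u times the old entry there plus the old entry 1 at
  R. The former is zero, because R - \<alpha>_i is lower than R and cannot dominate it; the height
  \<open>ht\<close> serves to see this.\<close>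

lemma extremal_entry:
  assumes ht: "\<And>i r. i \<in> {1..n} \<Longrightarrow> r < N \<Longrightarrow> ht (sg i r) = ht r - p i r"
    and w: "\<And>i u. (i, u) \<in> set w \<Longrightarrow> i \<in> {1..n} \<and> u \<noteq> 0" and r0: "r0 < N"
    and asc: "ascending (map fst w) r0"
  shows "Yprod w \<in> carrier_mat N N \<and> Yprod w $$ (foldr sg (map fst w) r0, r0) = 1 \<and>
    (\<forall>r<N. Yprod w $$ (r, r0) \<noteq> 0 \<longrightarrow> dominates ht r (foldr sg (map fst w) r0))"
  using w asc
proof (induction w)
  case Nil
  then show ?case using r0 by (auto simp: Yprod_def dominates_refl)
next
  case (Cons a w)
  obtain i u where a: "a = (i, u)" by (cases a)
  have i: "i \<in> {1..n}" and u: "u \<noteq> 0" using Cons.prems(1)[of i u] a by auto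
  define R where "R = foldr sg (map fst w) r0"
  have R: "R < N" unfolding R_def using Cons.prems(1) by (intro foldr_sg_lt r0) fastforce
  have pR: "p i R \<ge> 0" using Cons.prems(2) a R_def by simp
  have IH: "Yprod w \<in> carrier_mat N N" "Yprod w $$ (R, r0) = 1"
    "\<And>r. r < N \<Longrightarrow> Yprod w $$ (r, r0) \<noteq> 0 \<Longrightarrow> dominates ht r R"
    using Cons.IH Cons.prems unfolding R_def a by auto
  have Y: "Yprod (a # w) = ybold i u * Yprod w" by (simp add: Yprod_def a)
  have R': "foldr sg (map fst (a # w)) r0 = sg i R" by (simp add: a R_def)
  have row: "Yprod (a # w) $$ (r, r0) = (if p i r = 1 then Yprod w $$ (r, r0) / u
      else if p i r = -1 then u * Yprod w $$ (r, r0) + Yprod w $$ (sg i r, r0) else Yprod w $$ (r, r0))" if "r < N" for r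
    unfolding Y by (rule ybold_row[OF IH(1) i that r0 u])
  have raise: "dominates ht r (sg i R)" if d: "dominates ht r R" for r
  proof (cases "p i R = 0")
    case True
    then show ?thesis using d sg_fix[OF i R] by simp
  next
    case False
    then have p1: "p i R = 1" using pR p_range[OF i R] by auto
    obtain m where m: "\<And>j. j \<in> {1..n} \<Longrightarrow> p j r = p j R + (\<Sum>i=1..n. cartan_D n j i * int (m i))"
      "ht r = ht R + (\<Sum>i=1..n. int (m i))" using d unfolding dominates_def by blast
    show ?thesis unfolding dominates_def
      by (intro exI[of _ "m(i := Suc (m i))"] conjI ballI)
        (simp_all only: sum_upd[OF i] sum_upd1[OF i] m p_sg[OF i _ R] p1 ht[OF i R], simp_all)
  qed
  have lift: "dominates ht r (sg i R)" if d: "dominates ht (sg i r) R" and r: "r < N" "p i r = -1" for r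
  proof -
    obtain m where m: "\<And>j. j \<in> {1..n} \<Longrightarrow> p j (sg i r) = p j R + (\<Sum>i=1..n. cartan_D n j i * int (m i))"
      "ht (sg i r) = ht R + (\<Sum>i=1..n. int (m i))" using d unfolding dominates_def by blast
    have m': "p j r = p j R + (\<Sum>i=1..n. cartan_D n j i * int (m i)) - cartan_D n j i" if "j \<in> {1..n}" for j
      using m(1)[OF that] p_sg[OF i that r(1)] r(2) by simp
    have h': "ht r = ht R + (\<Sum>i=1..n. int (m i)) - 1" using m(2) ht[OF i r(1)] r(2) by simp
    \<comment> \<open>If \<alpha>_i occurs in the difference, one copy can be given up and r still
      dominates R. Otherwise the other simple roots contribute at most 0 to the pairing with h_i, so
      \<open>p i r = -1\<close> forces \<open>p i R = 1\<close>, and the missing \<alpha>_i is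
      gained by passing from R to \<open>sg i R\<close>.\<close>
    show ?thesis
    proof (cases "m i = 0")
      case True
      have "(\<Sum>l=1..n. cartan_D n i l * int (m l)) \<le> 0"
      proof (rule sum_nonpos)
        fix l show "cartan_D n i l * int (m l) \<le> 0"
          using True cartan_D_simps(2)[of i l n] by (cases "l = i") auto
      qed
      then have "p i R = 1" using m'[OF i] cartan_D_simps(1)[of n i] r(2) p_range[OF i R] by auto
      then show ?thesis unfolding dominates_def
        by (intro exI[of _ m] conjI ballI) (simp_all add: m' h' p_sg[OF i _ R] ht[OF i R])
    next
      case False
      then have mi: "int (m i - 1) - int (m i) = - 1" by simp
      have "dominates ht r R" unfolding dominates_def
      proof (intro exI[of _ "m(i := m i - 1)"] conjI ballI)
        fix j assume "j \<in> {1..n}"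
        from m'[OF this] show "p j r = p j R + (\<Sum>l=1..n. cartan_D n j l * int ((m(i := m i - 1)) l))"
          unfolding sum_upd[OF i] mi by simp
      next
        show "ht r = ht R + (\<Sum>l=1..n. int ((m(i := m i - 1)) l))"
          unfolding sum_upd1[OF i] mi h' by simp
      qed
      then show ?thesis by (rule raise)
    qed
  qed
  have "Yprod (a # w) $$ (sg i R, r0) = 1"
  proof (cases "p i R = 0")
    case True
    then show ?thesis using row[OF R] IH(2) sg_fix[OF i R] by simp
  next
    case False
    then have p1: "p i R = 1" using pR p_range[OF i R] by auto
    have "\<not> dominates ht (sg i R) R"
    proof
      assume "dominates ht (sg i R) R"
      then obtain m :: "nat \<Rightarrow> nat" where "ht (sg i R) = ht R + (\<Sum>i=1..n. int (m i))" unfolding dominates_def by blast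
      then have "(\<Sum>i=1..n. int (m i)) = - 1" using ht[OF i R] p1 by simp
      moreover have "(\<Sum>i=1..n. int (m i)) \<ge> 0" by (intro sum_nonneg) auto
      ultimately show False by simp
    qed
    then have "Yprod w $$ (sg i R, r0) = 0" using IH(3)[OF sg_lt[OF i R]] by blast
    then show ?thesis using row[OF sg_lt[OF i R]] p_sg_same[OF i R] p1 sg_sg[OF i R] IH(2) by simp
  qed
  moreover have "dominates ht r (sg i R)" if "r < N" "Yprod (a # w) $$ (r, r0) \<noteq> 0" for r
  proof (cases "Yprod w $$ (r, r0) = 0")
    case True
    then have "p i r = -1" "Yprod w $$ (sg i r, r0) \<noteq> 0" using that row[OF that(1)] by (auto split: if_splits)
    then show ?thesis using lift[OF IH(3)[OF sg_lt[OF i that(1)]] that(1)] by blast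
  next
    case False
    then show ?thesis using raise[OF IH(3)[OF that(1)]] by blast
  qed
  moreover have "Yprod (a # w) \<in> carrier_mat N N" unfolding Y using IH(1) i by (simp add: sq_closed)
  ultimately show ?case unfolding R' by blast
qed

end

section \<open>The Weyl group of type D\<close>

text \<open>The index \<open>r < 2 * n\<close> stands for the weight \<open>\<epsilon>\<^sub>r\<^sub>+\<^sub>1\<close> if \<open>r < n\<close> and for
  \<open>- \<epsilon>\<^sub>2\<^sub>n\<^sub>-\<^sub>r\<close> otherwise, so that \<open>2 * n - 1 - r\<close> is the opposite of \<open>r\<close>. The simple root
  \<open>\<alpha>\<^sub>i\<close> is the difference of the weights \<open>vtop n i\<close> and \<open>vbot n i\<close>.\<close>

definition vtop :: "nat \<Rightarrow> nat \<Rightarrow> nat" where "vtop n i = (if i = n then n - 2 else i - 1)"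
definition vbot :: "nat \<Rightarrow> nat \<Rightarrow> nat" where "vbot n i = (if i = n then n else i)"

definition vperm :: "nat \<Rightarrow> nat \<Rightarrow> nat \<Rightarrow> nat" where
  "vperm n i r = (if r = vtop n i then vbot n i else if r = vbot n i then vtop n i
     else if r = 2 * n - 1 - vtop n i then 2 * n - 1 - vbot n i
     else if r = 2 * n - 1 - vbot n i then 2 * n - 1 - vtop n i else r)"

definition vpair :: "nat \<Rightarrow> nat \<Rightarrow> nat \<Rightarrow> int" where
  "vpair n i r = (if r = vtop n i \<or> r = 2 * n - 1 - vbot n i then 1
     else if r = vbot n i \<or> r = 2 * n - 1 - vtop n i then - 1 else 0)"

locale type_D =
  fixes n :: nat
  assumes n4: "n \<ge> 4"
begin

abbreviation "\<sigma> \<equiv> vperm n"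
abbreviation "tp \<equiv> vtop n"
abbreviation "bt \<equiv> vbot n"
abbreviation "opp r \<equiv> 2 * n - 1 - r"

lemma tb: "i \<in> {1..n} \<Longrightarrow> tp i < n" "i \<in> {1..n} \<Longrightarrow> tp i < bt i" "i \<in> {1..n} \<Longrightarrow> bt i \<le> n" "i \<in> {1..n} \<Longrightarrow> tp i + bt i \<noteq> 2 * n - 1"
  using n4 by (auto simp: vtop_def vbot_def)

lemma tb_neq:
  assumes "i \<in> {1..n}"
  shows "tp i \<noteq> bt i" "tp i \<noteq> opp (bt i)" "bt i \<noteq> opp (tp i)" "opp (bt i) \<noteq> opp (tp i)" "tp i \<noteq> opp (tp i)" "bt i \<noteq> opp (bt i)"
    "opp (opp (tp i)) = tp i" "opp (opp (bt i)) = bt i" "bt i < 2 * n" "tp i < 2 * n" "opp (bt i) < opp (tp i)"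
  using n4 tb[OF assms] by (auto, presburger?)

lemma \<sigma>_tb:
  assumes "i \<in> {1..n}"
  shows "\<sigma> i (tp i) = bt i" "\<sigma> i (bt i) = tp i" "\<sigma> i (opp (tp i)) = opp (bt i)" "\<sigma> i (opp (bt i)) = opp (tp i)"
  using tb_neq[OF assms] by (auto simp: vperm_def)

lemma \<sigma>_lt: "i \<in> {1..n} \<Longrightarrow> r < 2 * n \<Longrightarrow> \<sigma> i r < 2 * n"
  using tb[of i] by (auto simp: vperm_def)

lemma \<sigma>_\<sigma>: "i \<in> {1..n} \<Longrightarrow> \<sigma> i (\<sigma> i r) = r"
  using tb_neq[of i] by (auto simp: vperm_def)

lemma \<sigma>_opp:
  assumes "i \<in> {1..n}" "r < 2 * n"
  shows "\<sigma> i (opp r) = opp (\<sigma> i r)"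
proof -
  note n = tb_neq[OF assms(1)] and t = \<sigma>_tb[OF assms(1)]
  consider "r = tp i" | "r = bt i" | "r = opp (tp i)" | "r = opp (bt i)"
    | "r \<noteq> tp i" "r \<noteq> bt i" "r \<noteq> opp (tp i)" "r \<noteq> opp (bt i)" by blast
  then show ?thesis
  proof cases
    case 5
    have inv: "opp r \<noteq> c" if "r \<noteq> opp c" for c using that assms(2) by linarith
    have inv': "opp r \<noteq> opp c" if "r \<noteq> c" "c < 2 * n" for c using that assms(2) by linarith
    have "opp r \<noteq> tp i" "opp r \<noteq> bt i" by (rule inv[OF 5(3)], rule inv[OF 5(4)])
    moreover have "opp r \<noteq> opp (tp i)" "opp r \<noteq> opp (bt i)"
      by (rule inv'[OF 5(1) n(10)], rule inv'[OF 5(2) n(9)])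
    ultimately have "\<sigma> i (opp r) = opp r" "\<sigma> i r = r" using 5 by (simp_all add: vperm_def)
    then show ?thesis by simp
  qed (simp_all only: t n)
qed

text \<open>The difference of the weights u and v is a root, positive for u < v, and a simple
  reflection keeps every positive root but its own positive. Pairs with u + v = 2n - 1 are not roots
  and have to be excluded: \<open>\<sigma> n\<close> sends (n - 1, n) to (n + 1, n - 2).\<close>

lemma \<sigma>_order:
  assumes "i \<in> {1..n}" "u < 2 * n" "v < 2 * n" "u \<noteq> v" "u + v \<noteq> 2 * n - 1"
    "{u, v} \<noteq> {tp i, bt i}" "{u, v} \<noteq> {opp (tp i), opp (bt i)}"
  shows "\<sigma> i u < \<sigma> i v \<longleftrightarrow> u < v"
proof (cases "i = n")
  case True
  obtain m where m: "n = m + 2" using n4 by (metis add.commute le_add_diff_inverse2 numeral_Bit0 add_leD2 le_trans)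
  have v: "tp i = m" "bt i = m + 2" "opp (tp i) = m + 3" "opp (bt i) = m + 1" using True m by (auto simp: vtop_def vbot_def)
  have s: "\<sigma> i m = m + 2" "\<sigma> i (m + 1) = m + 3" "\<sigma> i (m + 2) = m" "\<sigma> i (m + 3) = m + 1"
    "w < m \<or> w > m + 3 \<Longrightarrow> \<sigma> i w = w" for w
    unfolding vperm_def v(3,4) unfolding v(1,2) by auto
  have c: "w = m \<or> w = m + 1 \<or> w = m + 2 \<or> w = m + 3 \<or> (w < m \<or> w > m + 3)" for w by auto
  show ?thesis
  proof (cases "(u < m \<or> u > m + 3) \<or> (v < m \<or> v > m + 3)")
    case True
    have b: "m \<le> \<sigma> i w \<and> \<sigma> i w \<le> m + 3" if "\<not> (w < m \<or> w > m + 3)" for w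
    proof -
      from that consider "w = m" | "w = m + 1" | "w = m + 2" | "w = m + 3" by linarith
      then show ?thesis using s(1-4) by cases simp_all
    qed
    show ?thesis
    proof (cases "u < m \<or> u > m + 3")
      case u: True
      show ?thesis
      proof (cases "v < m \<or> v > m + 3")
        case True
        then show ?thesis using s(5)[OF u] s(5)[OF True] by simp
      next
        case False
        then show ?thesis using s(5)[OF u] b[OF False] u by linarith
      qed
    next
      case u: False
      then have "v < m \<or> v > m + 3" using True by blast
      then show ?thesis using s(5)[of v] b[OF u] u by linarith
    qed
  next
    case False
    then have uv: "(u = m \<and> \<sigma> i u = m + 2) \<or> (u = m + 1 \<and> \<sigma> i u = m + 3) \<or> (u = m + 2 \<and> \<sigma> i u = m) \<or> (u = m + 3 \<and> \<sigma> i u = m + 1)"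
      "(v = m \<and> \<sigma> i v = m + 2) \<or> (v = m + 1 \<and> \<sigma> i v = m + 3) \<or> (v = m + 2 \<and> \<sigma> i v = m) \<or> (v = m + 3 \<and> \<sigma> i v = m + 1)"
      using c[of u] c[of v] s(1-4) by blast+
    have ne: "\<not> (u = m \<and> v = m + 2)" "\<not> (u = m + 2 \<and> v = m)" "\<not> (u = m + 1 \<and> v = m + 3)" "\<not> (u = m + 3 \<and> v = m + 1)"
      using assms(6,7) unfolding v(3,4) unfolding v(1,2) by blast+
    have nb: "u + v \<noteq> 2 * m + 3" using assms(5) m by simp
    from uv(1) uv(2) show ?thesis
      by (elim disjE conjE) (use ne nb assms(4) in simp_all)
  qed
next
  case False
  obtain j where j: "i = j + 1" "j + 1 < n" using False assms(1) by (cases i) auto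
  obtain B where B: "2 * n = B + j + 2" "j + 1 < B"
  proof
    show "2 * n = (2 * n - j - 2) + j + 2" "j + 1 < 2 * n - j - 2" using j by linarith+
  qed
  have v: "tp i = j" "bt i = j + 1" "opp (tp i) = B + 1" "opp (bt i) = B" using False j B by (auto simp: vtop_def vbot_def)
  have s: "\<sigma> i j = j + 1" "\<sigma> i (j + 1) = j" "\<sigma> i B = B + 1" "\<sigma> i (B + 1) = B"
    "w \<noteq> j \<Longrightarrow> w \<noteq> j + 1 \<Longrightarrow> w \<noteq> B \<Longrightarrow> w \<noteq> B + 1 \<Longrightarrow> \<sigma> i w = w" for w
    using B(2) unfolding vperm_def v(3,4) unfolding v(1,2) by auto
  have c: "(w = j \<and> \<sigma> i w = j + 1) \<or> (w = j + 1 \<and> \<sigma> i w = j) \<or> (w = B \<and> \<sigma> i w = B + 1) \<or> (w = B + 1 \<and> \<sigma> i w = B)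
     \<or> (w < j \<and> \<sigma> i w = w) \<or> (w > j + 1 \<and> w < B \<and> \<sigma> i w = w) \<or> (w > B + 1 \<and> \<sigma> i w = w)" for w
  proof -
    consider "w = j" | "w = j + 1" | "w = B" | "w = B + 1" | "w < j" | "j + 1 < w" "w < B" | "w > B + 1" by linarith
    then show ?thesis using s(1-4) s(5)[of w] B(2) by cases simp_all
  qed
  have ne: "\<not> (u = j \<and> v = j + 1)" "\<not> (u = j + 1 \<and> v = j)" "\<not> (u = B \<and> v = B + 1)" "\<not> (u = B + 1 \<and> v = B)"
    using assms(6,7) unfolding v(3,4) unfolding v(1,2) by blast+
  show ?thesis using c[of u] c[of v] by (elim disjE conjE) (use ne assms(4) B(2) in simp_all)
qed

lemma vpair_tb: 
  assumes "i \<in> {1..n}" "j \<in> {1..n}"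
  shows "vpair n i (tp j) - vpair n i (bt j) = cartan_D n j i"
proof -
  obtain m where m: "n = m + 2" using n4 by (metis add.commute le_add_diff_inverse2 numeral_Bit0 add_leD2 le_trans)
  show ?thesis
  proof (cases "i = n")
    case i: True
    have v: "opp (tp i) = m + 3" "opp (bt i) = m + 1" "tp i = m" "bt i = m + 2" using i m by (auto simp: vtop_def vbot_def)
    have V: "vpair n i r = (if r = m \<or> r = m + 1 then 1 else if r = m + 2 \<or> r = m + 3 then - 1 else 0)" for r
      unfolding vpair_def v(1,2) unfolding v(3,4) ..
    show ?thesis
    proof (cases "j = n")
      case True
      then have "tp j = m" "bt j = m + 2" using m by (auto simp: vtop_def vbot_def)
      moreover have "vpair n i m - vpair n i (m + 2) = 2" unfolding V by simp
      ultimately show ?thesis using i True by (simp add: cartan_D_def)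
    next
      case False
      then obtain k where k: "j = k + 1" "k \<le> m" using assms(2) m by (cases j) auto
      then have jk: "tp j = k" "bt j = k + 1" using False by (auto simp: vtop_def vbot_def)
      have "vpair n i k - vpair n i (k + 1) = (if k + 1 = m then - 1 else 0)" unfolding V using k(2) by auto
      moreover have "cartan_D n j i = (if k + 1 = m then - 1 else 0)"
        unfolding i k(1) m using k(2) by (auto simp: cartan_D_def doubleton_eq_iff)
      ultimately show ?thesis unfolding jk by simp
    qed
  next
    case False
    then obtain l where l: "i = l + 1" "l \<le> m" using assms(1) m by (cases i) auto
    define B where "B = 2 * m + 2 - l"
    have B: "B \<ge> m + 2" "B = m + 2 \<longleftrightarrow> l = m" using l(2) by (auto simp: B_def)
    have v: "opp (tp i) = B + 1" "opp (bt i) = B" "tp i = l" "bt i = l + 1" using l m False by (auto simp: vtop_def vbot_def B_def)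
    have V: "vpair n i r = (if r = l \<or> r = B then 1 else if r = l + 1 \<or> r = B + 1 then - 1 else 0)" for r
      unfolding vpair_def v(1,2) unfolding v(3,4) ..
    show ?thesis
    proof (cases "j = n")
      case True
      then have jk: "tp j = m" "bt j = m + 2" using m by (auto simp: vtop_def vbot_def)
      have "vpair n i m - vpair n i (m + 2) = (if l + 1 = m then - 1 else 0)" unfolding V using B l(2) by auto
      moreover have "cartan_D n j i = (if l + 1 = m then - 1 else 0)"
        unfolding True l(1) m using l(2) by (auto simp: cartan_D_def doubleton_eq_iff)
      ultimately show ?thesis unfolding jk by simp
    next
      case False
      then obtain k where k: "j = k + 1" "k \<le> m" using assms(2) m by (cases j) auto
      then have jk: "tp j = k" "bt j = k + 1" using False by (auto simp: vtop_def vbot_def)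
      have kB: "k \<noteq> B" "k + 1 \<noteq> B" "k \<noteq> B + 1" "k + 1 \<noteq> B + 1" using k B by auto
      have V': "vpair n i k - vpair n i (k + 1) = (if k = l then 2 else if k = l + 1 \<or> k + 1 = l then - 1 else 0)"
        unfolding V using kB by auto
      have "cartan_D n j i = (if k = l then 2 else if k = l + 1 \<or> k + 1 = l then - 1 else 0)"
        unfolding k(1) l(1) m using k(2) l(2) by (auto simp: cartan_D_def doubleton_eq_iff)
      then show ?thesis unfolding jk V' by simp
    qed
  qed
qed

lemma vpair_vals:
  assumes "i \<in> {1..n}"
  shows "vpair n i (tp i) = 1" "vpair n i (bt i) = - 1" "vpair n i (opp (tp i)) = - 1" "vpair n i (opp (bt i)) = 1"
  using tb_neq[OF assms] by (simp_all add: vpair_def)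

lemma vpair_opp:
  assumes "i \<in> {1..n}" "r < 2 * n"
  shows "vpair n i (opp r) = - vpair n i r"
proof -
  note n = tb_neq[OF assms(1)] and p = vpair_vals[OF assms(1)]
  consider "r = tp i" | "r = bt i" | "r = opp (tp i)" | "r = opp (bt i)"
    | "r \<noteq> tp i" "r \<noteq> bt i" "r \<noteq> opp (tp i)" "r \<noteq> opp (bt i)" by blast
  then show ?thesis
  proof cases
    case 5
    have inv: "opp r \<noteq> c" if "r \<noteq> opp c" for c using that assms(2) by linarith
    have inv': "opp r \<noteq> opp c" if "r \<noteq> c" "c < 2 * n" for c using that assms(2) by linarith
    have "opp r \<noteq> tp i" "opp r \<noteq> bt i" by (rule inv[OF 5(3)], rule inv[OF 5(4)])
    moreover have "opp r \<noteq> opp (tp i)" "opp r \<noteq> opp (bt i)"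
      by (rule inv'[OF 5(1) n(10)], rule inv'[OF 5(2) n(9)])
    ultimately show ?thesis using 5 by (simp add: vpair_def)
  qed (simp_all only: p n(7,8) minus_minus)
qed

end

section \<open>The Weyl group as signed permutations of coordinates\<close>

context type_D
begin

text \<open>For r < n, \<open>Z r\<close> is twice the coefficient of \<epsilon>_{r+1} in the weight
  l, extended antisymmetrically to all indices. Doubling avoids the half-integers of the spin
  weights.\<close>

definition coords :: "weight \<Rightarrow> (nat \<Rightarrow> int) \<Rightarrow> bool" where
  "coords l Z \<longleftrightarrow> (\<forall>r<2 * n. Z (opp r) = - Z r) \<and> (\<forall>i\<in>{1..n}. Z (tp i) - Z (bt i) = 2 * l i)"

lemma coordsD:
  assumes "coords l Z"
  shows "r < 2 * n \<Longrightarrow> Z (opp r) = - Z r" "i \<in> {1..n} \<Longrightarrow> Z (tp i) - Z (bt i) = 2 * l i"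
  using assms unfolding coords_def by blast+

lemma coords_\<sigma>:
  assumes c: "coords l Z" and i: "i \<in> {1..n}" and r: "r < 2 * n"
  shows "Z (\<sigma> i r) = Z r - 2 * l i * vpair n i r"
proof -
  have "Z (opp (tp i)) = - Z (tp i)" "Z (opp (bt i)) = - Z (bt i)" "Z (tp i) - Z (bt i) = 2 * l i"
    by (rule coordsD(1)[OF c tb_neq(10)[OF i]], rule coordsD(1)[OF c tb_neq(9)[OF i]], rule coordsD(2)[OF c i])
  note z = this and n = tb_neq[OF i] and t = \<sigma>_tb[OF i] and p = vpair_vals[OF i]
  consider "r = tp i" | "r = bt i" | "r = opp (tp i)" | "r = opp (bt i)"
    | "r \<noteq> tp i" "r \<noteq> bt i" "r \<noteq> opp (tp i)" "r \<noteq> opp (bt i)" by blast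
  then show ?thesis
  proof cases
    case 5
    then show ?thesis by (simp add: vperm_def vpair_def)
  next
    case 1 show ?thesis unfolding 1 t p using z(3) by linarith
  next
    case 2 show ?thesis unfolding 2 t p using z(3) by linarith
  next
    case 3 show ?thesis unfolding 3 t p z(1,2) using z(3) by linarith
  next
    case 4 show ?thesis unfolding 4 t p z(1,2) using z(3) by linarith
  qed
qed

lemma coords_refl:
  assumes c: "coords l Z" and i: "i \<in> {1..n}"
  shows "coords (refl_D n i l) (Z \<circ> \<sigma> i)"
  unfolding coords_def
proof (intro conjI allI impI ballI)
  fix r assume r: "r < 2 * n"
  show "(Z \<circ> \<sigma> i) (opp r) = - (Z \<circ> \<sigma> i) r"
    unfolding comp_def \<sigma>_opp[OF i r] by (rule coordsD(1)[OF c \<sigma>_lt[OF i r]])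
next
  fix j assume j: "j \<in> {1..n}"
  have "(Z \<circ> \<sigma> i) (tp j) - (Z \<circ> \<sigma> i) (bt j) = (Z (tp j) - Z (bt j)) - 2 * l i * (vpair n i (tp j) - vpair n i (bt j))"
    unfolding comp_def coords_\<sigma>[OF c i tb_neq(10)[OF j]] coords_\<sigma>[OF c i tb_neq(9)[OF j]] by (simp add: algebra_simps)
  also have "\<dots> = 2 * refl_D n i l j"
    unfolding vpair_tb[OF i j] coordsD(2)[OF c j] using j by (simp add: refl_D_def algebra_simps)
  finally show "(Z \<circ> \<sigma> i) (tp j) - (Z \<circ> \<sigma> i) (bt j) = 2 * refl_D n i l j" .
qed

text \<open>Coordinates are functions of the index, so the leftmost letter acts last on the weight
  but first on the index. Hence \<open>fold\<close> here, and \<open>foldr\<close> for the action on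
  the indices themselves.\<close>

lemma coords_word:
  assumes "coords l Z" "set ks \<subseteq> {1..n}"
  shows "coords (weyl_word n ks l) (Z \<circ> fold \<sigma> ks)"
  using assms(2)
proof (induction ks)
  case Nil
  then show ?case using assms(1) by (simp add: weyl_word_def)
next
  case (Cons i ks)
  then have i: "set ks \<subseteq> {1..n}" "i \<in> {1..n}" by auto
  note coords_refl[OF Cons.IH[OF i(1)] i(2)]
  then show ?case by (simp add: weyl_word_def comp_def)
qed

text \<open>The consecutive differences are fixed by l. The additive constant that is left is
  removed at the branch: the coordinates n - 2 and n differ by a fixed amount, and coordinate n is
  the negative of coordinate n - 1.\<close>

lemma coords_unique:
  assumes "coords l Z" "coords l Z'" "r < 2 * n"
  shows "Z r = Z' r"
proof -
  define D where "D r = Z r - Z' r" for r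
  have o: "D (opp r) = - D r" if "r < 2 * n" for r
    unfolding D_def coordsD(1)[OF assms(1) that] coordsD(1)[OF assms(2) that] by simp
  have e: "D (tp i) = D (bt i)" if "i \<in> {1..n}" for i
  proof -
    have "Z (tp i) - Z (bt i) = Z' (tp i) - Z' (bt i)" 
      unfolding coordsD(2)[OF assms(1) that] coordsD(2)[OF assms(2) that] ..
    then show ?thesis by (simp add: D_def)
  qed
  have s: "D r = D (Suc r)" if "Suc r < n" for r
    using e[of "Suc r"] that by (simp add: vtop_def vbot_def)
  have "D (n - 2) = D n" using e[of n] n4 by (simp add: vtop_def vbot_def)
  moreover have "D (n - 2) = D (n - 1)" using s[of "n - 2"] n4 by (simp add: Suc_diff_Suc numeral_2_eq_2)
  moreover have "D n = - D (n - 1)" using o[of "n - 1"] n4 by (simp add: mult_2)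
  ultimately have 0: "D (n - 1) = 0" by simp
  have "D (n - 1 - k) = 0" if "k < n" for k
    using that
  proof (induction k)
    case (Suc k)
    then show ?case using s[of "n - 1 - Suc k"] by (simp add: Suc_diff_Suc)
  qed (use 0 in simp)
  have lo: "D r = 0" if "r < n" for r
  proof -
    have "n - 1 - (n - 1 - r) = r" "n - 1 - r < n" using that by linarith+
    with \<open>\<And>k. k < n \<Longrightarrow> D (n - 1 - k) = 0\<close>[of "n - 1 - r"] show ?thesis by simp
  qed
  show ?thesis
  proof (cases "r < n")
    case True
    then show ?thesis using lo by (simp add: D_def)
  next
    case False
    then have "opp r < n" using assms(3) by simp
    then show ?thesis using lo[of "opp r"] o[OF assms(3)] by (simp add: D_def)
  qed
qed

lemma coords_exists: "\<exists>Z. coords l Z"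
proof -
  \<comment> \<open>Read off from the fundamental weights: for i \<le> n - 2, \<Lambda>_i has
    coefficient 1 in the first i places and 0 after them; \<Lambda>_{n-1} and \<Lambda>_n have 1/2
    throughout, except for -1/2 in the last place of \<Lambda>_{n-1}.\<close>
  define X where "X r = (if r = n - 1 then l n - l (n - 1) else 2 * (\<Sum>i=r+1..n-2. l i) + l (n - 1) + l n)" for r
  define Z where "Z r = (if r < n then X r else - X (opp r))" for r
  have "coords l Z"
    unfolding coords_def
  proof (intro conjI allI impI ballI)
    fix r assume "r < 2 * n"
    then show "Z (opp r) = - Z r" by (auto simp: Z_def)
  next
    fix i assume i: "i \<in> {1..n}"
    obtain m where m: "n = m + 2" using n4 by (metis add.commute le_add_diff_inverse2 numeral_Bit0 add_leD2 le_trans)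
    have X1: "X m = l (n - 1) + l n" "X (m + 1) = l n - l (n - 1)" by (simp_all add: X_def m)
    have X2: "X k = 2 * l (k + 1) + X (k + 1)" if "k < m" for k
    proof -
      have "{k+1..m} = insert (k + 1) {k+2..m}" using that by auto
      then show ?thesis using that by (simp add: X_def m)
    qed
    have Z1: "Z k = X k" if "k < n" for k using that by (simp add: Z_def)
    have Z2: "Z n = - X (m + 1)" by (simp add: Z_def m)
    consider "i = n" | "i = m + 1" | k where "i = k + 1" "k < m" using i m by (cases i) (auto, linarith)
    then show "Z (tp i) - Z (bt i) = 2 * l i"
    proof cases
      case 1
      then have "tp i = m" "bt i = n" using m by (auto simp: vtop_def vbot_def)
      then show ?thesis using 1 Z1[of m] Z2 X1 m by simp
    next
      case 2
      then have "tp i = m" "bt i = m + 1" using m by (auto simp: vtop_def vbot_def)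
      then show ?thesis using 2 Z1[of m] Z1[of "m + 1"] X1 m by simp
    next
      case 3
      then have "tp i = k" "bt i = k + 1" using m by (auto simp: vtop_def vbot_def)
      then show ?thesis using 3 Z1[of k] Z1[of "k + 1"] X2[of k] m by simp
    qed
  qed
  then show ?thesis by blast
qed

lemma fold_foldr:
  assumes "set ks \<subseteq> {1..n}"
  shows "fold \<sigma> ks (foldr \<sigma> ks r) = r" "foldr \<sigma> ks (fold \<sigma> ks r) = r"
  using assms by (induction ks arbitrary: r) (auto simp: \<sigma>_\<sigma>)

lemma foldr_lt: "set ks \<subseteq> {1..n} \<Longrightarrow> r < 2 * n \<Longrightarrow> foldr \<sigma> ks r < 2 * n"
  by (induction ks) (simp_all add: \<sigma>_lt)

lemma fold_lt: "set ks \<subseteq> {1..n} \<Longrightarrow> r < 2 * n \<Longrightarrow> fold \<sigma> ks r < 2 * n"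
  by (induction ks arbitrary: r) (simp_all add: \<sigma>_lt)

lemma foldr_opp: "set ks \<subseteq> {1..n} \<Longrightarrow> r < 2 * n \<Longrightarrow> foldr \<sigma> ks (opp r) = opp (foldr \<sigma> ks r)"
proof (induction ks)
  case (Cons i ks)
  then have i: "set ks \<subseteq> {1..n}" "i \<in> {1..n}" by auto
  show ?case
    unfolding foldr_Cons comp_apply Cons.IH[OF i(1) Cons.prems(2)] by (rule \<sigma>_opp[OF i(2) foldr_lt[OF i(1) Cons.prems(2)]])
qed simp

lemma fold_opp: "set ks \<subseteq> {1..n} \<Longrightarrow> r < 2 * n \<Longrightarrow> fold \<sigma> ks (opp r) = opp (fold \<sigma> ks r)"
proof (induction ks arbitrary: r)
  case (Cons i ks)
  then have i: "set ks \<subseteq> {1..n}" "i \<in> {1..n}" by auto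
  show ?case
    unfolding fold_Cons comp_apply \<sigma>_opp[OF i(2) Cons.prems(2)] by (rule Cons.IH[OF i(1) \<sigma>_lt[OF i(2) Cons.prems(2)]])
qed simp

lemma weyl_word_off: "j \<notin> {1..n} \<Longrightarrow> weyl_word n ks l j = l j"
  by (induction ks) (auto simp: weyl_word_def refl_D_def)

lemma weyl_word_eq_fold:
  assumes "set ks \<subseteq> {1..n}" "set ks' \<subseteq> {1..n}"
  shows "weyl_word n ks = weyl_word n ks' \<longleftrightarrow> (\<forall>r<2 * n. fold \<sigma> ks r = fold \<sigma> ks' r)"
proof
  assume eq: "weyl_word n ks = weyl_word n ks'"
  \<comment> \<open>A weight whose 2n coordinates are all distinct determines the permutation. For
    \<rho> the two middle coordinates would both be 0; this is why \<open>l n\<close> is 2.\<close>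
  define Z where "Z r = 2 * int n - 1 - 2 * int r" for r
  define l where "l i = (if i = n then 2 else 1 :: int)" for i
  have "coords l Z"
    unfolding coords_def using n4 by (auto simp: Z_def l_def vtop_def vbot_def)
  note c = this
  have "coords (weyl_word n ks l) (Z \<circ> fold \<sigma> ks)" by (rule coords_word[OF c assms(1)])
  moreover have "coords (weyl_word n ks l) (Z \<circ> fold \<sigma> ks')" unfolding eq by (rule coords_word[OF c assms(2)])
  ultimately have "\<And>r. r < 2 * n \<Longrightarrow> (Z \<circ> fold \<sigma> ks) r = (Z \<circ> fold \<sigma> ks') r" by (rule coords_unique)
  then show "\<forall>r<2 * n. fold \<sigma> ks r = fold \<sigma> ks' r" by (auto simp: Z_def)
next
  assume eq: "\<forall>r<2 * n. fold \<sigma> ks r = fold \<sigma> ks' r"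
  show "weyl_word n ks = weyl_word n ks'"
  proof (intro ext)
    fix l j
    obtain Z where Z: "coords l Z" using coords_exists by blast
    show "weyl_word n ks l j = weyl_word n ks' l j"
    proof (cases "j \<in> {1..n}")
      case True
      have "Z (fold \<sigma> ks (tp j)) - Z (fold \<sigma> ks (bt j)) = 2 * weyl_word n ks l j"
        "Z (fold \<sigma> ks' (tp j)) - Z (fold \<sigma> ks' (bt j)) = 2 * weyl_word n ks' l j"
        using coordsD(2)[OF coords_word[OF Z assms(1)] True] coordsD(2)[OF coords_word[OF Z assms(2)] True] by simp_all
      then show ?thesis using eq tb_neq(9,10)[OF True] by simp
    qed (simp add: weyl_word_off)
  qed
qed

lemma weyl_word_eq:
  assumes "set ks \<subseteq> {1..n}" "set ks' \<subseteq> {1..n}"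
  shows "weyl_word n ks = weyl_word n ks' \<longleftrightarrow> (\<forall>r<2 * n. foldr \<sigma> ks r = foldr \<sigma> ks' r)"
  unfolding weyl_word_eq_fold[OF assms]
  by (metis assms fold_foldr fold_lt foldr_lt)

section \<open>Inversions and the length function\<close>

definition pairs :: "(nat \<times> nat) set" where
  "pairs = {(a, b). a < b \<and> b < 2 * n \<and> a + b \<noteq> 2 * n - 1}"

text \<open>(a, b) and (opp b, opp a) stand for one and the same root, the difference of the weights
  a and b. Every positive root is therefore counted twice, and the cardinality is twice the length.
  Pairs with a + b = 2n - 1 would give twice a weight, which is not a root of D_n.\<close>

definition inversions :: "nat list \<Rightarrow> (nat \<times> nat) set" where
  "inversions ks = {(a, b) \<in> pairs. foldr \<sigma> ks b < foldr \<sigma> ks a}"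

lemma finite_pairs: "finite pairs"
  by (rule finite_subset[of _ "{..<2 * n} \<times> {..<2 * n}"]) (auto simp: pairs_def)

lemma inversions_subset: "inversions ks \<subseteq> pairs" and finite_inversions: "finite (inversions ks)"
  by (auto simp: inversions_def intro: finite_subset[OF _ finite_pairs])

text \<open>With w the element spelled by \<open>ks\<close>, these are the two pairs of the positive
  one of the roots w^{-1} \<alpha>_i and - w^{-1} \<alpha>_i; \<open>fold\<close> computes w^{-1} on
  indices.\<close>

definition flips :: "nat \<Rightarrow> nat list \<Rightarrow> (nat \<times> nat) set" where
  "flips i ks = (let a = fold \<sigma> ks (tp i); b = fold \<sigma> ks (bt i) in
     if a < b then {(a, b), (opp b, opp a)} else {(b, a), (opp a, opp b)})"

lemma foldr_inj:
  assumes "set ks \<subseteq> {1..n}"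
  shows "foldr \<sigma> ks a = foldr \<sigma> ks b \<longleftrightarrow> a = b"
  using fold_foldr(1)[OF assms] by metis

lemma foldr_eq_iff:
  assumes "set ks \<subseteq> {1..n}"
  shows "foldr \<sigma> ks a = c \<longleftrightarrow> a = fold \<sigma> ks c"
  using fold_foldr[OF assms] by metis

lemma ab_facts:
  assumes ks: "set ks \<subseteq> {1..n}" and i: "i \<in> {1..n}"
  defines "a \<equiv> fold \<sigma> ks (tp i)" and "b \<equiv> fold \<sigma> ks (bt i)"
  shows "a < 2 * n" "b < 2 * n" "a \<noteq> b" "a + b \<noteq> 2 * n - 1" "foldr \<sigma> ks a = tp i" "foldr \<sigma> ks b = bt i"
    "foldr \<sigma> ks (opp a) = opp (tp i)" "foldr \<sigma> ks (opp b) = opp (bt i)"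
proof -
  show ab: "a < 2 * n" "b < 2 * n" unfolding a_def b_def by (intro fold_lt[OF ks] tb_neq(9,10)[OF i])+
  show f: "foldr \<sigma> ks a = tp i" "foldr \<sigma> ks b = bt i" unfolding a_def b_def by (rule fold_foldr(2)[OF ks])+
  show o: "foldr \<sigma> ks (opp a) = opp (tp i)" "foldr \<sigma> ks (opp b) = opp (bt i)"
    unfolding foldr_opp[OF ks ab(1)] foldr_opp[OF ks ab(2)] f by (rule refl)+
  show "a \<noteq> b" using f tb_neq(1)[OF i] by metis
  show "a + b \<noteq> 2 * n - 1"
  proof
    assume "a + b = 2 * n - 1"
    then have "b = opp a" by linarith
    then show False using f(2) o(1) tb_neq(3)[OF i] by metis
  qed
qed

lemma opp_pair: "(a, b) \<in> pairs \<Longrightarrow> (opp b, opp a) \<in> pairs \<and> (opp b, opp a) \<noteq> (a, b)"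
proof -
  assume "(a, b) \<in> pairs"
  then have p: "a < b" "b < 2 * n" "a + b \<noteq> 2 * n - 1" by (auto simp: pairs_def)
  then have "opp b < opp a" "opp a < 2 * n" "opp b + opp a \<noteq> 2 * n - 1" "opp b \<noteq> a" by linarith+
  then show ?thesis by (simp add: pairs_def)
qed

lemma flips_pairs:
  assumes ks: "set ks \<subseteq> {1..n}" and i: "i \<in> {1..n}"
  shows "flips i ks \<subseteq> pairs" "card (flips i ks) = 2"
proof -
  define a b where "a = fold \<sigma> ks (tp i)" and "b = fold \<sigma> ks (bt i)"
  note f = ab_facts[OF ks i, folded a_def b_def]
  have F: "flips i ks = (if a < b then {(a, b), (opp b, opp a)} else {(b, a), (opp a, opp b)})"
    by (simp add: flips_def a_def b_def Let_def)
  have p: "a < b \<Longrightarrow> (a, b) \<in> pairs" "\<not> a < b \<Longrightarrow> (b, a) \<in> pairs"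
    using f(1-4) unfolding pairs_def mem_Collect_eq prod.case by linarith+
  have c: "card {x, y} = 2" if "y \<noteq> x" for x y :: "nat \<times> nat" using that by simp
  have "flips i ks \<subseteq> pairs \<and> card (flips i ks) = 2"
  proof (cases "a < b")
    case True
    then have "flips i ks = {(a, b), (opp b, opp a)}" using F by (simp only: if_True)
    then show ?thesis using p(1)[OF True] opp_pair[OF p(1)[OF True]] c by (metis empty_subsetI insert_subset)
  next
    case False
    then have "flips i ks = {(b, a), (opp a, opp b)}" using F by (simp only: if_False)
    then show ?thesis using p(2)[OF False] opp_pair[OF p(2)[OF False]] c by (metis empty_subsetI insert_subset)
  qed
  then show "flips i ks \<subseteq> pairs" "card (flips i ks) = 2" by blast+
qed

text \<open>By \<open>\<sigma>_order\<close>, the reflection s_i reverses no pair other than those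
  of its own root. Left multiplication by s_i therefore toggles exactly the inversion belonging to
  w^{-1} \<alpha>_i.\<close>

lemma inversions_Cons:
  assumes ks: "set ks \<subseteq> {1..n}" and i: "i \<in> {1..n}" and ab: "(a, b) \<in> pairs"
  shows "(a, b) \<in> inversions (i # ks) \<longleftrightarrow> ((a, b) \<in> inversions ks) \<noteq> ((a, b) \<in> flips i ks)"
proof -
  define a0 b0 where "a0 = fold \<sigma> ks (tp i)" and "b0 = fold \<sigma> ks (bt i)"
  note f = ab_facts[OF ks i, folded a0_def b0_def]
  have F: "flips i ks = (if a0 < b0 then {(a0, b0), (opp b0, opp a0)} else {(b0, a0), (opp a0, opp b0)})"
    by (simp add: flips_def a0_def b0_def Let_def)
  have p: "a < b" "b < 2 * n" "a + b \<noteq> 2 * n - 1" using ab by (auto simp: pairs_def)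
  let ?u = "foldr \<sigma> ks a" and ?v = "foldr \<sigma> ks b"
  have uv: "?u < 2 * n" "?v < 2 * n" "?u \<noteq> ?v" using p foldr_lt[OF ks] foldr_inj[OF ks] by auto
  have uo: "?u + ?v \<noteq> 2 * n - 1"
  proof
    assume "?u + ?v = 2 * n - 1"
    then have "?v = opp ?u" by simp
    then have "?v = foldr \<sigma> ks (opp a)" using foldr_opp[OF ks, of a] p by simp
    then have "b = opp a" using foldr_inj[OF ks] by simp
    then show False using p by simp
  qed
  have ueq: "?u = c \<longleftrightarrow> a = fold \<sigma> ks c" "?v = c \<longleftrightarrow> b = fold \<sigma> ks c" for c using foldr_eq_iff[OF ks] by auto
  define oa ob T B OT OB where "oa = opp a0" and "ob = opp b0" and "T = tp i" and "B = bt i" and "OT = opp (tp i)" and "OB = opp (bt i)"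
  have oeq: "fold \<sigma> ks OT = oa" "fold \<sigma> ks OB = ob" "fold \<sigma> ks T = a0" "fold \<sigma> ks B = b0"
    unfolding a0_def b0_def oa_def ob_def T_def B_def OT_def OB_def
    by (rule fold_opp[OF ks tb_neq(10)[OF i]], rule fold_opp[OF ks tb_neq(9)[OF i]], rule refl, rule refl)
  have oab: "ob < oa \<longleftrightarrow> a0 < b0" "oa < ob \<longleftrightarrow> b0 < a0" unfolding oa_def ob_def using f(1,2) by linarith+
  have F: "flips i ks = (if a0 < b0 then {(a0, b0), (ob, oa)} else {(b0, a0), (oa, ob)})"
    unfolding F oa_def ob_def ..
  have st: "\<sigma> i T = B" "\<sigma> i B = T" "\<sigma> i OT = OB" "\<sigma> i OB = OT" "T < B" "OB < OT"
    unfolding T_def B_def OT_def OB_def by (rule \<sigma>_tb[OF i] tb(2)[OF i] tb_neq(11)[OF i])+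
  have I: "(a, b) \<in> inversions (i # ks) \<longleftrightarrow> \<sigma> i ?v < \<sigma> i ?u" "(a, b) \<in> inversions ks \<longleftrightarrow> ?v < ?u"
    using ab by (auto simp: inversions_def)
  have fl: "(a, b) \<in> flips i ks \<longleftrightarrow> {?u, ?v} = {T, B} \<or> {?u, ?v} = {OT, OB}"
    unfolding doubleton_eq_iff ueq oeq F using p(1) f(3) oab by auto
  note ord = \<sigma>_order[OF i uv(2,1) uv(3)[symmetric], folded T_def B_def OT_def OB_def]
  show ?thesis
  proof (cases "(a, b) \<in> flips i ks")
    case False
    then have "\<sigma> i ?v < \<sigma> i ?u \<longleftrightarrow> ?v < ?u"
      unfolding fl using uo by (intro ord) (auto simp: insert_commute add.commute)
    then show ?thesis using False unfolding I by simp
  next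
    case True
    then have "(?u = T \<and> ?v = B) \<or> (?u = B \<and> ?v = T) \<or> (?u = OT \<and> ?v = OB) \<or> (?u = OB \<and> ?v = OT)"
      unfolding fl doubleton_eq_iff by blast
    then have "\<sigma> i ?v < \<sigma> i ?u \<longleftrightarrow> \<not> ?v < ?u"
      using st by auto
    then show ?thesis using True unfolding I by simp
  qed
qed

lemma flips_inversions:
  assumes ks: "set ks \<subseteq> {1..n}" and i: "i \<in> {1..n}"
  shows "fold \<sigma> ks (tp i) < fold \<sigma> ks (bt i) \<Longrightarrow> flips i ks \<inter> inversions ks = {}"
    "\<not> fold \<sigma> ks (tp i) < fold \<sigma> ks (bt i) \<Longrightarrow> flips i ks \<subseteq> inversions ks"
proof -
  define a b where "a = fold \<sigma> ks (tp i)" and "b = fold \<sigma> ks (bt i)"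
  define oa ob T B OT OB where "oa = opp a" and "ob = opp b" and "T = tp i" and "B = bt i" and "OT = opp (tp i)" and "OB = opp (bt i)"
  have f: "foldr \<sigma> ks a = T" "foldr \<sigma> ks b = B" "foldr \<sigma> ks oa = OT" "foldr \<sigma> ks ob = OB"
    unfolding oa_def ob_def T_def B_def OT_def OB_def using ab_facts[OF ks i, folded a_def b_def] by blast+
  have st: "T < B" "OB < OT" unfolding T_def B_def OT_def OB_def by (rule tb(2)[OF i] tb_neq(11)[OF i])+
  have F: "flips i ks = (if a < b then {(a, b), (ob, oa)} else {(b, a), (oa, ob)})"
    by (simp add: flips_def a_def b_def Let_def oa_def ob_def)
  show "fold \<sigma> ks (tp i) < fold \<sigma> ks (bt i) \<Longrightarrow> flips i ks \<inter> inversions ks = {}"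
    unfolding F a_def[symmetric] b_def[symmetric] by (auto simp: inversions_def f) (use st in simp_all)
  show "\<not> fold \<sigma> ks (tp i) < fold \<sigma> ks (bt i) \<Longrightarrow> flips i ks \<subseteq> inversions ks"
    using flips_pairs(1)[OF assms] unfolding F a_def[symmetric] b_def[symmetric] by (auto simp: inversions_def f st)
qed

lemma card_inversions_Cons:
  assumes ks: "set ks \<subseteq> {1..n}" and i: "i \<in> {1..n}"
  shows "fold \<sigma> ks (tp i) < fold \<sigma> ks (bt i) \<Longrightarrow> card (inversions (i # ks)) = card (inversions ks) + 2"
    "\<not> fold \<sigma> ks (tp i) < fold \<sigma> ks (bt i) \<Longrightarrow> card (inversions ks) = card (inversions (i # ks)) + 2"
proof -
  have fin: "finite (flips i ks)" using flips_pairs[OF assms] finite_subset finite_pairs by blast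
  have eq: "x \<in> inversions (i # ks) \<longleftrightarrow> x \<in> pairs \<and> (x \<in> inversions ks) \<noteq> (x \<in> flips i ks)" for x
    using inversions_Cons[OF assms] inversions_subset[of "i # ks"] by (cases x) auto
  {
    assume a: "fold \<sigma> ks (tp i) < fold \<sigma> ks (bt i)"
    have "inversions (i # ks) = inversions ks \<union> flips i ks"
      using eq flips_inversions(1)[OF assms a] flips_pairs(1)[OF assms] inversions_subset[of ks] by auto
    then show "card (inversions (i # ks)) = card (inversions ks) + 2"
      using flips_inversions(1)[OF assms a] flips_pairs(2)[OF assms] fin finite_inversions[of ks]
      by (simp add: card_Un_disjoint Int_commute)
  }
  {
    assume a: "\<not> fold \<sigma> ks (tp i) < fold \<sigma> ks (bt i)"
    have "inversions (i # ks) = inversions ks - flips i ks"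
      using eq flips_inversions(2)[OF assms a] flips_pairs(1)[OF assms] inversions_subset[of ks] by auto
    moreover have "card (inversions ks - flips i ks) = card (inversions ks) - 2"
      using flips_inversions(2)[OF assms a] flips_pairs(2)[OF assms] fin by (simp add: card_Diff_subset)
    moreover have "2 \<le> card (inversions ks)"
      using card_mono[OF finite_inversions flips_inversions(2)[OF assms a]] flips_pairs(2)[OF assms] by simp
    ultimately show "card (inversions ks) = card (inversions (i # ks)) + 2" by simp
  }
qed

text \<open>At every letter i the root w^{-1} \<alpha>_i is positive, w being the element of the
  suffix behind that letter. Each letter thus raises the length by one, which is reducedness as a
  recursive condition.\<close>

primrec increasing :: "nat list \<Rightarrow> bool" where
  "increasing [] \<longleftrightarrow> True"
| "increasing (i # ks) \<longleftrightarrow> fold \<sigma> ks (tp i) < fold \<sigma> ks (bt i) \<and> increasing ks"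

lemma inversions_Nil: "inversions [] = {}"
  by (auto simp: inversions_def pairs_def)

lemma card_inversions_le: "set ks \<subseteq> {1..n} \<Longrightarrow> card (inversions ks) \<le> 2 * length ks"
proof (induction ks)
  case (Cons i ks)
  then have ks: "set ks \<subseteq> {1..n}" "i \<in> {1..n}" by auto
  have "card (inversions (i # ks)) = card (inversions ks) + 2 \<or> card (inversions ks) = card (inversions (i # ks)) + 2"
    using card_inversions_Cons[OF ks] by blast
  with Cons.IH[OF ks(1)] show ?case by (elim disjE) simp_all
qed (simp add: inversions_Nil)

text \<open>Each letter changes the length by one, up or down, so length and number of letters have
  the same parity. The modulus is 4 because roots are counted twice.\<close>

lemma card_inversions_mod: "set ks \<subseteq> {1..n} \<Longrightarrow> (card (inversions ks) + 2 * length ks) mod 4 = 0"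
proof (induction ks)
  case (Cons i ks)
  then have ks: "set ks \<subseteq> {1..n}" "i \<in> {1..n}" by auto
  have IH: "(card (inversions ks) + 2 * length ks) mod 4 = 0" by (rule Cons.IH[OF ks(1)])
  have "card (inversions (i # ks)) = card (inversions ks) + 2 \<or> card (inversions ks) = card (inversions (i # ks)) + 2"
    using card_inversions_Cons[OF ks] by blast
  then show ?case using IH unfolding length_Cons by presburger
qed (simp add: inversions_Nil)

lemma increasing_iff: "set ks \<subseteq> {1..n} \<Longrightarrow> card (inversions ks) = 2 * length ks \<Longrightarrow> increasing ks"
proof (induction ks)
  case (Cons i ks)
  have ks: "set ks \<subseteq> {1..n}" "i \<in> {1..n}" using Cons.prems by auto
  note le = card_inversions_le[OF ks(1)]
  have "fold \<sigma> ks (tp i) < fold \<sigma> ks (bt i)"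
  proof (rule ccontr)
    assume "\<not> ?thesis"
    from card_inversions_Cons(2)[OF ks this] show False using le Cons.prems by simp
  qed
  moreover from card_inversions_Cons(1)[OF ks this] have "increasing ks" using Cons by simp
  ultimately show ?case by simp
qed simp

text \<open>This separates D_n from B_n: the number of sign changes is even. The letters below n
  permute the first n indices; the letter n replaces the values at the last two of them by
  opposites, exchanging them.\<close>

lemma parity:
  assumes "set ks \<subseteq> {1..n}"
  shows "even (\<Sum>a<n. of_bool (fold \<sigma> ks a \<ge> n) :: nat)"
  using assms
proof (induction ks)
  case (Cons i ks)
  have ks: "set ks \<subseteq> {1..n}" "i \<in> {1..n}" using Cons.prems by auto
  let ?g = "\<lambda>a. of_bool (fold \<sigma> ks a \<ge> n) :: nat"
  have IH: "even (\<Sum>a<n. ?g a)" using Cons by simp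
  show ?case
  proof (cases "i = n")
    case False
    have "bij_betw (\<sigma> i) {..<n} {..<n}"
    proof (rule bij_betwI[where g = "\<sigma> i"])
      show "\<sigma> i \<in> {..<n} \<rightarrow> {..<n}"
        using False ks(2) by (auto simp: vperm_def vtop_def vbot_def)
      then show "\<sigma> i \<in> {..<n} \<rightarrow> {..<n}" .
    qed (use \<sigma>_\<sigma>[OF ks(2)] in auto)
    from sum.reindex_bij_betw[OF this, of ?g] show ?thesis using IH by simp
  next
    case True
    obtain k where k: "n = k + 2" using n4 by (metis add.commute le_add_diff_inverse2 numeral_Bit0 add_leD2 le_trans)
    have v: "vtop n n = k" "vbot n n = k + 2" "opp k = k + 3" "opp (k + 2) = k + 1" using k by (auto simp: vtop_def vbot_def)
    have s1: "\<sigma> n k = k + 2" "\<sigma> n (Suc k) = k + 3" and s2: "\<And>a. a < k \<Longrightarrow> \<sigma> n a = a"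
      unfolding vperm_def v(1,2) unfolding v(3,4) by auto
    have q1: "fold \<sigma> ks (k + 2) = opp (fold \<sigma> ks (k + 1))" "fold \<sigma> ks (k + 3) = opp (fold \<sigma> ks k)"
      using fold_opp[OF ks(1), of "k + 1"] fold_opp[OF ks(1), of k] k by (auto simp: numeral_3_eq_3)
    have l: "fold \<sigma> ks (k + 1) < 2 * n" "fold \<sigma> ks k < 2 * n" using fold_lt[OF ks(1)] k by auto
    have g: "?g (k + 2) + ?g (k + 1) = 1" "?g (k + 3) + ?g k = 1" using q1 l by (auto simp: of_bool_def)
    have "(\<Sum>a<n. of_bool (fold \<sigma> (i # ks) a \<ge> n) :: nat) = (\<Sum>a<k. ?g a) + ?g (k + 2) + ?g (k + 3)"
      unfolding k True[unfolded k] using s1 s2 by (simp add: k)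
    moreover have "(\<Sum>a<n. ?g a) = (\<Sum>a<k. ?g a) + ?g k + ?g (k + 1)" by (subst k) simp
    moreover have "even (P + x2 + x3)" if "x2 + x1 = 1" "x3 + x0 = 1" "even (P + x0 + x1)" for P x0 x1 x2 x3 :: nat
      using that by presburger
    ultimately show ?thesis using IH g by metis
  qed
qed simp

text \<open>If all simple roots stay positive, the indices 0, ..., n - 2 have no room to move. Then
  n - 1 goes to n - 1 or to n, and the latter would be a single sign change, which
  \<open>parity\<close> excludes.\<close>

lemma no_descent:
  assumes ks: "set ks \<subseteq> {1..n}" and asc: "\<And>i. i \<in> {1..n} \<Longrightarrow> fold \<sigma> ks (tp i) < fold \<sigma> ks (bt i)" and r: "r < 2 * n"
  shows "fold \<sigma> ks r = r"
proof -
  let ?q = "fold \<sigma> ks"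
  have s: "?q a < ?q (Suc a)" if "Suc a < n" for a
    using asc[of "Suc a"] that by (auto simp: vtop_def vbot_def)
  have ge: "a \<le> ?q a" if "a < n" for a
    using that by (induction a) (use s in \<open>auto intro: Suc_leI le_less_trans\<close>)
  have inc: "?q a + m \<le> ?q (a + m)" if "a + m < n" for a m
    using that by (induction m) (use s in \<open>auto intro: Suc_leI le_less_trans\<close>)
  have t: "?q (n - 2) < ?q (n - 1)" using s[of "n - 2"] n4 by (simp add: Suc_diff_Suc numeral_2_eq_2)
  have "?q (n - 2) < ?q n" using asc[of n] n4 by (auto simp: vtop_def vbot_def)
  moreover have "?q n = opp (?q (n - 1))" using fold_opp[OF ks, of "n - 1"] n4 by (simp add: mult_2)
  \<comment> \<open>The value at n - 2 is smaller than the value at n - 1 and smaller than its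
    opposite; these two add up to 2n - 1.\<close>
  ultimately have "?q (n - 2) \<le> n - 2" using t n4 by linarith
  then have lo: "?q a = a" if "a < n - 1" for a
  proof -
    have e: "a + (n - 2 - a) = n - 2" "n - 2 < n" "a < n" using that n4 by linarith+
    then have "?q a + (n - 2 - a) \<le> ?q (n - 2)" using inc[of a "n - 2 - a"] by simp
    with ge[OF e(3)] \<open>?q (n - 2) \<le> n - 2\<close> e(1) show ?thesis by linarith
  qed
  have inj: "?q a = ?q b \<Longrightarrow> a = b" for a b using fold_foldr(2)[OF ks] by metis
  have l: "?q (n - 1) < 2 * n" using fold_lt[OF ks] n4 by simp
  have "?q (n - 1) \<ge> n - 1"
  proof (rule ccontr)
    assume "\<not> ?thesis"
    then have "?q (n - 1) < n - 1" by simp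
    with inj[OF lo[OF this]] show False by simp
  qed
  moreover have "?q (n - 1) \<le> n"
  proof (rule ccontr)
    assume "\<not> ?thesis"
    then have o: "opp (?q (n - 1)) < n - 1" using n4 l by linarith
    have "n - 1 < 2 * n" using n4 by simp
    from fold_opp[OF ks this] have "?q (opp (?q (n - 1))) = ?q (opp (n - 1))"
      using lo[OF o] by metis
    then have "opp (?q (n - 1)) = opp (n - 1)" by (rule inj)
    then show False using o n4 by linarith
  qed
  moreover have "?q (n - 1) \<noteq> n"
  proof
    assume e: "?q (n - 1) = n"
    have "{..<n} = insert (n - 1) {..<n - 1}" using n4 by auto
    then have "(\<Sum>a<n. of_bool (?q a \<ge> n) :: nat) = of_bool (?q (n - 1) \<ge> n) + (\<Sum>a<n - 1. of_bool (?q a \<ge> n))" by simp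
    also have "(\<Sum>a<n - 1. of_bool (?q a \<ge> n) :: nat) = 0"
      by (rule sum.neutral) (use lo in auto)
    finally have "(\<Sum>a<n. of_bool (?q a \<ge> n) :: nat) = 1" using e by simp
    then have "odd (\<Sum>a<n. of_bool (?q a \<ge> n) :: nat)" by simp
    then show False using parity[OF ks] by blast
  qed
  ultimately have "?q (n - 1) = n - 1" by simp
  then have lo': "?q a = a" if "a < n" for a using lo that by (cases "a = n - 1") auto
  show ?thesis
  proof (cases "r < n")
    case False
    then have "opp r < n" using r by simp
    moreover have "opp r < 2 * n" "opp (opp r) = r" using r by linarith+
    ultimately show ?thesis using lo'[of "opp r"] fold_opp[OF ks, of "opp r"] by metis
  qed (rule lo')
qed

text \<open>While some simple root is sent to a negative one, multiplication by its reflection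
  removes two inversions. The process can only stop at the identity, and the letters used spell the
  element.\<close>

lemma reduce_word:
  assumes "set ks \<subseteq> {1..n}"
  shows "\<exists>ks'. set ks' \<subseteq> {1..n} \<and> weyl_word n ks' = weyl_word n ks \<and> 2 * length ks' = card (inversions ks)"
  using assms
proof (induction "card (inversions ks)" arbitrary: ks rule: less_induct)
  case less
  show ?case
  proof (cases "\<exists>i\<in>{1..n}. \<not> fold \<sigma> ks (tp i) < fold \<sigma> ks (bt i)")
    case True
    then obtain i where i: "i \<in> {1..n}" "\<not> fold \<sigma> ks (tp i) < fold \<sigma> ks (bt i)" by blast
    note c = card_inversions_Cons(2)[OF less.prems i]
    obtain ks' where ks': "set ks' \<subseteq> {1..n}" "weyl_word n ks' = weyl_word n (i # ks)" "2 * length ks' = card (inversions (i # ks))"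
      using less.hyps[of "i # ks"] c i less.prems by auto
    have "weyl_word n (i # ks') = weyl_word n (i # i # ks)" using ks'(2) by (simp add: weyl_word_def)
    also have "\<dots> = weyl_word n ks"
      by (subst weyl_word_eq) (use less.prems i in \<open>auto simp: \<sigma>_\<sigma>\<close>)
    finally show ?thesis using ks' c i by (intro exI[of _ "i # ks'"]) auto
  next
    case False
    then have id: "fold \<sigma> ks r = r" if "r < 2 * n" for r using no_descent[OF less.prems] that by blast
    then have "weyl_word n [] = weyl_word n ks" by (subst weyl_word_eq_fold) (use less.prems in auto)
    moreover have "foldr \<sigma> ks r = r" if "r < 2 * n" for r using id[OF that] fold_foldr(2)[OF less.prems] by metis
    then have "inversions ks = {}" by (auto simp: inversions_def pairs_def)
    ultimately show ?thesis by (intro exI[of _ "[]"]) simp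
  qed
qed

lemma inversions_cong:
  assumes "set ks \<subseteq> {1..n}" "set ks' \<subseteq> {1..n}" "weyl_word n ks = weyl_word n ks'"
  shows "inversions ks = inversions ks'"
  using assms(3) unfolding weyl_word_eq[OF assms(1,2)] by (auto simp: inversions_def pairs_def)

lemma weyl_length_word:
  assumes "set ks \<subseteq> {1..n}"
  shows "2 * weyl_length n (weyl_word n ks) = card (inversions ks)"
proof -
  obtain ks' where ks': "set ks' \<subseteq> {1..n}" "weyl_word n ks' = weyl_word n ks" "2 * length ks' = card (inversions ks)"
    using reduce_word[OF assms] by blast
  have "weyl_length n (weyl_word n ks) = length ks'"
    unfolding weyl_length_def
  proof (rule Least_equality)
    fix l assume "\<exists>ks''. set ks'' \<subseteq> {1..n} \<and> weyl_word n ks'' = weyl_word n ks \<and> length ks'' = l"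
    then obtain ks'' where k: "set ks'' \<subseteq> {1..n}" "weyl_word n ks'' = weyl_word n ks" "length ks'' = l" by blast
    then show "length ks' \<le> l" using card_inversions_le[OF k(1)] inversions_cong[OF k(1) assms k(2)] ks'(3) by simp
  qed (use ks' in blast)
  then show ?thesis using ks' by simp
qed

lemma inversions_empty:
  assumes ks: "set ks \<subseteq> {1..n}" and e: "inversions ks = {}" and r: "r < 2 * n"
  shows "foldr \<sigma> ks r = r"
proof -
  have "fold \<sigma> ks r = r"
  proof (rule no_descent[OF ks _ r], rule ccontr)
    fix i assume i: "i \<in> {1..n}" "\<not> fold \<sigma> ks (tp i) < fold \<sigma> ks (bt i)"
    from card_inversions_Cons(2)[OF ks this] show False using e by simp
  qed
  then show ?thesis using fold_foldr(2)[OF ks] by metis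
qed

end

section \<open>The Coxeter word and the longest element\<close>

context type_D
begin

text \<open>The Coxeter element s_1 ... s_n on indices. It is a cycle of length 2n - 2 together with
  the exchange of the two middle indices n - 1 and n. Its power n - 1, half the Coxeter number, is
  w_0.\<close>

definition cox :: "nat \<Rightarrow> nat" where "cox = foldr \<sigma> [1..<Suc n]"

definition i0 :: "nat list" where "i0 = concat (replicate (n - 1) [1..<Suc n])"

lemma set_range: "set [1..<Suc n] \<subseteq> {1..n}" "m \<le> n \<Longrightarrow> set [1..<m] \<subseteq> {1..n}"
  by auto

lemma set_i0: "set i0 \<subseteq> {1..n}"
  by (auto simp: i0_def)

lemma \<sigma>_low:
  assumes "1 \<le> m" "m < n" "r < n"
  shows "\<sigma> m r = (if r = m - 1 then m else if r = m then m - 1 else r)"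
proof -
  have v: "vtop n m = m - 1" "vbot n m = m" using assms by (auto simp: vtop_def vbot_def)
  have "r \<noteq> 2 * n - 1 - (m - 1)" "r \<noteq> 2 * n - 1 - m" using assms by linarith+
  then show ?thesis by (simp only: vperm_def v if_False)
qed

lemma foldr_cycle:
  assumes "1 \<le> m" "m \<le> n" "r < n"
  shows "foldr \<sigma> [1..<m] r = (if r + 1 < m then r + 1 else if r + 1 = m then 0 else r)"
  using assms
proof (induction m arbitrary: r)
  case (Suc m)
  show ?case
  proof (cases "m = 0")
    case False
    then have m: "1 \<le> m" "m < n" "m \<le> n" using Suc.prems by auto
    have u: "[1..<Suc m] = [1..<m] @ [m]" using m by simp
    have "foldr \<sigma> [1..<Suc m] r = foldr \<sigma> [1..<m] (\<sigma> m r)" unfolding u by simp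
    also have "\<sigma> m r = (if r = m - 1 then m else if r = m then m - 1 else r)"
      by (rule \<sigma>_low[OF m(1,2) Suc.prems(3)])
    finally have *: "foldr \<sigma> [1..<Suc m] r = foldr \<sigma> [1..<m] (if r = m - 1 then m else if r = m then m - 1 else r)" .
    have IH: "r' < n \<Longrightarrow> foldr \<sigma> [1..<m] r' = (if r' + 1 < m then r' + 1 else if r' + 1 = m then 0 else r')" for r'
      by (rule Suc.IH[OF m(1,3)])
    consider "r = m - 1" | "r = m" | "r \<noteq> m - 1" "r \<noteq> m" by blast
    then show ?thesis
    proof cases
      case 1
      then show ?thesis unfolding * using IH[OF m(2)] m by simp
    next
      case 2
      then show ?thesis unfolding * using IH[of "m - 1"] m by simp
    next
      case 3
      then show ?thesis unfolding * using IH[OF Suc.prems(3)] by auto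
    qed
  qed (use Suc.prems in simp)
qed simp

lemma cox_split: "cox r = foldr \<sigma> [1..<n] (\<sigma> n r)"
proof -
  have "[1..<Suc n] = [1..<n] @ [n]" using n4 by simp
  then show ?thesis unfolding cox_def by simp
qed

lemma cox_low: "r + 2 < n \<Longrightarrow> cox r = r + 1" and cox_n2: "cox (n - 2) = opp 0" and cox_n1: "cox (n - 1) = n"
proof -
  obtain k where k: "n = k + 2" using n4 by (metis add.commute le_add_diff_inverse2 numeral_Bit0 add_leD2 le_trans)
  have v: "vtop n n = k" "vbot n n = k + 2" "opp k = k + 3" "opp (k + 2) = k + 1" using k by (auto simp: vtop_def vbot_def)
  have s1: "\<sigma> n k = k + 2" "\<sigma> n (k + 1) = k + 3" and s2: "\<And>a. a < k \<Longrightarrow> \<sigma> n a = a"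
    unfolding vperm_def v(1,2) unfolding v(3,4) by auto
  have l: "set [1..<n] \<subseteq> {1..n}" by auto
  show "cox r = r + 1" if "r + 2 < n"
    unfolding cox_split using that s2[of r] foldr_cycle[of n r] k by simp
  have o: "k + 2 = opp (k + 1)" "k + 3 = opp k" "k + 1 < 2 * n" "k < 2 * n" using k by simp_all
  have "cox k = opp (foldr \<sigma> [1..<n] (k + 1))" unfolding cox_split s1(1) using foldr_opp[OF l o(3)] o(1) by metis
  also have "foldr \<sigma> [1..<n] (k + 1) = 0" using foldr_cycle[of n "k + 1"] k by simp
  finally show "cox (n - 2) = opp 0" using k by simp
  have "cox (k + 1) = opp (foldr \<sigma> [1..<n] k)" unfolding cox_split s1(2) using foldr_opp[OF l o(4)] o(2) by metis
  also have "foldr \<sigma> [1..<n] k = k + 1" using foldr_cycle[of n k] k by simp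
  finally show "cox (n - 1) = n" using k by simp
qed

lemma cox_opp: "r < 2 * n \<Longrightarrow> cox (opp r) = opp (cox r)"
  unfolding cox_def by (rule foldr_opp[OF set_range(1)])

lemma foldr_concat: "foldr \<sigma> (concat (replicate k [1..<Suc n])) r = (cox ^^ k) r"
  by (induction k) (simp_all add: cox_def del: upt_Suc)

lemma cox_pow_low: "r + k + 1 < n \<Longrightarrow> (cox ^^ k) r = r + k"
  by (induction k) (auto simp: cox_low)

lemma cox_pow_opp: "k + 1 < n \<Longrightarrow> (cox ^^ k) (opp 0) = opp k"
proof (induction k)
  case (Suc k)
  then have "(cox ^^ Suc k) (opp 0) = cox (opp k)" by simp
  also have "\<dots> = opp (cox k)" by (rule cox_opp) (use Suc.prems in simp)
  also have "cox k = Suc k" using cox_low[of k] Suc.prems by simp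
  finally show ?case .
qed simp

definition w0 :: "nat \<Rightarrow> nat" where "w0 = foldr \<sigma> i0"

text \<open>Of the n - 1 Coxeter steps, n - 2 - r lead from r to n - 2, one leads to the opposite of
  0, and r more lead to the opposite of r.\<close>

lemma w0_low: "r + 1 < n \<Longrightarrow> w0 r = opp r"
proof -
  assume r: "r + 1 < n"
  then have e: "n - 1 = r + Suc (n - 2 - r)" by linarith
  have "w0 r = (cox ^^ (n - 1)) r" unfolding w0_def i0_def by (rule foldr_concat)
  also have "\<dots> = (cox ^^ r) (cox ((cox ^^ (n - 2 - r)) r))" unfolding e by (simp only: funpow_add comp_apply funpow.simps(2))
  also have "(cox ^^ (n - 2 - r)) r = n - 2" using cox_pow_low[of r "n - 2 - r"] r by simp
  also have "cox (n - 2) = opp 0" by (rule cox_n2)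
  also have "(cox ^^ r) (opp 0) = opp r" by (rule cox_pow_opp[OF r])
  finally show ?thesis .
qed

text \<open>Each Coxeter step exchanges n - 1 and n, so the outcome depends on the parity of n.
  Membership is enough, because the pair (n - 1, n) does not belong to \<open>pairs\<close>.\<close>

lemma w0_mid: "r = n - 1 \<or> r = n \<Longrightarrow> w0 r = n - 1 \<or> w0 r = n"
proof -
  assume r: "r = n - 1 \<or> r = n"
  have o: "opp (n - 1) = n" "opp n = n - 1" "n - 1 < 2 * n" using n4 by simp_all
  have "cox n = n - 1" using cox_opp[OF o(3)] unfolding o(1) cox_n1 o(2) .
  then have "(cox ^^ k) r = n - 1 \<or> (cox ^^ k) r = n" for k
    using r cox_n1 by (induction k) auto
  then show ?thesis unfolding w0_def i0_def foldr_concat .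
qed

lemma w0_opp: "r < 2 * n \<Longrightarrow> w0 (opp r) = opp (w0 r)"
  unfolding w0_def by (rule foldr_opp[OF set_i0])

lemma w0_high: "r > n \<Longrightarrow> r < 2 * n \<Longrightarrow> w0 r = opp r"
proof -
  assume r: "r > n" "r < 2 * n"
  then have "opp r + 1 < n" "opp r < 2 * n" "opp (opp r) = r" by linarith+
  then show ?thesis using w0_opp[of "opp r"] w0_low[of "opp r"] by metis
qed

lemma inversions_i0: "inversions i0 = pairs"
proof -
  have "w0 b < w0 a" if ab: "a < b" "b < 2 * n" "a + b \<noteq> 2 * n - 1" for a b
  proof -
    have c: "(r + 1 < n \<and> w0 r = opp r) \<or> ((r = n - 1 \<or> r = n) \<and> (w0 r = n - 1 \<or> w0 r = n)) \<or> (r > n \<and> w0 r = opp r)" if "r < 2 * n" for r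
      using w0_low[of r] w0_mid[of r] w0_high[of r] that by linarith
    have "a < 2 * n" using ab by simp
    from c[OF this] c[OF ab(2)] ab n4 show ?thesis by (elim disjE conjE) linarith+
  qed
  then show ?thesis by (auto simp: inversions_def pairs_def w0_def)
qed

lemma card_pairs: "card pairs = 2 * (n * (n - 1))"
proof -
  have bij: "bij_betw prod.swap (SIGMA b:{..<2 * n}. {..<b} - {opp b}) pairs"
    by (rule bij_betwI[where g = prod.swap]) (auto simp: pairs_def)
  have "card pairs = card (SIGMA b:{..<2 * n}. {..<b} - {opp b})"
    using bij_betw_same_card[OF bij] by simp
  also have "\<dots> = (\<Sum>b<2 * n. card ({..<b} - {opp b}))" by (rule card_SigmaI) auto
  \<comment> \<open>The excluded partner \<open>opp b\<close> lies below b exactly when b \<ge>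
    n.\<close>
  also have "\<dots> = (\<Sum>b<2 * n. if b < n then b else b - 1)"
  proof (rule sum.cong[OF refl])
    fix b assume "b \<in> {..<2 * n}"
    then have "opp b < b \<longleftrightarrow> \<not> b < n" by simp linarith
    then show "card ({..<b} - {opp b}) = (if b < n then b else b - 1)"
      by (simp add: card_Diff_singleton_if)
  qed
  also have "\<dots> = (\<Sum>b<n. if b < n then b else b - 1) + (\<Sum>b=n..<n+n. if b < n then b else b - 1)"
    using sum.atLeastLessThan_concat[of 0 n "n + n" "\<lambda>b. if b < n then b else b - 1"] by (simp add: atLeast0LessThan mult_2)
  also have "(\<Sum>b=n..<n+n. if b < n then b else b - 1) = (\<Sum>b<n. b + (n - 1))"
    using sum.shift_bounds_nat_ivl[of "\<lambda>b. if b < n then b else b - 1" 0 n n] n4 by (simp add: atLeast0LessThan)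
  also have "(\<Sum>b<n. if b < n then b else b - 1) = (\<Sum>b<n. b)" by simp
  also have "(\<Sum>b<n. b) + (\<Sum>b<n. b + (n - 1)) = 2 * (\<Sum>b<n. b) + n * (n - 1)"
    by (simp only: sum.distrib sum_constant card_lessThan mult_2 add.assoc of_nat_id)
  also have "2 * (\<Sum>b<n. b) = n * (n - 1)"
  proof -
    have "2 * (\<Sum>b<Suc m. b) = Suc m * m" for m :: nat by (induction m) auto
    from this[of "n - 1"] show ?thesis using n4 by simp
  qed
  finally show ?thesis by simp
qed

lemma increasing_i0: "increasing i0"
proof (rule increasing_iff[OF set_i0])
  have "length (concat (replicate k [1..<Suc n])) = k * n" for k
    by (induction k) (auto simp del: upt_Suc)
  then have "length i0 = (n - 1) * n" unfolding i0_def .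
  then show "card (inversions i0) = 2 * length i0"
    unfolding inversions_i0 card_pairs by (simp add: mult.commute)
qed

text \<open>Both \<open>ks\<close> and w_0 reverse every admissible pair, so their composite
  reverses none and is the identity.\<close>

lemma full_inversions:
  assumes ks: "set ks \<subseteq> {1..n}" and full: "inversions ks = pairs" and r: "r < 2 * n"
  shows "foldr \<sigma> ks (w0 r) = r"
proof -
  have s: "set (ks @ i0) \<subseteq> {1..n}" using ks set_i0 by simp
  have "inversions (ks @ i0) = {}"
  proof -
    have "\<not> foldr \<sigma> ks (w0 b) < foldr \<sigma> ks (w0 a)" if ab: "(a, b) \<in> pairs" for a b
    proof -
      have p: "a < b" "b < 2 * n" "a + b \<noteq> 2 * n - 1" using ab by (auto simp: pairs_def)
      have i: "w0 b < w0 a" using ab inversions_i0 by (auto simp: inversions_def w0_def)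
      have l: "w0 a < 2 * n" unfolding w0_def using foldr_lt[OF set_i0] p by simp
      have "w0 b + w0 a \<noteq> 2 * n - 1"
      proof
        assume "w0 b + w0 a = 2 * n - 1"
        then have "w0 b = opp (w0 a)" using i l by linarith
        also have "\<dots> = w0 (opp a)" using w0_opp[of a] p by simp
        finally have "b = opp a" unfolding w0_def foldr_inj[OF set_i0] .
        then show False using p by linarith
      qed
      then have "(w0 b, w0 a) \<in> inversions ks" unfolding full using i l by (auto simp: pairs_def)
      then show ?thesis by (auto simp: inversions_def)
    qed
    then show ?thesis by (auto simp: inversions_def w0_def)
  qed
  from inversions_empty[OF s this r] show ?thesis by (simp add: w0_def)
qed

lemma full_inversions_word:
  assumes ks: "set ks \<subseteq> {1..n}" and full: "inversions ks = pairs"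
  shows "weyl_word n ks = weyl_word n i0"
proof -
  have "foldr \<sigma> ks r = foldr \<sigma> i0 r" if r: "r < 2 * n" for r
  proof -
    have "w0 r < 2 * n" unfolding w0_def by (rule foldr_lt[OF set_i0 r])
    from full_inversions[OF assms this] full_inversions[OF set_i0 inversions_i0 r]
    show ?thesis by (simp add: w0_def)
  qed
  then show ?thesis unfolding weyl_word_eq[OF ks set_i0] by blast
qed

lemma longest: "longest_D n = weyl_word n i0"
  unfolding longest_D_def
proof (rule the_equality)
  show "weyl_word n i0 \<in> weyl_group n \<and> (\<forall>u\<in>weyl_group n. weyl_length n u \<le> weyl_length n (weyl_word n i0))"
  proof (intro conjI ballI)
    show "weyl_word n i0 \<in> weyl_group n" unfolding weyl_group_def using set_i0 by blast
    fix u assume "u \<in> weyl_group n"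
    then obtain ks where ks: "u = weyl_word n ks" "set ks \<subseteq> {1..n}" unfolding weyl_group_def by blast
    have "card (inversions ks) \<le> card pairs" by (rule card_mono[OF finite_pairs inversions_subset])
    then show "weyl_length n u \<le> weyl_length n (weyl_word n i0)"
      using weyl_length_word[OF ks(2)] weyl_length_word[OF set_i0] ks(1) inversions_i0 by simp
  qed
next
  fix w assume w: "w \<in> weyl_group n \<and> (\<forall>u\<in>weyl_group n. weyl_length n u \<le> weyl_length n w)"
  then obtain ks where ks: "w = weyl_word n ks" "set ks \<subseteq> {1..n}" unfolding weyl_group_def by blast
  have "weyl_word n i0 \<in> weyl_group n" unfolding weyl_group_def using set_i0 by blast
  then have "weyl_length n (weyl_word n i0) \<le> weyl_length n w" using w by blast
  then have "card pairs \<le> card (inversions ks)"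
    using weyl_length_word[OF ks(2)] weyl_length_word[OF set_i0] ks(1) inversions_i0 by simp
  then have "inversions ks = pairs" by (rule card_seteq[OF finite_pairs inversions_subset])
  then show "w = weyl_word n i0" unfolding ks(1) by (rule full_inversions_word[OF ks(2)])
qed

text \<open>The word chosen by \<open>w_bar\<close> is unknown; these three facts are all that the
  evaluation of the minors uses about it.\<close>

lemma reduced_longest:
  assumes "reduced_expr n (longest_D n) ks"
  shows "set ks \<subseteq> {1..n}" "increasing ks" "r < 2 * n \<Longrightarrow> foldr \<sigma> ks r = w0 r"
proof -
  show ks: "set ks \<subseteq> {1..n}" using assms by (simp add: reduced_expr_def)
  have w: "weyl_word n ks = weyl_word n i0" "length ks = weyl_length n (weyl_word n ks)"
    using assms by (auto simp: reduced_expr_def longest)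
  show "increasing ks" using weyl_length_word[OF ks] w(2) by (intro increasing_iff[OF ks]) simp
  show "r < 2 * n \<Longrightarrow> foldr \<sigma> ks r = w0 r"
    using w(1) unfolding weyl_word_eq[OF ks set_i0] w0_def by blast
qed

lemma weyl_word_append: "weyl_word n (ks @ ks') = weyl_word n ks \<circ> weyl_word n ks'"
  by (induction ks) (simp_all add: weyl_word_def comp_assoc)

lemma weyl_word_single: "weyl_word n [k] = refl_D n k"
  by (simp add: weyl_word_def)

lemma refl_refl:
  assumes "k \<in> {1..n}"
  shows "refl_D n k \<circ> refl_D n k = id"
proof -
  have "weyl_word n ([k] @ [k]) = weyl_word n []"
    by (subst weyl_word_eq) (use assms in \<open>simp_all add: \<sigma>_\<sigma>\<close>)
  then show ?thesis unfolding weyl_word_append weyl_word_single by (simp add: weyl_word_def)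
qed

text \<open>Appending k to a reduced word of w_0 s_k yields a reduced word of w_0, so that the sign
  rule for w_0 also governs w_0 s_k.\<close>

lemma reduced_longest_refl:
  assumes k: "k \<in> {1..n}" and "reduced_expr n (longest_D n \<circ> refl_D n k) ks"
  shows "set ks \<subseteq> {1..n}" "increasing (ks @ [k])" "r < 2 * n \<Longrightarrow> foldr \<sigma> (ks @ [k]) r = w0 r"
proof -
  show ks: "set ks \<subseteq> {1..n}" using assms by (simp add: reduced_expr_def)
  have s: "set (i0 @ [k]) \<subseteq> {1..n}" "set (ks @ [k]) \<subseteq> {1..n}" using ks k set_i0 by auto
  have w: "weyl_word n ks = weyl_word n (i0 @ [k])" "length ks = weyl_length n (weyl_word n ks)"
    using assms(2) by (auto simp: reduced_expr_def longest weyl_word_append weyl_word_single)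
  have "weyl_word n (ks @ [k]) = weyl_word n i0 \<circ> (refl_D n k \<circ> refl_D n k)"
    unfolding weyl_word_append w(1) weyl_word_single by (rule comp_assoc)
  then have w0': "weyl_word n (ks @ [k]) = weyl_word n i0" unfolding refl_refl[OF k] by simp
  have full: "inversions (ks @ [k]) = pairs" using inversions_cong[OF s(2) set_i0 w0'] inversions_i0 by simp
  have c1: "2 * length ks = card (inversions (i0 @ [k]))"
    using weyl_length_word[OF ks] w inversions_cong[OF ks s(1) w(1)] by simp
  have c2: "card (inversions (i0 @ [k])) \<le> card pairs" by (rule card_mono[OF finite_pairs inversions_subset])
  have c3: "(card (inversions (i0 @ [k])) + 2 * (length i0 + 1)) mod 4 = 0" "(card pairs + 2 * length i0) mod 4 = 0"
    using card_inversions_mod[OF s(1)] card_inversions_mod[OF set_i0] inversions_i0 by simp_all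
  have c4: "card pairs \<le> 2 * length (ks @ [k])" using card_inversions_le[OF s(2)] full by simp
  \<comment> \<open>The length of w_0 s_k is at most that of w_0, differs from it in parity, and is
    smaller by at most one.\<close>
  have "card pairs = 2 * length (ks @ [k])" using c1 c2 c3 c4 by simp presburger
  then show "increasing (ks @ [k])" using full by (intro increasing_iff[OF s(2)]) simp
  show "r < 2 * n \<Longrightarrow> foldr \<sigma> (ks @ [k]) r = w0 r"
    using w0' unfolding weyl_word_eq[OF s(2) set_i0] w0_def by blast
qed

lemma reduced_refl:
  assumes k: "k \<in> {1..n}" and r: "reduced_expr n (refl_D n k) ks"
  shows "ks = [k]"
proof -
  have ks: "set ks \<subseteq> {1..n}" "weyl_word n ks = refl_D n k" "length ks = weyl_length n (refl_D n k)"
    using r by (auto simp: reduced_expr_def)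
  have "card (inversions [k]) = card (inversions []) + 2"
    by (rule card_inversions_Cons(1)) (use k tb(2)[OF k] in auto)
  moreover have "2 * weyl_length n (refl_D n k) = card (inversions [k])"
    using weyl_length_word[of "[k]"] k unfolding weyl_word_single by simp
  ultimately have "length ks = 1" using ks(3) by (simp add: inversions_Nil)
  then obtain j where j: "ks = [j]" by (cases ks) auto
  have "refl_D n j = refl_D n k" using ks(2) unfolding j weyl_word_single .
  \<comment> \<open>Both reflections are applied to \<Lambda>_j: its j-th coordinate becomes -1
    under s_j and remains 1 under every other s_k.\<close>
  then have e: "refl_D n j (\<lambda>i. if i = j then 1 else 0) j = refl_D n k (\<lambda>i. if i = j then 1 else 0) j" by simp
  have "j \<in> {1..n}" using ks(1) j by simp
  then have "j = k" using e by (auto simp: refl_D_def cartan_D_simps(1) split: if_splits)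
  then show ?thesis using j by simp
qed

lemma reduced_id:
  assumes "reduced_expr n id ks"
  shows "ks = []"
proof -
  have "weyl_word n [] = id" by (simp add: weyl_word_def)
  then show ?thesis using assms weyl_length_word[of "[]"] by (simp add: reduced_expr_def inversions_Nil)
qed

lemma reduced_exists:
  assumes "set ks \<subseteq> {1..n}"
  shows "reduced_expr n (weyl_word n ks) (SOME ks'. reduced_expr n (weyl_word n ks) ks')"
proof -
  obtain ks' where "set ks' \<subseteq> {1..n}" "weyl_word n ks' = weyl_word n ks" "2 * length ks' = card (inversions ks)"
    using reduce_word[OF assms] by blast
  then have "reduced_expr n (weyl_word n ks) ks'"
    using weyl_length_word[OF assms] by (simp add: reduced_expr_def)
  then show ?thesis by (rule someI)
qed

text \<open>Along an increasing word this number grows by one at exactly those letters where the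
  index reached from a has pairing -1. It is therefore the exponent of the sign picked up by row
  a.\<close>

definition ups :: "nat list \<Rightarrow> nat \<Rightarrow> nat" where "ups ks a = card {l. (l, a) \<in> inversions ks}"

lemma finite_ups: "finite {l. (l, a) \<in> inversions ks}"
  by (rule finite_subset[of _ "{..<2 * n}"]) (auto simp: inversions_def pairs_def)

lemma ups_Cons:
  assumes ks: "set ks \<subseteq> {1..n}" and i: "i \<in> {1..n}" and inc: "fold \<sigma> ks (tp i) < fold \<sigma> ks (bt i)"
  shows "ups (i # ks) a = ups ks a + (if vpair n i (foldr \<sigma> ks a) = - 1 then 1 else 0)"
proof -
  define a0 b0 where "a0 = fold \<sigma> ks (tp i)" and "b0 = fold \<sigma> ks (bt i)"
  note f = ab_facts[OF ks i, folded a0_def b0_def]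
  have F: "flips i ks = {(a0, b0), (opp b0, opp a0)}"
    using inc by (simp add: flips_def a0_def b0_def Let_def)
  have ne: "b0 \<noteq> opp a0" using f(1,2,4) by linarith
  have "vpair n i (foldr \<sigma> ks a) = - 1 \<longleftrightarrow> foldr \<sigma> ks a = bt i \<or> foldr \<sigma> ks a = opp (tp i)"
    using tb_neq[OF i] by (auto simp: vpair_def)
  also have "foldr \<sigma> ks a = bt i \<longleftrightarrow> a = b0" unfolding b0_def by (rule foldr_eq_iff[OF ks])
  also have "foldr \<sigma> ks a = opp (tp i) \<longleftrightarrow> a = opp a0"
    using f(7) foldr_inj[OF ks, of a "opp a0"] by simp
  finally have v: "vpair n i (foldr \<sigma> ks a) = - 1 \<longleftrightarrow> a = b0 \<or> a = opp a0" .
  have eq: "{l. (l, a) \<in> inversions (i # ks)} = {l. (l, a) \<in> inversions ks} \<union> {l. (l, a) \<in> flips i ks}"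
    using inversions_Cons[OF ks i] inversions_subset flips_pairs(1)[OF ks i] flips_inversions(1)[OF ks i inc] by blast
  have disj: "{l. (l, a) \<in> inversions ks} \<inter> {l. (l, a) \<in> flips i ks} = {}"
    using flips_inversions(1)[OF ks i inc] by blast
  have c: "{l. (l, a) \<in> flips i ks} = (if a = b0 then {a0} else if a = opp a0 then {opp b0} else {})"
    unfolding F using ne by auto
  then have "ups (i # ks) a = ups ks a + card {l. (l, a) \<in> flips i ks}"
    unfolding ups_def eq by (subst card_Un_disjoint[OF finite_ups _ disj]) auto
  then show ?thesis unfolding c using v by simp
qed

text \<open>Under w_0 every l < a is inverted with a. Row a thus has the sign (-1)^a, whichever
  reduced word was chosen.\<close>

lemma ups_full:
  assumes w: "\<And>r. r < 2 * n \<Longrightarrow> foldr \<sigma> ks r = w0 r" and a: "a < n"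
  shows "ups ks a = a"
proof -
  have "inversions ks = inversions i0"
  proof (rule Set.set_eqI)
    fix x :: "nat \<times> nat"
    obtain l b where x: "x = (l, b)" by (cases x)
    have "(l, b) \<in> pairs \<Longrightarrow> l < 2 * n \<and> b < 2 * n" unfolding pairs_def by simp
    then show "x \<in> inversions ks \<longleftrightarrow> x \<in> inversions i0"
      unfolding x inversions_def mem_Collect_eq prod.case using w[of l] w[of b] unfolding w0_def by metis
  qed
  then have f: "inversions ks = pairs" by (simp only: inversions_i0)
  have "{l. (l, a) \<in> inversions ks} = {..<a}"
  proof (rule Set.set_eqI)
    fix l
    have "l < a \<Longrightarrow> l + a \<noteq> 2 * n - 1" "a < 2 * n" using a by linarith+
    then show "l \<in> {l. (l, a) \<in> inversions ks} \<longleftrightarrow> l \<in> {..<a}"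
      unfolding f pairs_def mem_Collect_eq prod.case lessThan_iff by blast
  qed
  then show ?thesis by (simp add: ups_def)
qed

end

section \<open>Determinants of the vector representation\<close>

text \<open>The factor is the sign of reversing k rows. In the application it comes from the signs
  (-1)^a that the representative of the Weyl group element attaches to the rows.\<close>

definition signed_det :: "nat \<Rightarrow> (nat \<Rightarrow> nat \<Rightarrow> complex) \<Rightarrow> complex" where
  "signed_det k F = (\<Prod>a<k. (- 1) ^ a) * det (mat k k (\<lambda>(a, b). F a b))"

lemma det_row_scale: "det (mat k k (\<lambda>(a, b). d a * F a b)) = (\<Prod>a<k. d a) * det (mat k k (\<lambda>(a, b). F a b :: complex))"
proof -
  let ?D = "mat k k (\<lambda>(a, b). if a = b then d a else 0)"
  have "mat k k (\<lambda>(a, b). d a * F a b) = ?D * mat k k (\<lambda>(a, b). F a b)"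
  proof (rule eq_matI)
    fix i j assume ij: "i < dim_row (?D * mat k k (\<lambda>(a, b). F a b))" "j < dim_col (?D * mat k k (\<lambda>(a, b). F a b))"
    then have "(?D * mat k k (\<lambda>(a, b). F a b)) $$ (i, j) = (\<Sum>l<k. (if i = l then d i else 0) * F l j)"
      by (subst mult_entry[where N = k]) auto
    also have "\<dots> = (\<Sum>l<k. if i = l then d i * F l j else 0)" by (rule sum.cong) auto
    also have "\<dots> = d i * F i j" using ij by simp
    finally show "mat k k (\<lambda>(a, b). d a * F a b) $$ (i, j) = (?D * mat k k (\<lambda>(a, b). F a b)) $$ (i, j)"
      using ij by simp
  qed simp_all
  then have "det (mat k k (\<lambda>(a, b). d a * F a b)) = det ?D * det (mat k k (\<lambda>(a, b). F a b))"
    by (simp add: det_mult[of _ k])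
  also have "det ?D = prod_list (diag_mat ?D)"
    by (rule det_upper_triangular[of _ k]) auto
  also have "\<dots> = (\<Prod>a<k. d a)"
    by (simp add: diag_mat_def prod.list_conv_set_nth atLeast0LessThan)
  finally show ?thesis .
qed

lemma signed_det_scale: "signed_det k (\<lambda>a b. d a * F a b) = (\<Prod>a<k. d a) * signed_det k F"
  by (simp add: signed_det_def det_row_scale)

lemma signed_det_cong: "(\<And>a b. a < k \<Longrightarrow> b < k \<Longrightarrow> F a b = F' a b) \<Longrightarrow> signed_det k F = signed_det k F'"
  unfolding signed_det_def by (intro arg_cong2[of _ _ _ _ "(*)"] arg_cong[of _ _ det] refl eq_matI) auto

lemma signed_det_signs: "det (mat k k (\<lambda>(a, b). (- 1) ^ a * F a b)) = signed_det k F"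
  unfolding signed_det_def by (rule det_row_scale)

lemma signed_det_1: "signed_det (Suc 0) F = F 0 0"
  by (simp add: signed_det_def det_single)

text \<open>Subtracting consecutive rows clears a first column of ones.\<close>

lemma signed_det_condense:
  assumes one: "\<And>a. a \<le> k \<Longrightarrow> F a 0 = 1"
  shows "signed_det (Suc k) F = signed_det k (\<lambda>a b. F a (Suc b) - F (Suc a) (Suc b))"
proof -
  let ?B = "mat (Suc k) (Suc k) (\<lambda>(a, b). if b = a then 1 else if b = Suc a then - 1 else 0 :: complex)"
  let ?M = "mat (Suc k) (Suc k) (\<lambda>(a, b). F a b)"
  let ?C = "mat (Suc k) (Suc k) (\<lambda>(a, b). if a = k then F k b else F a b - F (Suc a) b)"
  have prod: "?B * ?M = ?C"
  proof (rule eq_matI)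
    fix i j assume "i < dim_row ?C" "j < dim_col ?C"
    then have ij: "i < Suc k" "j < Suc k" by simp_all
    then have "(?B * ?M) $$ (i, j) = (\<Sum>l<Suc k. (if l = i then 1 else if l = Suc i then - 1 else 0) * F l j)"
      by (subst mult_entry[where N = "Suc k"]) auto
    also have "\<dots> = (\<Sum>l<Suc k. (if l = i then F l j else 0) + (if l = Suc i then - F l j else 0))"
      by (rule sum.cong) auto
    also have "\<dots> = F i j + (if Suc i < Suc k then - F (Suc i) j else 0)"
      unfolding sum.distrib using ij by (simp add: sum.delta del: sum.lessThan_Suc)
    also have "\<dots> = ?C $$ (i, j)" using ij by auto
    finally show "(?B * ?M) $$ (i, j) = ?C $$ (i, j)" .
  qed simp_all
  have "det ?B = prod_list (diag_mat ?B)"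
    by (rule det_upper_triangular[of _ "Suc k"]) auto
  also have "\<dots> = 1"
    by (auto simp add: diag_mat_def prod.list_conv_set_nth simp del: upt_Suc intro!: prod.neutral)
  finally have B1: "det ?B = 1" .
  have "det (?B * ?M) = det ?B * det ?M" by (rule det_mult[of _ "Suc k"]) (rule mat_carrier)+
  then have "det ?M = det ?C" unfolding prod B1 mult_1_left by (rule sym)
  also have "\<dots> = (\<Sum>i<Suc k. ?C $$ (i, 0) * cofactor ?C i 0)"
    by (rule laplace_expansion_column) auto
  also have "\<dots> = (\<Sum>i<Suc k. if i = k then cofactor ?C k 0 else 0)"
    by (rule sum.cong) (auto simp: one)
  also have "\<dots> = cofactor ?C k 0" by simp
  also have "\<dots> = (- 1) ^ k * det (mat k k (\<lambda>(a, b). F a (Suc b) - F (Suc a) (Suc b)))"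
  proof -
    have "mat_delete ?C k 0 = mat k k (\<lambda>(a, b). F a (Suc b) - F (Suc a) (Suc b))"
      unfolding mat_delete_def by (rule eq_matI) auto
    then show ?thesis by (simp add: cofactor_def)
  qed
  finally have "det ?M = (- 1) ^ k * det (mat k k (\<lambda>(a, b). F a (Suc b) - F (Suc a) (Suc b)))" .
  \<comment> \<open>The cofactor sign (-1)^k cancels against the additional row sign of the larger
    determinant.\<close>
  then show ?thesis unfolding signed_det_def by (simp add: power_mult_distrib[symmetric])
qed

lemma signed_det_add_last:
  assumes "\<And>a b. a < k \<Longrightarrow> b \<le> k \<Longrightarrow> F a b = G a b" "\<And>a b. a < k \<Longrightarrow> b \<le> k \<Longrightarrow> H a b = G a b"
    and "\<And>b. b \<le> k \<Longrightarrow> H k b = x * F k b + y * G k b"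
  shows "signed_det (Suc k) H = x * signed_det (Suc k) F + y * signed_det (Suc k) G"
proof -
  let ?m = "\<lambda>F. mat (Suc k) (Suc k) (\<lambda>(a, b). F a b)"
  have del: "cofactor (?m F) k b = cofactor (?m G) k b" "cofactor (?m H) k b = cofactor (?m G) k b" if "b < Suc k" for b
  proof -
    have "mat_delete (?m F) k b = mat_delete (?m G) k b" "mat_delete (?m H) k b = mat_delete (?m G) k b"
      unfolding mat_delete_def using assms(1,2) by (auto intro!: eq_matI)
    then show "cofactor (?m F) k b = cofactor (?m G) k b" "cofactor (?m H) k b = cofactor (?m G) k b"
      by (simp_all add: cofactor_def)
  qed
  have ex: "det (?m F) = (\<Sum>b<Suc k. F k b * cofactor (?m F) k b)" for F
    by (subst laplace_expansion_row[of _ "Suc k" k]) (auto intro!: sum.cong)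
  have "det (?m H) = x * det (?m F) + y * det (?m G)"
    unfolding ex sum_distrib_left sum.distrib[symmetric]
    by (rule sum.cong[OF refl]) (use del assms(3) in \<open>auto simp: algebra_simps\<close>)
  then show ?thesis unfolding signed_det_def by (simp add: algebra_simps)
qed

text \<open>The diagonal coefficient of the row of v_i in one block of \<Theta>, for i < n. It is
  also the value of the monomial of v-bar i with its variables at level m, and in this way the
  barred monomials get into the result.\<close>

definition step_coef :: "nat \<Rightarrow> (nat \<Rightarrow> nat \<Rightarrow> complex) \<Rightarrow> nat \<Rightarrow> nat \<Rightarrow> complex" where
  "step_coef n c m i = (if i = n - 1 then c m (n - 2) / (c m (n - 1) * c m n) else c m (i - 1) / c m i)"

text \<open>\<open>A m i\<close> and \<open>B m j\<close> are the rows of \<open>v\<^sub>i\<close> and of \<open>v\<close>-bar \<open>j\<close> of the product of the factors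
  \<open>m, \<dots>, n - 1\<close> of \<open>\<Theta>\<close>, in the vector representation.\<close>

locale vector_rows =
  fixes n :: nat and c :: "nat \<Rightarrow> nat \<Rightarrow> complex" and A B :: "nat \<Rightarrow> nat \<Rightarrow> nat \<Rightarrow> complex"
  assumes n4: "n \<ge> 4" and nz: "\<And>m i. 1 \<le> m \<Longrightarrow> m < n \<Longrightarrow> i \<le> n \<Longrightarrow> c m i \<noteq> 0" and c_0: "\<And>m. c m 0 = 1"
    and A_top: "\<And>i s. 1 \<le> i \<Longrightarrow> i \<le> n \<Longrightarrow> s < n \<Longrightarrow> A n i s = (if s + 1 = i then 1 else 0)"
    and B_top: "\<And>j s. 1 \<le> j \<Longrightarrow> j \<le> n \<Longrightarrow> s < n \<Longrightarrow> B n j s = 0"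
    and A_1: "\<And>m s. 1 \<le> m \<Longrightarrow> m < n \<Longrightarrow> s < n \<Longrightarrow> A m 1 s = A (Suc m) 1 s / c m 1"
    and A_step: "\<And>m i s. 1 \<le> m \<Longrightarrow> m < n \<Longrightarrow> s < n \<Longrightarrow> 1 \<le> i \<Longrightarrow> i + 2 \<le> n \<Longrightarrow>
      A m (Suc i) s = step_coef n c m (Suc i) * A (Suc m) (Suc i) s + A (Suc m) i s"
    and A_n: "\<And>m s. 1 \<le> m \<Longrightarrow> m < n \<Longrightarrow> s < n \<Longrightarrow> A m n s = (c m (n - 1) * A (Suc m) n s + A (Suc m) (n - 1) s) / c m n"
    and B_n: "\<And>m s. 1 \<le> m \<Longrightarrow> m < n \<Longrightarrow> s < n \<Longrightarrow> B m n s = (c m n * B (Suc m) n s + A (Suc m) (n - 1) s) / c m (n - 1)"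
    and B_last: "\<And>m s. 1 \<le> m \<Longrightarrow> m < n \<Longrightarrow> s < n \<Longrightarrow> c m (n - 2) * B m (n - 1) s =
      c m (n - 1) * c m n * B (Suc m) (n - 1) s + c m (n - 1) * A (Suc m) n s + c m n * B (Suc m) n s + A (Suc m) (n - 1) s"
    and B_step: "\<And>m j s. 1 \<le> m \<Longrightarrow> m < n \<Longrightarrow> s < n \<Longrightarrow> 1 \<le> j \<Longrightarrow> j + 2 \<le> n \<Longrightarrow>
      c m (j - 1) * B m j s = c m j * B (Suc m) j s + c m j * B m (Suc j) s"
begin

text \<open>Each of the n - m remaining blocks keeps the row index or lowers it by one, the latter
  with coefficient 1. Columns that need more than n - m lowerings have entry 0; the column reached
  by lowering in every block has entry 1.\<close>

lemma A_low:
  assumes "1 \<le> m" "m \<le> n" "1 \<le> i" "i < n" "s < n" "s + 1 + n \<le> i + m"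
  shows "A m i s = (if s + 1 + n = i + m then 1 else 0)"
  using assms(2,1,3-)
proof (induction m arbitrary: i rule: inc_induct)
  case base
  then show ?case using A_top[of i s] by auto
next
  case (step m)
  then have i2: "2 \<le> i" by linarith
  define i' where "i' = i - 1"
  have i: "i = Suc i'" "1 \<le> i'" using i2 by (simp_all add: i'_def)
  have "A m (Suc i') s = step_coef n c m (Suc i') * A (Suc m) (Suc i') s + A (Suc m) i' s"
    by (rule A_step) (use step i in auto)
  moreover have "A (Suc m) (Suc i') s = 0" by (subst step.IH) (use step i in auto)
  moreover have "A (Suc m) i' s = (if s + 1 + n = i' + Suc m then 1 else 0)" by (rule step.IH) (use step i in auto)
  ultimately show ?case using i by simp
qed

text \<open>Here exactly one of the n - m blocks keeps the index. If t lowerings precede it, its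
  coefficient is \<open>step_coef n c (m + t) (i - t)\<close>.\<close>

lemma A_next:
  assumes "1 \<le> m" "m \<le> n" "1 \<le> i" "i < n" "s < n" "s + n = i + m"
  shows "A m i s = (\<Sum>t<n - m. step_coef n c (m + t) (i - t))"
  using assms(2,1,3-)
proof (induction m arbitrary: i rule: inc_induct)
  case base
  then show ?case using A_top[of i s] by auto
next
  case (step m)
  have split: "(\<Sum>t<n - m. step_coef n c (m + t) (i - t)) = step_coef n c m i + (\<Sum>t<n - Suc m. step_coef n c (Suc m + t) (i - Suc t))"
  proof -
    have "n - m = Suc (n - Suc m)" using step by simp
    then show ?thesis by (simp add: sum.lessThan_Suc_shift del: sum.lessThan_Suc)
  qed
  have lo: "A (Suc m) i s = 1" by (subst A_low) (use step.prems step.hyps in auto)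
  show ?case
  proof (cases "i = 1")
    case True
    then have m: "Suc m = n" "s = 0" using step by auto
    have "A m 1 s = A (Suc m) 1 s / c m 1" by (rule A_1) (use step in auto)
    then show ?thesis unfolding split using m True lo n4 by (auto simp: step_coef_def c_0)
  next
    case False
    then obtain i' where i: "i = Suc i'" "1 \<le> i'" using step.prems by (cases i) auto
    have "A m (Suc i') s = step_coef n c m (Suc i') * A (Suc m) (Suc i') s + A (Suc m) i' s"
      by (rule A_step) (use step i in auto)
    moreover have "A (Suc m) i' s = (\<Sum>t<n - Suc m. step_coef n c (Suc m + t) (i' - t))" by (rule step.IH) (use step i in auto)
    ultimately show ?thesis unfolding split using lo i by simp
  qed
qed

text \<open>A path from v_n or from a barred index has to pass through v_{n-1}, and from there the
  remaining blocks are too few to lower the index down to column s.\<close>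

lemma low_zero:
  assumes "1 \<le> m" "m \<le> n" "s + 1 < m"
  shows "A m n s = 0 \<and> (\<forall>j. 1 \<le> j \<longrightarrow> j \<le> n \<longrightarrow> B m j s = 0)"
  using assms(2,1,3)
proof (induction m rule: inc_induct)
  case base
  then show ?case using A_top[of n s] B_top by auto
next
  case (step m)
  have m: "1 \<le> m" "m < n" "s < n" using step by auto
  have IH: "A (Suc m) n s = 0" "\<And>j. 1 \<le> j \<Longrightarrow> j \<le> n \<Longrightarrow> B (Suc m) j s = 0" using step by auto
  have a: "A (Suc m) (n - 1) s = 0" by (subst A_low) (use step n4 in auto)
  have Bb: "B m j s = 0" if "1 \<le> j" "j \<le> n - 1" for j
    using that(2,1)
  proof (induction j rule: inc_induct)
    case base
    then show ?case using B_last[OF m] a IH n4 nz[OF m(1,2), of "n - 2"] by simp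
  next
    case (step j)
    have "c m (j - 1) * B m j s = c m j * B (Suc m) j s + c m j * B m (Suc j) s"
      by (rule B_step[OF m]) (use step in auto)
    then show ?case using step IH(2)[of j] nz[OF m(1,2), of "j - 1"] by auto
  qed
  have Bn: "B m n s = 0" using B_n[OF m] IH a n4 by simp
  have An: "A m n s = 0" using A_n[OF m] IH a by simp
  have "j = n \<or> j \<le> n - 1" if "j \<le> n" for j using that by linarith
  then show ?case using Bb Bn An by blast
qed

text \<open>Column m - 1 is the first one reached from these rows, by paths that come to v_{n-1}
  within block m. Scaling the row of v-bar j by \<open>c m (j - 1)\<close> turns this column into
  ones, as condensation requires.\<close>

lemma first_entries:
  assumes m: "1 \<le> m" "m < n"
  shows "A m n (m - 1) = 1 / c m n" "B m n (m - 1) = 1 / c m (n - 1)"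
    "1 \<le> j \<Longrightarrow> j < n \<Longrightarrow> c m (j - 1) * B m j (m - 1) = 1"
proof -
  have s: "m - 1 < n" using m by simp
  have IH: "A (Suc m) n (m - 1) = 0" "\<And>j. 1 \<le> j \<Longrightarrow> j \<le> n \<Longrightarrow> B (Suc m) j (m - 1) = 0" using low_zero[of "Suc m" "m - 1"] m by auto
  have a: "A (Suc m) (n - 1) (m - 1) = 1" by (subst A_low) (use m n4 in auto)
  show "A m n (m - 1) = 1 / c m n" using A_n[OF m s] IH a by simp
  show "B m n (m - 1) = 1 / c m (n - 1)" using B_n[OF m s] IH(2)[of n] a n4 by simp
  assume "1 \<le> j" "j < n"
  then have "j \<le> n - 1" "1 \<le> j" by auto
  then show "c m (j - 1) * B m j (m - 1) = 1"
  proof (induction j rule: inc_induct)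
    case base
    have "n - 1 - 1 = n - 2" by simp
    then show ?case using B_last[OF m s] IH a n4 by simp
  next
    case (step j)
    have "c m (j - 1) * B m j (m - 1) = c m j * B (Suc m) j (m - 1) + c m j * B m (Suc j) (m - 1)"
      by (rule B_step[OF m s]) (use step in auto)
    then show ?case using step IH(2)[of j] by auto
  qed
qed

text \<open>Row a is scaled by \<open>c m a\<close>. Then the first column consists of ones, and by
  \<open>B_step\<close> the differences of consecutive rows are multiples of rows of level m + 1.
  The scalars on both sides have the same product because \<open>c m 0 = 1\<close>.\<close>

lemma bar_minor_step:
  assumes m: "1 \<le> m" "m < n" and k: "Suc k < n" "1 \<le> k" and J: "J 0 = m - 1" "\<And>b. b \<le> k \<Longrightarrow> J b < n"
  shows "signed_det (Suc k) (\<lambda>a b. B m (Suc a) (J b)) = signed_det k (\<lambda>a b. B (Suc m) (Suc a) (J (Suc b)))"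
proof -
  have "(\<Prod>a<Suc k. c m a) * signed_det (Suc k) (\<lambda>a b. B m (Suc a) (J b))
      = signed_det (Suc k) (\<lambda>a b. c m a * B m (Suc a) (J b))"
    by (rule signed_det_scale[symmetric])
  also have "\<dots> = signed_det k (\<lambda>a b. c m a * B m (Suc a) (J (Suc b)) - c m (Suc a) * B m (Suc (Suc a)) (J (Suc b)))"
    by (rule signed_det_condense) (use first_entries(3)[OF m, of "Suc _"] J k in auto)
  also have "\<dots> = signed_det k (\<lambda>a b. c m (Suc a) * B (Suc m) (Suc a) (J (Suc b)))"
  proof (rule signed_det_cong)
    fix a b assume "a < k" "b < k"
    then have "c m (Suc a - 1) * B m (Suc a) (J (Suc b)) = c m (Suc a) * B (Suc m) (Suc a) (J (Suc b)) + c m (Suc a) * B m (Suc (Suc a)) (J (Suc b))"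
      by (intro B_step[OF m J(2)]) (use k in auto)
    then show "c m a * B m (Suc a) (J (Suc b)) - c m (Suc a) * B m (Suc (Suc a)) (J (Suc b)) = c m (Suc a) * B (Suc m) (Suc a) (J (Suc b))"
      by simp
  qed
  also have "\<dots> = (\<Prod>a<k. c m (Suc a)) * signed_det k (\<lambda>a b. B (Suc m) (Suc a) (J (Suc b)))"
    by (rule signed_det_scale)
  also have "(\<Prod>a<Suc k. c m a) = (\<Prod>a<k. c m (Suc a))"
    by (simp add: prod.lessThan_Suc_shift c_0 del: prod.lessThan_Suc)
  finally show ?thesis using nz[OF m] k by (auto simp del: prod.lessThan_Suc)
qed

text \<open>Every condensation removes one column and raises the level by one, until a single entry
  in the row of v-bar 1 is left. The column J k is free; it is the place where s_k will act.\<close>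

lemma bar_minor:
  assumes "1 \<le> m" "m + k < n" "\<And>b. b < k \<Longrightarrow> J b = m - 1 + b" "J k < n"
  shows "signed_det (Suc k) (\<lambda>a b. B m (Suc a) (J b)) = B (m + k) 1 (J k)"
  using assms
proof (induction k arbitrary: m J)
  case 0
  then show ?case by (simp add: signed_det_1)
next
  case (Suc k)
  have J: "J b < n" if "b \<le> Suc k" for b using Suc.prems(2) Suc.prems(3)[of b] Suc.prems(4) that by (cases "b = Suc k") auto
  have "signed_det (Suc (Suc k)) (\<lambda>a b. B m (Suc a) (J b)) = signed_det (Suc k) (\<lambda>a b. B (Suc m) (Suc a) (J (Suc b)))"
    by (rule bar_minor_step) (use Suc.prems J in auto)
  also have "\<dots> = B (Suc m + k) 1 (J (Suc k))"
    by (rule Suc.IH) (use Suc.prems in auto)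
  finally show ?case by simp
qed

text \<open>As v-bar k + 1 is left out, the last difference spans two steps of
  \<open>B_step\<close>. By linearity in the last row, condensation yields the minor without gap,
  which is 1, and the same gapped minor one level higher; so every level contributes one
  summand.\<close>

lemma bar_minor_gap:
  assumes "1 \<le> m" "m + k + 1 < n"
  shows "signed_det (Suc k) (\<lambda>a b. B m (if a = k then Suc (Suc k) else Suc a) (m - 1 + b)) = (\<Sum>t\<le>k. c (m + t) (k - t) / c (m + t) (Suc k - t))"
  using assms
proof (induction k arbitrary: m)
  case 0
  then have "c m 1 * B m 2 (m - 1) = 1" "c m 1 \<noteq> 0" using first_entries(3)[of m 2] n4 nz[of m 1] by auto
  then show ?case using c_0 by (simp add: signed_det_1 field_simps numeral_2_eq_2)
next
  case (Suc k)
  have m: "1 \<le> m" "m < n" and k: "m + k + 2 < n" using Suc.prems by auto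
  \<comment> \<open>Scaling factors that make the first column constant: the last row is that of
    v-bar k + 3, so its factor has index k + 2.\<close>
  define d where "d a = (if a = Suc k then c m (Suc (Suc k)) else c m a)" for a
  define F where "F a b = B m (if a = Suc k then Suc (Suc (Suc k)) else Suc a) (m - 1 + b)" for a b
  have s: "m - 1 + b < n" if "b \<le> Suc k" for b using that k by simp
  have e: "m - 1 + Suc b = Suc m - 1 + b" for b using m by simp
  have one: "d a * F a 0 = 1" if "a \<le> Suc k" for a
    using first_entries(3)[OF m, of "if a = Suc k then Suc (Suc (Suc k)) else Suc a"] that k m by (auto simp: d_def F_def)
  let ?S = "\<lambda>a b. B (Suc m) (Suc a) (Suc m - 1 + b)" and ?E = "\<lambda>a b. B (Suc m) (if a = k then Suc (Suc k) else Suc a) (Suc m - 1 + b)"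
  have diff: "d a * F a (Suc b) - d (Suc a) * F (Suc a) (Suc b) =
      (if a = k then c m (Suc k) * ?S k b + c m (Suc (Suc k)) * ?E k b else c m (Suc a) * ?S a b)" if ab: "a \<le> k" "b \<le> k" for a b
  proof -
    have st: "c m (j - 1) * B m j (m - 1 + Suc b) = c m j * B (Suc m) j (m - 1 + Suc b) + c m j * B m (Suc j) (m - 1 + Suc b)"
      if "1 \<le> j" "j \<le> Suc (Suc k)" for j
      by (rule B_step[OF m]) (use ab that k m in auto)
    define u where "u = m - 1 + Suc b"
    note st' = st[folded u_def]
    show ?thesis unfolding F_def e[symmetric] unfolding u_def[symmetric]
      using st'[of "Suc a"] st'[of "Suc (Suc k)"] ab by (auto simp: d_def)
  qed
  let ?p = "\<lambda>a. if a = k then 1 else c m (Suc a)"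
  have "(\<Prod>a<Suc (Suc k). d a) * signed_det (Suc (Suc k)) F = signed_det (Suc (Suc k)) (\<lambda>a b. d a * F a b)"
    by (rule signed_det_scale[symmetric])
  also have "\<dots> = signed_det (Suc k) (\<lambda>a b. d a * F a (Suc b) - d (Suc a) * F (Suc a) (Suc b))"
    by (rule signed_det_condense) (use one in auto)
  also have "\<dots> = c m (Suc k) * signed_det (Suc k) (\<lambda>a b. ?p a * ?S a b) + c m (Suc (Suc k)) * signed_det (Suc k) (\<lambda>a b. ?p a * ?E a b)"
    by (rule signed_det_add_last) (simp_all add: diff)
  also have "\<dots> = (\<Prod>a<Suc k. ?p a) * (c m (Suc k) * signed_det (Suc k) ?S + c m (Suc (Suc k)) * signed_det (Suc k) ?E)"
    unfolding signed_det_scale by (simp add: algebra_simps)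
  also have "signed_det (Suc k) ?S = 1"
  proof -
    have "signed_det (Suc k) ?S = B (Suc m + k) 1 (Suc m - 1 + k)" by (rule bar_minor) (use k in auto)
    also have "\<dots> = 1" using first_entries(3)[of "Suc m + k" 1] k c_0 by simp
    finally show ?thesis .
  qed
  also have "signed_det (Suc k) ?E = (\<Sum>t\<le>k. c (Suc m + t) (k - t) / c (Suc m + t) (Suc k - t))"
    by (rule Suc.IH) (use k in auto)
  also have "(\<Prod>a<Suc k. ?p a) = (\<Prod>a<k. c m (Suc a))" by simp
  also have "(\<Prod>a<Suc (Suc k). d a) = (\<Prod>a<k. c m (Suc a)) * c m (Suc (Suc k))"
  proof -
    have "(\<Prod>a<Suc k. d a) = (\<Prod>a<Suc k. c m a)" by (rule prod.cong) (auto simp: d_def)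
    also have "\<dots> = (\<Prod>a<k. c m (Suc a))" by (simp add: prod.lessThan_Suc_shift c_0 del: prod.lessThan_Suc)
    finally show ?thesis by (simp add: d_def)
  qed
  finally have eq: "(\<Prod>a<k. c m (Suc a)) * c m (Suc (Suc k)) * signed_det (Suc (Suc k)) F
      = (\<Prod>a<k. c m (Suc a)) * (c m (Suc k) * 1 + c m (Suc (Suc k)) * (\<Sum>t\<le>k. c (Suc m + t) (k - t) / c (Suc m + t) (Suc k - t)))" .
  have "(\<Prod>a<k. c m (Suc a)) \<noteq> 0" using nz[OF m] k by auto
  then have "c m (Suc (Suc k)) * signed_det (Suc (Suc k)) F
      = c m (Suc k) + c m (Suc (Suc k)) * (\<Sum>t\<le>k. c (Suc m + t) (k - t) / c (Suc m + t) (Suc k - t))"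
    using eq unfolding mult.assoc mult_cancel_left by simp
  then have "signed_det (Suc (Suc k)) F = c m (Suc k) / c m (Suc (Suc k)) + (\<Sum>t\<le>k. c (Suc m + t) (k - t) / c (Suc m + t) (Suc k - t))"
    using nz[OF m, of "Suc (Suc k)"] k by (simp add: field_simps)
  also have "\<dots> = (\<Sum>t\<le>Suc k. c (m + t) (Suc k - t) / c (m + t) (Suc (Suc k) - t))"
    by (subst sum.atMost_Suc_shift) simp
  finally show ?case unfolding F_def .
qed

text \<open>Column k is the first column of level k + 1, where the barred entries are known. Hence
  \<open>B_step\<close> telescopes over j = 1, ..., n - 2 and leaves the branch at n - 1, whose one
  further entry is the sum of \<open>A_next\<close>.\<close>

lemma last_row_entry:
  assumes k: "1 \<le> k" "k + 2 \<le> n"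
  shows "B k 1 k = (\<Sum>j=1..n - 2. c k j / c (Suc k) (j - 1)) + c k (n - 1) * c k n / c (Suc k) (n - 2)
    + c k (n - 1) / c (Suc k) n + c k n / c (Suc k) (n - 1) + (\<Sum>t<n - Suc k. step_coef n c (Suc k + t) (n - 1 - t))"
proof -
  have m: "1 \<le> k" "k < n" "k < n" and m': "1 \<le> Suc k" "Suc k < n" using k by auto
  have inv: "B (Suc k) j k = 1 / c (Suc k) (j - 1)" if "1 \<le> j" "j < n" for j
    using first_entries(3)[OF m' that] nz[OF m', of "j - 1"] that by (simp add: field_simps)
  have last: "c k (n - 2) * B k (n - 1) k = c k (n - 1) * c k n / c (Suc k) (n - 2)
    + c k (n - 1) / c (Suc k) n + c k n / c (Suc k) (n - 1) + (\<Sum>t<n - Suc k. step_coef n c (Suc k + t) (n - 1 - t))"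
  proof -
    have "A (Suc k) (n - 1) k = (\<Sum>t<n - Suc k. step_coef n c (Suc k + t) (n - 1 - t))"
      by (rule A_next) (use k n4 in auto)
    moreover have "n - 1 - 1 = n - 2" by simp
    ultimately show ?thesis using B_last[OF m] first_entries(1,2)[OF m'] inv[of "n - 1"] n4 by simp
  qed
  have "j + 1 \<le> n \<Longrightarrow> 1 \<le> j \<Longrightarrow> c k (j - 1) * B k j k = (\<Sum>i=j..n - 2. c k i / c (Suc k) (i - 1)) + c k (n - 2) * B k (n - 1) k" for j
  proof -
    assume "j + 1 \<le> n" "1 \<le> j"
    then have "j \<le> n - 1" "1 \<le> j" by auto
    then show ?thesis
    proof (induction j rule: inc_induct)
      case base
      have "n - 1 - 1 = n - 2" "{n - 1..n - 2} = {}" using n4 by auto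
      then show ?case by simp
    next
      case (step j)
      have "c k (j - 1) * B k j k = c k j * B (Suc k) j k + c k j * B k (Suc j) k"
        by (rule B_step[OF m]) (use step in auto)
      moreover have "{j..n - 2} = insert j {Suc j..n - 2}" using step by auto
      ultimately show ?case using step inv[of j] by simp
    qed
  qed
  from this[of 1] show ?thesis unfolding last using c_0 n4 by simp
qed

end

section \<open>Words for the elements at which the minors are evaluated\<close>

definition word_inv :: "(bool \<times> nat \<times> complex) list \<Rightarrow> (bool \<times> nat \<times> complex) list" where
  "word_inv w = map (\<lambda>(b, i, t). (b, i, - t)) (rev w)"

definition s_word :: "nat list \<Rightarrow> (bool \<times> nat \<times> complex) list" where
  "s_word ks = concat (map (\<lambda>i. [(True, i, - 1), (False, i, 1), (True, i, - 1)]) ks)"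

text \<open>The coroot at \<open>inverse a\<close> is spelled by its defining product, so that only
  letters x_i and y_i occur and the transfer of minors applies.\<close>

definition y_word :: "nat \<Rightarrow> complex \<Rightarrow> (bool \<times> nat \<times> complex) list" where
  "y_word i a = [(False, i, a), (True, i, inverse a), (False, i, - inverse (inverse a)), (True, i, inverse a),
     (True, i, - 1), (False, i, 1), (True, i, - 1)]"

lemma word_inv_ok [simp]: "word_ok n (word_inv w) \<longleftrightarrow> word_ok n w"
  by (auto simp: word_inv_def word_ok_def)

lemma s_word_ok: "set ks \<subseteq> {1..n} \<Longrightarrow> word_ok n (s_word ks)"
  by (induction ks) (auto simp: s_word_def)

lemma y_word_ok: "i \<in> {1..n} \<Longrightarrow> word_ok n (y_word i a)"
  by (simp add: y_word_def)

lemma word_inv_s_word: "word_inv (s_word ks) = concat (map (\<lambda>i. [(True, i, 1), (False, i, - 1), (True, i, 1)]) (rev ks))"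
  by (induction ks) (simp_all add: s_word_def word_inv_def)

lemma Theta_minus_product:
  "Theta_minus n N e f c = mat_prod N (map (\<lambda>(m, i). y_bold N e f i (c m i)) (List.product [1..int n - 1] [1..<Suc n]))"
  unfolding Theta_minus_def product_concat_map by (simp add: map_concat comp_def del: upt_Suc)

definition Theta_word :: "nat \<Rightarrow> (int \<Rightarrow> nat \<Rightarrow> complex) \<Rightarrow> (bool \<times> nat \<times> complex) list" where
  "Theta_word n c = concat (map (\<lambda>(m, i). y_word i (c m i)) (List.product [1..int n - 1] [1..<Suc n]))"

lemma Theta_word_ok: "word_ok n (Theta_word n c)"
  unfolding Theta_word_def word_ok_def by (auto simp: y_word_def)

lemma word_ok_concat: "(\<And>a. a \<in> set as \<Longrightarrow> word_ok n (W a)) \<Longrightarrow> word_ok n (concat (map W as))"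
  by (induction as) simp_all

context chevalley_rep
begin

lemma word_eval_concat:
  assumes "\<And>a. a \<in> set as \<Longrightarrow> word_ok n (W a)"
  shows "word_eval N e f (concat (map W as)) = mat_prod N (map (\<lambda>a. word_eval N e f (W a)) as)"
  using assms
proof (induction as)
  case (Cons a as)
  have "word_ok n (concat (map W as))" by (rule word_ok_concat) (use Cons.prems in simp)
  then show ?case using Cons by (simp add: word_eval_append)
qed (simp add: word_eval_Nil)

lemma s_bar_word: "i \<in> {1..n} \<Longrightarrow> s_bar N e f i = word_eval N e f [(True, i, - 1), (False, i, 1), (True, i, - 1)]"
  by (simp add: s_bar_def word_eval_def word_letter_def)

lemma s_word_eval: "set ks \<subseteq> {1..n} \<Longrightarrow> word_eval N e f (s_word ks) = mat_prod N (map (s_bar N e f) ks)"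
  unfolding s_word_def
  by (subst word_eval_concat) (auto simp: s_bar_word subset_iff intro!: arg_cong[of _ _ "mat_prod N"])

lemma y_word_eval:
  assumes i: "i \<in> {1..n}"
  shows "word_eval N e f (y_word i a) = y_bold N e f i a"
proof -
  have "y_word i a = [(False, i, a), (True, i, inverse a), (False, i, - inverse (inverse a)), (True, i, inverse a)] @ s_word [i]"
    by (simp add: y_word_def s_word_def)
  then have "word_eval N e f (y_word i a) = word_eval N e f [(False, i, a), (True, i, inverse a), (False, i, - inverse (inverse a)), (True, i, inverse a)]
      * word_eval N e f (s_word [i])"
    by (simp only:) (rule word_eval_append; use i in \<open>simp add: s_word_ok\<close>)
  also have "word_eval N e f (s_word [i]) = s_bar N e f i"
    using i by (simp add: s_word_eval right_mult_one_mat[of _ N N])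
  finally show ?thesis
    using i carr[OF i] by (simp add: y_bold_def coroot_def word_eval_Cons word_eval_Nil word_letter_def sq_simps[where N = N] right_mult_one_mat[of _ N N])
qed

lemma Theta_word_eval: "word_eval N e f (Theta_word n c) = Theta_minus n N e f c"
  unfolding Theta_minus_product Theta_word_def
  by (subst word_eval_concat) (auto simp: y_word_ok y_word_eval intro!: arg_cong[of _ _ "mat_prod N"])

lemma word_inv_eval:
  assumes "word_ok n w"
  shows "m_inv (GL N) (word_eval N e f w) = word_eval N e f (word_inv w)"
  using assms
proof (induction w)
  case Nil
  then show ?case using group.inv_equality[OF GL_group[of N], of "1\<^sub>m N" "1\<^sub>m N"] GL_one[of N]
    by (simp add: word_eval_Nil word_inv_def)
next
  case (Cons l w)
  obtain b i t where l: "l = (b, i, t)" by (cases l)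
  have i: "i \<in> {1..n}" and w: "word_ok n w" using Cons.prems l by auto
  have s: "word_eval N e f [(b, i, u)] = word_letter N e f (b, i, u)" for u
    using word_letter_GL[of "(b, i, u)"] i GL_carrier_mat
    by (simp add: word_eval_Cons word_eval_Nil right_mult_one_mat[of _ N N])
  have inv: "m_inv (GL N) (word_letter N e f l) = word_letter N e f (b, i, - t)"
    unfolding l using CG.x_inv[OF i, of t] CG.y_inv[OF i, of t] by (cases b) (simp_all add: word_letter_def)
  have "m_inv (GL N) (word_eval N e f (l # w)) = m_inv (GL N) (word_eval N e f w) * m_inv (GL N) (word_letter N e f l)"
    unfolding word_eval_Cons
    using group.inv_mult_group[OF GL_group word_letter_GL word_eval_GL[OF w]] l i by simp
  also have "\<dots> = word_eval N e f (word_inv w @ [(b, i, - t)])"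
    using Cons.IH[OF w] inv i w by (simp add: word_eval_append s)
  finally show ?case by (simp add: word_inv_def l)
qed

end

section \<open>Functions invariant under the unipotent subgroups\<close>

lemma unip_carrier:
  assumes a: "\<And>i. i \<in> {1..n} \<Longrightarrow> a i \<in> carrier_mat N N" and u: "u \<in> unip n N a"
  shows "u \<in> carrier_mat N N"
proof (rule GL_carrier_mat, rule group.generate_in_carrier[OF GL_group _ u[unfolded unip_def]])
  show "{one_param N (a i) t |i t. i \<in> {1..n}} \<subseteq> carrier (GL N)"
    using one_param_GL[OF a] by blast
qed

lemma unip_invariant:
  assumes a: "\<And>i. i \<in> {1..n} \<Longrightarrow> a i \<in> carrier_mat N N" and u: "u \<in> unip n N a"
    and M: "\<And>i t B. i \<in> {1..n} \<Longrightarrow> B \<in> carrier_mat N N \<Longrightarrow> M (one_param N (a i) t * B) = M B"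
    and B: "B \<in> carrier_mat N N"
  shows "M (u * B) = M B"
proof -
  have "u \<in> carrier_mat N N \<and> (\<forall>B\<in>carrier_mat N N. M (u * B) = M B)"
    using u unfolding unip_def
  proof (induction rule: generate.induct)
    case (incl g)
    then show ?case using M one_param_GL[OF a] GL_carrier_mat by auto
  next
    case (inv g)
    then obtain i t where g: "g = one_param N (a i) t" "i \<in> {1..n}" by auto
    have G: "g \<in> carrier (GL N)" using g one_param_GL[OF a] by simp
    have iG: "m_inv (GL N) g \<in> carrier (GL N)" by (rule group.inv_closed[OF GL_group G])
    show ?case
    proof (intro conjI ballI)
      show "m_inv (GL N) g \<in> carrier_mat N N" by (rule GL_carrier_mat[OF iG])
      fix B :: "complex mat" assume B: "B \<in> carrier_mat N N"
      have "M (g * (m_inv (GL N) g * B)) = M (m_inv (GL N) g * B)"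
        unfolding g(1) by (rule M[OF g(2)]) (use B GL_carrier_mat[OF iG] g(1) in auto)
      moreover have "g * (m_inv (GL N) g * B) = g * m_inv (GL N) g * B"
        by (rule assoc_mult_mat[symmetric, OF GL_carrier_mat[OF G] GL_carrier_mat[OF iG] B])
      moreover have "g * m_inv (GL N) g = 1\<^sub>m N" using group.r_inv[OF GL_group G] by simp
      ultimately show "M (m_inv (GL N) g * B) = M B" using B by simp
    qed
  next
    case (eng g h)
    then show ?case by (auto simp: assoc_mult_mat[of _ N N _ N _ N])
  qed simp
  then show ?thesis using B by blast
qed

lemma unip_invariant_right:
  assumes a: "\<And>i. i \<in> {1..n} \<Longrightarrow> a i \<in> carrier_mat N N" and u: "u \<in> unip n N a"
    and M: "\<And>i t B. i \<in> {1..n} \<Longrightarrow> B \<in> carrier_mat N N \<Longrightarrow> M (B * one_param N (a i) t) = M B"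
    and B: "B \<in> carrier_mat N N"
  shows "M (B * u) = M B"
proof -
  have "u \<in> carrier_mat N N \<and> (\<forall>B\<in>carrier_mat N N. M (B * u) = M B)"
    using u unfolding unip_def
  proof (induction rule: generate.induct)
    case (incl g)
    then show ?case using M one_param_GL[OF a] GL_carrier_mat by auto
  next
    case (inv g)
    then obtain i t where g: "g = one_param N (a i) t" "i \<in> {1..n}" by auto
    have G: "g \<in> carrier (GL N)" using g one_param_GL[OF a] by simp
    have iG: "m_inv (GL N) g \<in> carrier (GL N)" by (rule group.inv_closed[OF GL_group G])
    show ?case
    proof (intro conjI ballI)
      show "m_inv (GL N) g \<in> carrier_mat N N" by (rule GL_carrier_mat[OF iG])
      fix B :: "complex mat" assume B: "B \<in> carrier_mat N N"
      have "M (B * m_inv (GL N) g * g) = M (B * m_inv (GL N) g)"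
        unfolding g(1) by (rule M[OF g(2)]) (use B GL_carrier_mat[OF iG] g(1) in auto)
      moreover have "B * m_inv (GL N) g * g = B * (m_inv (GL N) g * g)"
        by (rule assoc_mult_mat[OF B GL_carrier_mat[OF iG] GL_carrier_mat[OF G]])
      moreover have "m_inv (GL N) g * g = 1\<^sub>m N" using group.l_inv[OF GL_group G] by simp
      ultimately show "M (B * m_inv (GL N) g) = M B" using B by simp
    qed
  next
    case (eng g h)
    then have gh: "g \<in> carrier_mat N N" "h \<in> carrier_mat N N" by auto
    show ?case
    proof (intro conjI ballI)
      show "g \<otimes>\<^bsub>GL N\<^esub> h \<in> carrier_mat N N" using gh by simp
      fix B :: "complex mat" assume B: "B \<in> carrier_mat N N"
      then have "B * (g * h) = B * g * h" "B * g \<in> carrier_mat N N" using gh by (auto simp: assoc_mult_mat[of _ N N _ N _ N])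
      then show "M (B * (g \<otimes>\<^bsub>GL N\<^esub> h)) = M B" using eng.IH B by simp
    qed
  qed simp
  then show ?thesis using B by blast
qed

context minuscule
begin

lemma torus_carrier: "torus_elt n N mE mF s \<in> carrier_mat N N"
  unfolding torus_elt_def by (rule mat_prod_carrier) auto

lemma torus_entry:
  assumes "\<forall>i\<in>{1..n}. u i \<noteq> 0" "r < N" "s < N"
  shows "torus_elt n N mE mF u $$ (r, s) = (if r = s then \<Prod>i=1..n. u i powi p i r else 0)"
proof -
  have "torus_elt n N mE mF u * 1\<^sub>m N = torus_elt n N mE mF u" by (rule right_mult_one_mat[OF torus_carrier])
  then have "torus_elt n N mE mF u $$ (r, s) = (\<Prod>i=1..n. u i powi p i r) * 1\<^sub>m N $$ (r, s)"
    using torus_row[OF assms one_carrier_mat] by simp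
  then show ?thesis using assms(2,3) by simp
qed

lemma cell_invariant:
  assumes a: "a \<in> unip n N mF" and b: "b \<in> unip n N mE"
    and L: "\<And>i t B. i \<in> {1..n} \<Longrightarrow> B \<in> carrier_mat N N \<Longrightarrow> M (y i t * B) = M B"
    and R: "\<And>i t B. i \<in> {1..n} \<Longrightarrow> B \<in> carrier_mat N N \<Longrightarrow> M (B * x i t) = M B"
  shows "M (a * torus_elt n N mE mF s * b) = M (torus_elt n N mE mF s)"
proof -
  have car: "u \<in> carrier_mat N N" if "u \<in> unip n N mF" for u
    by (rule unip_carrier[OF _ that]) simp
  have "M (a * torus_elt n N mE mF s * b) = M (a * torus_elt n N mE mF s)"
    by (rule unip_invariant_right[OF _ b R]) (use torus_carrier car[OF a] in auto)
  also have "\<dots> = M (torus_elt n N mE mF s)"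
    by (rule unip_invariant[OF _ a L]) (use torus_carrier in auto)
  finally show ?thesis .
qed

lemma sgn_word_append_single:
  "sgn_word (ks @ [k]) a = (if p k a = - 1 then - sgn_word ks (sg k a) else sgn_word ks (sg k a))"
  by (induction ks) auto

end

context chevalley_pair
begin

text \<open>The hypotheses with \<open>SOME\<close> name the reduced words that \<open>w_bar\<close>
  selects. The inverse of the left representative is spelled as a word too, so the whole argument of
  \<Delta> is one word, and its image acts on rows by \<open>word_inverse_row\<close>.\<close>

lemma gen_minor_transfer:
  assumes k: "k \<in> {1..n}" and us: "set us \<subseteq> {1..n}" "(SOME ks. reduced_expr n u ks) = us"
    and vs: "set vs \<subseteq> {1..n}" "(SOME ks. reduced_expr n v ks) = vs"
    and M_holo: "\<And>g. holo N' g \<Longrightarrow> (\<lambda>z. M (g z)) holomorphic_on UNIV"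
    and M_cell: "\<And>a s b. a \<in> unip n N' f' \<Longrightarrow> b \<in> unip n N' e' \<Longrightarrow> \<forall>i\<in>{1..n}. s i \<noteq> 0 \<Longrightarrow>
        M (a * torus_elt n N' e' f' s * b) = s k"
  shows "gen_minor n N e f \<Delta> k u v (Theta_minus n N e f c) =
    M (word_eval N' e' f' (concat (map (\<lambda>i. [(True, i, 1), (False, i, - 1), (True, i, 1)]) (rev us)))
      * (Theta_minus n N' e' f' c * mat_prod N' (map (s_bar N' e' f') vs)))"
proof -
  let ?w = "word_inv (s_word us) @ Theta_word n c @ s_word vs"
  note ok = s_word_ok[OF us(1)] s_word_ok[OF vs(1)] Theta_word_ok
  have car: "Theta_minus n N e f c \<in> carrier_mat N N" "word_eval N e f (word_inv (s_word us)) \<in> carrier_mat N N"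
    "mat_prod N (map (s_bar N e f) vs) \<in> carrier_mat N N"
    using R.word_eval_carrier[of "Theta_word n c"] R.word_eval_carrier[of "s_word vs"] R.word_eval_carrier[of "word_inv (s_word us)"] ok
    by (simp_all add: R.Theta_word_eval R.s_word_eval[OF vs(1)])
  have "gen_minor n N e f \<Delta> k u v (Theta_minus n N e f c) = \<Delta> k (word_eval N e f ?w)"
    unfolding gen_minor_def w_bar_def us(2) vs(2) R.s_word_eval[OF us(1), symmetric] R.word_inv_eval[OF ok(1)]
    using ok by (simp add: R.word_eval_append R.Theta_word_eval R.s_word_eval[OF vs(1)] assoc_mult_mat[OF car(2,1,3)])
  also have "\<dots> = M (word_eval N' e' f' ?w)"
    by (rule minor_transfer[OF k _ M_holo M_cell]) (use ok in simp_all)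
  also have "word_eval N' e' f' ?w = word_eval N' e' f' (word_inv (s_word us)) * (Theta_minus n N' e' f' c * mat_prod N' (map (s_bar N' e' f') vs))"
    using ok by (simp add: R'.word_eval_append R'.Theta_word_eval R'.s_word_eval[OF vs(1)])
  finally show ?thesis unfolding word_inv_s_word .
qed

end

section \<open>The vector representation\<close>

context type_D
begin

lemma vpair_low:
  assumes "1 \<le> i" "i < n" "r < 2 * n"
  shows "vpair n i r = (if r + 1 = i \<or> r + 1 + i = 2 * n then 1 else if r = i \<or> r + i = 2 * n then - 1 else 0)"
proof -
  have f: "vtop n i = i - 1" "vbot n i = i" using assms(2) by (simp_all add: vtop_def vbot_def)
  have "(r = i - 1) = (r + 1 = i)" "(r = 2 * n - 1 - i) = (r + 1 + i = 2 * n)" "(r = 2 * n - 1 - (i - 1)) = (r + i = 2 * n)"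
    using assms by linarith+
  then show ?thesis unfolding vpair_def f by (simp only:)
qed

lemma vpair_top:
  assumes "r < 2 * n"
  shows "vpair n n r = (if r + 2 = n \<or> r + 1 = n then 1 else if r = n \<or> r = n + 1 then - 1 else 0)"
proof -
  have f: "vtop n n = n - 2" "vbot n n = n" by (simp_all add: vtop_def vbot_def)
  have "(r = n - 2) = (r + 2 = n)" "(r = 2 * n - 1 - n) = (r + 1 = n)" "(r = 2 * n - 1 - (n - 2)) = (r = n + 1)"
    using assms n4 by linarith+
  then show ?thesis unfolding vpair_def f by (simp only:)
qed

lemma vperm_bar:
  assumes "1 \<le> i" "i < n"
  shows "\<sigma> i (2 * n - i) = 2 * n - Suc i"
proof -
  have "i \<in> {1..n}" "opp (tp i) = 2 * n - i" "opp (bt i) = 2 * n - Suc i" using assms by (auto simp: vtop_def vbot_def)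
  then show ?thesis using \<sigma>_tb(3)[of i] by metis
qed

lemma vperm_top: "\<sigma> n n = n - 2" "\<sigma> n (n + 1) = n - 1"
proof -
  have "n \<in> {1..n}" "bt n = n" "tp n = n - 2" "opp (tp n) = n + 1" "opp (bt n) = n - 1" using n4 by (auto simp: vtop_def vbot_def)
  then show "\<sigma> n n = n - 2" "\<sigma> n (n + 1) = n - 1" using \<sigma>_tb(2,3)[of n] by metis+
qed

lemma vector_minuscule: "minuscule n (2 * n) (vpair n) \<sigma>"
proof
  fix i r assume ir: "i \<in> {1..n}" "r < 2 * n"
  show "vpair n i r \<in> {- 1, 0, 1}" by (simp add: vpair_def)
  show "\<sigma> i r < 2 * n" by (rule \<sigma>_lt[OF ir])
  show "\<sigma> i (\<sigma> i r) = r" by (rule \<sigma>_\<sigma>[OF ir(1)])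
  show "\<sigma> i r = r" if "vpair n i r = 0"
    using that unfolding vpair_def vperm_def by (auto split: if_splits)
  fix j assume j: "j \<in> {1..n}"
  \<comment> \<open>These are the doubled coordinates of the root \<alpha>_j, so permuting them by
    \<open>\<sigma> i\<close> produces the reflection formula.\<close>
  have "coords (\<lambda>i. cartan_D n j i) (\<lambda>r. 2 * vpair n j r)"
    unfolding coords_def
  proof (intro conjI allI impI ballI)
    fix r assume "r < 2 * n"
    then show "2 * vpair n j (opp r) = - (2 * vpair n j r)" using vpair_opp[OF j] by simp
  next
    fix i assume i: "i \<in> {1..n}"
    show "2 * vpair n j (tp i) - 2 * vpair n j (bt i) = 2 * cartan_D n j i"
      using vpair_tb[OF j i] cartan_D_simps(3)[of n i j] by simp
  qed
  from coords_\<sigma>[OF this ir] have "2 * vpair n j (\<sigma> i r) = 2 * (vpair n j r - vpair n i r * cartan_D n j i)"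
    by (simp add: algebra_simps)
  then show "vpair n j (\<sigma> i r) = vpair n j r - vpair n i r * cartan_D n j i" by simp
next
  fix i j r assume ij: "i \<in> {1..n}" "j \<in> {1..n}" "i \<noteq> j" "cartan_D n i j = 0" "r < 2 * n"
  \<comment> \<open>Orthogonal reflections commute on weights, and by faithfulness also on
    indices.\<close>
  have "refl_D n i (refl_D n j l) = refl_D n j (refl_D n i l)" for l
    using ij(4) cartan_D_simps(3)[of n i j] by (auto simp: refl_D_def fun_eq_iff)
  then have "weyl_word n [i, j] = weyl_word n [j, i]" by (auto simp: weyl_word_def fun_eq_iff)
  then show "\<sigma> i (\<sigma> j r) = \<sigma> j (\<sigma> i r)" using ij weyl_word_eq[of "[i, j]" "[j, i]"] by auto
qed

end

sublocale type_D \<subseteq> V: minuscule n "2 * n" "vpair n" "vperm n"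
  by (rule vector_minuscule)

context type_D
begin

lemma sgn_word_increasing:
  assumes "set ks \<subseteq> {1..n}" "increasing ks"
  shows "V.sgn_word ks a = (- 1) ^ ups ks a"
  using assms
proof (induction ks)
  case Nil
  then show ?case by (simp add: ups_def inversions_Nil)
next
  case (Cons i ks)
  then show ?case by (simp add: ups_Cons)
qed

text \<open>\<open>P i\<close> contains the factors i, ..., n of one block and all later blocks, so
  R includes the block and Q does not. A row is touched only by the few factors pairing with it, and
  \<open>skip\<close> passes the others. The last formula has R on both sides because factor j leads
  from row 2n - j to row 2n - j - 1, on which later factors of the same block still act.\<close>

lemma coxeter_rows:
  fixes P :: "nat \<Rightarrow> nat \<Rightarrow> complex" and u :: "nat \<Rightarrow> complex"
  assumes rec: "\<And>i r. 1 \<le> i \<Longrightarrow> i \<le> n \<Longrightarrow> r < 2 * n \<Longrightarrow> P i r =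
      (if vpair n i r = 1 then P (Suc i) r / u i else if vpair n i r = - 1 then u i * P (Suc i) r + P (Suc i) (\<sigma> i r) else P (Suc i) r)"
    and nz: "\<And>i. i \<le> n \<Longrightarrow> u i \<noteq> 0" and u0: "u 0 = 1"
  defines "R \<equiv> P 1" and "Q \<equiv> P (Suc n)"
  shows "R 0 = Q 0 / u 1"
    and "1 \<le> i \<Longrightarrow> i + 2 \<le> n \<Longrightarrow> R i = (if Suc i = n - 1 then u (n - 2) / (u (n - 1) * u n) else u i / u (Suc i)) * Q i + Q (i - 1)"
    and "R (n - 1) = (u (n - 1) * Q (n - 1) + Q (n - 2)) / u n"
    and "R n = (u n * Q n + Q (n - 2)) / u (n - 1)"
    and "u (n - 2) * R (n + 1) = u (n - 1) * u n * Q (n + 1) + u (n - 1) * Q (n - 1) + u n * Q n + Q (n - 2)"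
    and "1 \<le> j \<Longrightarrow> j + 2 \<le> n \<Longrightarrow> u (j - 1) * R (2 * n - j) = u j * Q (2 * n - j) + u j * R (2 * n - Suc j)"
proof -
  have skip: "P i r = P i' r" if "i \<le> i'" "i' \<le> Suc n" "1 \<le> i" "r < 2 * n" "\<And>l. i \<le> l \<Longrightarrow> l < i' \<Longrightarrow> vpair n l r = 0" for i i' r
    using that(1,3,5)
  proof (induction i rule: inc_induct)
    case (step l)
    have "P l r = P (Suc l) r" using rec[of l r] step that(2,4) by simp
    also have "\<dots> = P i' r" using step by simp
    finally show ?case .
  qed simp
  have low: "vpair n l r = 0" if "1 \<le> l" "l < n" "r < 2 * n" "r + 1 \<noteq> l" "r + 1 + l \<noteq> 2 * n" "r \<noteq> l" "r + l \<noteq> 2 * n" for l r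
    using vpair_low[of l r] that by simp
  have all: "vpair n l r = 0" if "1 \<le> l" "l \<le> n" "r < 2 * n" "r + 1 \<noteq> l" "r + 1 + l \<noteq> 2 * n" "r \<noteq> l" "r + l \<noteq> 2 * n"
    "r + 2 \<noteq> n" "r + 1 \<noteq> n" "r \<noteq> n" "r \<noteq> n + 1" for l r
    using low[of l r] vpair_top[of r] that by (cases "l = n") auto
  have lt: "i < 2 * n" if "i \<le> n + 1" for i using that n4 by simp
  have sb: "\<sigma> i i = i - 1" if "1 \<le> i" "i < n" for i using \<sigma>_low[of i i] that by simp
  have n1: "P n (n - 1) = Q (n - 1) / u n" "P n (n - 2) = Q (n - 2) / u n" "P n n = u n * Q n + Q (n - 2)" "P n (n + 1) = u n * Q (n + 1) + Q (n - 1)"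
  proof -
    have a: "n - 1 < 2 * n" "n - 2 < 2 * n" "n < 2 * n" "n + 1 < 2 * n" "1 \<le> n" "n - 1 + 1 = n" "n - 2 + 2 = n" using n4 by simp_all
    have v: "vpair n n (n - 1) = 1" "vpair n n (n - 2) = 1" "vpair n n n = - 1" "vpair n n (n + 1) = - 1"
      using vpair_top[OF a(1)] vpair_top[OF a(2)] vpair_top[OF a(3)] vpair_top[OF a(4)] a by auto
    note r = rec[OF a(5) le_refl]
    show "P n (n - 1) = Q (n - 1) / u n" "P n (n - 2) = Q (n - 2) / u n" unfolding Q_def using r[OF a(1)] r[OF a(2)] v by simp_all
    show "P n n = u n * Q n + Q (n - 2)" "P n (n + 1) = u n * Q (n + 1) + Q (n - 1)"
      unfolding Q_def using r[OF a(3)] r[OF a(4)] v(3,4) vperm_top by simp_all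
  qed
  have m1: "P (n - 1) r = (if r + 1 = n - 1 \<or> r = n then P n r / u (n - 1)
     else if r = n - 1 \<or> r = n + 1 then u (n - 1) * P n r + P n (\<sigma> (n - 1) r) else P n r)" if "r < 2 * n" for r
  proof -
    have "vpair n (n - 1) r = (if r + 1 = n - 1 \<or> r = n then 1 else if r = n - 1 \<or> r = n + 1 then - 1 else 0)"
      using vpair_low[of "n - 1" r] that n4 by auto
    moreover have "Suc (n - 1) = n" using n4 by simp
    ultimately show ?thesis using rec[of "n - 1" r] that n4 by auto
  qed
  show "R 0 = Q 0 / u 1"
  proof -
    have "vpair n 1 0 = 1" using vpair_low[of 1 0] n4 by simp
    then have "P 1 0 = P (Suc 1) 0 / u 1" using rec[of 1 0] n4 by simp
    also have "P (Suc 1) 0 = P (Suc n) 0" by (rule skip) (use n4 in \<open>auto intro!: all\<close>)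
    finally show ?thesis by (simp add: R_def Q_def)
  qed
  show "R i = (if Suc i = n - 1 then u (n - 2) / (u (n - 1) * u n) else u i / u (Suc i)) * Q i + Q (i - 1)" if i: "1 \<le> i" "i + 2 \<le> n"
  proof -
    have "P 1 i = P i i" by (rule skip) (use i in \<open>auto intro!: low\<close>)
    also have "\<dots> = u i * P (Suc i) i + P (Suc i) (i - 1)"
      using rec[of i i] vpair_low[of i i] sb[of i] i by simp
    also have "P (Suc i) (i - 1) = P (Suc n) (i - 1)" by (rule skip) (use i in \<open>auto intro!: all\<close>)
    also have "P (Suc i) i = P (Suc (Suc i)) i / u (Suc i)"
      using rec[of "Suc i" i] vpair_low[of "Suc i" i] i by simp
    finally have e: "R i = u i / u (Suc i) * P (Suc (Suc i)) i + Q (i - 1)" by (simp add: R_def Q_def)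
    show ?thesis
    proof (cases "Suc i = n - 1")
      case True
      then have "Suc (Suc i) = n" "i = n - 2" by auto
      then show ?thesis using e n1(2) True by simp
    next
      case False
      have "P (Suc (Suc i)) i = P (Suc n) i" by (rule skip) (use i False in \<open>auto intro!: all\<close>)
      then show ?thesis using e False by (simp add: Q_def)
    qed
  qed
  show "R (n - 1) = (u (n - 1) * Q (n - 1) + Q (n - 2)) / u n"
  proof -
    have "P 1 (n - 1) = P (n - 1) (n - 1)" by (rule skip) (use n4 in \<open>auto intro!: low\<close>)
    also have "\<dots> = u (n - 1) * P n (n - 1) + P n (\<sigma> (n - 1) (n - 1))"
    proof -
      have ne: "n - 1 < 2 * n" "(n - 1 + 1 = n - 1) = False" "(n - 1 = n) = False" using n4 by auto
      show ?thesis unfolding m1[OF ne(1)] by (simp only: ne(2,3) if_False if_True simp_thms)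
    qed
    also have "\<sigma> (n - 1) (n - 1) = n - 2" using sb[of "n - 1"] n4 by simp
    finally show ?thesis unfolding n1 R_def by (simp add: add_divide_distrib)
  qed
  show "R n = (u n * Q n + Q (n - 2)) / u (n - 1)"
  proof -
    have "P 1 n = P (n - 1) n" by (rule skip) (use n4 in \<open>auto intro!: low\<close>)
    also have "\<dots> = P n n / u (n - 1)" using m1[of n] n4 by simp
    finally show ?thesis unfolding n1 R_def .
  qed
  \<comment> \<open>Of the factors before the j-th, only factor j - 1 touches this row, and it
    divides by \<open>u (j - 1)\<close>; the case j = 1 is covered by
    \<open>u 0 = 1\<close>.\<close>
  have bar: "u (j - 1) * R (2 * n - j) = P j (2 * n - j)" if j: "1 \<le> j" "j < n" for j
  proof (cases "j = 1")
    case False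
    then obtain i where i: "j = Suc i" "1 \<le> i" using j(1) by (cases j) auto
    have "P 1 (2 * n - j) = P i (2 * n - j)" by (rule skip) (use j i in \<open>auto intro!: low\<close>)
    also have "\<dots> = P j (2 * n - j) / u i"
    proof -
      have l: "1 \<le> i" "i < n" "i \<le> n" "2 * n - j < 2 * n" "2 * n - j + 1 + i = 2 * n" using j i by auto
      have "vpair n i (2 * n - j) = 1" using vpair_low[OF l(1,2,4)] l(5) by simp
      then show ?thesis using rec[OF l(1,3,4)] i by simp
    qed
    finally show ?thesis using nz[of i] j i by (simp add: R_def)
  qed (simp add: u0 R_def)
  show "u (n - 2) * R (n + 1) = u (n - 1) * u n * Q (n + 1) + u (n - 1) * Q (n - 1) + u n * Q n + Q (n - 2)"
  proof -
    have e: "2 * n - (n - 1) = n + 1" "n - 1 - 1 = n - 2" "2 * n - Suc (n - 1) = n" using n4 by auto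
    have "u (n - 2) * R (n + 1) = P (n - 1) (n + 1)" using bar[of "n - 1"] n4 unfolding e by simp
    also have "\<dots> = u (n - 1) * P n (n + 1) + P n n"
    proof -
      have ne: "n + 1 < 2 * n" "(n + 1 + 1 = n - 1) = False" "(n + 1 = n) = False" "(n + 1 = n - 1) = False" "1 \<le> n - 1" "n - 1 < n"
        using n4 by auto
      have "\<sigma> (n - 1) (n + 1) = n" using vperm_bar[OF ne(5,6)] unfolding e .
      then show ?thesis unfolding m1[OF ne(1)] by (simp only: ne(2,3,4) if_False if_True simp_thms)
    qed
    finally show ?thesis unfolding n1 by (simp add: algebra_simps)
  qed
  show "u (j - 1) * R (2 * n - j) = u j * Q (2 * n - j) + u j * R (2 * n - Suc j)" if j: "1 \<le> j" "j + 2 \<le> n"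
  proof -
    have "u (j - 1) * R (2 * n - j) = P j (2 * n - j)" using bar[of j] j by simp
    also have "\<dots> = u j * P (Suc j) (2 * n - j) + P (Suc j) (2 * n - Suc j)"
    proof -
      have l: "j < n" "j \<le> n" "2 * n - j < 2 * n" "2 * n - j + 1 \<noteq> j" "2 * n - j + 1 + j \<noteq> 2 * n" "2 * n - j + j = 2 * n"
        using j by auto
      have "vpair n j (2 * n - j) = - 1" using vpair_low[OF j(1) l(1,3)] l(4-6) by simp
      then show ?thesis using rec[OF j(1) l(2,3)] vperm_bar[OF j(1) l(1)] by simp
    qed
    also have "P (Suc j) (2 * n - j) = P (Suc n) (2 * n - j)" by (rule skip) (use j in \<open>auto intro!: all\<close>)
    also have "P (Suc j) (2 * n - Suc j) = u j * R (2 * n - Suc j)" using bar[of "Suc j"] j by simp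
    finally show ?thesis by (simp add: Q_def)
  qed
qed

definition vprod :: "(int \<Rightarrow> nat \<Rightarrow> complex) \<Rightarrow> nat \<Rightarrow> complex mat" where
  "vprod c m = mat_prod (2 * n) (map (\<lambda>(m, i). V.ybold i (c m i)) (List.product [int m..int n - 1] [1..<Suc n]))"

definition cext :: "(int \<Rightarrow> nat \<Rightarrow> complex) \<Rightarrow> nat \<Rightarrow> nat \<Rightarrow> complex" where
  "cext c m i = (if i = 0 then 1 else c (int m) i)"

lemma vprod_carrier: "vprod c m \<in> carrier_mat (2 * n) (2 * n)"
  unfolding vprod_def by (rule mat_prod_carrier) auto

lemma vprod_Theta: "vprod c 1 = Theta_minus n (2 * n) V.mE V.mF c"
  unfolding vprod_def Theta_minus_product by simp

lemma vector_rows_vprod: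
  assumes c: "\<And>m i. 1 \<le> m \<Longrightarrow> m < n \<Longrightarrow> i \<in> {1..n} \<Longrightarrow> c (int m) i \<noteq> 0"
  shows "vector_rows n (cext c) (\<lambda>m i s. vprod c m $$ (i - 1, s)) (\<lambda>m j s. vprod c m $$ (2 * n - j, s))"
proof -
  define P where "P m i = mat_prod (2 * n) (map (\<lambda>i. V.ybold i (c (int m) i)) [i..<Suc n]) * vprod c (Suc m)" for m i
  have Pc: "P m i \<in> carrier_mat (2 * n) (2 * n)" if "1 \<le> i" for m i
    unfolding P_def using that by (intro mult_carrier_mat[of _ "2 * n" "2 * n"] vprod_carrier mat_prod_carrier) auto
  have Ptop: "P m (Suc n) = vprod c (Suc m)" for m
    unfolding P_def using vprod_carrier[of c "Suc m"] by simp
  have Pbot: "P m 1 = vprod c m" if m: "m < n" for m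
  proof -
    have l: "[int m..int n - 1] = int m # [int (Suc m)..int n - 1]" using m by (subst upto_rec1) (auto simp: add.commute)
    show ?thesis unfolding P_def vprod_def l
      by (subst list.map(2) product_concat_map, simp del: upt_Suc, subst mat_prod_append)
        (auto simp: comp_def product_concat_map simp del: upt_Suc)
  qed
  have Prec: "P m i $$ (r, s) = (if vpair n i r = 1 then P m (Suc i) $$ (r, s) / cext c m i
      else if vpair n i r = - 1 then cext c m i * P m (Suc i) $$ (r, s) + P m (Suc i) $$ (\<sigma> i r, s) else P m (Suc i) $$ (r, s))"
    if m: "1 \<le> m" "m < n" and i: "1 \<le> i" "i \<le> n" and rs: "r < 2 * n" "s < 2 * n" for m i r s
  proof -
    have i': "i \<in> {1..n}" using i by simp
    have mc: "mat_prod (2 * n) (map (\<lambda>i. V.ybold i (c (int m) i)) [Suc i..<Suc n]) \<in> carrier_mat (2 * n) (2 * n)"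
      by (rule mat_prod_carrier) auto
    have "[i..<Suc n] = i # [Suc i..<Suc n]" using i by (simp add: upt_conv_Cons del: upt_Suc)
    then have "P m i = V.ybold i (c (int m) i) * P m (Suc i)"
      unfolding P_def by (simp add: assoc_mult_mat[OF V.ybold_carrier[OF i'] mc vprod_carrier] del: upt_Suc)
    moreover have "cext c m i = c (int m) i" using i by (simp add: cext_def)
    ultimately show ?thesis using V.ybold_row[OF Pc i' rs c[OF m i']] by simp
  qed
  have nz: "cext c m i \<noteq> 0" if "1 \<le> m" "m < n" "i \<le> n" for m i
    using c[OF that(1,2), of i] that(3) by (auto simp: cext_def)
  have top: "vprod c n = 1\<^sub>m (2 * n)" by (simp add: vprod_def)
  have s2: "s < 2 * n" if "s < n" for s using that by simp
  have rows: "vprod c m $$ (0, s) = vprod c (Suc m) $$ (0, s) / cext c m 1"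
    "\<And>i. 1 \<le> i \<Longrightarrow> i + 2 \<le> n \<Longrightarrow> vprod c m $$ (i, s) = (if Suc i = n - 1 then cext c m (n - 2) / (cext c m (n - 1) * cext c m n)
      else cext c m i / cext c m (Suc i)) * vprod c (Suc m) $$ (i, s) + vprod c (Suc m) $$ (i - 1, s)"
    "vprod c m $$ (n - 1, s) = (cext c m (n - 1) * vprod c (Suc m) $$ (n - 1, s) + vprod c (Suc m) $$ (n - 2, s)) / cext c m n"
    "vprod c m $$ (n, s) = (cext c m n * vprod c (Suc m) $$ (n, s) + vprod c (Suc m) $$ (n - 2, s)) / cext c m (n - 1)"
    "cext c m (n - 2) * vprod c m $$ (n + 1, s) = cext c m (n - 1) * cext c m n * vprod c (Suc m) $$ (n + 1, s)
      + cext c m (n - 1) * vprod c (Suc m) $$ (n - 1, s) + cext c m n * vprod c (Suc m) $$ (n, s) + vprod c (Suc m) $$ (n - 2, s)"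
    "\<And>j. 1 \<le> j \<Longrightarrow> j + 2 \<le> n \<Longrightarrow> cext c m (j - 1) * vprod c m $$ (2 * n - j, s) =
      cext c m j * vprod c (Suc m) $$ (2 * n - j, s) + cext c m j * vprod c m $$ (2 * n - Suc j, s)"
    if "1 \<le> m" "m < n" "s < n" for m s
  proof -
    note cr = coxeter_rows[of "\<lambda>i r. P m i $$ (r, s)" "cext c m", unfolded Ptop Pbot[OF that(2)], OF Prec[OF that(1,2) _ _ _ s2[OF that(3)]] nz[OF that(1,2)]]
    have c0: "cext c m 0 = 1" by (simp add: cext_def)
    show "vprod c m $$ (0, s) = vprod c (Suc m) $$ (0, s) / cext c m 1" by (rule cr(1)[OF _ _ _ _ c0])
    show "vprod c m $$ (i, s) = (if Suc i = n - 1 then cext c m (n - 2) / (cext c m (n - 1) * cext c m n)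
      else cext c m i / cext c m (Suc i)) * vprod c (Suc m) $$ (i, s) + vprod c (Suc m) $$ (i - 1, s)" if "1 \<le> i" "i + 2 \<le> n" for i
      by (rule cr(2)[OF _ _ _ _ c0 that])
    show "vprod c m $$ (n - 1, s) = (cext c m (n - 1) * vprod c (Suc m) $$ (n - 1, s) + vprod c (Suc m) $$ (n - 2, s)) / cext c m n"
      by (rule cr(3)[OF _ _ _ _ c0])
    show "vprod c m $$ (n, s) = (cext c m n * vprod c (Suc m) $$ (n, s) + vprod c (Suc m) $$ (n - 2, s)) / cext c m (n - 1)"
      by (rule cr(4)[OF _ _ _ _ c0])
    show "cext c m (n - 2) * vprod c m $$ (n + 1, s) = cext c m (n - 1) * cext c m n * vprod c (Suc m) $$ (n + 1, s)
      + cext c m (n - 1) * vprod c (Suc m) $$ (n - 1, s) + cext c m n * vprod c (Suc m) $$ (n, s) + vprod c (Suc m) $$ (n - 2, s)"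
      by (rule cr(5)[OF _ _ _ _ c0])
    show "cext c m (j - 1) * vprod c m $$ (2 * n - j, s) =
      cext c m j * vprod c (Suc m) $$ (2 * n - j, s) + cext c m j * vprod c m $$ (2 * n - Suc j, s)" if "1 \<le> j" "j + 2 \<le> n" for j
      by (rule cr(6)[OF _ _ _ _ c0 that])
  qed
  have e: "n - 1 - 1 = n - 2" "2 * n - n = n" "2 * n - (n - 1) = n + 1" using n4 by auto
  show ?thesis
  proof (unfold_locales, unfold e)
    show "4 \<le> n" by (rule n4)
    show "cext c m i \<noteq> 0" if "1 \<le> m" "m < n" "i \<le> n" for m i by (rule nz[OF that])
    show "cext c m 0 = 1" for m by (simp add: cext_def)
    show "vprod c n $$ (i - 1, s) = (if s + 1 = i then 1 else 0)" if "1 \<le> i" "i \<le> n" "s < n" for i s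
      unfolding top using that by auto
    show "vprod c n $$ (2 * n - j, s) = 0" if "1 \<le> j" "j \<le> n" "s < n" for j s
      unfolding top using that by auto
    show "vprod c m $$ (1 - 1, s) = vprod c (Suc m) $$ (1 - 1, s) / cext c m 1" if "1 \<le> m" "m < n" "s < n" for m s
      using rows(1)[OF that] by simp
    show "vprod c m $$ (Suc i - 1, s) = step_coef n (cext c) m (Suc i) * vprod c (Suc m) $$ (Suc i - 1, s) + vprod c (Suc m) $$ (i - 1, s)"
      if "1 \<le> m" "m < n" "s < n" "1 \<le> i" "i + 2 \<le> n" for m i s
      using rows(2)[OF that] unfolding step_coef_def diff_Suc_1 .
  qed (fact rows)+
qed

end

section \<open>Leading minors of the vector representation\<close>

context type_D
begin

text \<open>The highest weight matrix coefficient of the k-th exterior power of the vector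
  representation; its weight is \<Lambda>_k as long as k \<le> n - 2.\<close>

definition vminor :: "nat \<Rightarrow> complex mat \<Rightarrow> complex" where
  "vminor k g = det (mat k k (\<lambda>(a, b). g $$ (a, b)))"

lemma vminor_holo: "k \<le> 2 * n \<Longrightarrow> holo (2 * n) g \<Longrightarrow> (\<lambda>z. vminor k (g z)) holomorphic_on UNIV"
  unfolding vminor_def by (rule holo_det) (auto simp: holo_def)

lemma vpair_first:
  assumes "i \<in> {1..n}" "a + 3 \<le> n"
  shows "vpair n i a = (if a + 1 = i then 1 else if a = i then - 1 else 0)"
proof (cases "i = n")
  case True
  have "a < 2 * n" using assms by simp
  then show ?thesis using assms True by (simp add: vpair_top)
next
  case False
  then have i: "1 \<le> i" "i < n" "a < 2 * n" using assms by auto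
  have "a + 1 + i \<noteq> 2 * n" "a + i \<noteq> 2 * n" using i assms(2) by linarith+
  then show ?thesis using vpair_low[OF i] by simp
qed

lemma vperm_first: "1 \<le> i \<Longrightarrow> i < n \<Longrightarrow> \<sigma> i i = i - 1"
  using \<sigma>_low[of i i] by simp

text \<open>Among the first k rows \<open>V.y i t\<close> only adds a multiple of row i - 1 to row
  i; if row i is not among them, nothing changes.\<close>

lemma vminor_left:
  assumes k: "k + 2 \<le> n" and i: "i \<in> {1..n}" and B: "B \<in> carrier_mat (2 * n) (2 * n)"
  shows "vminor k (V.y i t * B) = vminor k B"
proof -
  have ent: "(V.y i t * B) $$ (a, b) = B $$ (a, b) + (if a = i then t * B $$ (i - 1, b) else 0)" if "a < k" "b < k" for a b
  proof -
    have a: "a < 2 * n" "b < 2 * n" "a + 3 \<le> n" using that k by auto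
    have "vpair n i a = - 1 \<longleftrightarrow> a = i" using vpair_first[OF i a(3)] by auto
    then show ?thesis using V.y_row[OF B i a(1,2), of t] vperm_first[of i] i a(3) by auto
  qed
  let ?b = "mat k k (\<lambda>(a, b). B $$ (a, b))"
  show ?thesis
  proof (cases "i < k")
    case True
    have "mat k k (\<lambda>(a, b). (V.y i t * B) $$ (a, b)) = addrow t i (i - 1) ?b"
      by (rule eq_matI) (use True i ent in \<open>auto simp del: index_mult_mat\<close>)
    moreover have "det (addrow t i (i - 1) ?b) = det ?b"
      by (rule det_addrow[of _ k]) (use True i in auto)
    ultimately show ?thesis unfolding vminor_def by metis
  next
    case False
    have "mat k k (\<lambda>(a, b). (V.y i t * B) $$ (a, b)) = ?b"
      by (rule eq_matI) (use False ent in \<open>auto simp del: index_mult_mat\<close>)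
    then show ?thesis unfolding vminor_def by metis
  qed
qed

lemma vminor_right:
  assumes k: "k + 2 \<le> n" and i: "i \<in> {1..n}" and B: "B \<in> carrier_mat (2 * n) (2 * n)"
  shows "vminor k (B * V.x i t) = vminor k B"
proof -
  have ent: "(B * V.x i t) $$ (a, b) = B $$ (a, b) + (if b = i then t * B $$ (a, i - 1) else 0)" if "a < k" "b < k" for a b
  proof -
    have a: "a < 2 * n" "b < 2 * n" "b + 3 \<le> n" using that k by auto
    have "vpair n i b = - 1 \<longleftrightarrow> b = i" using vpair_first[OF i a(3)] by auto
    then show ?thesis using V.x_col[OF B i a(1,2), of t] vperm_first[of i] i a(3) by auto
  qed
  let ?b = "mat k k (\<lambda>(a, b). B $$ (a, b))"
  show ?thesis
  proof (cases "i < k")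
    case True
    have "mat k k (\<lambda>(a, b). (B * V.x i t) $$ (a, b)) = addcol t i (i - 1) ?b"
      by (rule eq_matI) (use True i ent in \<open>auto simp del: index_mult_mat\<close>)
    moreover have "det (addcol t i (i - 1) ?b) = det ?b"
      by (rule det_addcol[of _ k]) (use True i in auto)
    ultimately show ?thesis unfolding vminor_def by metis
  next
    case False
    have "mat k k (\<lambda>(a, b). (B * V.x i t) $$ (a, b)) = ?b"
      by (rule eq_matI) (use False ent in \<open>auto simp del: index_mult_mat\<close>)
    then show ?thesis unfolding vminor_def by metis
  qed
qed

text \<open>Row a contributes s_{a+1} / s_a, with s_0 read as 1, and the product over a < k
  telescopes.\<close>

lemma vminor_torus:
  assumes k: "1 \<le> k" "k + 2 \<le> n" and s: "\<forall>i\<in>{1..n}. s i \<noteq> 0"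
  shows "vminor k (torus_elt n (2 * n) V.mE V.mF s) = s k"
proof -
  let ?d = "\<lambda>a. \<Prod>i=1..n. s i powi vpair n i a"
  have "mat k k (\<lambda>(a, b). torus_elt n (2 * n) V.mE V.mF s $$ (a, b)) = mat k k (\<lambda>(a, b). ?d a * (if a = b then 1 else 0))"
  proof (rule eq_matI)
    fix a b assume "a < dim_row (mat k k (\<lambda>(a, b). ?d a * (if a = b then 1 else 0)))" "b < dim_col (mat k k (\<lambda>(a, b). ?d a * (if a = b then 1 else 0)))"
    then have ab: "a < k" "b < k" "a < 2 * n" "b < 2 * n" using k by auto
    show "mat k k (\<lambda>(a, b). torus_elt n (2 * n) V.mE V.mF s $$ (a, b)) $$ (a, b) = mat k k (\<lambda>(a, b). ?d a * (if a = b then 1 else 0)) $$ (a, b)"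
      using ab(1,2) V.torus_entry[OF s ab(3,4)] by simp
  qed simp_all
  then have "vminor k (torus_elt n (2 * n) V.mE V.mF s) = (\<Prod>a<k. ?d a) * det (mat k k (\<lambda>(a, b). if a = b then 1 else 0))"
    unfolding vminor_def by (simp only: det_row_scale)
  also have "mat k k (\<lambda>(a, b). if a = b then 1 else 0) = (1\<^sub>m k :: complex mat)" by (rule eq_matI) auto
  also have "(\<Prod>a<k. ?d a) = (\<Prod>i=1..n. \<Prod>a<k. s i powi vpair n i a)" by (rule prod.swap)
  also have "\<dots> = (\<Prod>i=1..n. if i = k then s k else 1)"
  proof (rule prod.cong[OF refl])
    fix i assume i: "i \<in> {1..n}"
    have "(\<Prod>a<k. s i powi vpair n i a) = (\<Prod>a<k. (if a = i - 1 then s i else 1) * (if a = i then inverse (s i) else 1))"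
    proof (rule prod.cong[OF refl])
      fix a assume "a \<in> {..<k}"
      then have a: "a + 3 \<le> n" using k by simp
      show "s i powi vpair n i a = (if a = i - 1 then s i else 1) * (if a = i then inverse (s i) else 1)"
        using vpair_first[OF i a] i by (auto simp: power_int_minus)
    qed
    also have "\<dots> = (if i - 1 < k then s i else 1) * (if i < k then inverse (s i) else 1)"
      by (simp add: prod.distrib)
    also have "\<dots> = (if i = k then s k else 1)"
    proof -
      have "i - 1 < k \<longleftrightarrow> i \<le> k" using i by auto
      then show ?thesis using s i by auto
    qed
    finally show "(\<Prod>a<k. s i powi vpair n i a) = (if i = k then s k else 1)" .
  qed
  also have "\<dots> = s k" using k by simp
  finally show ?thesis by simp
qed

lemma vminor_cell:
  assumes k: "1 \<le> k" "k + 2 \<le> n" and ab: "a \<in> unip n (2 * n) V.mF" "b \<in> unip n (2 * n) V.mE" and s: "\<forall>i\<in>{1..n}. s i \<noteq> 0"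
  shows "vminor k (a * torus_elt n (2 * n) V.mE V.mF s * b) = s k"
  using V.cell_invariant[OF ab vminor_left[OF k(2)] vminor_right[OF k(2)]] vminor_torus[OF k s] by metis

lemma vminor_signs:
  assumes "\<And>a b. a < k \<Longrightarrow> b < k \<Longrightarrow> g $$ (a, b) = (- 1) ^ a * F a b"
  shows "vminor k g = signed_det k F"
proof -
  have "mat k k (\<lambda>(a, b). g $$ (a, b)) = mat k k (\<lambda>(a, b). (- 1) ^ a * F a b)"
    by (rule eq_matI) (use assms in auto)
  then show ?thesis unfolding vminor_def by (simp only: signed_det_signs)
qed

abbreviation inv_word_eval :: "nat list \<Rightarrow> complex mat" where
  "inv_word_eval us \<equiv> word_eval (2 * n) V.mE V.mF (concat (map (\<lambda>i. [(True, i, 1), (False, i, - 1), (True, i, 1)]) (rev us)))"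

text \<open>Row a becomes the row of v-bar a + 1 with sign (-1)^a, and the representative of s_k
  replaces column k - 1 by column k without a sign. The columns 0, ..., k - 2, k have the shape that
  \<open>bar_minor\<close> collapses to one entry.\<close>

lemma vector_minor_longest:
  assumes c: "\<And>m i. 1 \<le> m \<Longrightarrow> m < n \<Longrightarrow> i \<in> {1..n} \<Longrightarrow> c (int m) i \<noteq> 0"
    and k: "1 \<le> k" "k + 2 \<le> n" and us: "set us \<subseteq> {1..n}" "increasing us" "\<And>r. r < 2 * n \<Longrightarrow> foldr \<sigma> us r = w0 r"
  shows "vminor k (inv_word_eval us * (Theta_minus n (2 * n) V.mE V.mF c * mat_prod (2 * n) (map V.sbar [k])))
    = (\<Sum>j=1..n - 2. cext c k j / cext c (Suc k) (j - 1)) + cext c k (n - 1) * cext c k n / cext c (Suc k) (n - 2)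
    + cext c k (n - 1) / cext c (Suc k) n + cext c k n / cext c (Suc k) (n - 1)
    + (\<Sum>t<n - Suc k. step_coef n (cext c) (Suc k + t) (n - 1 - t))"
proof -
  interpret vector_rows n "cext c" "\<lambda>m i s. vprod c m $$ (i - 1, s)" "\<lambda>m j s. vprod c m $$ (2 * n - j, s)"
    by (rule vector_rows_vprod) (rule c)
  have k': "k \<in> {1..n}" using k by simp
  obtain q where q: "k = Suc q" using k by (cases k) auto
  let ?G = "vprod c 1 * mat_prod (2 * n) (map V.sbar [k])"
  have sc: "V.sbar k \<in> carrier_mat (2 * n) (2 * n)" using k' by simp
  have sb: "mat_prod (2 * n) (map V.sbar [k]) = V.sbar k"
    using right_mult_one_mat[OF sc] by simp
  have G: "?G \<in> carrier_mat (2 * n) (2 * n)" unfolding sb by (rule mult_carrier_mat[OF vprod_carrier sc])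
  have "vminor k (inv_word_eval us * ?G) = signed_det k (\<lambda>a b. vprod c 1 $$ (2 * n - Suc a, \<sigma> k b))"
  proof (rule vminor_signs)
    fix a b assume ab: "a < k" "b < k"
    have r: "a < 2 * n" "b < 2 * n" "a < n" "a + 1 < n" "2 * n - 1 - a < 2 * n" "b + 3 \<le> n" using ab k by auto
    have p: "vpair n k b \<noteq> - 1" using vpair_first[OF k' r(6)] ab by auto
    have "(inv_word_eval us * ?G) $$ (a, b) = V.sgn_word us a * ?G $$ (foldr \<sigma> us a, b)"
      by (rule V.word_inverse_row[OF us(1) r(1,2) G])
    also have "V.sgn_word us a = (- 1) ^ a"
    proof -
      have "ups us a = a" by (rule ups_full) (use us(3) r(3) in auto)
      then show ?thesis using sgn_word_increasing[OF us(1,2)] by simp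
    qed
    also have "foldr \<sigma> us a = 2 * n - 1 - a" unfolding us(3)[OF r(1)] by (rule w0_low[OF r(4)])
    also have "?G $$ (2 * n - 1 - a, b) = vprod c 1 $$ (2 * n - 1 - a, \<sigma> k b)"
      unfolding sb using V.sbar_col[OF vprod_carrier k' r(5,2)] p by simp
    finally show "(inv_word_eval us * ?G) $$ (a, b) = (- 1) ^ a * vprod c 1 $$ (2 * n - Suc a, \<sigma> k b)" by simp
  qed
  also have "\<dots> = vprod c (1 + q) $$ (2 * n - 1, \<sigma> k q)"
    unfolding q
  proof (rule bar_minor)
    fix b assume b: "b < q"
    have "b < n" using b q k by simp
    then show "\<sigma> (Suc q) b = 1 - 1 + b" using \<sigma>_low[of "Suc q" b] b q k by simp
  next
    show "\<sigma> (Suc q) q < n" using \<sigma>_low[of "Suc q" q] q k by simp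
  qed (use q k in auto)
  also have "\<sigma> k q = k" using \<sigma>_low[of k q] q k by simp
  finally have "vminor k (inv_word_eval us * ?G) = vprod c k $$ (2 * n - 1, k)" using q by simp
  then show ?thesis unfolding vprod_Theta last_row_entry[OF k] .
qed

text \<open>Now s_k acts on rows, so that v-bar k + 1 takes the place of v-bar k and the minor has a
  gap. The sign of the last row is (-1)^k by the sign rule for w_0, times -1 for the appended letter
  k, which again is (-1)^a for a = k - 1.\<close>

lemma vector_minor_refl:
  assumes c: "\<And>m i. 1 \<le> m \<Longrightarrow> m < n \<Longrightarrow> i \<in> {1..n} \<Longrightarrow> c (int m) i \<noteq> 0"
    and k: "1 \<le> k" "k + 2 \<le> n" and us: "set us \<subseteq> {1..n}" "increasing (us @ [k])" "\<And>r. r < 2 * n \<Longrightarrow> foldr \<sigma> (us @ [k]) r = w0 r"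
  shows "vminor k (inv_word_eval us * (Theta_minus n (2 * n) V.mE V.mF c * mat_prod (2 * n) (map V.sbar [])))
    = (\<Sum>t<k. cext c (Suc t) (k - Suc t) / cext c (Suc t) (k - t))"
proof -
  interpret vector_rows n "cext c" "\<lambda>m i s. vprod c m $$ (i - 1, s)" "\<lambda>m j s. vprod c m $$ (2 * n - j, s)"
    by (rule vector_rows_vprod) (rule c)
  have k': "k \<in> {1..n}" and usk: "set (us @ [k]) \<subseteq> {1..n}" using k us(1) by auto
  obtain q where q: "k = Suc q" using k by (cases k) auto
  have one: "vprod c 1 * mat_prod (2 * n) (map V.sbar []) = vprod c 1"
    using right_mult_one_mat[OF vprod_carrier] by simp
  have "vminor k (inv_word_eval us * vprod c 1) = signed_det k (\<lambda>a b. vprod c 1 $$ (2 * n - (if a = q then Suc (Suc q) else Suc a), 1 - 1 + b))"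
  proof (rule vminor_signs)
    fix a b assume ab: "a < k" "b < k"
    define a' where "a' = (if a = q then k else a)"
    have r: "a < 2 * n" "b < 2 * n" "a' < n" "a' + 1 < n" "a' < 2 * n" "a' + 3 \<le> n \<or> a' = k" "a < n" using ab k by (auto simp: a'_def)
    have sa: "\<sigma> k a' = a" using \<sigma>_low[of k a'] r(3) ab q k by (auto simp: a'_def)
    have p: "vpair n k a' = (if a = q then - 1 else 0)"
    proof (cases "a = q")
      case True
      then show ?thesis using vpair_low[of k k] k by (simp add: a'_def)
    next
      case False
      then show ?thesis using vpair_first[OF k', of a] ab k q by (auto simp: a'_def)
    qed
    have "ups (us @ [k]) a' = a'" by (rule ups_full) (use us(3) r(3) in auto)
    then have "V.sgn_word (us @ [k]) a' = (- 1) ^ a'"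
      using sgn_word_increasing[OF usk us(2)] by simp
    then have s: "V.sgn_word us a = (- 1) ^ a"
      unfolding V.sgn_word_append_single sa p using q by (auto simp: a'_def split: if_splits)
    have f: "foldr \<sigma> us a = 2 * n - 1 - a'"
      using us(3)[OF r(5)] w0_low[OF r(4)] sa by simp
    have "(inv_word_eval us * vprod c 1) $$ (a, b) = V.sgn_word us a * vprod c 1 $$ (foldr \<sigma> us a, b)"
      by (rule V.word_inverse_row[OF us(1) r(1,2) vprod_carrier])
    also have "\<dots> = (- 1) ^ a * vprod c 1 $$ (2 * n - Suc a', b)" unfolding s f by simp
    also have "Suc a' = (if a = q then Suc (Suc q) else Suc a)" using q by (simp add: a'_def)
    finally show "(inv_word_eval us * vprod c 1) $$ (a, b)
        = (- 1) ^ a * vprod c 1 $$ (2 * n - (if a = q then Suc (Suc q) else Suc a), 1 - 1 + b)" by simp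
  qed
  also have "\<dots> = (\<Sum>t\<le>q. cext c (1 + t) (q - t) / cext c (1 + t) (Suc q - t))"
    unfolding q by (rule bar_minor_gap) (use q k in auto)
  also have "\<dots> = (\<Sum>t<k. cext c (Suc t) (k - Suc t) / cext c (Suc t) (k - t))"
    unfolding q lessThan_Suc_atMost by simp
  finally show ?thesis unfolding vprod_Theta[symmetric] one .
qed

end

section \<open>The half-spin representations\<close>

context minuscule
begin

lemma Yprod_Cons: "Yprod ((i, u) # w) = ybold i u * Yprod w" and Yprod_Nil: "Yprod [] = 1\<^sub>m N"
  by (simp_all add: Yprod_def)

lemma Yprod_carrier:
  assumes "fst ` set w \<subseteq> {1..n}"
  shows "Yprod w \<in> carrier_mat N N"
  unfolding Yprod_def by (rule mat_prod_carrier) (use assms in auto)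

lemma Yprod_append:
  assumes "fst ` set v \<subseteq> {1..n}" "fst ` set w \<subseteq> {1..n}"
  shows "Yprod (v @ w) = Yprod v * Yprod w"
  unfolding Yprod_def map_append by (rule mat_prod_append) (use assms in auto)

lemma Yprod_fixed_col:
  assumes "fst ` set w \<subseteq> {1..n}" "\<forall>(i, u)\<in>set w. u \<noteq> 0 \<and> p i s = 0" "B \<in> carrier_mat N N" "r < N" "s < N"
  shows "(B * Yprod w) $$ (r, s) = B $$ (r, s)"
  using assms(1,2,3)
proof (induction w arbitrary: B)
  case (Cons a w)
  obtain i u where a: "a = (i, u)" by (cases a)
  have i: "i \<in> {1..n}" and w: "fst ` set w \<subseteq> {1..n}" and u: "u \<noteq> 0" "p i s = 0" using Cons.prems a by auto
  have "B * Yprod (a # w) = B * ybold i u * Yprod w"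
    unfolding a Yprod_Cons by (rule assoc_mult_mat[symmetric, OF Cons.prems(3) ybold_carrier[OF i] Yprod_carrier[OF w]])
  moreover have "(B * ybold i u * Yprod w) $$ (r, s) = (B * ybold i u) $$ (r, s)"
    by (rule Cons.IH[OF w]) (use Cons.prems mult_carrier_mat[OF Cons.prems(3) ybold_carrier[OF i]] in auto)
  ultimately show ?case using ybold_col[OF Cons.prems(3) i assms(4,5) u(1)] u by simp
qed (simp add: Yprod_Nil right_mult_one_mat[of _ N N])

lemma ascending_append: "ascending (v @ w) r \<longleftrightarrow> ascending v (foldr sg w r) \<and> ascending w r"
  by (induction v) auto

text \<open>The letters after the last k fix both h and its reflection. That k acts on the lower
  weight of a string by the diagonal entry u, and the part of the word before it has extremal entry
  1.\<close>

lemma extremal_entry_last: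
  assumes ht: "\<And>i r. i \<in> {1..n} \<Longrightarrow> r < N \<Longrightarrow> ht (sg i r) = ht r - p i r"
    and w: "w = v @ (k, u) # v'" "fst ` set w \<subseteq> {1..n}" "\<forall>(i, u)\<in>set w. u \<noteq> 0"
    and h: "h < N" "p k h = 1" "\<forall>(i, u)\<in>set v'. p i h = 0 \<and> cartan_D n i k = 0"
    and asc: "ascending (map fst w) h"
  shows "Yprod w $$ (foldr sg (map fst w) h, sg k h) = u"
proof -
  have k: "k \<in> {1..n}" and v: "fst ` set v \<subseteq> {1..n}" and v': "fst ` set v' \<subseteq> {1..n}" and u: "u \<noteq> 0"
    using w by auto
  have sh: "sg k h < N" "p k (sg k h) = - 1" using sg_lt[OF k h(1)] p_sg_same[OF k h(1)] h(2) by auto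
  have fix0: "foldr sg (map fst v') h = h"
    using v' h(3) by (induction v') (auto simp: sg_fix h(1))
  have R: "foldr sg (map fst w) h = foldr sg (map fst v) (sg k h)" unfolding w(1) using fix0 by simp
  have Rl: "foldr sg (map fst w) h < N" by (rule foldr_sg_lt) (use w(2) h(1) in auto)
  have asc': "ascending (map fst v) (sg k h)"
    using asc fix0 unfolding w(1) by (simp add: ascending_append)
  have Yv: "Yprod v \<in> carrier_mat N N" by (rule Yprod_carrier[OF v])
  have Yk: "Yprod v * ybold k u \<in> carrier_mat N N" by (rule mult_carrier_mat[OF Yv ybold_carrier[OF k]])
  have "Yprod w = Yprod v * (ybold k u * Yprod v')"
    unfolding w(1) using Yprod_append[OF v, of "(k, u) # v'"] v' k by (simp add: Yprod_Cons)
  also have "\<dots> = Yprod v * ybold k u * Yprod v'"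
    by (rule assoc_mult_mat[symmetric, OF Yv ybold_carrier[OF k] Yprod_carrier[OF v']])
  finally have "Yprod w $$ (foldr sg (map fst w) h, sg k h) = (Yprod v * ybold k u * Yprod v') $$ (foldr sg (map fst w) h, sg k h)"
    by simp
  also have "\<dots> = (Yprod v * ybold k u) $$ (foldr sg (map fst w) h, sg k h)"
  proof (rule Yprod_fixed_col[OF v' _ Yk Rl sh(1)])
    show "\<forall>(i, u)\<in>set v'. u \<noteq> 0 \<and> p i (sg k h) = 0"
    proof (safe)
      fix i b assume i: "(i, b) \<in> set v'"
      then have "i \<in> {1..n}" using v' by force
      then show "p i (sg k h) = 0" using p_sg[OF k _ h(1), of i] h(3) i by auto
      show "(i, 0) \<in> set v' \<Longrightarrow> False" using w by fastforce
    qed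
  qed
  also have "\<dots> = u * Yprod v $$ (foldr sg (map fst w) h, sg k h)"
    using ybold_col[OF Yv k Rl sh(1) u] sh(2) by simp
  also have "Yprod v $$ (foldr sg (map fst w) h, sg k h) = 1"
    unfolding R using extremal_entry[of ht v "sg k h", OF ht _ sh(1) asc'] w v by fastforce
  finally show ?thesis by simp
qed

end

section \<open>The weights of the half-spin representations\<close>

context type_D
begin

text \<open>The weight \<open>(\<plusminus>1/2, \<dots>, \<plusminus>1/2)\<close> is encoded by the set of those weights of the vector
  representation that pair positively with it; \<open>spin_states\<close> collects both half-spin representations.\<close>

definition spin_states :: "nat set set" where
  "spin_states = {A. A \<subseteq> {..<2 * n} \<and> (\<forall>r<2 * n. opp r \<in> A \<longleftrightarrow> r \<notin> A)}"

definition spin_num :: nat where "spin_num = card spin_states"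

text \<open>Matrices are indexed by numbers, so the states are numbered in an arbitrary way.\<close>

definition spin_set :: "nat \<Rightarrow> nat set" where
  "spin_set = (SOME f. bij_betw f {0..<spin_num} spin_states)"

definition spin_idx :: "nat set \<Rightarrow> nat" where "spin_idx = the_inv_into {0..<spin_num} spin_set"

text \<open>The pairing with h_i is the difference of two coefficients 1/2 or -1/2, hence a
  difference of membership indicators.\<close>

definition spin_p :: "nat \<Rightarrow> nat \<Rightarrow> int" where
  "spin_p i r = of_bool (tp i \<in> spin_set r) - of_bool (bt i \<in> spin_set r)"

definition spin_sg :: "nat \<Rightarrow> nat \<Rightarrow> nat" where "spin_sg i r = spin_idx (\<sigma> i ` spin_set r)"

lemma spin_bij: "bij_betw spin_set {0..<spin_num} spin_states"
proof -
  have "finite spin_states" by (rule finite_subset[of _ "Pow {..<2 * n}"]) (auto simp: spin_states_def)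
  then have "\<exists>f. bij_betw f {0..<spin_num} spin_states" unfolding spin_num_def by (rule ex_bij_betw_nat_finite)
  then show ?thesis unfolding spin_set_def by (rule someI_ex)
qed

lemma spin_set_state: "r < spin_num \<Longrightarrow> spin_set r \<in> spin_states"
  using spin_bij by (auto simp: bij_betw_def)

lemma spin_idx: "A \<in> spin_states \<Longrightarrow> spin_idx A < spin_num" "A \<in> spin_states \<Longrightarrow> spin_set (spin_idx A) = A"
  and spin_idx_set: "r < spin_num \<Longrightarrow> spin_idx (spin_set r) = r"
proof -
  note b = spin_bij[unfolded bij_betw_def]
  show "A \<in> spin_states \<Longrightarrow> spin_set (spin_idx A) = A" unfolding spin_idx_def by (rule f_the_inv_into_f) (use b in auto)
  show "A \<in> spin_states \<Longrightarrow> spin_idx A < spin_num"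
    unfolding spin_idx_def using the_inv_into_into[of spin_set "{0..<spin_num}" A "{0..<spin_num}"] b by auto
  show "r < spin_num \<Longrightarrow> spin_idx (spin_set r) = r" unfolding spin_idx_def by (rule the_inv_into_f_f) (use b in auto)
qed

lemma stateD:
  assumes "A \<in> spin_states"
  shows "x \<in> A \<Longrightarrow> x < 2 * n" "r < 2 * n \<Longrightarrow> opp r \<in> A \<longleftrightarrow> r \<notin> A"
  using assms unfolding spin_states_def by blast+

lemma in_image_\<sigma>: "i \<in> {1..n} \<Longrightarrow> x \<in> \<sigma> i ` A \<longleftrightarrow> \<sigma> i x \<in> A"
  using \<sigma>_\<sigma>[of i] by (metis imageE imageI)

lemma \<sigma>_state:
  assumes i: "i \<in> {1..n}" and A: "A \<in> spin_states"
  shows "\<sigma> i ` A \<in> spin_states"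
  unfolding spin_states_def mem_Collect_eq
proof (intro conjI allI impI)
  show "\<sigma> i ` A \<subseteq> {..<2 * n}" using stateD(1)[OF A] \<sigma>_lt[OF i] by auto
  fix r assume r: "r < 2 * n"
  show "opp r \<in> \<sigma> i ` A \<longleftrightarrow> r \<notin> \<sigma> i ` A"
    unfolding in_image_\<sigma>[OF i] \<sigma>_opp[OF i r] by (rule stateD(2)[OF A \<sigma>_lt[OF i r]])
qed

lemma spin_sg_set: "i \<in> {1..n} \<Longrightarrow> r < spin_num \<Longrightarrow> spin_set (spin_sg i r) = \<sigma> i ` spin_set r"
  unfolding spin_sg_def by (intro spin_idx \<sigma>_state spin_set_state)

lemma spin_sg_lt: "i \<in> {1..n} \<Longrightarrow> r < spin_num \<Longrightarrow> spin_sg i r < spin_num"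
  unfolding spin_sg_def by (intro spin_idx \<sigma>_state spin_set_state)

lemma spin_eqI: "r < spin_num \<Longrightarrow> s < spin_num \<Longrightarrow> spin_set r = spin_set s \<Longrightarrow> r = s"
  using spin_idx_set by metis

lemma spin_coords:
  assumes r: "r < spin_num"
  shows "coords (\<lambda>i. spin_p i r) (\<lambda>x. if x \<in> spin_set r then 1 else - 1)"
  unfolding coords_def spin_p_def using stateD(2)[OF spin_set_state[OF r]] by simp

lemma spin_minuscule: "minuscule n spin_num spin_p spin_sg"
proof
  fix i r assume ir: "i \<in> {1..n}" "r < spin_num"
  show "spin_p i r \<in> {- 1, 0, 1}" by (simp add: spin_p_def)
  show "spin_sg i r < spin_num" by (rule spin_sg_lt[OF ir])
  have sg2: "spin_sg i r < spin_num" "spin_sg i (spin_sg i r) < spin_num" by (intro spin_sg_lt ir)+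
  show "spin_sg i (spin_sg i r) = r"
    by (rule spin_eqI[OF sg2(2) ir(2)])
      (simp add: spin_sg_set[OF ir(1) sg2(1)] spin_sg_set[OF ir] image_image \<sigma>_\<sigma>[OF ir(1)])
  have z: "(if \<sigma> i x \<in> spin_set r then 1 else - 1) = (if x \<in> spin_set r then 1 else - 1 :: int) - 2 * spin_p i r * vpair n i x"
    if "x < 2 * n" for x
    by (rule coords_\<sigma>[OF spin_coords[OF ir(2)] ir(1) that])
  show "spin_sg i r = r" if "spin_p i r = 0"
  proof (rule spin_eqI[OF sg2(1) ir(2)], rule Set.set_eqI)
    fix x
    have "\<sigma> i x \<in> spin_set r \<Longrightarrow> x < 2 * n"
      using stateD(1)[OF spin_set_state[OF ir(2)], of "\<sigma> i x"] \<sigma>_lt[OF ir(1), of "\<sigma> i x"] \<sigma>_\<sigma>[OF ir(1)] by auto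
    then show "x \<in> spin_set (spin_sg i r) \<longleftrightarrow> x \<in> spin_set r"
      unfolding spin_sg_set[OF ir] in_image_\<sigma>[OF ir(1)]
      using z[of x] that stateD(1)[OF spin_set_state[OF ir(2)], of x] by (auto split: if_splits)
  qed
  fix j assume j: "j \<in> {1..n}"
  have t: "tp j < 2 * n" "bt j < 2 * n" using tb_neq(10)[OF j] tb_neq(9)[OF j] .
  have "2 * spin_p j (spin_sg i r) = (if \<sigma> i (tp j) \<in> spin_set r then 1 else - 1) - (if \<sigma> i (bt j) \<in> spin_set r then 1 else - 1)"
    unfolding spin_p_def spin_sg_set[OF ir] in_image_\<sigma>[OF ir(1)] by simp
  also have "\<dots> = 2 * spin_p j r - 2 * spin_p i r * (vpair n i (tp j) - vpair n i (bt j))"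
    unfolding z[OF t(1)] z[OF t(2)] by (simp add: spin_p_def[of j] algebra_simps)
  finally show "spin_p j (spin_sg i r) = spin_p j r - spin_p i r * cartan_D n j i"
    unfolding vpair_tb[OF ir(1) j] by simp
next
  fix i j r assume ij: "i \<in> {1..n}" "j \<in> {1..n}" "i \<noteq> j" "cartan_D n i j = 0" "r < spin_num"
  have "refl_D n i (refl_D n j l) = refl_D n j (refl_D n i l)" for l
    using ij(4) cartan_D_simps(3)[of n i j] by (auto simp: refl_D_def fun_eq_iff)
  then have "weyl_word n [i, j] = weyl_word n [j, i]" by (auto simp: weyl_word_def fun_eq_iff)
  then have "\<sigma> i (\<sigma> j x) = \<sigma> j (\<sigma> i x)" if "x < 2 * n" for x using that ij weyl_word_eq[of "[i, j]" "[j, i]"] by auto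
  then have "\<sigma> i ` \<sigma> j ` spin_set r = \<sigma> j ` \<sigma> i ` spin_set r"
    using stateD(1)[OF spin_set_state[OF ij(5)]] unfolding image_image by (intro image_cong) auto
  then show "spin_sg i (spin_sg j r) = spin_sg j (spin_sg i r)"
    by (intro spin_eqI spin_sg_lt ij)
      (simp only: spin_sg_set[OF ij(1) spin_sg_lt[OF ij(2,5)]] spin_sg_set[OF ij(2) spin_sg_lt[OF ij(1,5)]] spin_sg_set[OF ij(1,5)] spin_sg_set[OF ij(2,5)])
qed

end

sublocale type_D \<subseteq> S: minuscule n spin_num spin_p spin_sg
  by (rule spin_minuscule)

section \<open>Heights, highest weights and the half-spin minors\<close>

context type_D
begin

text \<open>The height is the pairing with \<rho>: Z holds twice the coordinates of \<rho>, and the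
  weight is half the sum over its state, whence the division by 4. It need not be exact, but
  reflections change the sum by multiples of 4, so rounding does no harm.\<close>

lemma spin_height:
  "\<exists>ht. \<forall>i\<in>{1..n}. \<forall>r<spin_num. ht (spin_sg i r) = ht r - spin_p i r"
proof -
  obtain Z where Z: "coords (\<lambda>_. 1) Z" using coords_exists by blast
  define ht where "ht r = (\<Sum>x\<in>spin_set r. Z x) div 4" for r
  have "ht (spin_sg i r) = ht r - spin_p i r" if i: "i \<in> {1..n}" and r: "r < spin_num" for i r
  proof -
    let ?A = "spin_set r"
    note st = stateD[OF spin_set_state[OF r]]
    have fin: "finite ?A" by (rule finite_subset[of _ "{..<2 * n}"]) (use st(1) in auto)
    note nq = tb_neq[OF i]
    have "(\<Sum>x\<in>?A. vpair n i x) = (\<Sum>x\<in>?A. (of_bool (x = tp i) - of_bool (x = bt i)) + (of_bool (x = opp (bt i)) - of_bool (x = opp (tp i))))"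
      by (rule sum.cong[OF refl]) (use nq in \<open>auto simp: vpair_def\<close>)
    also have "\<dots> = (of_bool (tp i \<in> ?A) - of_bool (bt i \<in> ?A)) + (of_bool (opp (bt i) \<in> ?A) - of_bool (opp (tp i) \<in> ?A))"
      using fin by (simp add: sum.distrib sum_subtractf of_bool_def)
    also have "\<dots> = 2 * spin_p i r"
      using st(2)[OF nq(9)] st(2)[OF nq(10)] by (auto simp: spin_p_def)
    finally have v: "(\<Sum>x\<in>?A. vpair n i x) = 2 * spin_p i r" .
    have "(\<Sum>x\<in>spin_set (spin_sg i r). Z x) = (\<Sum>x\<in>?A. Z (\<sigma> i x))"
      unfolding spin_sg_set[OF i r] by (subst sum.reindex) (auto intro!: inj_onI dest: arg_cong[of _ _ "\<sigma> i"] simp: \<sigma>_\<sigma>[OF i])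
    also have "\<dots> = (\<Sum>x\<in>?A. Z x - 2 * vpair n i x)"
      by (rule sum.cong[OF refl]) (use coords_\<sigma>[OF Z i] st(1) in auto)
    also have "\<dots> = (\<Sum>x\<in>?A. Z x) - 2 * (\<Sum>x\<in>?A. vpair n i x)"
      by (simp add: sum_subtractf sum_distrib_left)
    also have "\<dots> = (\<Sum>x\<in>?A. Z x) - 4 * spin_p i r" unfolding v by simp
    finally show ?thesis unfolding ht_def by presburger
  qed
  then show ?thesis by blast
qed

lemma foldr_spin:
  assumes "set ks \<subseteq> {1..n}" "r < spin_num"
  shows "foldr spin_sg ks r < spin_num" "spin_set (foldr spin_sg ks r) = foldr \<sigma> ks ` spin_set r"
proof -
  show lt: "foldr spin_sg ks r < spin_num" by (rule S.foldr_sg_lt[OF assms])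
  show "spin_set (foldr spin_sg ks r) = foldr \<sigma> ks ` spin_set r"
    using assms(1)
  proof (induction ks)
    case (Cons i ks)
    then have "foldr spin_sg ks r < spin_num" using S.foldr_sg_lt[of ks r] assms(2) by simp
    then show ?case using Cons by (simp add: spin_sg_set image_image)
  qed simp
qed

text \<open>\<Lambda>_n has all coefficients 1/2. \<Lambda>_{n-1} has -1/2 in the last place, so its
  state contains n, the opposite of n - 1, instead of n - 1.\<close>

definition spin_hw :: "nat \<Rightarrow> nat" where
  "spin_hw k = spin_idx (if k = n then {..<n} else insert n {..<n - 1})"

lemma hw_state: "(if k = n then {..<n} else insert n {..<n - 1}) \<in> spin_states"
proof (cases "k = n")
  case True
  have "opp r < n \<longleftrightarrow> \<not> r < n" if "r < 2 * n" for r using that by linarith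
  then show ?thesis using True unfolding spin_states_def by auto
next
  case False
  have "opp r = n \<or> opp r < n - 1 \<longleftrightarrow> \<not> (r = n \<or> r < n - 1)" if "r < 2 * n" for r using that n4 by linarith
  moreover have "insert n {..<n - 1} \<subseteq> {..<2 * n}" using n4 by auto
  ultimately show ?thesis using False unfolding spin_states_def by simp
qed

lemma spin_hw: "spin_hw k < spin_num" "spin_set (spin_hw k) = (if k = n then {..<n} else insert n {..<n - 1})"
  unfolding spin_hw_def by (intro spin_idx hw_state)+

lemma spin_p_hw:
  assumes k: "k = n - 1 \<or> k = n" and i: "i \<in> {1..n}"
  shows "spin_p i (spin_hw k) = (if i = k then 1 else 0)"
proof (cases "k = n")
  case True
  have "tp i < n" "bt i < n \<longleftrightarrow> i \<noteq> n" using tb(1)[OF i] i by (auto simp: vbot_def)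
  then show ?thesis unfolding spin_p_def spin_hw using True by simp
next
  case False
  have "tp i = n \<or> tp i < n - 1" "bt i = n \<or> bt i < n - 1 \<longleftrightarrow> i \<noteq> n - 1"
    using i n4 by (auto simp: vbot_def vtop_def)
  then show ?thesis unfolding spin_p_def spin_hw using False k by simp
qed

text \<open>Along a reduced word w^{-1} \<alpha>_i is positive, so it pairs non-negatively with a
  dominant weight. In terms of states: if the larger of the two indices belongs to the highest
  weight state, so does the smaller.\<close>

lemma increasing_ascending:
  assumes k: "k = n - 1 \<or> k = n" and ks: "set ks \<subseteq> {1..n}" "increasing ks"
  shows "S.ascending ks (spin_hw k)"
  using ks
proof (induction ks)
  case (Cons i ks)
  then have ks: "set ks \<subseteq> {1..n}" and i: "i \<in> {1..n}" and inc: "fold \<sigma> ks (tp i) < fold \<sigma> ks (bt i)" by auto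
  have mem: "x \<in> foldr \<sigma> ks ` A \<longleftrightarrow> fold \<sigma> ks x \<in> A" for x A
  proof
    assume "x \<in> foldr \<sigma> ks ` A"
    then obtain a where "a \<in> A" "x = foldr \<sigma> ks a" by blast
    then show "fold \<sigma> ks x \<in> A" by (simp add: fold_foldr(1)[OF ks])
  next
    assume "fold \<sigma> ks x \<in> A"
    then have "foldr \<sigma> ks (fold \<sigma> ks x) \<in> foldr \<sigma> ks ` A" by (rule imageI)
    then show "x \<in> foldr \<sigma> ks ` A" by (simp add: fold_foldr(2)[OF ks])
  qed
  have ne: "fold \<sigma> ks (tp i) + fold \<sigma> ks (bt i) \<noteq> 2 * n - 1" by (rule ab_facts(4)[OF ks i])
  have "fold \<sigma> ks (bt i) \<in> spin_set (spin_hw k) \<Longrightarrow> fold \<sigma> ks (tp i) \<in> spin_set (spin_hw k)"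
  proof (cases "k = n")
    case False
    assume "fold \<sigma> ks (bt i) \<in> spin_set (spin_hw k)"
    then have "fold \<sigma> ks (bt i) = n \<or> fold \<sigma> ks (bt i) < n - 1" using False unfolding spin_hw by simp
    \<comment> \<open>The only index below n that is missing from the state of \<Lambda>_{n-1} is n
      - 1, and the pair (n - 1, n) is excluded by \<open>ne\<close>.\<close>
    then have "fold \<sigma> ks (tp i) < n - 1" using inc ne n4 by linarith
    then show ?thesis using False unfolding spin_hw by simp
  qed (use inc in \<open>auto simp: spin_hw\<close>)
  then have "spin_p i (foldr spin_sg ks (spin_hw k)) \<ge> 0"
    unfolding spin_p_def foldr_spin(2)[OF ks spin_hw(1)] mem by simp
  then show ?case using Cons by simp
qed simp

lemma spin_minor_cell:
  assumes k: "k = n - 1 \<or> k = n" and ab: "a \<in> unip n spin_num S.mF" "b \<in> unip n spin_num S.mE" and s: "\<forall>i\<in>{1..n}. s i \<noteq> 0"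
  shows "(a * torus_elt n spin_num S.mE S.mF s * b) $$ (spin_hw k, spin_hw k) = s k"
proof -
  note h = spin_hw(1)[of k]
  have p: "spin_p i (spin_hw k) \<noteq> - 1" if "i \<in> {1..n}" for i using spin_p_hw[OF k that] by simp
  have "(a * torus_elt n spin_num S.mE S.mF s * b) $$ (spin_hw k, spin_hw k) = torus_elt n spin_num S.mE S.mF s $$ (spin_hw k, spin_hw k)"
    by (rule S.cell_invariant[where M = "\<lambda>g. g $$ (spin_hw k, spin_hw k)", OF ab])
      (use p h in \<open>simp_all add: S.y_row S.x_col del: index_mult_mat\<close>)
  also have "\<dots> = (\<Prod>i=1..n. s i powi spin_p i (spin_hw k))" using S.torus_entry[OF s h h] by simp
  also have "\<dots> = (\<Prod>i=1..n. if i = k then s k else 1)"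
    by (rule prod.cong[OF refl]) (simp add: spin_p_hw[OF k])
  also have "\<dots> = s k" using k n4 by auto
  finally show ?thesis .
qed

text \<open>The left representative leads from the highest weight row to the row of w_0 \<Lambda>_k
  with sign 1, the right one from the column of \<Lambda>_k to that of s_k \<Lambda>_k. The last
  block ends with the letters n - 1, n, which are orthogonal, so for either k the value is the
  parameter of its last letter.\<close>

lemma spin_minor:
  assumes c: "\<And>m i. m \<in> {1..int n - 1} \<Longrightarrow> i \<in> {1..n} \<Longrightarrow> c m i \<noteq> 0"
    and k: "k = n - 1 \<or> k = n" and us: "set us \<subseteq> {1..n}" "increasing us" "\<And>r. r < 2 * n \<Longrightarrow> foldr \<sigma> us r = w0 r"
  shows "(word_eval spin_num S.mE S.mF (concat (map (\<lambda>i. [(True, i, 1), (False, i, - 1), (True, i, 1)]) (rev us)))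
      * (Theta_minus n spin_num S.mE S.mF c * mat_prod spin_num (map S.sbar [k]))) $$ (spin_hw k, spin_hw k) = c (int n - 1) k"
proof -
  define h where "h = spin_hw k"
  have h: "h < spin_num" unfolding h_def by (rule spin_hw)
  have kn: "k \<in> {1..n}" using k n4 by auto
  have ph: "spin_p i h = (if i = k then 1 else 0)" if "i \<in> {1..n}" for i unfolding h_def by (rule spin_p_hw[OF k that])
  define w where "w = map (\<lambda>(m, i). (i, c m i)) (List.product [1..int n - 1] [1..<Suc n])"
  have Th: "Theta_minus n spin_num S.mE S.mF c = S.Yprod w"
    unfolding Theta_minus_product S.Yprod_def w_def by (simp add: comp_def split_def del: upt_Suc)
  have w1: "fst ` set w \<subseteq> {1..n}" "\<forall>(i, u)\<in>set w. u \<noteq> 0" unfolding w_def using c by auto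
  have mw: "map fst w = i0"
  proof -
    have "map (\<lambda>(m, i). i) (List.product ms is) = concat (replicate (length ms) is)" for ms :: "int list" and "is" :: "nat list"
      by (induction ms) (simp_all add: comp_def)
    moreover have "nat (int n - 1) = n - 1" by linarith
    ultimately show ?thesis
      unfolding w_def i0_def by (simp add: comp_def split_def del: upt_Suc)
  qed
  \<comment> \<open>The chosen reduced word of w_0 and \<open>i0\<close> agree on indices, hence on
    states.\<close>
  have us0: "foldr spin_sg us h = foldr spin_sg i0 h"
  proof (rule spin_eqI)
    show "spin_set (foldr spin_sg us h) = spin_set (foldr spin_sg i0 h)"
      unfolding foldr_spin(2)[OF us(1) h] foldr_spin(2)[OF set_i0 h]
      by (rule image_cong[OF refl]) (use us(3) stateD(1)[OF spin_set_state[OF h]] in \<open>simp add: w0_def\<close>)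
  qed (intro foldr_spin us set_i0 h)+
  obtain v where v: "w = v @ [(n - 1, c (int n - 1) (n - 1)), (n, c (int n - 1) n)]"
  proof -
    have "[1..int n - 1] = [1..int n - 2] @ [int n - 1]" using n4 by (subst upto_rec2) auto
    moreover have "[1..<Suc n] = [1..<n - 1] @ [n - 1, n]"
    proof -
      obtain q where "n = Suc q" "1 \<le> q" using n4 by (cases n) auto
      then show ?thesis by simp
    qed
    ultimately show ?thesis using that unfolding w_def by (simp add: product_concat_map del: upt_Suc)
  qed
  obtain ht where ht: "\<And>i r. i \<in> {1..n} \<Longrightarrow> r < spin_num \<Longrightarrow> ht (spin_sg i r) = ht r - spin_p i r"
    using spin_height by blast
  have asc: "S.ascending (map fst w) h" unfolding mw h_def by (rule increasing_ascending[OF k set_i0 increasing_i0])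
  have val: "S.Yprod w $$ (foldr spin_sg (map fst w) h, spin_sg k h) = c (int n - 1) k"
  proof (cases "k = n")
    case True
    show ?thesis
      by (rule S.extremal_entry_last[OF ht, of w "v @ [(n - 1, c (int n - 1) (n - 1))]" k _ "[]"])
        (use v w1 h ph[OF kn] asc True in auto)
  next
    case False
    then have k': "k = n - 1" using k by simp
    have "cartan_D n n (n - 1) = 0" "n \<in> {1..n}" using n4 by (auto simp: cartan_D_def doubleton_eq_iff)
    then show ?thesis
      by (intro S.extremal_entry_last[OF ht, of w v k _ "[(n, c (int n - 1) n)]"])
        (use v w1 h ph[OF kn] ph[of n] asc k' False in auto)
  qed
  let ?G = "S.Yprod w * mat_prod spin_num (map S.sbar [k])"
  have sc: "S.sbar k \<in> carrier_mat spin_num spin_num" using kn by simp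
  have sb: "mat_prod spin_num (map S.sbar [k]) = S.sbar k" using right_mult_one_mat[OF sc] by simp
  have Yc: "S.Yprod w \<in> carrier_mat spin_num spin_num" by (rule S.Yprod_carrier[OF w1(1)])
  have G: "?G \<in> carrier_mat spin_num spin_num" unfolding sb by (rule mult_carrier_mat[OF Yc sc])
  have "(word_eval spin_num S.mE S.mF (concat (map (\<lambda>i. [(True, i, 1), (False, i, - 1), (True, i, 1)]) (rev us))) * ?G) $$ (h, h)
      = S.sgn_word us h * ?G $$ (foldr spin_sg us h, h)"
    by (rule S.word_inverse_row[OF us(1) h h G])
  also have "S.sgn_word us h = 1"
    unfolding h_def by (rule S.sgn_ascending[OF us(1) increasing_ascending[OF k us(1,2)]])
  also have "?G $$ (foldr spin_sg us h, h) = S.Yprod w $$ (foldr spin_sg us h, spin_sg k h)"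
    unfolding sb using S.sbar_col[OF Yc kn foldr_spin(1)[OF us(1) h] h] ph[OF kn] by simp
  also have "\<dots> = c (int n - 1) k" unfolding us0 using val unfolding mw .
  finally show ?thesis unfolding Th h_def by simp
qed

end

section \<open>The vector crystal in Laurent monomials\<close>

lemma lookup_c_var: "Poly_Mapping.lookup (c_var m i) x = (if x = (m, i) then 1 else 0)"
  by (simp add: c_var_def lookup_single when_def)

lemma single_minus_one: "Poly_Mapping.single (m, i) (- 1) = - c_var m i"
  by (rule poly_mapping_eqI) (simp add: c_var_def lookup_single when_def)

lemma mon_eval_superset:
  assumes "finite S" "Poly_Mapping.keys Y \<subseteq> S"
  shows "mon_eval c Y = (\<Prod>(m, i)\<in>S. c m i powi Poly_Mapping.lookup Y (m, i))"
  unfolding mon_eval_def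
  by (rule prod.mono_neutral_left[OF assms]) (auto simp: in_keys_iff)

lemma mon_eval_c_var: "mon_eval c (c_var a i) = c a i"
proof -
  have "mon_eval c (c_var a i) = (\<Prod>(m, l)\<in>{(a, i)}. c m l powi Poly_Mapping.lookup (c_var a i) (m, l))"
    by (rule mon_eval_superset) (auto simp: in_keys_iff lookup_c_var split: if_splits)
  then show ?thesis by (simp add: lookup_c_var)
qed

lemma mon_eval_inverse: "mon_eval c (- c_var a i) = 1 / c a i"
proof -
  have "mon_eval c (- c_var a i) = (\<Prod>(m, l)\<in>{(a, i)}. c m l powi Poly_Mapping.lookup (- c_var a i) (m, l))"
    by (rule mon_eval_superset) (auto simp: in_keys_iff lookup_c_var split: if_splits)
  then show ?thesis by (simp add: lookup_c_var power_int_minus divide_inverse)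
qed

lemma mon_eval_quotient:
  assumes "(a, i) \<noteq> (b, j)"
  shows "mon_eval c (c_var a i - c_var b j) = c a i / c b j"
proof -
  have ne: "((a, i) = (b, j)) = False" "((b, j) = (a, i)) = False" using assms by auto
  have "mon_eval c (c_var a i - c_var b j)
      = (\<Prod>(m, l)\<in>{(a, i), (b, j)}. c m l powi Poly_Mapping.lookup (c_var a i - c_var b j) (m, l))"
    by (rule mon_eval_superset) (auto simp: in_keys_iff lookup_c_var lookup_minus split: if_splits)
  also have "\<dots> = c a i powi Poly_Mapping.lookup (c_var a i - c_var b j) (a, i)
      * c b j powi Poly_Mapping.lookup (c_var a i - c_var b j) (b, j)"
    using assms by simp
  also have "Poly_Mapping.lookup (c_var a i - c_var b j) (a, i) = 1"
    by (simp only: lookup_c_var lookup_minus ne) simp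
  also have "Poly_Mapping.lookup (c_var a i - c_var b j) (b, j) = - 1"
    by (simp only: lookup_c_var lookup_minus ne) simp
  finally show ?thesis by (simp add: power_int_minus divide_inverse)
qed

lemma mon_eval_quotient_left:
  assumes "(a, i) \<noteq> (b, j)" "(a, i) \<noteq> (d, l)" "(b, j) \<noteq> (d, l)"
  shows "mon_eval c (c_var a i + c_var b j - c_var d l) = c a i * c b j / c d l"
proof -
  have ne: "((a, i) = (b, j)) = False" "((b, j) = (a, i)) = False" "((a, i) = (d, l)) = False" "((d, l) = (a, i)) = False"
    "((b, j) = (d, l)) = False" "((d, l) = (b, j)) = False" using assms by auto
  have "mon_eval c (c_var a i + c_var b j - c_var d l)
      = (\<Prod>(m, l')\<in>{(a, i), (b, j), (d, l)}. c m l' powi Poly_Mapping.lookup (c_var a i + c_var b j - c_var d l) (m, l'))"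
    by (rule mon_eval_superset) (auto simp: in_keys_iff lookup_c_var lookup_minus lookup_add split: if_splits)
  also have "\<dots> = c a i powi Poly_Mapping.lookup (c_var a i + c_var b j - c_var d l) (a, i)
      * (c b j powi Poly_Mapping.lookup (c_var a i + c_var b j - c_var d l) (b, j) * c d l powi Poly_Mapping.lookup (c_var a i + c_var b j - c_var d l) (d, l))"
    using assms by simp
  also have "Poly_Mapping.lookup (c_var a i + c_var b j - c_var d l) (a, i) = 1"
    by (simp only: lookup_c_var lookup_minus lookup_add ne) simp
  also have "Poly_Mapping.lookup (c_var a i + c_var b j - c_var d l) (b, j) = 1"
    by (simp only: lookup_c_var lookup_minus lookup_add ne) simp
  also have "Poly_Mapping.lookup (c_var a i + c_var b j - c_var d l) (d, l) = - 1"
    by (simp only: lookup_c_var lookup_minus lookup_add ne) simp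
  finally show ?thesis by (simp add: power_int_minus divide_inverse mult.assoc)
qed

lemma mon_eval_quotient_right:
  assumes "(a, i) \<noteq> (b, j)" "(a, i) \<noteq> (d, l)" "(b, j) \<noteq> (d, l)"
  shows "mon_eval c (c_var a i - c_var b j - c_var d l) = c a i / (c b j * c d l)"
proof -
  have ne: "((a, i) = (b, j)) = False" "((b, j) = (a, i)) = False" "((a, i) = (d, l)) = False" "((d, l) = (a, i)) = False"
    "((b, j) = (d, l)) = False" "((d, l) = (b, j)) = False" using assms by auto
  have "mon_eval c (c_var a i - c_var b j - c_var d l)
      = (\<Prod>(m, l')\<in>{(a, i), (b, j), (d, l)}. c m l' powi Poly_Mapping.lookup (c_var a i - c_var b j - c_var d l) (m, l'))"
    by (rule mon_eval_superset) (auto simp: in_keys_iff lookup_c_var lookup_minus split: if_splits)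
  also have "\<dots> = c a i powi Poly_Mapping.lookup (c_var a i - c_var b j - c_var d l) (a, i)
      * (c b j powi Poly_Mapping.lookup (c_var a i - c_var b j - c_var d l) (b, j) * c d l powi Poly_Mapping.lookup (c_var a i - c_var b j - c_var d l) (d, l))"
    using assms by simp
  also have "Poly_Mapping.lookup (c_var a i - c_var b j - c_var d l) (a, i) = 1"
    by (simp only: lookup_c_var lookup_minus lookup_add ne) simp
  also have "Poly_Mapping.lookup (c_var a i - c_var b j - c_var d l) (b, j) = - 1"
    by (simp only: lookup_c_var lookup_minus lookup_add ne) simp
  also have "Poly_Mapping.lookup (c_var a i - c_var b j - c_var d l) (d, l) = - 1"
    by (simp only: lookup_c_var lookup_minus lookup_add ne) simp
  finally show ?thesis by (simp add: power_int_minus divide_inverse)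
qed

text \<open>The partial exponent sums jump from 0 to 1 at m0, so \<phi>_i is 1 and its maximum is
  first attained at m0. All arrows followed below are of this kind.\<close>

lemma mon_f_single:
  assumes l: "\<And>m. Poly_Mapping.lookup Y (m, i) = (if m = m0 then 1 else 0)"
  shows "mon_f n p i Y = Some (Y - A_mon n p m0 i)"
proof -
  have ps: "psum Y i m = (if m0 \<le> m then 1 else 0)" for m
  proof -
    have "{k. k \<le> m \<and> (k, i) \<in> Poly_Mapping.keys Y} = (if m0 \<le> m then {m0} else {})"
      by (auto simp: in_keys_iff l split: if_splits)
    then show ?thesis unfolding psum_def by (simp add: l)
  qed
  have "range (psum Y i) = {0, 1}"
  proof -
    have "psum Y i m0 = 1" "psum Y i (m0 - 1) = 0" by (simp_all add: ps)
    then have "0 \<in> range (psum Y i)" "1 \<in> range (psum Y i)" by (metis rangeI)+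
    moreover have "range (psum Y i) \<subseteq> {0, 1}" by (auto simp: ps)
    ultimately show ?thesis by blast
  qed
  then have phi: "mon_phi i Y = 1" by (simp add: mon_phi_def)
  have "(LEAST m. mon_phi i Y = psum Y i m) = m0"
    by (rule Least_equality) (auto simp: phi ps split: if_splits)
  then show ?thesis by (simp add: mon_f_def phi)
qed

section \<open>The monomials of the vector crystal\<close>

lemma A_mon_sum:
  assumes "S \<subseteq> {1..n} - {i}" "\<And>j. j \<in> {1..n} - {i} \<Longrightarrow> cartan_D n j i = (if j \<in> S then - 1 else 0)"
  shows "A_mon n p0 m i = c_var m i + c_var (m + 1) i - (\<Sum>j\<in>S. c_var (m + p0 j i) j)"
proof -
  have "(\<Sum>j\<in>{1..n} - {i}. Poly_Mapping.single (m + p0 j i, j) (cartan_D n j i))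
      = (\<Sum>j\<in>S. Poly_Mapping.single (m + p0 j i, j) (cartan_D n j i))"
    by (rule sum.mono_neutral_right) (use assms in auto)
  also have "\<dots> = (\<Sum>j\<in>S. - c_var (m + p0 j i) j)"
  proof (rule sum.cong[OF refl])
    fix j assume "j \<in> S"
    then have "j \<in> {1..n} - {i}" using assms(1) by (rule rev_subsetD)
    then have "cartan_D n j i = - 1" using assms(2)[of j] \<open>j \<in> S\<close> by simp
    then show "Poly_Mapping.single (m + p0 j i, j) (cartan_D n j i) = - c_var (m + p0 j i) j"
      by (simp only: single_minus_one)
  qed
  finally show ?thesis by (simp add: A_mon_def sum_negf)
qed

text \<open>A neighbour j < i carries the shift p_{j,i} = 1, a neighbour j > i the shift 0; node 1
  has no lower neighbour.\<close>

lemma A_mon_low: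
  assumes n: "n \<ge> 4" and i: "1 \<le> i" "i + 3 \<le> n"
  shows "A_mon n p0 m i = c_var m i + c_var (m + 1) i - (if i = 1 then 0 else c_var (m + 1) (i - 1)) - c_var m (i + 1)"
proof (cases "i = 1")
  case True
  have "A_mon n p0 m i = c_var m i + c_var (m + 1) i - (\<Sum>j\<in>{i + 1}. c_var (m + p0 j i) j)"
    by (rule A_mon_sum) (use n i True in \<open>auto simp: cartan_D_def doubleton_eq_iff\<close>)
  then show ?thesis using True by (simp add: p0_def)
next
  case False
  have "A_mon n p0 m i = c_var m i + c_var (m + 1) i - (\<Sum>j\<in>{i - 1, i + 1}. c_var (m + p0 j i) j)"
    by (rule A_mon_sum) (use n i False in \<open>auto simp: cartan_D_def doubleton_eq_iff\<close>)
  also have "(\<Sum>j\<in>{i - 1, i + 1}. c_var (m + p0 j i) j) = c_var (m + 1) (i - 1) + c_var m (i + 1)"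
    using i False by (subst sum.insert) (auto simp: p0_def)
  finally show ?thesis using False by (simp add: algebra_simps)
qed

lemma A_mon_branch:
  assumes n: "n \<ge> 4"
  shows "A_mon n p0 m (n - 2) = c_var m (n - 2) + c_var (m + 1) (n - 2) - c_var (m + 1) (n - 3) - c_var m (n - 1) - c_var m n"
proof -
  obtain q where q: "n = q + 4" using n by (metis add.commute le_add_diff_inverse)
  have "A_mon n p0 m (n - 2) = c_var m (n - 2) + c_var (m + 1) (n - 2) - (\<Sum>j\<in>{n - 3, n - 1, n}. c_var (m + p0 j (n - 2)) j)"
    by (rule A_mon_sum) (auto simp: q cartan_D_def doubleton_eq_iff)
  also have "(\<Sum>j\<in>{n - 3, n - 1, n}. c_var (m + p0 j (n - 2)) j) = c_var (m + 1) (n - 3) + (c_var m (n - 1) + c_var m n)"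
    by (simp add: p0_def q)
  finally show ?thesis by (simp add: algebra_simps)
qed

lemma A_mon_end:
  assumes n: "n \<ge> 4" and i: "i = n - 1 \<or> i = n"
  shows "A_mon n p0 m i = c_var m i + c_var (m + 1) i - c_var (m + 1) (n - 2)"
proof -
  have "A_mon n p0 m i = c_var m i + c_var (m + 1) i - (\<Sum>j\<in>{n - 2}. c_var (m + p0 j i) j)"
    by (rule A_mon_sum) (use n i in \<open>auto simp: cartan_D_def doubleton_eq_iff\<close>)
  then show ?thesis using n i by (auto simp: p0_def)
qed

definition V_mon :: "nat \<Rightarrow> int \<Rightarrow> nat \<Rightarrow> monomial" where
  "V_mon n k j = (if j = n then c_var k n - c_var (k + 1) (n - 1)
     else if j = n - 1 then c_var k (n - 1) + c_var k n - c_var (k + 1) (n - 2)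
     else c_var k j - (if j = 1 then 0 else c_var (k + 1) (j - 1)))"

definition Vbar_mon :: "nat \<Rightarrow> int \<Rightarrow> nat \<Rightarrow> monomial" where
  "Vbar_mon n k j = (if j = n then c_var k (n - 1) - c_var (k + 1) n
     else if j = n - 1 then c_var (k + 1) (n - 2) - c_var (k + 1) (n - 1) - c_var (k + 1) n
     else (if j = 1 then 0 else c_var (k + int n - int j) (j - 1)) - c_var (k + int n - int j) j)"

lemma V_mon_step:
  assumes n: "n \<ge> 4" and j: "1 \<le> j" "j + 2 \<le> n"
  shows "mon_f n p0 j (V_mon n k j) = Some (V_mon n k (j + 1))"
proof -
  have Y: "V_mon n k j = c_var k j - (if j = 1 then 0 else c_var (k + 1) (j - 1))" using j by (auto simp: V_mon_def)
  have "mon_f n p0 j (V_mon n k j) = Some (V_mon n k j - A_mon n p0 k j)"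
    unfolding Y by (rule mon_f_single) (use j in \<open>auto simp: lookup_minus lookup_c_var\<close>)
  also have "V_mon n k j - A_mon n p0 k j = V_mon n k (j + 1)"
  proof (cases "j + 3 \<le> n")
    case True
    then show ?thesis unfolding Y A_mon_low[OF n j(1) True] using j by (auto simp: V_mon_def algebra_simps)
  next
    case False
    then have e: "j = n - 2" using j by simp
    then show ?thesis unfolding Y e A_mon_branch[OF n] using n by (auto simp: V_mon_def algebra_simps numeral_3_eq_3 Suc_diff_Suc)
  qed
  finally show ?thesis .
qed

lemma V_mon_end:
  assumes n: "n \<ge> 4"
  shows "mon_f n p0 (n - 1) (V_mon n k (n - 1)) = Some (V_mon n k n)"
    and "mon_f n p0 n (V_mon n k (n - 1)) = Some (Vbar_mon n k n)"
    and "mon_f n p0 (n - 1) (Vbar_mon n k n) = Some (Vbar_mon n k (n - 1))"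
proof -
  have "n - 1 \<noteq> n" using n by simp
  note V_mon_n = V_mon_def[of n k n, simplified] and Vbar_mon_n = Vbar_mon_def[of n k "n - 1", unfolded if_not_P[OF this] if_P[OF refl]]
  have Y: "V_mon n k (n - 1) = c_var k (n - 1) + c_var k n - c_var (k + 1) (n - 2)" using n by (auto simp: V_mon_def)
  have Y': "Vbar_mon n k n = c_var k (n - 1) - c_var (k + 1) n" by (simp add: Vbar_mon_def)
  have "mon_f n p0 (n - 1) (V_mon n k (n - 1)) = Some (V_mon n k (n - 1) - A_mon n p0 k (n - 1))"
    unfolding Y by (rule mon_f_single) (use n in \<open>auto simp: lookup_minus lookup_add lookup_c_var\<close>)
  also have "V_mon n k (n - 1) - A_mon n p0 k (n - 1) = V_mon n k n"
    unfolding Y A_mon_end[OF n disjI1[OF refl]] by (simp add: V_mon_n)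
  finally show "mon_f n p0 (n - 1) (V_mon n k (n - 1)) = Some (V_mon n k n)" .
  have "mon_f n p0 n (V_mon n k (n - 1)) = Some (V_mon n k (n - 1) - A_mon n p0 k n)"
    unfolding Y by (rule mon_f_single) (use n in \<open>auto simp: lookup_minus lookup_add lookup_c_var\<close>)
  also have "V_mon n k (n - 1) - A_mon n p0 k n = Vbar_mon n k n"
    unfolding Y Y' A_mon_end[OF n disjI2[OF refl]] by (simp add: algebra_simps)
  finally show "mon_f n p0 n (V_mon n k (n - 1)) = Some (Vbar_mon n k n)" .
  have "mon_f n p0 (n - 1) (Vbar_mon n k n) = Some (Vbar_mon n k n - A_mon n p0 k (n - 1))"
    unfolding Y' by (rule mon_f_single) (use n in \<open>auto simp: lookup_minus lookup_c_var\<close>)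
  also have "Vbar_mon n k n - A_mon n p0 k (n - 1) = Vbar_mon n k (n - 1)"
    unfolding Y' A_mon_end[OF n disjI1[OF refl]] Vbar_mon_n by simp
  finally show "mon_f n p0 (n - 1) (Vbar_mon n k n) = Some (Vbar_mon n k (n - 1))" .
qed

lemma Vbar_mon_step:
  assumes n: "n \<ge> 4" and j: "1 \<le> j" "j + 2 \<le> n"
  shows "mon_f n p0 j (Vbar_mon n k (j + 1)) = Some (Vbar_mon n k j)"
proof (cases "j + 3 \<le> n")
  case True
  let ?M = "k + int n - int j - 1"
  have Y: "Vbar_mon n k (j + 1) = c_var ?M j - c_var ?M (j + 1)"
    using True j by (auto simp: Vbar_mon_def algebra_simps)
  have "mon_f n p0 j (Vbar_mon n k (j + 1)) = Some (Vbar_mon n k (j + 1) - A_mon n p0 ?M j)"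
    unfolding Y by (rule mon_f_single) (auto simp: lookup_minus lookup_c_var)
  also have "Vbar_mon n k (j + 1) - A_mon n p0 ?M j = Vbar_mon n k j"
    unfolding Y A_mon_low[OF n j(1) True] using True by (auto simp: Vbar_mon_def algebra_simps)
  finally show ?thesis .
next
  case False
  then have e: "j = n - 2" using j by simp
  have e1: "n - 2 + 1 = n - 1" using n by simp
  have Y: "Vbar_mon n k (n - 1) = c_var (k + 1) (n - 2) - c_var (k + 1) (n - 1) - c_var (k + 1) n"
    using n by (auto simp: Vbar_mon_def)
  have "mon_f n p0 (n - 2) (Vbar_mon n k (n - 1)) = Some (Vbar_mon n k (n - 1) - A_mon n p0 (k + 1) (n - 2))"
    unfolding Y by (rule mon_f_single) (use n in \<open>auto simp: lookup_minus lookup_c_var\<close>)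
  also have "Vbar_mon n k (n - 1) - A_mon n p0 (k + 1) (n - 2) = c_var (k + 2) (n - 3) - c_var (k + 2) (n - 2)"
    unfolding Y A_mon_branch[OF n] by (simp add: algebra_simps)
  also have "\<dots> = Vbar_mon n k (n - 2)"
  proof -
    have "k + int n - int (n - 2) = k + 2" "n - 2 - 1 = n - 3" "n - 2 \<noteq> n" "n - 2 \<noteq> n - 1" "n - 2 \<noteq> 1" using n by auto
    then show ?thesis by (simp only: Vbar_mon_def if_False)
  qed
  finally show ?thesis unfolding e e1 .
qed

text \<open>The value on the highest weight element determines \<psi>, because every label is
  reached from \<open>V 1\<close> along arrows: up to \<open>V (n - 1)\<close>, from there by
  f_{n-1} to \<open>V n\<close> and by f_n to \<open>Vbar n\<close>, and on from
  \<open>Vbar n\<close> down to \<open>Vbar 1\<close>.\<close>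

lemma embedded_vector_crystal:
  assumes n: "n \<ge> 4" and v: "vec_labelling n v"
    and \<psi>: "crystal_embedding n (fund_crystal n 1) (mon_crystal n p0) \<psi>" "\<psi> (hw_elt 1) = c_var k 1"
    and j: "j \<in> {1..n}"
  shows "\<psi> (v (V j)) = V_mon n k j" "\<psi> (v (Vbar j)) = Vbar_mon n k j"
proof -
  have step: "\<psi> (v b') = Y" if b: "b \<in> V ` {1..n} \<union> Vbar ` {1..n}" and i: "i \<in> {1..n}"
    and f: "vec_f n i b = Some b'" and Y: "mon_f n p0 i (\<psi> (v b)) = Some Y" for b b' i Y
  proof -
    have "v b \<in> cr_set (fund_crystal n 1)" using v b unfolding vec_labelling_def bij_betw_def by blast
    then have "cr_f (mon_crystal n p0) i (\<psi> (v b)) = map_option \<psi> (cr_f (fund_crystal n 1) i (v b))"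
      using \<psi>(1) i unfolding crystal_embedding_def by blast
    moreover have "cr_f (fund_crystal n 1) i (v b) = map_option v (vec_f n i b)"
      using v b i unfolding vec_labelling_def by blast
    ultimately show ?thesis using f Y by (simp add: mon_crystal_def)
  qed
  have 1: "\<psi> (v (V 1)) = V_mon n k 1" using v \<psi>(2) n by (auto simp: vec_labelling_def V_mon_def)
  have V: "\<psi> (v (V j)) = V_mon n k j" if "1 \<le> j" "j + 1 \<le> n" for j
    using that
  proof (induction j)
    case (Suc j)
    show ?case
    proof (cases "j = 0")
      case False
      then have IH: "\<psi> (v (V j)) = V_mon n k j" using Suc by simp
      have "\<psi> (v (V (j + 1))) = V_mon n k (j + 1)"
        by (rule step[of "V j" j]) (use False Suc.prems n V_mon_step[OF n, of j k] IH in auto)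
      then show ?thesis by simp
    qed (use 1 in simp)
  qed simp
  have V': "\<psi> (v (V (n - 1))) = V_mon n k (n - 1)" using V[of "n - 1"] n by simp
  have Vn: "\<psi> (v (V n)) = V_mon n k n"
    by (rule step[of "V (n - 1)" "n - 1"]) (use n V' V_mon_end(1)[OF n] in auto)
  have Bn: "\<psi> (v (Vbar n)) = Vbar_mon n k n"
    by (rule step[of "V (n - 1)" n]) (use n V' V_mon_end(2)[OF n] in auto)
  have Bn1: "\<psi> (v (Vbar (n - 1))) = Vbar_mon n k (n - 1)"
    by (rule step[of "Vbar n" "n - 1"]) (use n Bn V_mon_end(3)[OF n] in auto)
  have B: "\<psi> (v (Vbar (n - 1 - t))) = Vbar_mon n k (n - 1 - t)" if "t + 2 \<le> n" for t
    using that
  proof (induction t)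
    case (Suc t)
    have e: "n - 1 - t = (n - 1 - Suc t) + 1" using Suc.prems by simp
    show ?case
      by (rule step[of "Vbar (n - 1 - t)" "n - 1 - Suc t"])
        (use Suc n Vbar_mon_step[OF n, of "n - 1 - Suc t" k] e in auto)
  qed (use Bn1 in simp)
  show "\<psi> (v (V j)) = V_mon n k j" using V[of j] Vn j by (cases "j = n") auto
  show "\<psi> (v (Vbar j)) = Vbar_mon n k j" using B[of "n - 1 - j"] Bn j by (cases "j = n") auto
qed

lemma eval_V_mon:
  assumes "n \<ge> 4" "1 \<le> j" "j \<le> n"
  shows "mon_eval c (V_mon n k j) = (if j = n then c k n / c (k + 1) (n - 1)
     else if j = n - 1 then c k (n - 1) * c k n / c (k + 1) (n - 2)
     else c k j / (if j = 1 then 1 else c (k + 1) (j - 1)))"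
  using assms by (auto simp: V_mon_def mon_eval_quotient mon_eval_quotient_left mon_eval_c_var)

lemma eval_Vbar_mon:
  assumes "n \<ge> 4" "1 \<le> j" "j \<le> n"
  shows "mon_eval c (Vbar_mon n k j) = (if j = n then c k (n - 1) / c (k + 1) n
     else if j = n - 1 then c (k + 1) (n - 2) / (c (k + 1) (n - 1) * c (k + 1) n)
     else (if j = 1 then 1 else c (k + int n - int j) (j - 1)) / c (k + int n - int j) j)"
  using assms by (auto simp: Vbar_mon_def mon_eval_quotient mon_eval_quotient_right mon_eval_inverse)

section \<open>The generalized minors\<close>

context type_D
begin

lemma eval_V_mon_low:
  assumes "1 \<le> j" "j + 2 \<le> n"
  shows "mon_eval c (V_mon n (int k) j) = cext c k j / cext c (Suc k) (j - 1)"
proof -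
  have j: "j \<le> n" "(j = n) = False" "(j = n - 1) = False" "(j - 1 = 0) = (j = 1)" "(j = 0) = False" using assms by auto
  have k: "int (Suc k) = int k + 1" by simp
  show ?thesis unfolding eval_V_mon[OF n4 assms(1) j(1)] cext_def k j(2-5) by simp
qed

lemma eval_Vbar_mon_high:
  assumes "1 \<le> j" "j < n" "int m = k + int n - int j"
  shows "mon_eval c (Vbar_mon n k j) = step_coef n (cext c) m j"
proof -
  have j: "j \<le> n" "(j = n) = False" "(j = 0) = False" "(j - 1 = 0) = (j = 1)" using assms by auto
  show ?thesis
  proof (cases "j = n - 1")
    case True
    have "(n - 2 = 0) = False" "(n - 1 = 0) = False" "(n = 0) = False" "k + 1 = int m" using True assms n4 by auto
    then show ?thesis
      unfolding eval_Vbar_mon[OF n4 assms(1) j(1)] step_coef_def cext_def j(2) using True by simp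
  next
    case False
    then have "(j = n - 1) = False" by simp
    then show ?thesis
      unfolding eval_Vbar_mon[OF n4 assms(1) j(1)] step_coef_def cext_def j(2-4) assms(3)[symmetric] by simp
  qed
qed

text \<open>The summands on the left are the monomials of v_1, ..., v_{n-2}, then of v_{n-1}, v-bar
  n and v_n, and finally of v-bar n - 1, ..., v-bar k + 1, where t = n - 1 - j.\<close>

lemma eval_longest_sum:
  assumes k: "1 \<le> k" "k + 2 \<le> n"
  shows "(\<Sum>j=1..n - 2. cext c k j / cext c (Suc k) (j - 1)) + cext c k (n - 1) * cext c k n / cext c (Suc k) (n - 2)
    + cext c k (n - 1) / cext c (Suc k) n + cext c k n / cext c (Suc k) (n - 1)
    + (\<Sum>t<n - Suc k. step_coef n (cext c) (Suc k + t) (n - 1 - t))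
    = (\<Sum>j=1..n. mon_eval c (V_mon n (int k) j)) + (\<Sum>j=k + 1..n. mon_eval c (Vbar_mon n (int k) j))"
proof -
  have low: "(\<Sum>j=1..n - 2. mon_eval c (V_mon n (int k) j)) = (\<Sum>j=1..n - 2. cext c k j / cext c (Suc k) (j - 1))"
  proof (rule sum.cong[OF refl])
    fix j assume "j \<in> {1..n - 2}"
    then have "1 \<le> j" "j + 2 \<le> n" using n4 by auto
    then show "mon_eval c (V_mon n (int k) j) = cext c k j / cext c (Suc k) (j - 1)" by (rule eval_V_mon_low)
  qed
  have high: "(\<Sum>j=k + 1..n - 1. mon_eval c (Vbar_mon n (int k) j)) = (\<Sum>t<n - Suc k. step_coef n (cext c) (Suc k + t) (n - 1 - t))"
  proof (rule sum.reindex_bij_witness[of _ "\<lambda>t. n - 1 - t" "\<lambda>j. n - 1 - j"])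
    fix j assume j: "j \<in> {k + 1..n - 1}"
    then have e: "n - 1 - (n - 1 - j) = j" "1 \<le> j" "j < n" using k by auto
    have "int (Suc k + (n - 1 - j)) = int k + int n - int j" using e by linarith
    then show "step_coef n (cext c) (Suc k + (n - 1 - j)) (n - 1 - (n - 1 - j)) = mon_eval c (Vbar_mon n (int k) j)"
      unfolding e(1) by (rule eval_Vbar_mon_high[OF e(2,3), symmetric])
  qed (use k in auto)
  have n: "1 \<le> n" "1 \<le> n - 1" "n - 1 \<le> n" "n \<le> n" "(n - 1 = n) = False" "(n = 0) = False" "(n - 1 = 0) = False" "(n - 2 = 0) = False" using n4 by auto
  have kk: "int (Suc k) = int k + 1" by simp
  have top: "mon_eval c (V_mon n (int k) (n - 1)) = cext c k (n - 1) * cext c k n / cext c (Suc k) (n - 2)"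
    "mon_eval c (V_mon n (int k) n) = cext c k n / cext c (Suc k) (n - 1)"
    "mon_eval c (Vbar_mon n (int k) n) = cext c k (n - 1) / cext c (Suc k) n"
    unfolding eval_V_mon[OF n4 n(2,3)] eval_V_mon[OF n4 n(1,4)] eval_Vbar_mon[OF n4 n(1,4)] cext_def kk n(5-8) by simp_all
  have "(\<Sum>j=1..n. mon_eval c (V_mon n (int k) j)) = (\<Sum>j=1..n - 2. mon_eval c (V_mon n (int k) j))
      + mon_eval c (V_mon n (int k) (n - 1)) + mon_eval c (V_mon n (int k) n)"
  proof -
    have eq: "{1..n} = insert n (insert (n - 1) {1..n - 2})" and nn: "n \<notin> insert (n - 1) {1..n - 2}" "n - 1 \<notin> {1..n - 2}"
      using n4 by auto
    show ?thesis
      unfolding eq sum.insert[OF finite.insertI[OF finite_atLeastAtMost] nn(1)] sum.insert[OF finite_atLeastAtMost nn(2)]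
      by (simp only: ac_simps)
  qed
  moreover have "(\<Sum>j=k + 1..n. mon_eval c (Vbar_mon n (int k) j)) = (\<Sum>j=k + 1..n - 1. mon_eval c (Vbar_mon n (int k) j)) + mon_eval c (Vbar_mon n (int k) n)"
  proof -
    have eq: "{k + 1..n} = insert n {k + 1..n - 1}" and nn: "n \<notin> {k + 1..n - 1}" using k by auto
    show ?thesis unfolding eq sum.insert[OF finite_atLeastAtMost nn] by (simp only: ac_simps)
  qed
  ultimately show ?thesis unfolding low high top by (simp add: algebra_simps)
qed

text \<open>With base level k - n + 1 the variables of v-bar j are at level k - j + 1, which is t +
  1 for j = k - t.\<close>

lemma eval_refl_sum:
  assumes k: "1 \<le> k" "k + 2 \<le> n"
  shows "(\<Sum>t<k. cext c (Suc t) (k - Suc t) / cext c (Suc t) (k - t)) = (\<Sum>j=1..k. mon_eval c (Vbar_mon n (int k - int n + 1) j))"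
proof (rule sum.reindex_bij_witness[of _ "\<lambda>j. k - j" "\<lambda>t. k - t"])
  fix t assume t: "t \<in> {..<k}"
  then have j: "1 \<le> k - t" "k - t < n" "int (Suc t) = int k - int n + 1 + int n - int (k - t)" "(k - t = n - 1) = False" "k - t - 1 = k - Suc t"
    using k by auto
  show "mon_eval c (Vbar_mon n (int k - int n + 1) (k - t)) = cext c (Suc t) (k - Suc t) / cext c (Suc t) (k - t)"
    unfolding eval_Vbar_mon_high[OF j(1-3)] step_coef_def j(4,5) by simp
qed auto

end

theorem theorem9p6:
  fixes n N :: nat
    and e f h :: "nat \<Rightarrow> complex mat"
    and \<Delta> :: "nat \<Rightarrow> complex mat \<Rightarrow> complex"
    and c :: "int \<Rightarrow> nat \<Rightarrow> complex"
    and v :: "vec_label \<Rightarrow> monomial"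
    and mm :: "nat \<Rightarrow> int \<Rightarrow> monomial \<Rightarrow> monomial"
  assumes n: "n \<ge> 4"
    and G: "simply_connected_D n N e f h"
    and minors: "\<forall>i \<in> {1..n}. is_principal_minor n N e f i (\<Delta> i)"
    and c: "\<forall>m \<in> {1..int n - 1}. \<forall>i \<in> {1..n}. c m i \<noteq> 0"
    and v: "vec_labelling n v"
    and mm: "\<forall>i \<in> {1..n}. \<forall>k. crystal_embedding n (fund_crystal n i) (mon_crystal n p0) (mm i k) \<and>
               mm i k (hw_elt i) = c_var k i"
  shows
    "(\<forall>k \<in> {1..n - 2}.
        gen_minor n N e f \<Delta> k (longest_D n) (refl_D n k) (Theta_minus n N e f c) =
          (\<Sum>j = 1..n. mon_eval c (mm 1 (int k) (v (V j)))) +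
          (\<Sum>j = k + 1..n. mon_eval c (mm 1 (int k) (v (Vbar j)))) \<and>
        gen_minor n N e f \<Delta> k (longest_D n \<circ> refl_D n k) id (Theta_minus n N e f c) =
          (\<Sum>j = 1..k. mon_eval c (mm 1 (int k - int n + 1) (v (Vbar j))))) \<and>
     gen_minor n N e f \<Delta> (n - 1) (longest_D n) (refl_D n (n - 1)) (Theta_minus n N e f c) =
       mon_eval c (mm (n - 1) (int n - 1) (hw_elt (n - 1))) \<and>
     gen_minor n N e f \<Delta> n (longest_D n) (refl_D n n) (Theta_minus n N e f c) =
       mon_eval c (mm n (int n - 1) (hw_elt n))"
proof -
  interpret type_D n by unfold_locales (rule n)
  interpret VP: chevalley_pair n N "2 * n" e f h V.mE V.mF V.mH \<Delta>
    using G minors by unfold_locales (auto simp: simply_connected_D_def)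
  interpret SP: chevalley_pair n N spin_num e f h S.mE S.mF S.mH \<Delta>
    using G minors by unfold_locales (auto simp: simply_connected_D_def)
  have nz: "c m i \<noteq> 0" if "m \<in> {1..int n - 1}" "i \<in> {1..n}" for m i using c that by blast
  have nz': "c (int m) i \<noteq> 0" if "1 \<le> m" "m < n" "i \<in> {1..n}" for m i
    by (rule nz) (use that in auto)
  \<comment> \<open>The very word that \<open>w_bar\<close> selects for w_0; it is kept fixed, and
    only its reducedness is used.\<close>
  define us where "us = (SOME ks. reduced_expr n (longest_D n) ks)"
  have "reduced_expr n (longest_D n) us"
    unfolding us_def longest by (rule reduced_exists[OF set_i0])
  note us = us_def[symmetric] reduced_longest[OF this]
  have refl: "(SOME ks. reduced_expr n (refl_D n k) ks) = [k]" "set [k] \<subseteq> {1..n}" if "k \<in> {1..n}" for k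
  proof -
    show s: "set [k] \<subseteq> {1..n}" using that by simp
    show "(SOME ks. reduced_expr n (refl_D n k) ks) = [k]"
      by (rule reduced_refl[OF that reduced_exists[OF s, unfolded weyl_word_single]])
  qed
  have id: "(SOME ks. reduced_expr n id ks) = []" "set [] \<subseteq> {1..n}"
  proof -
    have w: "weyl_word n [] = id" by (simp add: weyl_word_def)
    show "(SOME ks. reduced_expr n id ks) = []" using reduced_exists[of "[]"] unfolding w by (auto intro: reduced_id)
  qed simp
  have crystal: "mm 1 k (v (V j)) = V_mon n k j" "mm 1 k (v (Vbar j)) = Vbar_mon n k j" if "j \<in> {1..n}" for k j
  proof -
    have "1 \<in> {1..n}" using n by simp
    then have "crystal_embedding n (fund_crystal n 1) (mon_crystal n p0) (mm 1 k)" "mm 1 k (hw_elt 1) = c_var k 1"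
      using mm by blast+
    from embedded_vector_crystal[OF n v this that]
    show "mm 1 k (v (V j)) = V_mon n k j" "mm 1 k (v (Vbar j)) = Vbar_mon n k j" .
  qed
  have first: "gen_minor n N e f \<Delta> k (longest_D n) (refl_D n k) (Theta_minus n N e f c) =
      (\<Sum>j = 1..n. mon_eval c (mm 1 (int k) (v (V j)))) + (\<Sum>j = k + 1..n. mon_eval c (mm 1 (int k) (v (Vbar j))))"
    if k: "1 \<le> k" "k + 2 \<le> n" for k
  proof -
    have kn: "k \<in> {1..n}" "k \<le> 2 * n" using k by auto
    have "gen_minor n N e f \<Delta> k (longest_D n) (refl_D n k) (Theta_minus n N e f c)
        = vminor k (inv_word_eval us * (Theta_minus n (2 * n) V.mE V.mF c * mat_prod (2 * n) (map V.sbar [k])))"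
      by (rule VP.gen_minor_transfer[OF kn(1) us(2,1) refl(2,1)[OF kn(1)] vminor_holo[OF kn(2)] vminor_cell[OF k]])
    also have "\<dots> = (\<Sum>j=1..n. mon_eval c (V_mon n (int k) j)) + (\<Sum>j=k + 1..n. mon_eval c (Vbar_mon n (int k) j))"
      unfolding eval_longest_sum[OF k, symmetric] by (rule vector_minor_longest[OF _ k us(2,3)]) (use nz' in blast, use us(4) in blast)
    finally show ?thesis using crystal by simp
  qed
  have second: "gen_minor n N e f \<Delta> k (longest_D n \<circ> refl_D n k) id (Theta_minus n N e f c) =
      (\<Sum>j = 1..k. mon_eval c (mm 1 (int k - int n + 1) (v (Vbar j))))"
    if k: "1 \<le> k" "k + 2 \<le> n" for k
  proof -
    have kn: "k \<in> {1..n}" "k \<le> 2 * n" using k by auto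
    define vs where "vs = (SOME ks. reduced_expr n (longest_D n \<circ> refl_D n k) ks)"
    have "set (i0 @ [k]) \<subseteq> {1..n}" using set_i0 kn by simp
    then have "reduced_expr n (longest_D n \<circ> refl_D n k) vs"
      unfolding vs_def longest weyl_word_single[symmetric] weyl_word_append[symmetric] by (rule reduced_exists)
    note vs = vs_def[symmetric] reduced_longest_refl[OF kn(1) this]
    have "gen_minor n N e f \<Delta> k (longest_D n \<circ> refl_D n k) id (Theta_minus n N e f c)
        = vminor k (inv_word_eval vs * (Theta_minus n (2 * n) V.mE V.mF c * mat_prod (2 * n) (map V.sbar [])))"
      by (rule VP.gen_minor_transfer[OF kn(1) vs(2,1) id(2,1) vminor_holo[OF kn(2)] vminor_cell[OF k]])
    also have "\<dots> = (\<Sum>j=1..k. mon_eval c (Vbar_mon n (int k - int n + 1) j))"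
      unfolding eval_refl_sum[OF k, symmetric] by (rule vector_minor_refl[OF _ k vs(2,3)]) (use nz' in blast, use vs(4) in blast)
    finally show ?thesis using crystal k by simp
  qed
  have spin: "gen_minor n N e f \<Delta> k (longest_D n) (refl_D n k) (Theta_minus n N e f c) = mon_eval c (mm k (int n - 1) (hw_elt k))"
    if k: "k = n - 1 \<or> k = n" for k
  proof -
    have kn: "k \<in> {1..n}" using k n by auto
    have "gen_minor n N e f \<Delta> k (longest_D n) (refl_D n k) (Theta_minus n N e f c)
        = (word_eval spin_num S.mE S.mF (concat (map (\<lambda>i. [(True, i, 1), (False, i, - 1), (True, i, 1)]) (rev us)))
          * (Theta_minus n spin_num S.mE S.mF c * mat_prod spin_num (map S.sbar [k]))) $$ (spin_hw k, spin_hw k)"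
    proof (rule SP.gen_minor_transfer[OF kn us(2,1) refl(2,1)[OF kn]])
      show "(\<lambda>z. g z $$ (spin_hw k, spin_hw k)) holomorphic_on UNIV" if "holo spin_num g" for g
        using that spin_hw(1)[of k] unfolding holo_def by blast
    qed (rule spin_minor_cell[OF k])
    also have "\<dots> = c (int n - 1) k" by (rule spin_minor[OF nz k us(2-4)])
    also have "\<dots> = mon_eval c (mm k (int n - 1) (hw_elt k))" using mm kn by (simp add: mon_eval_c_var)
    finally show ?thesis .
  qed
  have "1 \<le> k \<and> k + 2 \<le> n" if "k \<in> {1..n - 2}" for k using that n by auto
  then show ?thesis using first second spin by blast
qed

end
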